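(* Let $M$ be a 2-dimensional complex manifold, and let $F_\epsilon$ be a family of automorphisms of $M$ depending holomorphically on $\epsilon$ near $0\in\mathbf C$, normalized near the fixed point $O$ of $F_0$ as $$F_\epsilon(x,y)=\left(x+(x^2+\epsilon^2)\alpha_\epsilon(x,y),\ b_\epsilon(x)y+(x^2+\epsilon^2)\beta_\epsilon(x,y)\right),$$ with $\alpha_\epsilon=1+(q+1)x+ry+O(|x|^2+|y|^2+|\epsilon|^2)$ and $b_0(0)=b$, $0<|b|<1$. Let $\alpha\in\mathbf C$. If $\{\epsilon_j\}$ is an $\alpha$-sequence, then $$\liminf_{j\to\infty}J^*(F_{\epsilon_j})\supset J^*(F_0,T_\alpha).$$
   Context: The displayed form of $F_\epsilon$ holds in local holomorphic coordinates at $O=(0,0)$; $\alpha_\epsilon(x,y)$, $\beta_\epsilon(x,y)$, $b_\epsilon(x)$ are holomorphic in all variables including $\epsilon$, and $q,r\in\mathbf C$ are constants. $\{\epsilon_j\}$ is an $\alpha$-sequence if $\epsilon_j\to0$ and there are positive integers $n_j\to\infty$ with $n_j-\pi/\epsilon_j\to\alpha$. $\mathcal B$ is the set of points of $M$ having a neighborhood on which $F_0^n$ converges uniformly to $O$. $\Sigma=\{p\in M\setminus\{O\}: F_0^{-n}(p)\to O\}$, a Riemann surface equivalent to $\mathbf C$. With principal logarithms put $w^\iota(x,y)=-\frac1x-q\log(-x)$, $w^o(x,y)=-\frac1x-q\log(x)$. The Fatou coordinates are $\varphi^\iota:\mathcal B\to\mathbf C$, $\varphi^\iota(p)=\lim_{n\to\infty}(w^\iota(F_0^n(p))-n)$,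 and $\varphi^o:\Sigma\to\mathbf C$, $\varphi^o(p)=\lim_{n\to\infty}(w^o(F_0^{-n}(p))+n)$; these limits exist and are holomorphic, and $\varphi^o$ is a bijection onto $\mathbf C$. With $\tau_\alpha(\zeta)=\zeta+\alpha$, set $T_\alpha=(\varphi^o)^{-1}\circ\tau_\alpha\circ\varphi^\iota:\mathcal B\to\Sigma$. Let $\Omega=\varphi^o(\mathcal B\cap\Sigma)\subset\mathbf C$ and $h_\alpha=\tau_\alpha\circ\varphi^\iota\circ(\varphi^o)^{-1}:\Omega\to\mathbf C$. A point $\zeta_0$ is a periodic point of $h_\alpha$ if $h_\alpha^j(\zeta_0)\in\Omega$ for all $j\ge0$ and $h_\alpha^n(\zeta_0)=\zeta_0$ for some $n\ge1$; it is repelling if $|(h_\alpha^n)'(\zeta_0)|>1$. Let $\mathcal R_\alpha$ be the set of repelling periodic points of $h_\alpha$. Then $J^*(F_0,T_\alpha)$ denotes the closure in $M$ of $(\varphi^o)^{-1}(\mathcal R_\alpha)$. For an automorphism $F$ of $M$, $J^*(F)$ is the closure of the set of saddle periodic points of $F$. For closed sets $X_j$, $\liminf_j X_j$ is the set of points each of whose neighborhoods meets $X_j$ for all sufficiently large $j$. *)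

theory Defs
  imports "HOL-Analysis.Analysis"
begin

section \<open>Holomorphic functions of several variables\<close>

definition holo_fun :: "(complex^'n \<Rightarrow> complex) \<Rightarrow> (complex^'n) set \<Rightarrow> bool"
  where "holo_fun f S \<longleftrightarrow>
    (\<forall>z\<in>S. \<exists>a :: complex^'n. (f has_derivative (\<lambda>v. \<Sum>i\<in>UNIV. a $ i * v $ i)) (at z))"

definition holo_map :: "(complex^'n \<Rightarrow> complex^'m) \<Rightarrow> (complex^'n) set \<Rightarrow> bool"
  where "holo_map f S \<longleftrightarrow> (\<forall>i. holo_fun (\<lambda>z. f z $ i) S)"

definition polydisc :: "real \<Rightarrow> (complex^'n) set"
  where "polydisc \<rho> = {z. \<forall>i. norm (z $ i) < \<rho>}"


section \<open>Complex surfaces\<close>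

text \<open>A manifold is a type that is Hausdorff and second countable, together with an atlas.
  A chart is a pair of its domain and its coordinate map; values of the coordinate map outside
  the domain are irrelevant.\<close>

type_synonym 'a chart2 = "'a set \<times> ('a \<Rightarrow> complex^2)"

definition is_chart :: "'a::topological_space chart2 \<Rightarrow> bool"
  where "is_chart = (\<lambda>(U, \<phi>). open U \<and> open (\<phi> ` U) \<and> homeomorphism U (\<phi> ` U) \<phi> (inv_into U \<phi>))"

definition compatible :: "'a chart2 \<Rightarrow> 'a chart2 \<Rightarrow> bool"
  where "compatible = (\<lambda>(U, \<phi>) (V, \<psi>).
    holo_map (\<psi> \<circ> inv_into U \<phi>) (\<phi> ` (U \<inter> V)) \<and>
    holo_map (\<phi> \<circ> inv_into V \<psi>) (\<psi> ` (U \<inter> V)))"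

definition complex_surface :: "'a::{t2_space, second_countable_topology} chart2 set \<Rightarrow> bool"
  where "complex_surface A \<longleftrightarrow>
    (\<Union>(U, \<phi>)\<in>A. U) = UNIV \<and> (\<forall>c\<in>A. is_chart c) \<and> (\<forall>c\<in>A. \<forall>d\<in>A. compatible c d)"

text \<open>Local holomorphic coordinates: the charts of the maximal atlas.\<close>

definition holo_chart :: "'a::topological_space chart2 set \<Rightarrow> 'a chart2 \<Rightarrow> bool"
  where "holo_chart A c \<longleftrightarrow> is_chart c \<and> (\<forall>d\<in>A. compatible c d)"

definition holo_self_map :: "'a::topological_space chart2 set \<Rightarrow> ('a \<Rightarrow> 'a) \<Rightarrow> bool"
  where "holo_self_map A f \<longleftrightarrow> continuous_on UNIV f \<and>
    (\<forall>(U, \<phi>)\<in>A. \<forall>(V, \<psi>)\<in>A. holo_map (\<psi> \<circ> f \<circ> inv_into U \<phi>) (\<phi> ` (U \<inter> f -` V)))"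

definition automorphism :: "'a::topological_space chart2 set \<Rightarrow> ('a \<Rightarrow> 'a) \<Rightarrow> bool"
  where "automorphism A f \<longleftrightarrow> bij f \<and> holo_self_map A f \<and> holo_self_map A (inv f)"

text \<open>Holomorphic dependence on the parameter means that \<open>(\<epsilon>, p) \<mapsto> F \<epsilon> p\<close> is holomorphic on the
  product of a disc about 0 with the surface; in coordinates the parameter is the first of three
  variables.\<close>

definition holo_family :: "'a::topological_space chart2 set \<Rightarrow> (complex \<Rightarrow> 'a \<Rightarrow> 'a) \<Rightarrow> bool"
  where "holo_family A F \<longleftrightarrow> (\<exists>\<delta>>0.
    (\<forall>\<epsilon>\<in>ball 0 \<delta>. automorphism A (F \<epsilon>)) \<and>
    continuous_on (ball 0 \<delta> \<times> UNIV) (\<lambda>(\<epsilon>, p). F \<epsilon> p) \<and>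
    (\<forall>(U, \<phi>)\<in>A. \<forall>(V, \<psi>)\<in>A.
      holo_map (\<lambda>w :: complex^3. \<psi> (F (w $ 1) (inv_into U \<phi> (vector [w $ 2, w $ 3]))))
        {w. w $ 1 \<in> ball 0 \<delta> \<and> vector [w $ 2, w $ 3] \<in> \<phi> ` U \<and>
            F (w $ 1) (inv_into U \<phi> (vector [w $ 2, w $ 3])) \<in> V}))"


section \<open>The semi-parabolic normal form\<close>

text \<open>The remainder in the expansion of \<open>a \<epsilon> x y\<close> is bounded on the whole polydisc, whose radius
  may be taken small.\<close>

definition normal_form ::
  "(complex \<Rightarrow> 'a \<Rightarrow> 'a) \<Rightarrow> 'a chart2 \<Rightarrow> complex \<Rightarrow> complex \<Rightarrow> complex \<Rightarrow> bool"
  where "normal_form F = (\<lambda>(U, \<phi>) q r b.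
    \<exists>\<rho>>0. \<exists>(a :: complex \<Rightarrow> complex \<Rightarrow> complex \<Rightarrow> complex)
            (\<beta> :: complex \<Rightarrow> complex \<Rightarrow> complex \<Rightarrow> complex)
            (bb :: complex \<Rightarrow> complex \<Rightarrow> complex).
      holo_fun (\<lambda>w :: complex^3. a (w $ 1) (w $ 2) (w $ 3)) (polydisc \<rho>) \<and>
      holo_fun (\<lambda>w :: complex^3. \<beta> (w $ 1) (w $ 2) (w $ 3)) (polydisc \<rho>) \<and>
      holo_fun (\<lambda>w :: complex^2. bb (w $ 1) (w $ 2)) (polydisc \<rho>) \<and>
      bb 0 0 = b \<and>
      (\<exists>C. \<forall>\<epsilon> x y. norm \<epsilon> < \<rho> \<and> norm x < \<rho> \<and> norm y < \<rho> \<longrightarrow>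
        norm (a \<epsilon> x y - (1 + (q + 1) * x + r * y)) \<le> C * (norm x ^ 2 + norm y ^ 2 + norm \<epsilon> ^ 2)) \<and>
      (\<forall>\<epsilon> x y. norm \<epsilon> < \<rho> \<and> norm x < \<rho> \<and> norm y < \<rho> \<longrightarrow>
        vector [x, y] \<in> \<phi> ` U \<and>
        F \<epsilon> (inv_into U \<phi> (vector [x, y])) \<in> U \<and>
        \<phi> (F \<epsilon> (inv_into U \<phi> (vector [x, y]))) =
          vector [x + (x ^ 2 + \<epsilon> ^ 2) * a \<epsilon> x y, bb \<epsilon> x * y + (x ^ 2 + \<epsilon> ^ 2) * \<beta> \<epsilon> x y]))"

definition alpha_sequence :: "complex \<Rightarrow> (nat \<Rightarrow> complex) \<Rightarrow> bool"
  where "alpha_sequence \<alpha> \<epsilon> \<longleftrightarrow> (\<forall>j. \<epsilon> j \<noteq> 0) \<and> \<epsilon> \<longlonglongrightarrow> 0 \<and>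
    (\<exists>n :: nat \<Rightarrow> nat. (\<forall>j. n j > 0) \<and> filterlim n at_top sequentially \<and>
      (\<lambda>j. of_nat (n j) - of_real pi / \<epsilon> j) \<longlonglongrightarrow> \<alpha>)"


section \<open>Fatou coordinates and the transition map\<close>

text \<open>Below, \<open>f\<close> is the semi-parabolic map, \<open>p0\<close> its fixed point, and \<open>\<phi>\<close> the coordinate map at \<open>p0\<close>.
  In the two limits only orbit points near \<open>p0\<close> matter, and these lie in the domain of \<open>\<phi>\<close>.\<close>

definition basin :: "('a::topological_space \<Rightarrow> 'a) \<Rightarrow> 'a \<Rightarrow> 'a set"
  where "basin f p0 = {p. \<exists>N. open N \<and> p \<in> N \<and>
    (\<forall>V. open V \<and> p0 \<in> V \<longrightarrow> (\<forall>\<^sub>F n in sequentially. \<forall>z\<in>N. (f ^^ n) z \<in> V))}"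

definition asymptotic_curve :: "('a::topological_space \<Rightarrow> 'a) \<Rightarrow> 'a \<Rightarrow> 'a set"
  where "asymptotic_curve f p0 = {p. p \<noteq> p0 \<and> (\<lambda>n. (inv f ^^ n) p) \<longlonglongrightarrow> p0}"

definition w_in :: "complex \<Rightarrow> complex^2 \<Rightarrow> complex"
  where "w_in q z = - 1 / z $ 1 - q * Ln (- (z $ 1))"

definition w_out :: "complex \<Rightarrow> complex^2 \<Rightarrow> complex"
  where "w_out q z = - 1 / z $ 1 - q * Ln (z $ 1)"

definition fatou_in :: "('a \<Rightarrow> 'a) \<Rightarrow> ('a \<Rightarrow> complex^2) \<Rightarrow> complex \<Rightarrow> 'a \<Rightarrow> complex"
  where "fatou_in f \<phi> q p = lim (\<lambda>n. w_in q (\<phi> ((f ^^ n) p)) - of_nat n)"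

definition fatou_out :: "('a \<Rightarrow> 'a) \<Rightarrow> ('a \<Rightarrow> complex^2) \<Rightarrow> complex \<Rightarrow> 'a \<Rightarrow> complex"
  where "fatou_out f \<phi> q p = lim (\<lambda>n. w_out q (\<phi> ((inv f ^^ n) p)) + of_nat n)"

definition fatou_out_inv ::
  "('a::topological_space \<Rightarrow> 'a) \<Rightarrow> 'a \<Rightarrow> ('a \<Rightarrow> complex^2) \<Rightarrow> complex \<Rightarrow> complex \<Rightarrow> 'a"
  where "fatou_out_inv f p0 \<phi> q = inv_into (asymptotic_curve f p0) (fatou_out f \<phi> q)"

definition transition_domain ::
  "('a::topological_space \<Rightarrow> 'a) \<Rightarrow> 'a \<Rightarrow> ('a \<Rightarrow> complex^2) \<Rightarrow> complex \<Rightarrow> complex set"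
  where "transition_domain f p0 \<phi> q = fatou_out f \<phi> q ` (basin f p0 \<inter> asymptotic_curve f p0)"

definition transition ::
  "('a::topological_space \<Rightarrow> 'a) \<Rightarrow> 'a \<Rightarrow> ('a \<Rightarrow> complex^2) \<Rightarrow> complex \<Rightarrow> complex \<Rightarrow> complex \<Rightarrow> complex"
  where "transition f p0 \<phi> q \<alpha> = (\<lambda>\<zeta>. \<zeta> + \<alpha>) \<circ> fatou_in f \<phi> q \<circ> fatou_out_inv f p0 \<phi> q"

definition repelling_points :: "complex set \<Rightarrow> (complex \<Rightarrow> complex) \<Rightarrow> complex set"
  where "repelling_points \<Omega> h = {\<zeta>. (\<forall>j. (h ^^ j) \<zeta> \<in> \<Omega>) \<and>
    (\<exists>n\<ge>1. (h ^^ n) \<zeta> = \<zeta> \<and>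
      (\<exists>D. ((h ^^ n) has_field_derivative D) (at \<zeta>) \<and> norm D > 1))}"


section \<open>The sets \<open>J\<^sup>*\<close>\<close>

text \<open>Multipliers are eigenvalues of the derivative of the return map read in a chart; they do not
  depend on the chart.\<close>

definition eigval :: "complex^'n^'n \<Rightarrow> complex \<Rightarrow> bool"
  where "eigval J \<mu> \<longleftrightarrow> (\<exists>v. v \<noteq> 0 \<and> J *v v = \<mu> *s v)"

definition saddle_periodic :: "'a chart2 set \<Rightarrow> ('a \<Rightarrow> 'a) \<Rightarrow> 'a \<Rightarrow> bool"
  where "saddle_periodic A f p \<longleftrightarrow> (\<exists>n\<ge>1. (f ^^ n) p = p \<and>
    (\<exists>(U, \<phi>)\<in>A. p \<in> U \<and>
      (\<exists>J :: complex^2^2. ((\<phi> \<circ> (f ^^ n) \<circ> inv_into U \<phi>) has_derivative (\<lambda>v. J *v v)) (at (\<phi> p)) \<and>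
        (\<exists>\<mu> \<nu>. eigval J \<mu> \<and> eigval J \<nu> \<and> norm \<mu> < 1 \<and> norm \<nu> > 1))))"

definition J_star :: "'a::topological_space chart2 set \<Rightarrow> ('a \<Rightarrow> 'a) \<Rightarrow> 'a set"
  where "J_star A f = closure {p. saddle_periodic A f p}"

text \<open>\<open>J\<^sup>*(f, T\<^sub>\<alpha>)\<close>, where \<open>T\<^sub>\<alpha>\<close> maps \<open>p\<close> in the basin to
  \<open>fatou_out_inv f p0 \<phi> q (fatou_in f \<phi> q p + \<alpha>)\<close>; the set is defined through its conjugate
  \<open>transition f p0 \<phi> q \<alpha>\<close>.\<close>

definition J_star_T ::
  "('a::topological_space \<Rightarrow> 'a) \<Rightarrow> 'a \<Rightarrow> ('a \<Rightarrow> complex^2) \<Rightarrow> complex \<Rightarrow> complex \<Rightarrow> 'a set"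
  where "J_star_T f p0 \<phi> q \<alpha> = closure (fatou_out_inv f p0 \<phi> q `
    repelling_points (transition_domain f p0 \<phi> q) (transition f p0 \<phi> q \<alpha>))"

definition liminf_sets :: "(nat \<Rightarrow> 'a::topological_space set) \<Rightarrow> 'a set"
  where "liminf_sets X =
    {p. \<forall>V. open V \<and> p \<in> V \<longrightarrow> (\<forall>\<^sub>F j in sequentially. V \<inter> X j \<noteq> {})}"

end

theory Submission
  imports Defs "HOL-Complex_Analysis.Complex_Analysis"
begin

text \<open>
  Let \<open>Psi\<close> be the inverse of the outgoing Fatou coordinate and \<open>T p = Psi (\<phi>\<^sup>\<iota> p + \<alpha>)\<close>. The core is that
  \<open>F \<epsilon>\<^sub>j ^^ n\<^sub>j \<longlongrightarrow> T\<close> locally uniformly on the basin. In the coordinate \<open>v\<close> with \<open>x = - \<epsilon> cot (\<epsilon> v)\<close>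
  the map \<open>F \<epsilon>\<close> moves \<open>v\<close> by \<open>Arctan (\<epsilon> D) / \<epsilon>\<close>, where \<open>D\<close> is close to 1; after the logarithmic correction
  \<open>q Ln (sin (\<epsilon> v) / \<epsilon>)\<close> it is a translation by 1 up to an error \<open>r y + O(|x|\<^sup>2 + |y|\<^sup>2 + |\<epsilon>|\<^sup>2)\<close>, which is
  summable along the orbit. Passing the gate from \<open>v = 0\<close> to \<open>v = \<pi> / \<epsilon>\<close> thus takes \<open>\<pi> / \<epsilon>\<close> steps and acts as a
  translation between the two Fatou coordinates.

  If \<open>\<zeta>\<close> is a repelling point of period \<open>k\<close> with multiplier \<open>D\<close>, then \<open>T ^^ k\<close> fixes \<open>Psi \<zeta>\<close>, and its image
  lies on the curve \<open>range Psi\<close>, so its derivative there has eigenvalues 0 and \<open>D\<close>. The maps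
  \<open>F \<epsilon>\<^sub>j ^^ (k * n\<^sub>j)\<close> converge to \<open>T ^^ k\<close> together with their derivatives; Brouwer's theorem gives nearby
  fixed points, and these are saddles.
\<close>

text \<open>The definitions use \<open>lim\<close> and \<open>inv_into\<close>, so convergence of
  both Fatou coordinates and bijectivity of the outgoing one have to be proved before
  \<open>T\<close> means anything. The obstacle is circular control: the step estimates hold only
  while the orbit is near its predicted position in the polydisc, and the prediction rests on
  summing those estimates, whose logarithmic term drifts without bound.
  \<open>translation_bootstrap\<close> breaks the circle: one step may spoil a relative error 1/2 to
  3/4, and the corrected coordinate, controlled over the whole passage, restores 1/2. The term
  \<open>r y\<close> is not quadratic; it is summable only through the contraction of y. Derivatives
  are never followed along orbits. Lipschitz and derivative bounds for iterates come from Cauchy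
  estimates on complex lines, so that bounded pointwise convergence suffices. Rank one of the limit
  derivative is read off from an image too thin for the open mapping theorem. Complex
  \<open>\<epsilon>\<close> causes no trouble because the condition on the sequence keeps
  \<open>\<pi> / \<epsilon>\<close> at bounded distance from an integer.\<close>

section \<open>Elementary estimates\<close>

lemma norm_Ln_one_plus_diff_le:
  fixes z :: complex
  assumes "norm z \<le> 1/2"
  shows "norm (Ln (1 + z) - z) \<le> 2 * norm z ^ 2"
proof -
  have "norm (Ln (1 + z) - z) \<le> norm z ^ 2 / (1 - norm z)"
    using Ln_approx_linear[of z] assms by auto
  also have "\<dots> \<le> norm z ^ 2 / (1/2)"
    by (rule divide_left_mono) (use assms in auto)
  finally show ?thesis by simp
qed

lemma norm_Ln_one_plus_le:
  fixes z :: complex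
  assumes "norm z \<le> 1/2"
  shows "norm (Ln (1 + z)) \<le> 2 * norm z"
proof -
  have "norm (Ln (1 + z)) \<le> norm (Ln (1 + z) - z) + norm z"
    using norm_triangle_ineq[of "Ln (1 + z) - z" z] by simp
  also have "\<dots> \<le> 2 * norm z * norm z + norm z"
    using norm_Ln_one_plus_diff_le[OF assms] by (simp add: power2_eq_square)
  also have "2 * norm z * norm z \<le> 1 * norm z"
    by (rule mult_right_mono) (use assms in auto)
  finally show ?thesis by simp
qed

text \<open>Both arguments are smaller than pi/2 in absolute value, so their difference stays in the
  principal strip. The logarithmic corrections below are kept in the right half plane so that this
  applies.\<close>

lemma Ln_divide_Re_pos:
  assumes "0 < Re a" "0 < Re b"
  shows "Ln (a / b) = Ln a - Ln b"
proof (rule Ln_unique)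
  have "a \<noteq> 0" "b \<noteq> 0" using assms by auto
  then show "exp (Ln a - Ln b) = a / b" by (simp add: exp_diff)
  show "- pi < Im (Ln a - Ln b)" "Im (Ln a - Ln b) \<le> pi"
    using Re_Ln_pos_lt_imp[OF assms(1)] Re_Ln_pos_lt_imp[OF assms(2)] by (simp_all add: abs_less_iff)
qed

lemma norm_Ln_le_ln_norm:
  assumes "z \<noteq> 0"
  shows "norm (Ln z) \<le> \<bar>ln (norm z)\<bar> + pi"
proof -
  have "norm (Ln z) \<le> \<bar>Re (Ln z)\<bar> + \<bar>Im (Ln z)\<bar>" by (rule cmod_le)
  also have "\<bar>Im (Ln z)\<bar> \<le> pi"
    using mpi_less_Im_Ln[OF assms] Im_Ln_le_pi[OF assms] by (simp add: abs_le_iff)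
  finally show ?thesis using assms by simp
qed

text \<open>Below pi/3 the cosine is at least 1/2 and the mean value theorem suffices; above pi/3
  the sine is at least 17/20 while a/2 is at most pi/4.\<close>

lemma sin_ge_half:
  fixes a :: real
  assumes "0 \<le> a" "a \<le> pi / 2"
  shows "a / 2 \<le> sin a"
proof (cases "a \<le> pi / 3")
  case True
  show ?thesis
  proof (cases "a = 0")
    case False
    with assms have "0 < a" by simp
    from MVT2[OF this, of sin cos] obtain z where z: "0 < z" "z < a" "sin a - sin 0 = (a - 0) * cos z"
      by (auto intro: DERIV_sin)
    have "cos (pi/3) \<le> cos z"
      by (rule cos_monotone_0_pi_le) (use z True pi_gt_zero in auto)
    then have "1/2 \<le> cos z" by (simp add: cos_60)
    then have "a * (1/2) \<le> a * cos z" using \<open>0 < a\<close> by (intro mult_left_mono) auto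
    then show ?thesis using z by simp
  qed simp
next
  case False
  have "sin (pi/3) \<le> sin a"
    by (rule sin_monotone_2pi_le) (use assms False pi_gt_zero in auto)
  moreover have "sqrt 3 \<ge> 17/10" by (rule real_le_rsqrt) (simp add: power2_eq_square)
  moreover have "pi < 3.2" using pi_less_4 pi_approx by simp
  ultimately show ?thesis using assms by (simp add: sin_60)
qed

text \<open>This is four times \<open>(sinh b)^2 \<ge> b^2\<close>, in the exponential form that
  \<open>norm_sin_squared\<close> produces.\<close>

lemma sinh_sqr_ge:
  fixes b :: real
  shows "exp (2 * b) + inverse (exp (2 * b)) \<ge> 2 + 4 * b\<^sup>2"
proof -
  have *: "exp b - exp (-b) \<ge> 2 * b" if "b \<ge> 0" for b :: real
  proof -
    have "(\<lambda>x. exp x - exp (-x) - 2 * x) 0 \<le> (\<lambda>x. exp x - exp (-x) - 2 * x) b"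
    proof (rule DERIV_nonneg_imp_nondecreasing[OF that])
      fix x :: real
      have "((\<lambda>x. exp x - exp (-x) - 2 * x) has_real_derivative (exp x + exp (-x) - 2)) (at x)"
        by (auto intro!: derivative_eq_intros)
      moreover have "exp x + exp (-x) - 2 \<ge> 0"
        using exp_ge_add_one_self[of x] exp_ge_add_one_self[of "-x"] by linarith
      ultimately show "\<exists>y. ((\<lambda>x. exp x - exp (-x) - 2 * x) has_real_derivative y) (at x) \<and> 0 \<le> y"
        by blast
    qed
    then show ?thesis by simp
  qed
  have "(2 * \<bar>b\<bar>)\<^sup>2 \<le> (exp \<bar>b\<bar> - exp (-\<bar>b\<bar>))\<^sup>2"
    by (rule power_mono) (use *[of "\<bar>b\<bar>"] in auto)
  also have "\<dots> = exp (2 * \<bar>b\<bar>) + inverse (exp (2 * \<bar>b\<bar>)) - 2"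
  proof -
    have "exp (2 * \<bar>b\<bar>) = exp \<bar>b\<bar> * exp \<bar>b\<bar>" by (simp flip: exp_add)
    then show ?thesis by (simp add: exp_minus power2_eq_square field_simps)
  qed
  also have "\<dots> = exp (2 * b) + inverse (exp (2 * b)) - 2"
    by (cases "b \<ge> 0") (auto simp: exp_minus)
  finally show ?thesis by (simp add: power2_eq_square)
qed

text \<open>The squared norm of the sine is \<open>(sin (Re s))^2 + (sinh (Im s))^2\<close>; each
  summand is compared with its own part of s.\<close>

lemma norm_sin_ge:
  assumes "0 \<le> Re s" "Re s \<le> pi / 2"
  shows "norm s / 2 \<le> norm (sin s)"
proof -
  define E where "E = exp (2 * Im s) + inverse (exp (2 * Im s))"
  define S where "S = (sin (Re s))\<^sup>2"
  define a where "a = (Re s)\<^sup>2"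
  define b where "b = (Im s)\<^sup>2"
  have "(Re s / 2)\<^sup>2 \<le> (sin (Re s))\<^sup>2"
    by (rule power_mono) (use sin_ge_half assms in auto)
  then have 1: "a \<le> 4 * S" by (simp add: power2_eq_square a_def S_def)
  have 2: "2 + 4 * b \<le> E" using sinh_sqr_ge[of "Im s"] by (simp add: E_def b_def)
  have "4 * norm (sin s) ^ 2 = E - 2 + 4 * S"
    unfolding norm_sin_squared cos_double_sin E_def S_def by simp
  moreover have "norm s ^ 2 = a + b" by (simp add: cmod_power2 a_def b_def)
  moreover have "0 \<le> b" by (simp add: b_def)
  ultimately have "norm s ^ 2 \<le> 4 * norm (sin s) ^ 2" using 1 2 by linarith
  then have "(norm s / 2)\<^sup>2 \<le> norm (sin s) ^ 2" by (simp add: power_divide)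
  then show ?thesis by (rule power2_le_imp_le) simp
qed

lemma norm_sin_ge_min:
  fixes s :: complex
  assumes "0 \<le> Re s" "Re s \<le> pi"
  shows "min (norm s) (norm (pi - s)) / 2 \<le> norm (sin s)"
proof (cases "Re s \<le> pi / 2")
  case True
  then show ?thesis using norm_sin_ge[of s] assms by auto
next
  case False
  then have "norm (pi - s) / 2 \<le> norm (sin (pi - s))"
    by (intro norm_sin_ge) (use assms in auto)
  moreover have "sin (pi - s) = sin s" by (simp add: sin_diff flip: sin_of_real cos_of_real)
  ultimately show ?thesis by auto
qed

lemma norm_sin_le:
  fixes s :: complex
  shows "norm (sin s) \<le> norm s * exp (norm s)"
proof -
  have "norm (sin s - sin 0) \<le> exp (norm s) * norm (s - 0)"
  proof (rule field_differentiable_bound[where f' = cos and S = "cball 0 (norm s)"])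
    fix z :: complex assume "z \<in> cball 0 (norm s)"
    then show "norm (cos z) \<le> exp (norm s)" using norm_cos_le[of z] by (simp add: order_trans)
  qed (auto intro!: derivative_eq_intros)
  then show ?thesis by (simp add: mult.commute)
qed

lemma norm_cos_minus_one_le:
  fixes s :: complex
  assumes "norm s \<le> 1"
  shows "norm (cos s - 1) \<le> 3 * norm s ^ 2"
proof -
  have "norm (cos s - cos 0) \<le> (3 * norm s) * norm (s - 0)"
  proof (rule field_differentiable_bound[where f' = "\<lambda>z. - sin z" and S = "cball 0 (norm s)"])
    fix z :: complex assume z: "z \<in> cball 0 (norm s)"
    have "exp (norm z) \<le> exp 1" using z assms by simp
    also have "exp 1 \<le> (3::real)" by (rule exp_le)
    finally have "norm z * exp (norm z) \<le> norm s * 3" by (intro mult_mono) (use z in auto)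
    then show "norm (- sin z) \<le> 3 * norm s" using norm_sin_le[of z] by simp
  qed (auto intro!: derivative_eq_intros)
  then show ?thesis by (simp add: power2_eq_square)
qed

lemma norm_Arctan_diff_le:
  fixes t :: complex
  assumes "norm t \<le> 1/2"
  shows "norm (Arctan t - t) \<le> 2 * norm t ^ 3"
proof -
  have "norm ((\<lambda>t. Arctan t - t) t - (\<lambda>t. Arctan t - t) 0) \<le> (2 * norm t ^ 2) * norm (t - 0)"
  proof (rule field_differentiable_bound[where f' = "\<lambda>z. inverse (1 + z\<^sup>2) - 1" and S = "cball 0 (norm t)"])
    fix z :: complex assume z: "z \<in> cball 0 (norm t)"
    then have nz: "norm z \<le> 1/2" using assms by simp
    have "norm (z\<^sup>2) \<le> (1/2)^2" unfolding norm_power by (rule power_mono) (use nz in auto)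
    then have z2: "norm (z\<^sup>2) \<le> 1/4" by (simp add: power2_eq_square)
    have n1: "norm (1 + z\<^sup>2) \<ge> 1/2"
      using norm_triangle_ineq2[of 1 "-(z\<^sup>2)"] z2 by simp
    then have nz1: "1 + z\<^sup>2 \<noteq> 0" by auto
    show "((\<lambda>t. Arctan t - t) has_field_derivative inverse (1 + z\<^sup>2) - 1) (at z within cball 0 (norm t))"
    proof -
      have "\<bar>Im z\<bar> < 1" using abs_Im_le_cmod[of z] nz by linarith
      then show ?thesis
        by (intro derivative_intros has_field_derivative_at_within has_field_derivative_Arctan) auto
    qed
    have "inverse (1 + z\<^sup>2) - 1 = - (z\<^sup>2) / (1 + z\<^sup>2)" using nz1 by (simp add: field_simps)
    then have "norm (inverse (1 + z\<^sup>2) - 1) = norm z ^ 2 / norm (1 + z\<^sup>2)"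
      by (simp add: norm_divide norm_power)
    also have "\<dots> \<le> norm z ^ 2 / (1/2)" by (rule divide_left_mono) (use n1 in auto)
    also have "\<dots> \<le> 2 * norm t ^ 2" using z by (simp add: power_mono)
    finally show "norm (inverse (1 + z\<^sup>2) - 1) \<le> 2 * norm t ^ 2" .
  qed auto
  then show ?thesis by (simp add: power2_eq_square power3_eq_cube mult.assoc)
qed

lemma Arctan_small:
  fixes t :: complex
  assumes "norm t \<le> 1/2"
  shows "tan (Arctan t) = t" "norm (Arctan t) \<le> 2 * norm t" "cos (Arctan t) \<noteq> 0"
proof -
  have "t\<^sup>2 \<noteq> -1"
  proof
    assume "t\<^sup>2 = -1"
    then have "norm t ^ 2 = 1" by (metis norm_minus_cancel norm_one norm_power)
    then have "norm t = 1" by (simp add: power2_eq_1_iff) (smt (verit) norm_ge_zero)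
    then show False using assms by simp
  qed
  then show "tan (Arctan t) = t" by (intro tan_Arctan) auto
  have "norm (Arctan t) \<le> norm (Arctan t - t) + norm t"
    using norm_triangle_ineq[of "Arctan t - t" t] by simp
  also have "\<dots> \<le> 2 * norm t ^ 3 + norm t" using norm_Arctan_diff_le[OF assms] by simp
  also have "2 * norm t ^ 3 \<le> 1 * norm t"
  proof -
    have "norm t * norm t \<le> 1/2 * (1/2)" by (rule mult_mono) (use assms in auto)
    then have "(2 * (norm t * norm t)) * norm t \<le> 1 * norm t" by (intro mult_right_mono) auto
    then show ?thesis by (simp add: power3_eq_cube)
  qed
  finally show n: "norm (Arctan t) \<le> 2 * norm t" by simp
  show "cos (Arctan t) \<noteq> 0"
  proof
    assume c: "cos (Arctan t) = 0"
    \<comment> \<open>Division by zero: a vanishing cosine makes \<open>tan\<close> equal to 0,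
      hence t = 0, where the cosine is 1.\<close>
    then have "tan (Arctan t) = 0" by (simp add: tan_def)
    then have "t = 0" using \<open>tan (Arctan t) = t\<close> by simp
    then show False using c by simp
  qed
qed

section \<open>Cauchy estimates\<close>

lemma holomorphic_bounded_ball_estimates:
  assumes hol: "g holomorphic_on ball 0 \<rho>" and \<rho>: "0 < \<rho>"
    and bd: "\<And>z. z \<in> ball 0 \<rho> \<Longrightarrow> norm (g z) \<le> B"
  shows "norm (deriv g 0) \<le> 4 * B / \<rho>"
    and "norm t \<le> \<rho>/2 \<Longrightarrow> norm (g t - g 0) \<le> 4 * B / \<rho> * norm t"
    and "norm t \<le> \<rho>/2 \<Longrightarrow> norm (g t - g 0 - t * deriv g 0) \<le> 32 * B / \<rho>^2 * norm t ^ 2"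
proof -
  \<comment> \<open>Circles of radius \<open>\<rho> / 4\<close> about points of the half disc stay
    in the disc. For n = 1 and n = 2 they give the constants 4 and 2 * 16 = 32.\<close>
  have est: "norm ((deriv ^^ n) g z) \<le> fact n * B / (\<rho>/4)^n" if "norm z \<le> \<rho>/2" for n z
  proof (rule Cauchy_inequality)
    have sub: "cball z (\<rho>/4) \<subseteq> ball 0 \<rho>"
    proof
      fix w assume "w \<in> cball z (\<rho>/4)"
      then have "norm (w - z) \<le> \<rho>/4" by (simp add: dist_norm norm_minus_commute)
      then have "norm w \<le> \<rho>/4 + \<rho>/2" using norm_triangle_ineq[of "w - z" z] that by simp
      then show "w \<in> ball 0 \<rho>" using \<rho> by simp
    qed
    then show "g holomorphic_on ball z (\<rho>/4)" using hol by (meson ball_subset_cball holomorphic_on_subset order_trans)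
    show "continuous_on (cball z (\<rho>/4)) g"
      using sub hol holomorphic_on_imp_continuous_on continuous_on_subset by blast
    show "norm (g x) \<le> B" if "norm (z - x) = \<rho>/4" for x
      using that sub bd by (auto simp: dist_norm)
  qed (use \<rho> in auto)
  have B0: "B \<ge> 0" using bd[of 0] \<rho> norm_ge_zero[of "g 0"] by (simp del: norm_ge_zero)
  have e1: "norm (deriv g z) \<le> 4 * B / \<rho>" if "norm z \<le> \<rho>/2" for z
    using est[OF that, of 1] by (simp add: field_simps)
  then show "norm (deriv g 0) \<le> 4 * B / \<rho>" using \<rho> by simp
  have sub2: "cball 0 (\<rho>/2) \<subseteq> ball (0::complex) \<rho>" using \<rho> by auto
  have der: "((deriv ^^ i) g has_field_derivative (deriv ^^ Suc i) g z) (at z within cball 0 (\<rho>/2))"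
    if "z \<in> cball 0 (\<rho>/2)" for i z
  proof -
    have "(deriv ^^ i) g holomorphic_on ball 0 \<rho>" by (rule holomorphic_higher_deriv[OF hol]) simp
    then have "((deriv ^^ i) g has_field_derivative deriv ((deriv ^^ i) g) z) (at z)"
      using that sub2 by (intro holomorphic_derivI[of _ "ball 0 \<rho>"]) auto
    then show ?thesis by (auto intro: has_field_derivative_at_within)
  qed
  show "norm (g t - g 0) \<le> 4 * B / \<rho> * norm t" if "norm t \<le> \<rho>/2"
  proof -
    have "norm (g t - g 0) \<le> 4 * B / \<rho> * norm (t - 0)"
    proof (rule field_differentiable_bound[where S = "cball 0 (\<rho>/2)" and f' = "deriv g"])
      show "(g has_field_derivative deriv g z) (at z within cball 0 (\<rho>/2))" if "z \<in> cball 0 (\<rho>/2)" for z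
        using der[OF that, of 0] by simp
    qed (use that \<rho> e1 in auto)
    then show ?thesis by simp
  qed
  show "norm (g t - g 0 - t * deriv g 0) \<le> 32 * B / \<rho>^2 * norm t ^ 2" if "norm t \<le> \<rho>/2"
  proof -
    have "norm ((\<lambda>i. (deriv ^^ i) g) 0 t - (\<Sum>i\<le>1. (\<lambda>i. (deriv ^^ i) g) i 0 * (t - 0) ^ i / fact i))
          \<le> (32 * B / \<rho>^2) * norm (t - 0) ^ Suc 1 / fact 1"
    proof (rule complex_Taylor[where S = "cball 0 (\<rho>/2)"])
      show "norm ((deriv ^^ Suc 1) g x) \<le> 32 * B / \<rho>\<^sup>2" if "x \<in> cball 0 (\<rho>/2)" for x
        using est[of x 2] that by (simp add: numeral_2_eq_2 field_simps)
    qed (use that \<rho> der in auto)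
    then show ?thesis by (simp add: algebra_simps power2_eq_square)
  qed
qed

no_notation fps_nth (infixl \<open>$\<close> 75)

section \<open>Holomorphic maps of several variables\<close>

lemma norm_axis_eq: "norm (axis i x :: 'a::real_normed_vector^'n) = norm x"
proof -
  have "norm (axis i x :: 'a^'n) = L2_set (\<lambda>j. norm (if j = i then x else 0)) UNIV"
    unfolding norm_vec_def axis_def by (simp cong: if_cong)
  also have "\<dots> = sqrt (\<Sum>j\<in>UNIV. if j = i then (norm x)\<^sup>2 else 0)"
    unfolding L2_set_def by (intro arg_cong[where f = sqrt] sum.cong) auto
  finally show ?thesis by simp
qed

lemma bounded_linear_axis: "bounded_linear (axis i :: 'a::real_normed_vector \<Rightarrow> 'a^'n)"
  by (rule bounded_linear_intro[where K = 1])
     (auto simp: vec_eq_iff norm_axis_eq, auto simp: axis_def)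

lemma sum_axis_nth: "(\<Sum>i\<in>UNIV. axis i (x $ i)) = (x :: 'a::comm_monoid_add^'n)"
  by (simp add: vec_eq_iff axis_def sum.If_cases)

lemma has_derivative_vec_componentwise:
  fixes f :: "'b::real_normed_vector \<Rightarrow> 'a::real_normed_vector^'n"
  assumes "\<And>i. ((\<lambda>z. f z $ i) has_derivative (\<lambda>v. g v $ i)) F"
  shows "(f has_derivative g) F"
proof -
  have "((\<lambda>z. \<Sum>i\<in>UNIV. axis i (f z $ i)) has_derivative (\<lambda>v. \<Sum>i\<in>UNIV. axis i (g v $ i))) F"
    by (intro has_derivative_sum bounded_linear.has_derivative[OF bounded_linear_axis] assms)
  then show ?thesis by (simp add: sum_axis_nth)
qed

text \<open>Holomorphy is defined componentwise; in matrix form the chain rule for real derivatives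
  keeps complex linearity visible.\<close>

lemma holo_map_iff_matrix:
  "holo_map f S \<longleftrightarrow> (\<forall>z\<in>S. \<exists>J. (f has_derivative (\<lambda>v. J *v v)) (at z))"
proof (intro iffI ballI)
  fix z assume "holo_map f S" "z \<in> S"
  then have "\<forall>i. \<exists>a. ((\<lambda>z. f z $ i) has_derivative (\<lambda>v. \<Sum>j\<in>UNIV. a $ j * v $ j)) (at z)"
    by (auto simp: holo_map_def holo_fun_def)
  then obtain a where a: "\<And>i. ((\<lambda>z. f z $ i) has_derivative (\<lambda>v. \<Sum>j\<in>UNIV. a i $ j * v $ j)) (at z)"
    by metis
  have "(f has_derivative (\<lambda>v. (\<chi> i. a i) *v v)) (at z)"
    by (rule has_derivative_vec_componentwise) (use a in \<open>simp add: matrix_vector_mult_def\<close>)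
  then show "\<exists>J. (f has_derivative (\<lambda>v. J *v v)) (at z)" by blast
next
  assume *: "\<forall>z\<in>S. \<exists>J. (f has_derivative (\<lambda>v. J *v v)) (at z)"
  show "holo_map f S"
    unfolding holo_map_def holo_fun_def
  proof (intro allI ballI)
    fix i z assume "z \<in> S"
    with * obtain J where J: "(f has_derivative (\<lambda>v. J *v v)) (at z)" by blast
    have "((\<lambda>z. f z $ i) has_derivative (\<lambda>v. (J *v v) $ i)) (at z)"
      by (rule bounded_linear.has_derivative[OF bounded_linear_vec_nth J])
    then show "\<exists>a. ((\<lambda>z. f z $ i) has_derivative (\<lambda>v. \<Sum>j\<in>UNIV. a $ j * v $ j)) (at z)"
      by (intro exI[of _ "J $ i"]) (simp add: matrix_vector_mult_def)
  qed
qed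

lemma holo_map_at: "holo_map f S \<Longrightarrow> z \<in> S \<Longrightarrow> \<exists>J. (f has_derivative (\<lambda>v. J *v v)) (at z)"
  by (simp add: holo_map_iff_matrix)

lemma holo_map_subset: "holo_map f S \<Longrightarrow> T \<subseteq> S \<Longrightarrow> holo_map f T"
  by (auto simp: holo_map_iff_matrix)

lemma holo_map_continuous_on: "holo_map f S \<Longrightarrow> continuous_on S f"
  by (meson continuous_at_imp_continuous_on has_derivative_continuous holo_map_at)

text \<open>Complex curves are read as maps from the plane whose derivative is \<open>h \<mapsto> h *s u\<close>.\<close>

lemma holomorphic_curve_has_derivative:
  fixes c :: "complex \<Rightarrow> complex^'n"
  assumes "\<And>i. ((\<lambda>t. c t $ i) has_field_derivative u $ i) (at t)"
  shows "(c has_derivative (\<lambda>h. h *s u)) (at t)"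
proof (rule has_derivative_vec_componentwise)
  fix i show "((\<lambda>z. c z $ i) has_derivative (\<lambda>v. (v *s u) $ i)) (at t)"
    using assms[of i] by (simp add: has_field_derivative_def mult_commute_abs)
qed

lemma has_derivative_curve_nth:
  fixes c :: "complex \<Rightarrow> complex^'n"
  assumes "(c has_derivative (\<lambda>h. h *s u)) (at t)"
  shows "((\<lambda>t. c t $ i) has_field_derivative u $ i) (at t)"
  using bounded_linear.has_derivative[OF bounded_linear_vec_nth[of i] assms]
  by (simp add: has_field_derivative_def mult_commute_abs)

lemma matrix_vector_scale: "(J :: complex^'n^'m) *v (h *s u) = h *s (J *v u)"
  by (simp add: vec_eq_iff matrix_vector_mult_def sum_distrib_left ac_simps)

lemma has_derivative_curve_compose:
  fixes c :: "complex \<Rightarrow> complex^'n" and f :: "complex^'n \<Rightarrow> complex^'m"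
  assumes "(c has_derivative (\<lambda>h. h *s u)) (at t)"
    and "(f has_derivative (\<lambda>v. J *v v)) (at (c t))"
  shows "((\<lambda>t. f (c t)) has_derivative (\<lambda>h. h *s (J *v u))) (at t)"
  using diff_chain_at[OF assms] by (simp add: comp_def matrix_vector_scale)

lemma holo_map_curve_holomorphic:
  fixes c :: "complex \<Rightarrow> complex^'n" and f :: "complex^'n \<Rightarrow> complex^'m"
  assumes f: "holo_map f S" and c: "\<And>i. (\<lambda>t. c t $ i) holomorphic_on T" and T: "open T"
    and sub: "\<And>t. t \<in> T \<Longrightarrow> c t \<in> S"
  shows "(\<lambda>t. f (c t) $ i) holomorphic_on T"
proof (rule holomorphic_onI)
  fix t assume t: "t \<in> T"
  have "\<forall>i. ((\<lambda>t. c t $ i) has_field_derivative deriv (\<lambda>t. c t $ i) t) (at t)"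
    using holomorphic_derivI[OF c T t] by blast
  then have "(c has_derivative (\<lambda>h. h *s (\<chi> i. deriv (\<lambda>t. c t $ i) t))) (at t)"
    by (intro holomorphic_curve_has_derivative) simp
  moreover obtain J where "(f has_derivative (\<lambda>v. J *v v)) (at (c t))"
    using holo_map_at[OF f sub[OF t]] by blast
  ultimately have "((\<lambda>t. f (c t) $ i) has_field_derivative (J *v (\<chi> i. deriv (\<lambda>t. c t $ i) t)) $ i) (at t)"
    by (intro has_derivative_curve_nth has_derivative_curve_compose)
  then have "(\<lambda>t. f (c t) $ i) field_differentiable at t"
    unfolding field_differentiable_def by blast
  then show "(\<lambda>t. f (c t) $ i) field_differentiable at t within T"
    by (rule field_differentiable_at_within)
qed

lemma norm_vec_le_sum: "norm x \<le> (\<Sum>i\<in>UNIV. norm (x $ i))"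
  by (simp add: norm_vec_def L2_set_le_sum)

lemma norm_vec2_le: "norm (x :: complex^2) \<le> norm (x $ 1) + norm (x $ 2)"
  using norm_vec_le_sum[of x] by (simp add: sum_2)

lemma norm_matrix_vector_le:
  fixes J :: "complex^2^2"
  assumes "\<And>i j. norm (J $ i $ j) \<le> e"
  shows "norm (J *v v) \<le> 4 * e * norm v"
proof -
  have "norm ((J *v v) $ i) \<le> 2 * e * norm v" for i
  proof -
    have "norm ((J *v v) $ i) \<le> norm (J $ i $ 1) * norm (v $ 1) + norm (J $ i $ 2) * norm (v $ 2)"
      by (simp add: matrix_vector_mult_def sum_2 norm_triangle_ineq flip: norm_mult)
    also have "\<dots> \<le> e * norm v + e * norm v"
      by (intro add_mono mult_mono assms Finite_Cartesian_Product.norm_nth_le)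
         (use order_trans[OF norm_ge_zero assms[of i 1]] in auto)
    finally show ?thesis by simp
  qed
  from this[of 1] this[of 2] show ?thesis using norm_vec2_le[of "J *v v"] by simp
qed

text \<open>On the complex line \<open>z0 + t v\<close> the map is bounded over the disc of radius
  \<open>s / norm v\<close>, which reduces everything to one variable, evaluated at t = 1. Adding
  two components doubles the constants 4 and 32.\<close>

lemma holo_map_bounded_estimates:
  fixes f :: "complex^2 \<Rightarrow> complex^2"
  assumes f: "holo_map f (ball z0 s)" and s: "0 < s"
    and bd: "\<And>z. z \<in> ball z0 s \<Longrightarrow> norm (f z) \<le> B"
    and J: "(f has_derivative (\<lambda>v. J *v v)) (at z0)"
  shows "norm (J $ i $ j) \<le> 4 * B / s"
    and "norm v \<le> s / 2 \<Longrightarrow> norm (f (z0 + v) - f z0) \<le> 8 * B / s * norm v"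
    and "norm v \<le> s / 2 \<Longrightarrow> norm (f (z0 + v) - f z0 - J *v v) \<le> 64 * B / s^2 * norm v ^ 2"
proof -
  have key: "norm ((J *v v) $ i) \<le> 4 * B / s * norm v \<and>
     norm (f (z0 + v) $ i - f z0 $ i) \<le> 4 * B / s * norm v \<and>
     norm (f (z0 + v) $ i - f z0 $ i - (J *v v) $ i) \<le> 32 * B / s^2 * norm v ^ 2"
    if v: "norm v \<le> s / 2" "v \<noteq> 0" for v i
  proof -
    define \<rho> where "\<rho> = s / norm v"
    have \<rho>: "\<rho> > 0" using s v by (simp add: \<rho>_def)
    define c where "c = (\<lambda>t::complex. z0 + t *s v)"
    have nsv: "norm (t *s v) = norm t * norm v" for t :: complex
      by (simp add: norm_vec_def norm_mult L2_set_right_distrib)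
    have cin: "c t \<in> ball z0 s" if "t \<in> ball 0 \<rho>" for t
      using that v by (simp add: c_def dist_norm nsv \<rho>_def pos_less_divide_eq)
    have hol: "(\<lambda>t. f (c t) $ i) holomorphic_on ball 0 \<rho>"
    proof (rule holo_map_curve_holomorphic[OF f _ _ cin])
      show "(\<lambda>t. c t $ i) holomorphic_on ball 0 \<rho>" for i
        by (auto simp: c_def intro!: holomorphic_intros)
    qed auto
    have bnd: "norm (f (c t) $ i) \<le> B" if "t \<in> ball 0 \<rho>" for t
      using Finite_Cartesian_Product.norm_nth_le order_trans bd[OF cin[OF that]] by blast
    have cd: "(c has_derivative (\<lambda>h. h *s v)) (at 0)"
      unfolding c_def by (rule holomorphic_curve_has_derivative) (auto intro!: derivative_eq_intros)
    have c0: "c 0 = z0" by (simp add: c_def)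
    have c1: "c 1 = z0 + v" by (simp add: c_def)
    have der: "deriv (\<lambda>t. f (c t) $ i) 0 = (J *v v) $ i"
      by (rule DERIV_imp_deriv, rule has_derivative_curve_nth, rule has_derivative_curve_compose[OF cd])
         (use J c0 in simp)
    have r1: "norm (1::complex) \<le> \<rho> / 2" using v by (simp add: \<rho>_def field_simps)
    have B0: "4 * B / \<rho> = 4 * B / s * norm v" "32 * B / \<rho>^2 = 32 * B / s^2 * norm v ^ 2"
      using v s by (simp_all add: \<rho>_def power_divide)
    have "norm (deriv (\<lambda>t. f (c t) $ i) 0) \<le> 4 * B / \<rho>"
      by (rule holomorphic_bounded_ball_estimates(1)[OF hol \<rho> bnd])
    moreover have "norm (f (c 1) $ i - f (c 0) $ i) \<le> 4 * B / \<rho> * norm (1::complex)"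
      by (rule holomorphic_bounded_ball_estimates(2)[OF hol \<rho> bnd r1])
    moreover have "norm (f (c 1) $ i - f (c 0) $ i - 1 * deriv (\<lambda>t. f (c t) $ i) 0)
        \<le> 32 * B / \<rho>\<^sup>2 * norm (1::complex) ^ 2"
      by (rule holomorphic_bounded_ball_estimates(3)[OF hol \<rho> bnd r1])
    ultimately show ?thesis unfolding der c0 c1 B0 by simp
  qed
  show "norm (f (z0 + v) - f z0) \<le> 8 * B / s * norm v" if "norm v \<le> s / 2"
  proof (cases "v = 0")
    case False
    from key[OF that this, of 1] key[OF that this, of 2] show ?thesis
      using norm_vec2_le[of "f (z0 + v) - f z0"] by simp
  qed simp
  show "norm (f (z0 + v) - f z0 - J *v v) \<le> 64 * B / s^2 * norm v ^ 2" if "norm v \<le> s / 2"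
  proof (cases "v = 0")
    case False
    from key[OF that this, of 1] key[OF that this, of 2] show ?thesis
      using norm_vec2_le[of "f (z0 + v) - f z0 - J *v v"] by simp
  qed simp
  show "norm (J $ i $ j) \<le> 4 * B / s"
  proof -
    \<comment> \<open>A coordinate direction of the largest admissible length isolates one matrix
      entry.\<close>
    define v :: "complex^2" where "v = axis j (of_real (s/2))"
    have nv: "norm v = s / 2" using s by (simp add: v_def norm_axis_eq norm_mult norm_divide)
    have "v \<noteq> 0" using nv s by auto
    then have "norm ((J *v v) $ i) \<le> 4 * B / s * (s / 2)" using key[of v i] nv by simp
    moreover have "(J *v v) $ i = J $ i $ j * of_real (s/2)"
    proof -
      have "(J *v v) $ i = (\<Sum>k\<in>UNIV. J $ i $ k * v $ k)" by (simp add: matrix_vector_mult_def)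
      also have "\<dots> = (\<Sum>k\<in>UNIV. if k = j then J $ i $ j * of_real (s/2) else 0)"
        by (rule sum.cong) (auto simp: v_def axis_def)
      finally show ?thesis by simp
    qed
    ultimately have "norm (J $ i $ j) * (s/2) \<le> 4 * B / s * (s / 2)"
      using s by (simp add: norm_mult norm_divide)
    then show ?thesis by (rule mult_right_le_imp_le) (use s in simp)
  qed
qed

section \<open>Saddle fixed points near a limit of rank one\<close>

lemma eigval_if_char_poly_root:
  fixes J :: "complex^2^2"
  assumes "(J $ 1 $ 1 - \<mu>) * (J $ 2 $ 2 - \<mu>) = J $ 1 $ 2 * J $ 2 $ 1"
  shows "eigval J \<mu>"
proof -
  have *: "eigval J \<mu>" if "J $ 1 $ 1 * a + J $ 1 $ 2 * b = \<mu> * a" "J $ 2 $ 1 * a + J $ 2 $ 2 * b = \<mu> * b"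
    "a \<noteq> 0 \<or> b \<noteq> 0" for a b
    unfolding eigval_def
    by (rule exI[of _ "vector [a, b]"])
       (use that in \<open>auto simp: vec_eq_iff forall_2 matrix_vector_mult_def sum_2\<close>)
  consider "J $ 1 $ 2 \<noteq> 0" | "J $ 2 $ 1 \<noteq> 0" | "J $ 1 $ 2 = 0" "J $ 2 $ 1 = 0" by blast
  then show ?thesis
  proof cases
    case 1
    show ?thesis by (rule *[of "J $ 1 $ 2" "\<mu> - J $ 1 $ 1"]) (use 1 assms in \<open>simp_all add: algebra_simps\<close>)
  next
    case 2
    show ?thesis by (rule *[of "\<mu> - J $ 2 $ 2" "J $ 2 $ 1"]) (use 2 assms in \<open>simp_all add: algebra_simps\<close>)
  next
    case 3
    then have "J $ 1 $ 1 = \<mu> \<or> J $ 2 $ 2 = \<mu>" using assms by auto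
    then show ?thesis using *[of 1 0] *[of 0 1] 3 by auto
  qed
qed

lemma complex_quadratic_roots:
  fixes t d :: complex
  obtains \<mu> \<nu> where "\<mu> + \<nu> = t" "\<mu> * \<nu> = d" "norm \<mu> \<le> norm \<nu>"
proof -
  define w where "w = csqrt (t\<^sup>2 - 4 * d)"
  have w: "w\<^sup>2 = t\<^sup>2 - 4 * d" by (simp add: w_def)
  define x y where "x = (t - w) / 2" and "y = (t + w) / 2"
  have "x + y = t" by (simp add: x_def y_def field_simps)
  moreover have "x * y = d" using w by (simp add: x_def y_def field_simps power2_eq_square)
  ultimately show ?thesis using that[of x y] that[of y x] by (cases "norm x \<le> norm y") (auto simp: ac_simps)
qed

text \<open>The matrix L has eigenvalues 0 and its trace. Determinant and trace are polynomials in
  the entries, so smallness of the one and size of the other persist nearby. They give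
  \<open>norm \<mu> ^ 2 \<le> norm (\<mu> * \<nu>) < \<theta> ^ 2\<close> for the smaller root, and
  the larger root is at least the trace minus that.\<close>

lemma saddle_eigenvalues_stable:
  fixes L :: "complex^2^2"
  assumes det0: "L $ 1 $ 1 * L $ 2 $ 2 = L $ 1 $ 2 * L $ 2 $ 1"
    and tr: "norm (L $ 1 $ 1 + L $ 2 $ 2) > 1"
  obtains \<eta> where "\<eta> > 0" "\<And>J :: complex^2^2. (\<And>a b. norm (J $ a $ b - L $ a $ b) < \<eta>) \<Longrightarrow>
    \<exists>\<mu> \<nu>. eigval J \<mu> \<and> eigval J \<nu> \<and> norm \<mu> < 1 \<and> norm \<nu> > 1"
proof -
  define \<theta> where "\<theta> = min (1/2) ((norm (L $ 1 $ 1 + L $ 2 $ 2) - 1) / 2)"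
  have \<theta>: "\<theta> > 0" "\<theta> \<le> 1/2" "norm (L $ 1 $ 1 + L $ 2 $ 2) > 1 + \<theta>" using tr by (auto simp: \<theta>_def min_def field_simps)
  define de where "de = (\<lambda>J::complex^2^2. J $ 1 $ 1 * J $ 2 $ 2 - J $ 1 $ 2 * J $ 2 $ 1)"
  define trc where "trc = (\<lambda>J::complex^2^2. J $ 1 $ 1 + J $ 2 $ 2)"
  have "open {J. norm (de J) < \<theta>\<^sup>2 \<and> norm (trc J) > 1 + \<theta>}"
    unfolding de_def trc_def
    by (intro open_Collect_conj open_Collect_less continuous_intros)
  moreover have "L \<in> {J. norm (de J) < \<theta>\<^sup>2 \<and> norm (trc J) > 1 + \<theta>}"
    using det0 \<theta> by (simp add: de_def trc_def)
  ultimately obtain d where d: "d > 0" "\<And>J. dist J L < d \<Longrightarrow> norm (de J) < \<theta>\<^sup>2 \<and> norm (trc J) > 1 + \<theta>"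
    unfolding open_dist by blast
  show ?thesis
  proof (rule that[of "d / 4"])
    show "d / 4 > 0" using d by simp
    fix J :: "complex^2^2" assume J: "\<And>a b. norm (J $ a $ b - L $ a $ b) < d / 4"
    have "dist J L \<le> (\<Sum>a\<in>UNIV. norm ((J - L) $ a))" unfolding dist_norm by (rule norm_vec_le_sum)
    also have "\<dots> \<le> (\<Sum>a\<in>UNIV. (\<Sum>b\<in>UNIV. norm ((J - L) $ a $ b)))" by (intro sum_mono norm_vec_le_sum)
    also have "\<dots> < d" using J[of 1 1] J[of 1 2] J[of 2 1] J[of 2 2] by (simp add: sum_2)
    finally have J': "norm (de J) < \<theta>\<^sup>2" "norm (trc J) > 1 + \<theta>" using d by auto
    obtain \<mu> \<nu> where r: "\<mu> + \<nu> = trc J" "\<mu> * \<nu> = de J" "norm \<mu> \<le> norm \<nu>"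
      using complex_quadratic_roots by metis
    have "norm \<mu> * norm \<mu> \<le> norm \<mu> * norm \<nu>" using r by (intro mult_left_mono) auto
    then have "(norm \<mu>)\<^sup>2 < \<theta>\<^sup>2" using J' r by (simp add: power2_eq_square flip: norm_mult)
    then have m: "norm \<mu> < \<theta>" by (rule power_less_imp_less_base) (use \<theta> in simp)
    have "norm (trc J) \<le> norm \<mu> + norm \<nu>" using r norm_triangle_ineq by metis
    then have "norm \<nu> > 1" using J' m by simp
    moreover have "norm \<mu> < 1" using m \<theta> by simp
    moreover have "eigval J \<mu>"
      by (rule eigval_if_char_poly_root) (use r in \<open>simp add: de_def trc_def, algebra\<close>)
    moreover have "eigval J \<nu>"
      by (rule eigval_if_char_poly_root) (use r in \<open>simp add: de_def trc_def, algebra\<close>)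
    ultimately show "\<exists>\<mu> \<nu>. eigval J \<mu> \<and> eigval J \<nu> \<and> norm \<mu> < 1 \<and> norm \<nu> > 1" by blast
  qed
qed

lemma has_derivative_at_if_quadratic_error:
  fixes f :: "'a::real_normed_vector \<Rightarrow> 'b::real_normed_vector"
  assumes "bounded_linear f'" "0 < d"
    and "\<And>v. norm v \<le> d \<Longrightarrow> norm (f (x + v) - f x - f' v) \<le> C * norm v ^ 2"
  shows "(f has_derivative f') (at x)"
proof (rule has_derivativeI_sandwich[where e = d and H = "\<lambda>y. C * norm (y - x)"])
  show "((\<lambda>y. C * norm (y - x)) \<longlongrightarrow> 0) (at x)"
    by (rule tendsto_eq_intros refl | simp)+
  fix y assume y: "y \<noteq> x" "dist y x < d"
  have "norm (f (x + (y - x)) - f x - f' (y - x)) \<le> C * norm (y - x) ^ 2"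
    by (rule assms(3)) (use y in \<open>simp add: dist_norm\<close>)
  then show "norm (f y - f x - f' (y - x)) / norm (y - x) \<le> C * norm (y - x)"
    using y by (simp add: divide_le_eq power2_eq_square mult.assoc)
qed (use assms in auto)

lemma bounded_linear_matrix_vector_complex: "bounded_linear (\<lambda>v. (J :: complex^2^2) *v v)"
  using matrix_vector_mul_bounded_linear[of J] by simp

text \<open>Difference quotients with a fixed small step t converge in j and differ from the
  derivative by O(t) uniformly in j, so the derivatives form a Cauchy sequence. The second order
  estimate then passes to the limit and makes G differentiable.\<close>

lemma limit_of_bounded_holo_maps_has_derivative:
  fixes g :: "nat \<Rightarrow> complex^2 \<Rightarrow> complex^2"
  assumes s: "0 < s"
    and hol: "\<And>j. holo_map (g j) (ball z0 s)"
    and bd: "\<And>j z. z \<in> ball z0 s \<Longrightarrow> norm (g j z) \<le> B"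
    and lim: "\<And>z. z \<in> ball z0 s \<Longrightarrow> (\<lambda>j. g j z) \<longlonglongrightarrow> G z"
    and J: "\<And>j. (g j has_derivative (\<lambda>v. J j *v v)) (at z0)"
  obtains L where "\<And>a b. (\<lambda>j. J j $ a $ b) \<longlonglongrightarrow> L $ a $ b" "(G has_derivative (\<lambda>v. L *v v)) (at z0)"
proof -
  define C where "C = 64 * B / s^2"
  have B0: "B \<ge> 0" using bd[of z0 0] s norm_ge_zero[of "g 0 z0"] by (simp del: norm_ge_zero)
  have C0: "C \<ge> 0" using B0 by (simp add: C_def)
  have est: "norm (g j (z0 + v) - g j z0 - J j *v v) \<le> C * norm v ^ 2" if "norm v \<le> s / 2" for j v
    unfolding C_def by (rule holo_map_bounded_estimates(3)[OF hol s bd J that])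
  have inb: "z0 + v \<in> ball z0 s" if "norm v \<le> s / 2" for v
    using that s by (simp add: dist_norm)
  have z0in: "z0 \<in> ball z0 s" using s by simp
  have "Cauchy (\<lambda>j. J j $ a $ b)" for a b
  proof (rule CauchyI)
    fix e :: real assume e: "0 < e"
    \<comment> \<open>Makes the second order error \<open>C * t\<close> at most e/8;
      \<open>C + 1\<close> avoids a zero denominator.\<close>
    define t where "t = min (s/4) (e / (8 * (C + 1)))"
    have t: "t > 0" "t \<le> s/2" using s e C0 by (auto simp: t_def)
    have "(C + 1) * t \<le> (C + 1) * (e / (8 * (C + 1)))" using C0 by (intro mult_left_mono) (auto simp: t_def)
    also have "\<dots> = e / 8" using C0 by (simp add: field_simps)
    finally have Ct: "C * t \<le> e / 8" using t by (simp add: algebra_simps)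
    define v :: "complex^2" where "v = axis b (of_real t)"
    have nv: "norm v = t" using t by (simp add: v_def norm_axis_eq)
    define w where "w = (\<lambda>j. (g j (z0 + v) - g j z0) $ a)"
    have "w \<longlonglongrightarrow> (G (z0 + v) - G z0) $ a"
      unfolding w_def by (intro tendsto_vec_nth tendsto_diff lim inb z0in) (use nv t in simp)
    then have "Cauchy w" by (rule LIMSEQ_imp_Cauchy)
    then obtain M where M: "\<And>m n. m \<ge> M \<Longrightarrow> n \<ge> M \<Longrightarrow> norm (w m - w n) < e * t / 4"
      using CauchyD[of w "e * t / 4"] e t by auto
    have col: "(J j *v v) $ a = J j $ a $ b * of_real t" for j
    proof -
      have "(J j *v v) $ a = (\<Sum>k\<in>UNIV. J j $ a $ k * v $ k)" by (simp add: matrix_vector_mult_def)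
      also have "\<dots> = (\<Sum>k\<in>UNIV. if k = b then J j $ a $ b * of_real t else 0)"
        by (rule sum.cong) (auto simp: v_def axis_def)
      finally show ?thesis by simp
    qed
    have near: "norm (w j - J j $ a $ b * of_real t) \<le> t * (e / 8)" for j
    proof -
      have "norm (w j - J j $ a $ b * of_real t) = norm ((g j (z0 + v) - g j z0 - J j *v v) $ a)"
        by (simp add: w_def col)
      also have "\<dots> \<le> C * t ^ 2"
        using est[of v j] nv t order_trans[OF Finite_Cartesian_Product.norm_nth_le] by metis
      also have "\<dots> = t * (C * t)" by (simp add: power2_eq_square)
      also have "\<dots> \<le> t * (e / 8)" by (rule mult_left_mono[OF Ct]) (use t in simp)
      finally show ?thesis .
    qed
    show "\<exists>M. \<forall>m\<ge>M. \<forall>n\<ge>M. norm (J m $ a $ b - J n $ a $ b) < e"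
    proof (intro exI allI impI)
      fix m n assume mn: "M \<le> m" "M \<le> n"
      have "norm ((J m $ a $ b - J n $ a $ b) * of_real t)
        = norm ((w m - w n) - (w m - J m $ a $ b * of_real t) + (w n - J n $ a $ b * of_real t))"
        by (simp add: algebra_simps)
      also have "\<dots> \<le> norm (w m - w n) + norm (w m - J m $ a $ b * of_real t) + norm (w n - J n $ a $ b * of_real t)"
        by (meson add_mono norm_triangle_ineq norm_triangle_ineq4 order_refl order_trans)
      also have "\<dots> < e * t / 4 + t * (e/8) + t * (e/8)" using M[OF mn] near[of m] near[of n] by linarith
      also have "\<dots> \<le> e * t" using e t by (simp add: algebra_simps)
      finally have "norm (J m $ a $ b - J n $ a $ b) * t < e * t" using t by (simp add: norm_mult)
      then show "norm (J m $ a $ b - J n $ a $ b) < e" using t by simp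
    qed
  qed
  then have "\<forall>a b. \<exists>l. (\<lambda>j. J j $ a $ b) \<longlonglongrightarrow> l"
    using Cauchy_convergent convergent_def by blast
  then obtain l where l: "\<And>a b. (\<lambda>j. J j $ a $ b) \<longlonglongrightarrow> l a b" by metis
  define L where "L = (\<chi> a b. l a b)"
  have L: "(\<lambda>j. J j $ a $ b) \<longlonglongrightarrow> L $ a $ b" for a b using l by (simp add: L_def)
  have Lv: "(\<lambda>j. J j *v v) \<longlonglongrightarrow> L *v v" for v
    by (rule vec_tendstoI) (simp add: matrix_vector_mult_def, intro tendsto_intros L)
  have "(G has_derivative (\<lambda>v. L *v v)) (at z0)"
  proof (rule has_derivative_at_if_quadratic_error[OF bounded_linear_matrix_vector_complex, of "s/2" _ _ _ C])
    fix v :: "complex^2" assume v: "norm v \<le> s/2"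
    have "(\<lambda>j. norm (g j (z0 + v) - g j z0 - J j *v v)) \<longlonglongrightarrow> norm (G (z0 + v) - G z0 - L *v v)"
      by (intro tendsto_intros lim inb v z0in Lv)
    then show "norm (G (z0 + v) - G z0 - L *v v) \<le> C * norm v ^ 2"
      by (rule LIMSEQ_le_const2) (use est[OF v] in auto)
  qed (use s in auto)
  with L that show ?thesis by blast
qed

text \<open>Convergence is only pointwise, but the Cauchy estimates give a common Lipschitz
  constant, which the limit inherits. Two points of the ball of radius s/8 are at distance at most
  s/4, half the radius of a ball of radius s/2 about either of them.\<close>

lemma continuous_on_limit_of_bounded_holo_maps:
  fixes g :: "nat \<Rightarrow> complex^2 \<Rightarrow> complex^2"
  assumes s: "0 < s"
    and hol: "\<And>j. holo_map (g j) (ball z0 s)"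
    and bd: "\<And>j z. z \<in> ball z0 s \<Longrightarrow> norm (g j z) \<le> B"
    and lim: "\<And>z. z \<in> ball z0 s \<Longrightarrow> (\<lambda>j. g j z) \<longlonglongrightarrow> G z"
  shows "continuous_on (ball z0 (s/8)) G"
proof -
  have B0: "B \<ge> 0" using bd[of z0 0] s norm_ge_zero[of "g 0 z0"] by (simp del: norm_ge_zero)
  have lip: "norm (G y - G x) \<le> 16 * B / s * norm (y - x)"
    if x: "x \<in> ball z0 (s/8)" and y: "y \<in> ball z0 (s/8)" for x y
  proof -
    have sub: "ball x (s/2) \<subseteq> ball z0 s" unfolding ball_subset_ball_iff using x s by (simp add: dist_commute)
    have xy: "norm (y - x) \<le> (s/2)/2"
      using dist_triangle[of y x z0] x y by (simp add: dist_norm[symmetric] dist_commute)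
    have xin: "x \<in> ball z0 s" "y \<in> ball z0 s" using x y s by auto
    have "norm (g j y - g j x) \<le> 16 * B / s * norm (y - x)" for j
    proof -
      have h: "holo_map (g j) (ball x (s/2))" using hol holo_map_subset sub by blast
      obtain J where J: "(g j has_derivative (\<lambda>v. J *v v)) (at x)" using holo_map_at[OF hol xin(1)] by blast
      have b: "norm (g j z) \<le> B" if "z \<in> ball x (s/2)" for z using bd sub that by blast
      have "norm (g j (x + (y - x)) - g j x) \<le> 8 * B / (s/2) * norm (y - x)"
        by (rule holo_map_bounded_estimates(2)[OF h _ b J xy]) (use s in auto)
      then show ?thesis by simp
    qed
    moreover have "(\<lambda>j. norm (g j y - g j x)) \<longlonglongrightarrow> norm (G y - G x)"
      by (intro tendsto_intros lim xin)
    ultimately show ?thesis by (intro LIMSEQ_le_const2) auto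
  qed
  have "(16 * B / s)-lipschitz_on (ball z0 (s/8)) G"
    by (rule lipschitz_onI) (use lip B0 s in \<open>auto simp: dist_norm norm_minus_commute\<close>)
  then show ?thesis by (rule lipschitz_on_continuous_on)
qed

text \<open>Differentiating the semiconjugacy at the fixed point turns the multiplier of h into an
  eigenvalue, with the tangent of the curve as eigenvector.\<close>

lemma derivative_on_curve_conjugated:
  fixes \<psi> :: "complex \<Rightarrow> complex^2" and G :: "complex^2 \<Rightarrow> complex^2"
  assumes L: "(G has_derivative (\<lambda>v. L *v v)) (at (\<psi> \<zeta>))"
    and \<psi>: "(\<psi> has_derivative (\<lambda>h. h *s u)) (at \<zeta>)"
    and h: "(h has_field_derivative D) (at \<zeta>)" "h \<zeta> = \<zeta>"
    and conj: "\<forall>\<^sub>F w in nhds \<zeta>. G (\<psi> w) = \<psi> (h w)"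
  shows "L *v u = D *s u"
proof -
  have 1: "((\<lambda>w. G (\<psi> w)) has_derivative (\<lambda>h. h *s (L *v u))) (at \<zeta>)"
    by (rule has_derivative_curve_compose[OF \<psi> L])
  have "(h has_derivative (\<lambda>k. D * k)) (at \<zeta>)" using h(1) by (simp add: has_field_derivative_def)
  then have "((\<psi> \<circ> h) has_derivative ((\<lambda>h. h *s u) \<circ> (\<lambda>k. D * k))) (at \<zeta>)"
    by (rule diff_chain_at) (use \<psi> h in simp)
  moreover have "\<forall>\<^sub>F w in at \<zeta>. (\<psi> \<circ> h) w = G (\<psi> w)"
    using conj by (auto simp: eventually_at_filter elim: eventually_mono)
  moreover have "(\<psi> \<circ> h) \<zeta> = G (\<psi> \<zeta>)" using eventually_nhds_x_imp_x[OF conj] by simp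
  ultimately have 2: "((\<lambda>w. G (\<psi> w)) has_derivative ((\<lambda>h. h *s u) \<circ> (\<lambda>k. D * k))) (at \<zeta>)"
    by (rule has_derivative_transform_eventually) auto
  have "(\<lambda>h. h *s (L *v u)) = ((\<lambda>h. h *s u) \<circ> (\<lambda>k. D * k))" by (rule has_derivative_unique[OF 1 2])
  from fun_cong[OF this, of 1] show ?thesis by simp
qed

text \<open>An invertible derivative at \<open>z0\<close> would make \<open>G z0\<close> an interior
  point of the image. Sussmann's form of the open mapping theorem asks for the derivative at this
  single point, which is what the limit of the iterates supplies.\<close>

lemma det_derivative_zero_if_thin_image:
  fixes G :: "complex^2 \<Rightarrow> complex^2"
  assumes r: "r > 0" and cont: "continuous_on (ball z0 r) G"
    and L: "(G has_derivative (\<lambda>v. L *v v)) (at z0)"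
    and thin: "interior (G ` ball z0 r) = {}"
  shows "det L = 0"
proof (rule ccontr)
  assume "det L \<noteq> 0"
  then have "invertible L" by (simp add: invertible_det_nz)
  then obtain M where M: "L ** M = mat 1" unfolding invertible_def by blast
  have "G z0 \<in> interior (G ` ball z0 r)"
  proof (rule sussmann_open_mapping[OF open_ball cont _ L bounded_linear_matrix_vector_complex[of M]])
    show "(\<lambda>v. L *v v) \<circ> (\<lambda>v. M *v v) = id"
      by (rule ext) (simp add: matrix_vector_mul_assoc M)
  qed (use r in auto)
  then show False using thin by simp
qed

lemma trace_if_rank_one:
  fixes L :: "complex^2^2"
  assumes "det L = 0" "L *v u = D *s u" "u \<noteq> 0" "D \<noteq> 0"
  shows "L $ 1 $ 1 + L $ 2 $ 2 = D"
proof -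
  have e: "L $ 1 $ 1 * u $ 1 + L $ 1 $ 2 * u $ 2 = D * u $ 1" "L $ 2 $ 1 * u $ 1 + L $ 2 $ 2 * u $ 2 = D * u $ 2"
    using assms(2) by (auto simp: vec_eq_iff forall_2 matrix_vector_mult_def sum_2)
  have d: "L $ 1 $ 1 * L $ 2 $ 2 - L $ 1 $ 2 * L $ 2 $ 1 = 0" using assms(1) by (simp add: det_2)
  have nz: "u $ 1 \<noteq> 0 \<or> u $ 2 \<noteq> 0" using assms(3) by (auto simp: vec_eq_iff forall_2)
  \<comment> \<open>Cayley-Hamilton with determinant 0: \<open>L (L u)\<close> is the trace times
    \<open>L u\<close>, that is, \<open>D^2 u\<close> equals D times the trace times u.\<close>
  have "D * (D - L $ 1 $ 1 - L $ 2 $ 2) * u $ 1 = 0" using e d by algebra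
  moreover have "D * (D - L $ 1 $ 1 - L $ 2 $ 2) * u $ 2 = 0" using e d by algebra
  ultimately have "D - L $ 1 $ 1 - L $ 2 $ 2 = 0" using nz assms(4) by auto
  then show ?thesis by (simp add: algebra_simps)
qed

text \<open>Since 1 is not an eigenvalue of the limit derivative L, the Newton type map
  \<open>z - M (g z - z)\<close>, with M the inverse of \<open>L - 1\<close>, sends a small ball
  into itself, and Brouwer's theorem gives a fixed point there. A Cauchy estimate keeps the
  derivative at that point close to L, whose eigenvalues are 0 and D.\<close>

lemma saddle_fixed_points_near_rank_one_limit:
  fixes g :: "nat \<Rightarrow> complex^2 \<Rightarrow> complex^2"
  assumes s: "0 < s"
    and hol: "\<And>j. holo_map (g j) (ball z0 s)"
    and bd: "\<And>j z. z \<in> ball z0 s \<Longrightarrow> norm (g j z) \<le> B"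
    and lim: "\<And>z. z \<in> ball z0 s \<Longrightarrow> (\<lambda>j. g j z) \<longlonglongrightarrow> G z"
    and fixp: "G z0 = z0"
    and \<psi>: "(\<psi> has_derivative (\<lambda>h. h *s u)) (at \<zeta>)" "u \<noteq> 0" "\<psi> \<zeta> = z0"
    and h: "(h has_field_derivative D) (at \<zeta>)" "h \<zeta> = \<zeta>" "1 < norm D"
    and conj: "\<forall>\<^sub>F w in nhds \<zeta>. G (\<psi> w) = \<psi> (h w)"
    and thin: "interior (G ` ball z0 s) = {}"
    and e: "0 < e"
  shows "\<forall>\<^sub>F j in sequentially. \<exists>z\<in>ball z0 e. g j z = z \<and> (\<exists>J. (g j has_derivative (\<lambda>v. J *v v)) (at z) \<and>
           (\<exists>\<mu> \<nu>. eigval J \<mu> \<and> eigval J \<nu> \<and> norm \<mu> < 1 \<and> norm \<nu> > 1))"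
proof -
  define C where "C = 64 * B / s^2"
  have B0: "B \<ge> 0" using bd[of z0 0] s norm_ge_zero[of "g 0 z0"] by (simp del: norm_ge_zero)
  have C0: "C \<ge> 0" using B0 by (simp add: C_def)
  have z0in: "z0 \<in> ball z0 s" using s by simp
  have "\<forall>j. \<exists>J. (g j has_derivative (\<lambda>v. J *v v)) (at z0)" using holo_map_at[OF hol z0in] by blast
  then obtain J where J: "\<And>j. (g j has_derivative (\<lambda>v. J j *v v)) (at z0)" by metis
  have est: "norm (g j (z0 + v) - g j z0 - J j *v v) \<le> C * norm v ^ 2" if "norm v \<le> s / 2" for j v
    unfolding C_def by (rule holo_map_bounded_estimates(3)[OF hol s bd J that])
  obtain L where Lc: "\<And>a b. (\<lambda>j. J j $ a $ b) \<longlonglongrightarrow> L $ a $ b" and L: "(G has_derivative (\<lambda>v. L *v v)) (at z0)"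
    using limit_of_bounded_holo_maps_has_derivative[OF s hol bd lim J] by metis
  have Lu: "L *v u = D *s u"
    by (rule derivative_on_curve_conjugated[OF _ \<psi>(1) h(1,2) conj]) (use L \<psi> in simp)
  have detL: "det L = 0"
  proof (rule det_derivative_zero_if_thin_image[OF _ continuous_on_limit_of_bounded_holo_maps[OF s hol bd lim] L])
    have "G ` ball z0 (s/8) \<subseteq> G ` ball z0 s" using s by (intro image_mono subset_ball) simp
    then show "interior (G ` ball z0 (s/8)) = {}" using interior_mono thin by blast
  qed (use s in auto)
  have D0: "D \<noteq> 0" "D \<noteq> 1" using h(3) by auto
  have tr: "L $ 1 $ 1 + L $ 2 $ 2 = D" by (rule trace_if_rank_one[OF detL Lu \<psi>(2) D0(1)])
  have det2: "L $ 1 $ 1 * L $ 2 $ 2 = L $ 1 $ 2 * L $ 2 $ 1" using detL by (simp add: det_2)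
  obtain \<eta> where \<eta>: "\<eta> > 0" "\<And>J :: complex^2^2. (\<And>a b. norm (J $ a $ b - L $ a $ b) < \<eta>) \<Longrightarrow>
    \<exists>\<mu> \<nu>. eigval J \<mu> \<and> eigval J \<nu> \<and> norm \<mu> < 1 \<and> norm \<nu> > 1"
    using saddle_eigenvalues_stable[OF det2] tr h(3) by metis
  \<comment> \<open>In dimension two \<open>det (L - 1)\<close> is 1 minus the trace plus the
    determinant.\<close>
  have "det (L - mat 1) = 1 - D" using tr det2 by (simp add: det_2 mat_def algebra_simps)
  then have "invertible (L - mat 1)" using D0 by (simp add: invertible_det_nz)
  then obtain M where M: "(L - mat 1) ** M = mat 1" "M ** (L - mat 1) = mat 1" unfolding invertible_def by blast
  define m where "m = 1 + (\<Sum>a\<in>UNIV. \<Sum>b\<in>UNIV. norm (M $ a $ b))"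
  have m: "norm (M $ a $ b) \<le> m" for a b
    using exhaust_2[of a] exhaust_2[of b] by (auto simp: m_def sum_2)
  have m1: "m \<ge> 1" by (simp add: m_def sum_nonneg)
  define K where "K = 4 * m"
  have K: "norm (M *v v) \<le> K * norm v" for v unfolding K_def by (rule norm_matrix_vector_le[OF m])
  have K1: "K \<ge> 4" using m1 by (simp add: K_def)
  \<comment> \<open>In turn: the fixed point falls within e; all balls used stay in
    \<open>ball z0 s\<close>; \<open>K * C * t \<le> 1/4\<close> for the self-map property;
    \<open>64 * C * t \<le> \<eta>\<close> for the derivative at the fixed point.\<close>
  define t where "t = min (min (e/2) (s/8)) (min (1 / (4 * K * (C + 1))) (\<eta> / (64 * (C + 1))))"
  have t: "t > 0" using e s K1 C0 \<eta> by (auto simp: t_def)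
  have "t \<le> e/2" "t \<le> s/8" by (auto simp only: t_def min.coboundedI1 min.coboundedI2 order_refl)
  then have t: "t > 0" "t < e" "t \<le> s/8" using t e by auto
  have "t \<le> 1 / (4 * K * (C + 1))" "t \<le> \<eta> / (64 * (C + 1))" by (auto simp: t_def)
  then have "t * (4 * K * (C + 1)) \<le> 1" "t * (64 * (C + 1)) \<le> \<eta>" using K1 C0 by (simp_all add: pos_le_divide_eq)
  then have "4 * (t * K) + 4 * (K * C * t) \<le> 1" "64 * t + 64 * C * t \<le> \<eta>" by (simp_all add: algebra_simps)
  moreover have "0 \<le> t * K" using t K1 by simp
  ultimately have tC: "K * C * t \<le> 1/4" "64 * C * t \<le> \<eta>" using t by linarith+
  have evJ: "\<forall>\<^sub>F j in sequentially. \<forall>a b. norm (J j $ a $ b - L $ a $ b) < min (\<eta>/2) (1 / (16 * K))"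
  proof -
    have "\<forall>\<^sub>F j in sequentially. norm (J j $ a $ b - L $ a $ b) < min (\<eta>/2) (1 / (16 * K))" for a b
      using tendstoD[OF Lc[of a b], of "min (\<eta>/2) (1 / (16 * K))"] \<eta> K1 by (simp add: dist_norm)
    then show ?thesis by (simp add: forall_2 eventually_conj_iff)
  qed
  have evz: "\<forall>\<^sub>F j in sequentially. norm (g j z0 - z0) < t / (4 * K)"
    using tendstoD[OF lim[OF z0in], of "t / (4 * K)"] t K1 fixp by (simp add: dist_norm)
  show ?thesis
    using evJ evz
  proof eventually_elim
    case (elim j)
    define \<Phi> where "\<Phi> = (\<lambda>z. z - M *v (g j z - z))"
    have sub: "cball z0 t \<subseteq> ball z0 s" using t s by auto
    have cont: "continuous_on (cball z0 t) \<Phi>"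
      unfolding \<Phi>_def
      by (intro continuous_intros continuous_on_subset[OF holo_map_continuous_on[OF hol] sub]
          linear_continuous_on_compose[OF _ bounded_linear.linear[OF bounded_linear_matrix_vector_complex]])
    have map: "\<Phi> z \<in> cball z0 t" if z: "z \<in> cball z0 t" for z
    proof -
      define v where "v = z - z0"
      have v: "norm v \<le> t" "z = z0 + v" using z by (auto simp: v_def dist_norm norm_minus_commute)
      define R where "R = g j (z0 + v) - g j z0 - J j *v v"
      have R: "norm R \<le> C * norm v ^ 2" unfolding R_def by (rule est) (use v t s in linarith)
      have "norm v ^ 2 \<le> t ^ 2" using v by (simp add: power_mono)
      then have R': "norm R \<le> C * t * t" using R mult_left_mono[OF _ C0] by (fastforce simp: power2_eq_square mult.assoc)
      have jl: "norm ((J j - L) *v v) \<le> 4 * (1 / (16 * K)) * norm v"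
        by (rule norm_matrix_vector_le) (use elim in \<open>simp add: less_imp_le\<close>)
      also have "\<dots> \<le> 4 * (1 / (16 * K)) * t" using v K1 by (intro mult_left_mono) auto
      finally have jl: "norm ((J j - L) *v v) \<le> t / (4 * K)" by simp
      have "M *v ((L - mat 1) *v v) = v" by (simp add: matrix_vector_mul_assoc M)
      then have Mv: "M *v (L *v v - v) = v" by (simp add: matrix_vector_mult_diff_rdistrib)
      have gz: "g j z - z = (L *v v - v) + ((J j - L) *v v + R + (g j z0 - z0))"
        by (simp add: R_def v matrix_vector_mult_diff_rdistrib)
      have "\<Phi> z - z0 = v - M *v (g j z - z)" by (simp add: \<Phi>_def v(2))
      also have "\<dots> = v - (v + M *v ((J j - L) *v v + R + (g j z0 - z0)))"
        unfolding gz matrix_vector_right_distrib[of M "L *v v - v"] Mv ..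
      finally have "\<Phi> z - z0 = - (M *v ((J j - L) *v v + R + (g j z0 - z0)))" by simp
      then have "norm (\<Phi> z - z0) \<le> K * norm ((J j - L) *v v + R + (g j z0 - z0))"
        using K by simp
      also have "\<dots> \<le> K * (t / (4 * K) + C * t * t + t / (4 * K))"
        using jl R' elim K1
        by (intro mult_left_mono order_trans[OF norm_triangle_ineq] add_mono) (auto simp: less_imp_le)
      also have "\<dots> = t / 2 + (K * C * t) * t" using K1 by (simp add: field_simps)
      also have "\<dots> \<le> t / 2 + 1/4 * t" using tC t by (intro add_left_mono mult_right_mono) auto
      also have "\<dots> \<le> t" using t by simp
      finally show ?thesis by (simp add: dist_norm norm_minus_commute)
    qed
    obtain z where z: "z \<in> cball z0 t" "\<Phi> z = z"
      using brouwer[of "cball z0 t" \<Phi>] cont map t by (auto simp: Pi_def)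
    have zin: "z \<in> ball z0 s" using z sub by auto
    have "(L - mat 1) *v (M *v (g j z - z)) = 0" using z by (simp add: \<Phi>_def)
    then have fx: "g j z = z" by (simp add: matrix_vector_mul_assoc M)
    obtain J' where J': "(g j has_derivative (\<lambda>v. J' *v v)) (at z)" using holo_map_at[OF hol zin] by blast
    \<comment> \<open>Without its affine part the map has size at most \<open>C * (2 * t)^2\<close>
      on a ball of radius t, so a Cauchy estimate bounds its derivative by
      \<open>16 * C * t\<close>.\<close>
    define f where "f = (\<lambda>w. g j w - g j z0 - J j *v (w - z0))"
    have subz: "ball z t \<subseteq> ball z0 s"
      unfolding ball_subset_ball_iff using z t s by (simp add: dist_commute)
    have fder: "(f has_derivative (\<lambda>v. (A - J j) *v v)) (at w)"
      if "(g j has_derivative (\<lambda>v. A *v v)) (at w)" for A w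
    proof -
      have "((\<lambda>w. w - z0) has_derivative (\<lambda>v. v)) (at w)" by (auto intro!: derivative_eq_intros)
      from bounded_linear.has_derivative[OF bounded_linear_matrix_vector_complex this, of "J j"]
      have "((\<lambda>w. g j w - g j z0 - J j *v (w - z0)) has_derivative (\<lambda>v. A *v v - 0 - J j *v v)) (at w)"
        by (intro has_derivative_diff that has_derivative_const)
      then show ?thesis by (simp add: f_def matrix_vector_mult_diff_rdistrib)
    qed
    have fhol: "holo_map f (ball z t)"
      unfolding holo_map_iff_matrix using fder holo_map_at[OF hol] subz by blast
    have fb: "norm (f w) \<le> C * (2 * t)^2" if "w \<in> ball z t" for w
    proof -
      have w: "norm (w - z0) \<le> 2 * t"
        using that z dist_triangle[of w z0 z] by (simp add: dist_norm[symmetric] dist_commute)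
      then have "norm (g j (z0 + (w - z0)) - g j z0 - J j *v (w - z0)) \<le> C * norm (w - z0) ^ 2"
        by (intro est) (use t in linarith)
      also have "\<dots> \<le> C * (2 * t)^2" using w C0 by (intro mult_left_mono power_mono) auto
      finally show ?thesis by (simp add: f_def)
    qed
    have "norm (J' $ a $ b - L $ a $ b) < \<eta>" for a b
    proof -
      have "norm ((J' - J j) $ a $ b) \<le> 4 * (C * (2 * t)^2) / t"
        by (rule holo_map_bounded_estimates(1)[OF fhol t(1) fb fder[OF J']])
      also have "\<dots> = 16 * C * t" using t by (simp add: power2_eq_square)
      also have "\<dots> \<le> \<eta> / 4" using tC by simp
      finally have "norm (J' $ a $ b - J j $ a $ b) \<le> \<eta> / 4" by simp
      moreover have "norm (J j $ a $ b - L $ a $ b) < \<eta>/2" using elim by auto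
      ultimately show ?thesis
        using norm_triangle_ineq[of "J' $ a $ b - J j $ a $ b" "J j $ a $ b - L $ a $ b"] \<eta> by simp
    qed
    from \<eta>(2)[OF this] J' fx z t show ?case by (intro bexI[of _ z]) auto
  qed
qed

section \<open>The approximate translation property\<close>

lemma norm_add_bound: "x = a + b \<Longrightarrow> norm a \<le> A \<Longrightarrow> norm b \<le> B \<Longrightarrow> norm (x :: 'a::real_normed_vector) \<le> A + B"
  by (auto intro: norm_triangle_le)

lemma norm_diff_bound: "x = a - b \<Longrightarrow> norm a \<le> A \<Longrightarrow> norm b \<le> B \<Longrightarrow> norm (x :: 'a::real_normed_vector) \<le> A + B"
  by (meson add_mono norm_triangle_le_diff)

text \<open>\<open>D\<close> is the displacement of -1/x under the step with parameter 0. Dividing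
  \<open>a\<close> by \<open>1 + x a\<close> costs one x, so \<open>D = 1 + q x + r y\<close> up to
  second order, and the logarithm removes \<open>q x\<close>. For nonzero parameter the arctangent
  and the cosine change this by \<open>O(\<epsilon>^2)\<close> only.\<close>

lemma parabolic_step_estimates:
  fixes q r a x y \<epsilon> :: complex and C \<delta> M :: real
  defines "M \<equiv> norm q + norm r + C + 2"
    and "D \<equiv> a / (1 + x * a)" and "e2 \<equiv> norm x ^ 2 + norm y ^ 2 + norm \<epsilon> ^ 2"
  assumes C: "C \<ge> 0" and \<delta>: "\<delta> = 1 / (100 * M)"
    and x: "norm x \<le> \<delta>" and y: "norm y \<le> \<delta>" and \<epsilon>: "norm \<epsilon> \<le> \<delta>"
    and a: "norm (a - (1 + (q + 1) * x + r * y)) \<le> C * e2"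
  shows "norm (x * a) \<le> 1/2" "norm (D - 1) \<le> 1/2" "norm a \<le> 2"
    and "norm (D - q * Ln (1 + x * a) - 1 - r * y) \<le> 100 * M^2 * e2"
    and "norm (\<epsilon> * D) \<le> 1/2"
    and "\<epsilon> \<noteq> 0 \<Longrightarrow> norm (Arctan (\<epsilon> * D) / \<epsilon> - 1) \<le> 1/2"
    and "\<epsilon> \<noteq> 0 \<Longrightarrow> norm (Arctan (\<epsilon> * D) / \<epsilon> + q * Ln (cos (Arctan (\<epsilon> * D)) / (1 + x * a)) - 1 - r * y) \<le> 100 * M^2 * e2"
proof -
  have M2: "M \<ge> 2" using C by (simp add: M_def)
  \<comment> \<open>\<open>M\<close> dominates every coefficient, so
    \<open>M * \<delta> = 1/100\<close> makes all first order terms small.\<close>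
  have \<delta>0: "0 < \<delta>" "\<delta> \<le> 1/200" "M * \<delta> = 1/100"
    using M2 by (auto simp: \<delta> field_simps)
  have e20: "e2 \<ge> 0" by (simp add: e2_def)
  have xx: "norm x * norm x \<le> e2" "norm \<epsilon> ^ 2 \<le> e2" by (simp_all add: e2_def power2_eq_square)
  have xy: "norm x * norm y \<le> e2"
    using sum_squares_bound[of "norm x" "norm y"] zero_le_power2[of "norm x"] zero_le_power2[of "norm y"] zero_le_power2[of "norm \<epsilon>"]
    unfolding e2_def by linarith
  have sq: "t ^ 2 \<le> \<delta> * \<delta>" if "0 \<le> t" "t \<le> \<delta>" for t
    using that mult_mono[of t \<delta> t \<delta>] by (simp add: power2_eq_square)
  have "e2 \<le> 3 * (\<delta> * \<delta>)" unfolding e2_def using sq x y \<epsilon> by (smt (verit) norm_ge_zero)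
  also have "3 * (\<delta> * \<delta>) \<le> 1 * \<delta>" unfolding mult.assoc[symmetric] using \<delta>0 by (intro mult_right_mono) auto
  finally have e2s: "e2 \<le> \<delta>" by simp
  define \<rho> where "\<rho> = a - (1 + (q + 1) * x + r * y)"
  have qM: "norm (q + 1) \<le> M" "norm q \<le> M" "norm r \<le> M" "C \<le> M"
    using C norm_triangle_ineq[of q 1] norm_ge_zero[of r] norm_ge_zero[of q]
    by (simp_all add: M_def del: norm_ge_zero)
  have a1: "norm (a - 1) \<le> M * norm x + M * norm y + C * e2"
  proof -
    have "a - 1 = (q + 1) * x + r * y + \<rho>" by (simp add: \<rho>_def)
    then have "norm (a - 1) \<le> norm ((q + 1) * x) + norm (r * y) + norm \<rho>"
      by (metis norm_triangle_le order_refl add_mono norm_triangle_ineq)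
    moreover have "norm ((q + 1) * x) \<le> M * norm x" "norm (r * y) \<le> M * norm y"
      unfolding norm_mult by (intro mult_right_mono qM, simp)+
    ultimately show ?thesis using a by (simp add: \<rho>_def)
  qed
  have "M * norm x \<le> M * \<delta>" "M * norm y \<le> M * \<delta>" "C * e2 \<le> M * \<delta>"
    using x y M2 C qM e2s e20 by (auto intro!: mult_left_mono mult_mono)
  then have a1s: "norm (a - 1) \<le> 3/100" using a1 \<delta>0 by linarith
  then show na: "norm a \<le> 2" using norm_triangle_ineq[of "a - 1" 1] by simp
  have xa2: "norm (x * a) \<le> 2 * norm x"
    using mult_left_mono[OF na norm_ge_zero[of x]] by (simp add: norm_mult mult.commute)
  then have xas: "norm (x * a) \<le> 1/100" using x \<delta>0 by linarith
  then show "norm (x * a) \<le> 1/2" by simp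
  have d1: "norm (1 + x * a) \<ge> 1/2" using norm_diff_ineq[of 1 "x * a"] xas by simp
  then have d0: "1 + x * a \<noteq> 0" by auto
  have xa1: "norm (x * (a - 1)) \<le> 3 * M * e2"
  proof -
    have "norm x * norm (a - 1) \<le> norm x * (M * norm x + M * norm y + C * e2)"
      by (rule mult_left_mono[OF a1]) simp
    also have "\<dots> = M * (norm x * norm x) + M * (norm x * norm y) + norm x * (C * e2)" by (simp add: algebra_simps)
    also have "\<dots> \<le> M * e2 + M * e2 + 1 * (M * e2)"
      using M2 xx xy x \<delta>0 qM C e20 by (intro add_mono mult_left_mono mult_mono) auto
    finally show ?thesis by (simp add: norm_mult)
  qed
  have qr: "norm (q * x + r * y) \<le> M * norm x + M * norm y"
    using qM by (intro norm_triangle_le add_mono) (auto simp: norm_mult mult_right_mono)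
  have main: "norm (D - 1 - q * x - r * y) \<le> 18 * M * e2"
  proof -
    have "D - 1 - q * x - r * y = (a - (1 + q * x + r * y) * (1 + x * a)) / (1 + x * a)"
      using d0 by (simp add: D_def field_simps)
    \<comment> \<open>The terms of order at most one cancel; what is left is the remainder of
      \<open>a\<close> and products of two small factors.\<close>
    also have "a - (1 + q * x + r * y) * (1 + x * a) = \<rho> - (q * x + r * y) * x - (1 + q * x + r * y) * (x * (a - 1))"
      by (simp add: \<rho>_def algebra_simps)
    finally have eq: "D - 1 - q * x - r * y = (\<rho> - (q * x + r * y) * x - (1 + q * x + r * y) * (x * (a - 1))) / (1 + x * a)" .
    have n1: "norm ((q * x + r * y) * x) \<le> 2 * M * e2"
    proof -
      have "norm (q * x + r * y) * norm x \<le> (M * norm x + M * norm y) * norm x"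
        by (rule mult_right_mono[OF qr]) simp
      also have "\<dots> = M * (norm x * norm x) + M * (norm x * norm y)" by (simp add: algebra_simps)
      also have "\<dots> \<le> M * e2 + M * e2" using M2 xx xy by (intro add_mono mult_left_mono) auto
      finally show ?thesis by (simp add: norm_mult)
    qed
    have "norm (q * x + r * y) \<le> M * \<delta> + M * \<delta>" using qr x y M2 by (smt (verit) mult_left_mono)
    then have "norm (1 + (q * x + r * y)) \<le> 4/3"
      using norm_triangle_ineq[of 1 "q * x + r * y"] \<delta>0 by simp
    then have "norm (1 + q * x + r * y) * norm (x * (a - 1)) \<le> 4/3 * (3 * M * e2)"
      using xa1 by (intro mult_mono) (auto simp: add.assoc)
    then have n2: "norm ((1 + q * x + r * y) * (x * (a - 1))) \<le> 4 * M * e2" by (simp add: norm_mult)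
    have "C * e2 \<le> M * e2" using qM e20 by (intro mult_right_mono) auto
    then have n0: "norm \<rho> \<le> M * e2" using a by (simp add: \<rho>_def)
    have "norm (\<rho> - (q * x + r * y) * x - (1 + q * x + r * y) * (x * (a - 1))) \<le> 9 * (M * e2)"
      using norm_triangle_ineq4[of "\<rho> - (q * x + r * y) * x" "(1 + q * x + r * y) * (x * (a - 1))"]
        norm_triangle_ineq4[of \<rho> "(q * x + r * y) * x"] n0 n1 n2 M2 e20 mult_nonneg_nonneg[of M e2] by linarith
    then have "norm (D - 1 - q * x - r * y) \<le> 9 * (M * e2) / (1/2)"
      unfolding eq norm_divide using d1 M2 e20 by (intro frac_le) auto
    then show ?thesis by simp
  qed
  have lnx: "norm (Ln (1 + x * a) - x) \<le> 7 * M * e2"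
  proof -
    have "norm (x * a) ^ 2 \<le> (2 * norm x)^2" by (rule power_mono[OF xa2]) simp
    also have "\<dots> = 4 * (norm x * norm x)" by (simp add: power2_eq_square)
    finally have "norm (Ln (1 + x * a) - x * a) \<le> 8 * e2"
      using norm_Ln_one_plus_diff_le[of "x * a"] xas xx by simp
    moreover have "8 * e2 \<le> 4 * M * e2" using M2 e20 by (intro mult_right_mono) auto
    moreover have "norm (Ln (1 + x * a) - x) \<le> norm (Ln (1 + x * a) - x * a) + norm (x * (a - 1))"
      using norm_triangle_ineq[of "Ln (1 + x * a) - x * a" "x * (a - 1)"] by (simp add: algebra_simps)
    ultimately show ?thesis using xa1 by simp
  qed
  have MM: "M * e2 \<le> M^2 * e2 / 2"
    using M2 mult_right_mono[of 2 M "M * e2"] e20 by (simp add: power2_eq_square mult.assoc)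
  have "norm (q * (Ln (1 + x * a) - x)) \<le> M * (7 * M * e2)"
    unfolding norm_mult using qM lnx M2 by (intro mult_mono) auto
  then have qln: "norm (q * (Ln (1 + x * a) - x)) \<le> 7 * (M^2 * e2)" by (simp add: power2_eq_square)
  have z16: "norm (D - q * Ln (1 + x * a) - 1 - r * y) \<le> 16 * (M^2 * e2)"
  proof -
    have "D - q * Ln (1 + x * a) - 1 - r * y = (D - 1 - q * x - r * y) - q * (Ln (1 + x * a) - x)"
      by (simp add: algebra_simps)
    from norm_diff_bound[OF this main qln] show ?thesis using MM by simp
  qed
  have M2e: "0 \<le> M^2 * e2" using e20 by simp
  show "norm (D - q * Ln (1 + x * a) - 1 - r * y) \<le> 100 * M^2 * e2" using z16 M2e by simp
  have D14: "norm (D - 1) \<le> 1/4"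
  proof -
    have "M * e2 \<le> M * \<delta>" using e2s M2 by (intro mult_left_mono) auto
    then have "norm (D - 1 - q * x - r * y) \<le> 18/100" using main \<delta>0 by simp
    moreover have "norm (q * x + r * y) \<le> M * \<delta> + M * \<delta>" using qr x y M2 by (smt (verit) mult_left_mono)
    moreover have "D - 1 = (D - 1 - q * x - r * y) + (q * x + r * y)" by simp
    ultimately show ?thesis using norm_triangle_ineq[of "D - 1 - q * x - r * y" "q * x + r * y"] \<delta>0 by simp
  qed
  then show "norm (D - 1) \<le> 1/2" by simp
  have nD: "norm D \<le> 5/4" using norm_triangle_ineq[of "D - 1" 1] D14 by simp
  define t where "t = \<epsilon> * D"
  have "norm D \<le> 2" using nD by simp
  from mult_left_mono[OF this norm_ge_zero[of \<epsilon>]] have t2: "norm t \<le> 2 * norm \<epsilon>" by (simp add: t_def norm_mult)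
  have ts: "norm t \<le> 1/100" using t2 \<epsilon> \<delta>0 by linarith
  then show "norm (\<epsilon> * D) \<le> 1/2" by (simp add: t_def)
  have AD: "norm (Arctan t / \<epsilon> - D) \<le> 16 * norm \<epsilon> ^ 2" if "\<epsilon> \<noteq> 0"
  proof -
    have "norm t ^ 3 \<le> (2 * norm \<epsilon>) ^ 3" by (rule power_mono[OF t2]) simp
    then have "norm (Arctan t - t) \<le> 16 * norm \<epsilon> ^ 3" using norm_Arctan_diff_le[of t] ts by (simp add: power_mult_distrib)
    moreover have "Arctan t / \<epsilon> - D = (Arctan t - t) / \<epsilon>" using that by (simp add: t_def field_simps)
    ultimately show ?thesis using that by (simp add: norm_divide divide_le_eq power3_eq_cube power2_eq_square mult.assoc)
  qed
  show "norm (Arctan (\<epsilon> * D) / \<epsilon> - 1) \<le> 1/2" if "\<epsilon> \<noteq> 0"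
  proof -
    have "norm \<epsilon> ^ 2 \<le> \<delta>" using xx(2) e2s by simp
    then show ?thesis
      using AD[OF that] D14 norm_triangle_ineq[of "Arctan t / \<epsilon> - D" "D - 1"] \<delta>0 by (simp add: t_def)
  qed
  show "norm (Arctan (\<epsilon> * D) / \<epsilon> + q * Ln (cos (Arctan (\<epsilon> * D)) / (1 + x * a)) - 1 - r * y) \<le> 100 * M^2 * e2"
    if e0: "\<epsilon> \<noteq> 0"
  proof -
    define s where "s = Arctan t"
    have s: "norm s \<le> 4 * norm \<epsilon>" using Arctan_small(2)[of t] ts t2 by (simp add: s_def)
    then have s1: "norm s \<le> 1/50" using \<epsilon> \<delta>0 by linarith
    have "norm s ^ 2 \<le> (4 * norm \<epsilon>)^2" by (rule power_mono[OF s]) simp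
    then have c: "norm (cos s - 1) \<le> 48 * norm \<epsilon> ^ 2"
      using norm_cos_minus_one_le[of s] s1 by (simp add: power_mult_distrib)
    have "48 * norm \<epsilon> ^ 2 \<le> 48 * (\<delta> * \<delta>)" using sq[of "norm \<epsilon>"] \<epsilon> by simp
    also have "\<dots> \<le> 48 * (1/200 * (1/200))" using \<delta>0 by (intro mult_left_mono mult_mono) auto
    finally have c1: "norm (cos s - 1) \<le> 1/2" using c by simp
    have "norm (Ln (1 + (cos s - 1))) \<le> 2 * norm (cos s - 1)" by (rule norm_Ln_one_plus_le[OF c1])
    then have lc: "norm (Ln (cos s)) \<le> 96 * norm \<epsilon> ^ 2" using c by simp
    have "Re (cos s) > 0" using abs_Re_le_cmod[of "cos s - 1"] c1 by simp
    moreover have "Re (1 + x * a) > 0" using abs_Re_le_cmod[of "x * a"] xas by simp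
    ultimately have leq: "Ln (cos s / (1 + x * a)) = Ln (cos s) - Ln (1 + x * a)" by (rule Ln_divide_Re_pos)
    have eq: "s / \<epsilon> + q * Ln (cos s / (1 + x * a)) - 1 - r * y
        = (D - q * Ln (1 + x * a) - 1 - r * y) + (s / \<epsilon> - D) + q * Ln (cos s)"
      unfolding leq by (simp add: algebra_simps)
    have "norm (q * Ln (cos s)) \<le> M * (96 * norm \<epsilon> ^ 2)" unfolding norm_mult using qM lc M2 by (intro mult_mono) auto
    also have "\<dots> \<le> M * (96 * e2)" using M2 xx by (intro mult_left_mono) auto
    finally have l: "norm (q * Ln (cos s)) \<le> 48 * (M^2 * e2)" using MM by simp
    have "norm (s / \<epsilon> - D) \<le> 16 * e2" using AD[OF e0] xx by (simp add: s_def)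
    also have "\<dots> \<le> 8 * (M * e2)" using mult_right_mono[OF M2 e20] by simp
    finally have k: "norm (s / \<epsilon> - D) \<le> 4 * (M^2 * e2)" using MM by simp
    have "norm (s / \<epsilon> + q * Ln (cos s / (1 + x * a)) - 1 - r * y) \<le> 16 * (M^2 * e2) + 4 * (M^2 * e2) + 48 * (M^2 * e2)"
      unfolding eq by (intro norm_triangle_le add_mono z16 k l order_trans[OF norm_triangle_ineq])
    then show ?thesis using M2e unfolding s_def t_def mult.assoc by linarith
  qed
qed

section \<open>A bootstrap for approximate translations\<close>

text \<open>Uses \<open>ln x = 2 * ln (sqrt x) \<le> 2 * (sqrt x - 1)\<close>; once x exceeds
  \<open>(6 * K)^2\<close>, the bound \<open>2 * K * sqrt x\<close> is at most a third of x.\<close>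

lemma log_eventually_small:
  fixes K x :: real
  assumes "K \<ge> 0" "x \<ge> (6 * K)\<^sup>2" "x \<ge> 1"
  shows "K * (1 + ln x) \<le> 3/8 * x"
proof -
  have "ln (sqrt x) \<le> sqrt x - 1" by (rule ln_le_minus_one) (use assms in simp)
  then have "1 + ln x \<le> 2 * sqrt x" using assms by (simp add: ln_sqrt)
  then have "K * (1 + ln x) \<le> K * (2 * sqrt x)" using assms by (intro mult_left_mono) auto
  also have "6 * K \<le> sqrt x" using assms real_le_rsqrt by blast
  then have "(6 * K) * sqrt x \<le> sqrt x * sqrt x" using assms by (intro mult_right_mono) auto
  then have "K * (2 * sqrt x) \<le> 1/3 * x" using assms by simp
  also have "\<dots> \<le> 3/8 * x" using assms by simp
  finally show ?thesis .
qed

text \<open>Error of the corrected coordinate per unit of \<open>norm (y 0) + 1 / R\<close>. The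
  summands come from the sum of the \<open>norm (y k)\<close>, from the sum of the
  \<open>C / d^2\<close>, and from the fixed point \<open>C / (1 - lam)\<close> of
  \<open>y \<mapsto> lam * y + C\<close>, which bounds the residual of y.\<close>

definition bootstrap_const :: "real \<Rightarrow> real \<Rightarrow> complex \<Rightarrow> real" where
  "bootstrap_const lam C r = (norm r + C) * (1 + 4 * C) / (1 - lam) + 4 * C + C / (1 - lam)"

text \<open>The square lets \<open>log_eventually_small\<close> absorb the logarithmic drift, the
  quotient by \<open>\<delta>\<close> keeps the residual of y below \<open>\<delta> / 2\<close>, and
  8 absorbs additive constants.\<close>

definition bootstrap_radius :: "real \<Rightarrow> real \<Rightarrow> real \<Rightarrow> complex \<Rightarrow> complex \<Rightarrow> real" where
  "bootstrap_radius lam C \<delta> q r =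
    (6 * (2 * bootstrap_const lam C r + norm q * C))\<^sup>2 + 2 * (C / (1 - lam)) / \<delta> + 8"

lemma bootstrap_const_nonneg: "lam < 1 \<Longrightarrow> 1 \<le> C \<Longrightarrow> 0 \<le> bootstrap_const lam C r"
  by (simp add: bootstrap_const_def)

lemma bootstrap_radius_ge: "lam < 1 \<Longrightarrow> 1 \<le> C \<Longrightarrow> 0 < \<delta> \<Longrightarrow> 8 \<le> bootstrap_radius lam C \<delta> q r"
  by (simp add: bootstrap_radius_def)

text \<open>\<open>v\<close> is the translation coordinate, \<open>l\<close> its logarithmic correction and \<open>c\<close> the position
  predicted for \<open>v\<close>; \<open>d\<close> measures the distance of \<open>c\<close> from the points where the coordinate
  degenerates. The predicate \<open>I\<close> carries the relation between \<open>v\<close>, \<open>y\<close> and an actual orbit.\<close>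

lemma translation_bootstrap:
  fixes lam C \<delta> R :: real and q r :: complex
    and v y l c :: "nat \<Rightarrow> complex" and d :: "nat \<Rightarrow> real" and I :: "nat \<Rightarrow> bool"
  assumes lam: "0 \<le> lam" "lam < 1" and C: "1 \<le> C" and \<delta>: "0 < \<delta>" "\<delta> \<le> 1"
    and R: "R \<ge> bootstrap_radius lam C \<delta> q r"
    and d: "\<And>m. m \<le> n \<Longrightarrow> d m \<ge> R" and d': "\<And>m. m < n \<Longrightarrow> d m \<le> d (Suc m) + 1"
    and c: "\<And>m. m < n \<Longrightarrow> c (Suc m) = c m + 1" and sumd: "(\<Sum>m<n. 1 / (d m)^2) \<le> 4 / R"
    and I0: "I 0" and W0: "norm (v 0 + q * l 0 - c 0) \<le> R/8" and v0: "norm (v 0 - c 0) \<le> d 0 / 2"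
    and y0: "norm (y 0) \<le> \<delta>/2"
    and step: "\<And>m. \<lbrakk>m < n; I m; norm (v m - c m) \<le> d m / 2; norm (y m) \<le> \<delta>\<rbrakk> \<Longrightarrow>
      norm (v (Suc m) - v m - 1) \<le> 1/2 \<and> norm (y (Suc m)) \<le> lam * norm (y m) + C / (d m)^2"
    and step2: "\<And>m. \<lbrakk>m < n; I m; norm (v m - c m) \<le> d m / 2; norm (y m) \<le> \<delta>; norm (y (Suc m)) \<le> \<delta>;
           norm (v (Suc m) - c (Suc m)) \<le> 3/4 * d (Suc m)\<rbrakk> \<Longrightarrow>
      I (Suc m) \<and> norm (v (Suc m) + q * l (Suc m) - (v m + q * l m) - 1 - r * y m) \<le> C * (1 / (d m)^2 + norm (y m)^2)"
    and lb: "\<And>m. \<lbrakk>m \<le> n; I m; norm (v m - c m) \<le> 3/4 * d m\<rbrakk> \<Longrightarrow> norm (l m) \<le> C * (1 + ln (d m))"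
    and mn: "m \<le> n"
  shows "I m \<and> norm (v m - c m) \<le> d m / 2 \<and> norm (y m) \<le> \<delta> \<and>
    norm (y m) \<le> lam ^ m * norm (y 0) + bootstrap_const lam C r / R^2 \<and>
    norm (v m + q * l m - (v 0 + q * l 0) - of_nat m) \<le> bootstrap_const lam C r * (norm (y 0) + 1 / R)"
proof -
  define E where "E = C / (1 - lam)"
  define C' where "C' = bootstrap_const lam C r"
  have C'_def': "C' = (norm r + C) * (1 + 4 * C) / (1 - lam) + 4 * C + E"
    by (simp add: C'_def E_def bootstrap_const_def)
  define K where "K = 2 * C' + norm q * C"
  define R0 where "R0 = (6 * K)\<^sup>2 + 2 * E / \<delta> + 8"
  have R: "R \<ge> R0" using R by (simp add: R0_def K_def C'_def E_def bootstrap_radius_def)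
  have l1: "1 - lam > 0" using lam by simp
  have E0: "E \<ge> 0" using C l1 by (simp add: E_def)
  have lamE: "lam * E + C = E" using l1 by (simp add: E_def field_simps)
  have C'0: "C' \<ge> 0" using C l1 E0 by (simp add: C'_def')
  have C'E: "E \<le> C'" using C l1 by (simp add: C'_def')
  have K0: "K \<ge> 0" using C C'0 by (simp add: K_def)
  have "2 * E / \<delta> \<ge> 0" using E0 \<delta> by simp
  then have R0: "R0 \<ge> 8" "R0 \<ge> (6 * K)\<^sup>2" "R0 \<ge> 2 * E / \<delta>" by (simp_all add: R0_def)
    have R8: "R \<ge> 8" using R R0 by simp
    define S where "S = (\<lambda>m. \<Sum>k<m. 1 / (d k)^2)"
    have Smono: "S m \<le> 4 / R" if "m \<le> n" for m
    proof -
      have "S m \<le> S n" unfolding S_def by (rule sum_mono2) (use that in auto)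
      then show ?thesis using sumd by (simp add: S_def)
    qed
    define W where "W = (\<lambda>m. v m + q * l m)"
    have ci: "c m = c 0 + of_nat m" if "m \<le> n" for m
      using that by (induction m) (auto simp: c)
    have ysmall: "norm (y m) \<le> \<delta>" if "norm (y m) \<le> lam ^ m * norm (y 0) + E / R^2" for m
    proof -
      have "lam ^ m \<le> 1" using lam by (intro power_le_one) auto
      then have "lam ^ m * norm (y 0) \<le> 1 * (\<delta>/2)" using y0 lam by (intro mult_mono) auto
      moreover have "E / R^2 \<le> \<delta> / 2"
      proof -
        have "2 * E / \<delta> \<le> R" using R R0(3) by simp
        then have "E * 2 \<le> \<delta> * R" using \<delta> by (simp add: divide_le_eq mult.commute)
        also have "\<dots> \<le> \<delta> * (R * R)" using R8 \<delta> by (intro mult_left_mono) auto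
        finally show ?thesis using R8 by (simp add: power2_eq_square divide_le_eq)
      qed
      ultimately show ?thesis using that by linarith
    qed
    \<comment> \<open>The partial sum of the \<open>norm (y k)\<close> carries the potential
      \<open>norm (y m) / (1 - lam)\<close>, which pays for the next term and makes the induction
      close.\<close>
    have "I m \<and> norm (v m - c m) \<le> d m / 2 \<and> norm (y m) \<le> lam ^ m * norm (y 0) + E / R^2 \<and>
        (\<Sum>k<m. norm (y k)) + norm (y m) / (1 - lam) \<le> (norm (y 0) + C * S m) / (1 - lam) \<and>
        norm (W m - W 0 - of_nat m) \<le> (norm r + C) * (\<Sum>k<m. norm (y k)) + C * S m \<and>
        norm (W m - W 0 - of_nat m) \<le> C' * (norm (y 0) + 1 / R)"
      using mn
    proof (induction m)
      case 0
      show ?case using I0 v0 E0 R8 C'0 by (simp add: S_def)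
    next
      case (Suc m)
      then have m: "m < n" "m \<le> n" by auto
      note IH = Suc.IH[OF m(2)]
      have Im: "I m" and vm: "norm (v m - c m) \<le> d m / 2"
        and ym: "norm (y m) \<le> lam ^ m * norm (y 0) + E / R^2"
        and sy: "(\<Sum>k<m. norm (y k)) + norm (y m) / (1 - lam) \<le> (norm (y 0) + C * S m) / (1 - lam)"
        and We: "norm (W m - W 0 - of_nat m) \<le> (norm r + C) * (\<Sum>k<m. norm (y k)) + C * S m"
        using IH by blast+
      have yd: "norm (y m) \<le> \<delta>" by (rule ysmall[OF ym])
      have st: "norm (v (Suc m) - v m - 1) \<le> 1/2" "norm (y (Suc m)) \<le> lam * norm (y m) + C / (d m)^2"
        using step[OF m(1) Im vm yd] by auto
      have dR: "d m \<ge> R" "d (Suc m) \<ge> R" using d Suc.prems by auto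
      have dd: "C / (d m)^2 \<le> C / R^2"
        using dR R8 C by (intro divide_left_mono power_mono) auto
      have ySuc: "norm (y (Suc m)) \<le> lam ^ Suc m * norm (y 0) + E / R^2"
      proof -
        have "lam * norm (y m) \<le> lam * (lam ^ m * norm (y 0) + E / R^2)" using ym lam by (intro mult_left_mono) auto
        then have "norm (y (Suc m)) \<le> lam ^ Suc m * norm (y 0) + (lam * E + C) / R^2"
          using st(2) dd by (simp add: algebra_simps add_divide_distrib)
        then show ?thesis by (simp add: lamE)
      qed
      have ydS: "norm (y (Suc m)) \<le> \<delta>" by (rule ysmall[OF ySuc])
      \<comment> \<open>One step worsens the relative error from 1/2 to at most 3/4, since d drops
        by at most 1 and is at least 8.\<close>
      have v34: "norm (v (Suc m) - c (Suc m)) \<le> 3/4 * d (Suc m)"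
      proof -
        have "v (Suc m) - c (Suc m) = (v (Suc m) - v m - 1) + (v m - c m)" by (simp add: c[OF m(1)])
        from norm_add_bound[OF this st(1) vm] show ?thesis using d'[OF m(1)] dR R8 by simp
      qed
      have s2: "I (Suc m)" "norm (W (Suc m) - W m - 1 - r * y m) \<le> C * (1 / (d m)^2 + norm (y m)^2)"
        using step2[OF m(1) Im vm yd ydS v34] by (auto simp: W_def)
      have sy': "(\<Sum>k<Suc m. norm (y k)) + norm (y (Suc m)) / (1 - lam) \<le> (norm (y 0) + C * S (Suc m)) / (1 - lam)"
      proof -
        have gen: "a + (lam * a + b) / (1 - lam) = a / (1 - lam) + b / (1 - lam)" for a b :: real
        proof -
          have "a = a * (1 - lam) / (1 - lam)" using l1 by simp
          then have "a + (lam * a + b) / (1 - lam) = (a * (1 - lam) + (lam * a + b)) / (1 - lam)"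
            unfolding add_divide_distrib by linarith
          also have "a * (1 - lam) + (lam * a + b) = a + b" by (simp add: algebra_simps)
          finally show ?thesis by (simp add: add_divide_distrib)
        qed
        have "norm (y (Suc m)) / (1 - lam) \<le> (lam * norm (y m) + C / (d m)^2) / (1 - lam)"
          using st(2) l1 by (intro divide_right_mono) auto
        moreover have "norm (y m) + (lam * norm (y m) + C / (d m)^2) / (1 - lam) = norm (y m) / (1 - lam) + C / (d m)^2 / (1 - lam)"
          by (rule gen)
        moreover have "(norm (y 0) + C * S (Suc m)) / (1 - lam) = (norm (y 0) + C * S m) / (1 - lam) + C / (d m)^2 / (1 - lam)"
          by (simp add: S_def algebra_simps add_divide_distrib)
        ultimately show ?thesis using sy by simp
      qed
      have We': "norm (W (Suc m) - W 0 - of_nat (Suc m)) \<le> (norm r + C) * (\<Sum>k<Suc m. norm (y k)) + C * S (Suc m)"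
      proof -
        have "norm (y m) ^ 2 \<le> 1 * norm (y m)" unfolding power2_eq_square using yd \<delta> by (intro mult_right_mono) auto
        then have "C * norm (y m)^2 \<le> C * norm (y m)" using C by (intro mult_left_mono) auto
        then have a: "norm (W (Suc m) - W m - 1 - r * y m) \<le> C * (1 / (d m)^2) + C * norm (y m)"
          using s2(2) by (simp add: distrib_left)
        have "W (Suc m) - W 0 - of_nat (Suc m) = (W m - W 0 - of_nat m) + (W (Suc m) - W m - 1 - r * y m) + r * y m"
          by simp
        moreover have "norm (r * y m) \<le> norm r * norm (y m)" by (simp add: norm_mult)
        ultimately have "norm (W (Suc m) - W 0 - of_nat (Suc m)) \<le>
            ((norm r + C) * (\<Sum>k<m. norm (y k)) + C * S m) + (C * (1 / (d m)^2) + C * norm (y m)) + norm r * norm (y m)"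
          by (rule norm_add_bound[OF _ norm_add_bound[OF refl We a]])
        then show ?thesis by (simp add: S_def algebra_simps)
      qed
      have WC: "norm (W (Suc m) - W 0 - of_nat (Suc m)) \<le> C' * (norm (y 0) + 1 / R)"
      proof -
        have S4: "S (Suc m) \<le> 4 / R" by (rule Smono[OF Suc.prems])
        then have "C * S (Suc m) \<le> C * (4 / R)" using C by (intro mult_left_mono) auto
        then have CS: "C * S (Suc m) \<le> 4 * C * (1 / R)" by (simp add: mult.commute)
        have "norm (y (Suc m)) / (1 - lam) \<ge> 0" using l1 by simp
        then have "(\<Sum>k<Suc m. norm (y k)) \<le> (norm (y 0) + C * S (Suc m)) / (1 - lam)" using sy' by simp
        also have "\<dots> \<le> ((norm (y 0) + 1 / R) * (1 + 4 * C)) / (1 - lam)"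
        proof (intro divide_right_mono)
          have "(norm (y 0) + 1 / R) * (1 + 4 * C) = norm (y 0) + norm (y 0) * (4 * C) + 1 / R + 4 * C * (1 / R)"
            by (simp add: distrib_left distrib_right)
          moreover have "0 \<le> norm (y 0) * (4 * C)" using C by simp
          moreover have "0 \<le> 1 / R" using R8 by simp
          ultimately show "norm (y 0) + C * S (Suc m) \<le> (norm (y 0) + 1 / R) * (1 + 4 * C)"
            using CS by linarith
        qed (use l1 in auto)
        finally have "(norm r + C) * (\<Sum>k<Suc m. norm (y k)) \<le> (norm r + C) * (((norm (y 0) + 1 / R) * (1 + 4 * C)) / (1 - lam))"
          using C by (intro mult_left_mono) auto
        also have "\<dots> = ((norm r + C) * (1 + 4 * C) / (1 - lam)) * (norm (y 0) + 1 / R)" by simp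
        finally have x1: "(norm r + C) * (\<Sum>k<Suc m. norm (y k)) \<le> ((norm r + C) * (1 + 4 * C) / (1 - lam)) * (norm (y 0) + 1 / R)" .
        have x2: "C * S (Suc m) \<le> (4 * C) * (norm (y 0) + 1 / R)"
        proof -
          have "0 \<le> 4 * C * norm (y 0)" using C by simp
          then show ?thesis using CS unfolding distrib_left by linarith
        qed
        have "0 \<le> E * (norm (y 0) + 1 / R)" using E0 R8 by simp
        then have "(norm r + C) * (\<Sum>k<Suc m. norm (y k)) + C * S (Suc m) \<le> C' * (norm (y 0) + 1 / R)"
          using x1 x2 unfolding C'_def' distrib_right by linarith
        then show ?thesis using We' by simp
      qed
      \<comment> \<open>Back to 1/2: \<open>v - c\<close> is the accumulated error, at most
        \<open>2 * C'\<close>, plus the initial one, at most R/8, minus \<open>q * l\<close>, which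
        is logarithmic in d.\<close>
      have vS: "norm (v (Suc m) - c (Suc m)) \<le> d (Suc m) / 2"
      proof -
        have "v (Suc m) - c (Suc m) = (W (Suc m) - W 0 - of_nat (Suc m)) + (v 0 + q * l 0 - c 0) - q * l (Suc m)"
          by (simp add: W_def ci[OF Suc.prems])
        moreover have "norm (W (Suc m) - W 0 - of_nat (Suc m)) \<le> C' * 2"
        proof -
          have "1 / R \<le> 1" using R8 by simp
          then have "norm (y 0) + 1 / R \<le> 2" using y0 \<delta> by linarith
          then show ?thesis
            using WC C'0 mult_left_mono[of "norm (y 0) + 1 / R" 2 C'] by linarith
        qed
        moreover have "norm (q * l (Suc m)) \<le> norm q * (C * (1 + ln (d (Suc m))))"
          unfolding norm_mult by (intro mult_left_mono lb[OF Suc.prems s2(1) v34]) simp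
        ultimately have "norm (v (Suc m) - c (Suc m)) \<le> C' * 2 + R/8 + norm q * (C * (1 + ln (d (Suc m))))"
          using W0 norm_diff_bound norm_add_bound by blast
        also have "\<dots> \<le> d (Suc m) / 8 + K * (1 + ln (d (Suc m)))"
        proof -
          have "0 \<le> ln (d (Suc m))" using dR R8 by simp
          then have "0 \<le> C' * 2 * ln (d (Suc m))" using C'0 by simp
          then show ?thesis using dR by (simp add: K_def algebra_simps)
        qed
        also have "K * (1 + ln (d (Suc m))) \<le> 3/8 * d (Suc m)"
          by (rule log_eventually_small[OF K0]) (use dR R R0 in auto)
        finally show ?thesis by simp
      qed
      show ?case using s2(1) vS ySuc sy' We' WC by blast
    qed
    moreover have "E / R^2 \<le> C' / R^2" using C'E by (intro divide_right_mono) auto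
    ultimately show ?thesis
      using ysmall[of m] unfolding W_def C'_def[symmetric] by auto
qed

section \<open>Charts\<close>

lemma is_chartD:
  assumes "is_chart (U, \<phi>)"
  shows "open U" "open (\<phi> ` U)" "continuous_on U \<phi>" "continuous_on (\<phi> ` U) (inv_into U \<phi>)"
    "inj_on \<phi> U" "\<And>x. x \<in> U \<Longrightarrow> inv_into U \<phi> (\<phi> x) = x"
  using assms by (auto simp: is_chart_def homeomorphism_def intro: inj_on_inverseI)

lemma open_chart_image:
  assumes "is_chart (U, \<phi>)" "open W"
  shows "open (\<phi> ` (U \<inter> W))"
proof -
  note c = is_chartD[OF assms(1)]
  have "\<phi> ` (U \<inter> W) = \<phi> ` U \<inter> inv_into U \<phi> -` W" using c(6) by auto
  moreover have "open (\<phi> ` U \<inter> inv_into U \<phi> -` W)"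
    by (rule continuous_open_preimage[OF c(4,2) assms(2)])
  ultimately show ?thesis by simp
qed

lemma holo_chart_is_chart: "holo_chart A (U, \<phi>) \<Longrightarrow> is_chart (U, \<phi>)"
  by (simp add: holo_chart_def)

lemma complex_surface_holo_chart: "complex_surface A \<Longrightarrow> c \<in> A \<Longrightarrow> holo_chart A c"
  by (auto simp: complex_surface_def holo_chart_def)

lemma complex_surface_chart_at:
  assumes "complex_surface A"
  obtains U \<phi> where "(U, \<phi>) \<in> A" "p \<in> U"
proof -
  have "p \<in> (\<Union>(U, \<phi>)\<in>A. U)" using assms by (simp add: complex_surface_def)
  then show ?thesis using that by auto
qed

lemma holo_map_chart_change:
  assumes "holo_chart A (U, \<phi>)" "(V, \<psi>) \<in> A"
  shows "holo_map (\<psi> \<circ> inv_into U \<phi>) (\<phi> ` (U \<inter> V))" "holo_map (\<phi> \<circ> inv_into V \<psi>) (\<psi> ` (U \<inter> V))"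
proof -
  have "compatible (U, \<phi>) (V, \<psi>)" using assms by (auto simp: holo_chart_def)
  then show "holo_map (\<psi> \<circ> inv_into U \<phi>) (\<phi> ` (U \<inter> V))" "holo_map (\<phi> \<circ> inv_into V \<psi>) (\<psi> ` (U \<inter> V))"
    by (simp_all add: compatible_def)
qed

lemma has_derivative_compose_charts:
  fixes f :: "complex^2 \<Rightarrow> complex^2"
  assumes f: "holo_map f S" "z \<in> S" and g: "holo_map g T" "f z \<in> T"
    and O: "open W" "z \<in> W" "\<And>w. w \<in> W \<Longrightarrow> k w = g (f w)"
  shows "\<exists>J. (k has_derivative (\<lambda>v. J *v v)) (at z)"
proof -
  obtain J where J: "(f has_derivative (\<lambda>v. J *v v)) (at z)" using holo_map_at[OF f] by blast
  obtain K where K: "(g has_derivative (\<lambda>v. K *v v)) (at (f z))" using holo_map_at[OF g] by blast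
  have "(g \<circ> f has_derivative (\<lambda>v. K *v v) \<circ> (\<lambda>v. J *v v)) (at z)" by (rule diff_chain_at[OF J K])
  then have "(k has_derivative (\<lambda>v. K *v v) \<circ> (\<lambda>v. J *v v)) (at z)"
    by (rule has_derivative_transform_within_open[OF _ O(1,2)]) (use O(3) in auto)
  then show ?thesis by (intro exI[of _ "K ** J"]) (simp add: comp_def matrix_vector_mul_assoc)
qed

lemma holo_self_map_continuous: "holo_self_map A f \<Longrightarrow> continuous_on UNIV f"
  by (simp add: holo_self_map_def)

lemma holo_self_map_atlas:
  "holo_self_map A f \<Longrightarrow> (U, \<phi>) \<in> A \<Longrightarrow> (V, \<psi>) \<in> A \<Longrightarrow> holo_map (\<psi> \<circ> f \<circ> inv_into U \<phi>) (\<phi> ` (U \<inter> f -` V))"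
  by (auto simp: holo_self_map_def)

text \<open>A self map is given as holomorphic between charts of A. Inserting atlas charts near p
  and near \<open>f p\<close> carries this over to the maximal atlas, to which \<open>\<phi>\<close>
  belongs.\<close>

lemma holo_self_map_in_charts:
  assumes A: "complex_surface A" and f: "holo_self_map A f"
    and U: "holo_chart A (U, \<phi>)" and V: "holo_chart A (V, \<psi>)"
  shows "holo_map (\<psi> \<circ> f \<circ> inv_into U \<phi>) (\<phi> ` (U \<inter> f -` V))"
  unfolding holo_map_iff_matrix
proof
  fix z assume "z \<in> \<phi> ` (U \<inter> f -` V)"
  then obtain p where p: "p \<in> U" "f p \<in> V" "z = \<phi> p" by auto
  obtain U1 \<phi>1 where 1: "(U1, \<phi>1) \<in> A" "p \<in> U1" using complex_surface_chart_at[OF A] by metis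
  obtain V1 \<psi>1 where 2: "(V1, \<psi>1) \<in> A" "f p \<in> V1" using complex_surface_chart_at[OF A] by metis
  note cU = is_chartD[OF holo_chart_is_chart[OF U]] and cV = is_chartD[OF holo_chart_is_chart[OF V]]
  note c1 = is_chartD[OF holo_chart_is_chart[OF complex_surface_holo_chart[OF A 1(1)]]]
    and c2 = is_chartD[OF holo_chart_is_chart[OF complex_surface_holo_chart[OF A 2(1)]]]
  have fo: "open (f -` W)" if "open W" for W
    using continuous_on_open_vimage[of UNIV f] holo_self_map_continuous[OF f] that by simp
  define k1 where "k1 = \<psi>1 \<circ> f \<circ> inv_into U \<phi>"
  have h1: "holo_map k1 (\<phi> ` (U \<inter> (U1 \<inter> f -` V1)))"
    unfolding holo_map_iff_matrix
  proof
    fix w assume "w \<in> \<phi> ` (U \<inter> (U1 \<inter> f -` V1))"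
    then obtain p' where p': "p' \<in> U" "p' \<in> U1" "f p' \<in> V1" "w = \<phi> p'" by auto
    show "\<exists>J. (k1 has_derivative (\<lambda>v. J *v v)) (at w)"
    proof (rule has_derivative_compose_charts[OF holo_map_chart_change(1)[OF U 1(1)] _ holo_self_map_atlas[OF f 1(1) 2(1)]])
      show "open (\<phi> ` (U \<inter> U1))" by (rule open_chart_image[OF holo_chart_is_chart[OF U] c1(1)])
      show "(\<phi>1 \<circ> inv_into U \<phi>) w \<in> \<phi>1 ` (U1 \<inter> f -` V1)" using p' cU(6) by auto
    qed (use p' cU(6) c1(6) in \<open>auto simp: k1_def\<close>)
  qed
  show "\<exists>J. (\<psi> \<circ> f \<circ> inv_into U \<phi> has_derivative (\<lambda>v. J *v v)) (at z)"
  proof (rule has_derivative_compose_charts[OF h1 _ holo_map_chart_change(2)[OF V 2(1)]])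
    show "open (\<phi> ` (U \<inter> (U1 \<inter> f -` V1)))"
      by (intro open_chart_image[OF holo_chart_is_chart[OF U]] open_Int c1 c2 fo)
    show "k1 z \<in> \<psi>1 ` (V \<inter> V1)" using p 1 2 cU(6) by (auto simp: k1_def)
  qed (use p 1 2 cU(6) c2(6) in \<open>auto simp: k1_def\<close>)
qed

lemma holo_self_map_compose:
  assumes A: "complex_surface A" and f: "holo_self_map A f" and g: "holo_self_map A g"
  shows "holo_self_map A (g \<circ> f)"
  unfolding holo_self_map_def
proof (intro conjI ballI, safe)
  show "continuous_on UNIV (g \<circ> f)"
    by (rule continuous_on_compose) (use f g in \<open>auto simp: holo_self_map_def intro: continuous_on_subset\<close>)
  fix U \<phi> V \<psi> assume U: "(U, \<phi>) \<in> A" and V: "(V, \<psi>) \<in> A"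
  show "holo_map (\<psi> \<circ> (g \<circ> f) \<circ> inv_into U \<phi>) (\<phi> ` (U \<inter> (g \<circ> f) -` V))"
    unfolding holo_map_iff_matrix
  proof
    fix z assume "z \<in> \<phi> ` (U \<inter> (g \<circ> f) -` V)"
    then obtain p where p: "p \<in> U" "g (f p) \<in> V" "z = \<phi> p" by auto
    obtain W \<omega> where W: "(W, \<omega>) \<in> A" "f p \<in> W" using complex_surface_chart_at[OF A] by metis
    note ch = complex_surface_holo_chart[OF A, THEN holo_chart_is_chart]
    note cU = is_chartD[OF ch[OF U]] and cW = is_chartD[OF ch[OF W(1)]] and cV = is_chartD[OF ch[OF V]]
    have fo: "open (f -` W)" if "open W" for W
      using continuous_on_open_vimage[of UNIV f] holo_self_map_continuous[OF f] that by simp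
    show "\<exists>J. (\<psi> \<circ> (g \<circ> f) \<circ> inv_into U \<phi> has_derivative (\<lambda>v. J *v v)) (at z)"
    proof (rule has_derivative_compose_charts[OF holo_self_map_atlas[OF f U W(1)] _ holo_self_map_atlas[OF g W(1) V]])
      show "open (\<phi> ` (U \<inter> f -` W))" by (intro open_chart_image[OF ch[OF U]] fo cW)
    qed (use p W cU(6) cW(6) in auto)
  qed
qed

lemma holo_self_map_id: "complex_surface A \<Longrightarrow> holo_self_map A id"
  by (auto simp: holo_self_map_def complex_surface_def compatible_def)

lemma holo_self_map_funpow:
  assumes "complex_surface A" "holo_self_map A f"
  shows "holo_self_map A (f ^^ n)"
proof (induction n)
  case 0
  show ?case using holo_self_map_id[OF assms(1)] by (simp add: id_def)
next
  case (Suc n)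
  show ?case unfolding funpow.simps by (rule holo_self_map_compose[OF assms(1) Suc assms(2)])
qed

text \<open>Regularity of the surface: a closed coordinate ball is compact, hence closed in a
  Hausdorff space. It serves to keep limits of points of V' inside V.\<close>

lemma chart_closed_neighbourhood:
  fixes p :: "'a::t2_space"
  assumes c: "is_chart (U, \<phi>)" and "p \<in> U" and V: "open V" "p \<in> V"
  obtains V' where "open V'" "p \<in> V'" "closure V' \<subseteq> V"
proof -
  note cU = is_chartD[OF c]
  have "open (\<phi> ` (U \<inter> V))" by (rule open_chart_image[OF c V(1)])
  then obtain e where e: "e > 0" "cball (\<phi> p) e \<subseteq> \<phi> ` (U \<inter> V)"
    using assms open_contains_cball_eq[of "\<phi> ` (U \<inter> V)"] by blast
  define K where "K = inv_into U \<phi> ` cball (\<phi> p) e"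
  have "compact K" unfolding K_def
    by (intro compact_continuous_image continuous_on_subset[OF cU(4)]) (use e in auto)
  then have K: "closed K" by (rule compact_imp_closed)
  have KV: "K \<subseteq> V"
  proof
    fix x assume "x \<in> K"
    then obtain w where w: "w \<in> cball (\<phi> p) e" "x = inv_into U \<phi> w" by (auto simp: K_def)
    then obtain x' where "x' \<in> U \<inter> V" "w = \<phi> x'" using e by blast
    then show "x \<in> V" using w cU(6) by auto
  qed
  define V' where "V' = U \<inter> \<phi> -` ball (\<phi> p) e"
  have "open V'" unfolding V'_def by (rule continuous_open_preimage[OF cU(3,1) open_ball])
  moreover have "p \<in> V'" using assms e by (simp add: V'_def)
  moreover have "V' \<subseteq> K"
  proof
    fix x assume "x \<in> V'"
    then have "x = inv_into U \<phi> (\<phi> x)" "\<phi> x \<in> cball (\<phi> p) e" using cU(6) by (auto simp: V'_def)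
    then show "x \<in> K" unfolding K_def by blast
  qed
  then have "closure V' \<subseteq> K" using K by (rule closure_minimal)
  then have "closure V' \<subseteq> V" using KV by blast
  ultimately show ?thesis using that by blast
qed

section \<open>Semi-parabolic families in a small polydisc\<close>

text \<open>The normal form is kept as inequalities on one closed polydisc; \<open>b\<close> and
  \<open>\<beta>\<close> survive in the contraction of the second coordinate. The holomorphy behind
  the Cauchy estimates is that of the automorphisms themselves.\<close>

locale semiparabolic_family =
  fixes A :: "'a::{t2_space, second_countable_topology} chart2 set"
    and F :: "complex \<Rightarrow> 'a \<Rightarrow> 'a"
    and U :: "'a set" and \<phi> :: "'a \<Rightarrow> complex^2" and p0 :: 'a
    and q r :: complex and a :: "complex \<Rightarrow> complex \<Rightarrow> complex \<Rightarrow> complex"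
    and \<delta> lam C :: real
  assumes surface: "complex_surface A"
    and automorphism: "norm \<epsilon> < \<delta> \<Longrightarrow> automorphism A (F \<epsilon>)"
    and joint_continuous: "continuous_on (ball 0 \<delta> \<times> UNIV) (\<lambda>(\<epsilon>, p). F \<epsilon> p)"
    and fixed: "F 0 p0 = p0"
    and chart: "holo_chart A (U, \<phi>)" and p0_in: "p0 \<in> U" and \<phi>_p0: "\<phi> p0 = 0"
    and \<delta>: "0 < \<delta>" "\<delta> \<le> 1" and lam: "0 \<le> lam" "lam < 1" and C: "1 \<le> C"
    and box: "norm x \<le> \<delta> \<Longrightarrow> norm y \<le> \<delta> \<Longrightarrow> vector [x, y] \<in> \<phi> ` U"
    and dynamics: "norm \<epsilon> < \<delta> \<Longrightarrow> norm x \<le> \<delta> \<Longrightarrow> norm y \<le> \<delta> \<Longrightarrow>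
      F \<epsilon> (inv_into U \<phi> (vector [x, y])) \<in> U \<and>
      \<phi> (F \<epsilon> (inv_into U \<phi> (vector [x, y]))) $ 1 = x + (x^2 + \<epsilon>^2) * a \<epsilon> x y \<and>
      norm (\<phi> (F \<epsilon> (inv_into U \<phi> (vector [x, y]))) $ 2) \<le> lam * norm y + C * norm (x^2 + \<epsilon>^2)"
    and a_bounds: "norm \<epsilon> < \<delta> \<Longrightarrow> norm x \<le> \<delta> \<Longrightarrow> norm y \<le> \<delta> \<Longrightarrow>
      norm (x * a \<epsilon> x y) \<le> 1/2 \<and> norm (a \<epsilon> x y) \<le> 2 \<and> norm (a \<epsilon> x y / (1 + x * a \<epsilon> x y) - 1) \<le> 1/2 \<and>
      norm (\<epsilon> * (a \<epsilon> x y / (1 + x * a \<epsilon> x y))) \<le> 1/2"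
    and step0: "norm \<epsilon> < \<delta> \<Longrightarrow> norm x \<le> \<delta> \<Longrightarrow> norm y \<le> \<delta> \<Longrightarrow>
      norm (a \<epsilon> x y / (1 + x * a \<epsilon> x y) - q * Ln (1 + x * a \<epsilon> x y) - 1 - r * y)
        \<le> C * (norm x^2 + norm y^2 + norm \<epsilon>^2)"
    and step: "norm \<epsilon> < \<delta> \<Longrightarrow> norm x \<le> \<delta> \<Longrightarrow> norm y \<le> \<delta> \<Longrightarrow> \<epsilon> \<noteq> 0 \<Longrightarrow>
      norm (Arctan (\<epsilon> * (a \<epsilon> x y / (1 + x * a \<epsilon> x y))) / \<epsilon> - 1) \<le> 1/2 \<and>
      norm (Arctan (\<epsilon> * (a \<epsilon> x y / (1 + x * a \<epsilon> x y))) / \<epsilon>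
          + q * Ln (cos (Arctan (\<epsilon> * (a \<epsilon> x y / (1 + x * a \<epsilon> x y)))) / (1 + x * a \<epsilon> x y)) - 1 - r * y)
        \<le> C * (norm x^2 + norm y^2 + norm \<epsilon>^2)"
begin

definition cx :: "'a \<Rightarrow> complex" where "cx p = \<phi> p $ 1"
definition cy :: "'a \<Rightarrow> complex" where "cy p = \<phi> p $ 2"
definition emb :: "complex \<Rightarrow> complex \<Rightarrow> 'a" where "emb x y = inv_into U \<phi> (vector [x, y])"
definition Box :: "'a set" where "Box = {p \<in> U. norm (cx p) \<le> \<delta> \<and> norm (cy p) \<le> \<delta>}"

lemmas chartU = is_chartD[OF holo_chart_is_chart[OF chart]]

lemma vector_cx_cy: "vector [cx p, cy p] = \<phi> p"
  by (simp add: vec_eq_iff forall_2 cx_def cy_def)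

lemma emb_cx_cy: "p \<in> U \<Longrightarrow> emb (cx p) (cy p) = p"
  by (simp add: emb_def vector_cx_cy chartU(6))

lemma emb_box:
  assumes "norm x \<le> \<delta>" "norm y \<le> \<delta>"
  shows "emb x y \<in> U" "cx (emb x y) = x" "cy (emb x y) = y" "\<phi> (emb x y) = vector [x, y]" "emb x y \<in> Box"
proof -
  have v: "vector [x, y] \<in> \<phi> ` U" by (rule box[OF assms])
  show "emb x y \<in> U" unfolding emb_def by (rule inv_into_into[OF v])
  show *: "\<phi> (emb x y) = vector [x, y]" unfolding emb_def by (rule f_inv_into_f[OF v])
  show "cx (emb x y) = x" "cy (emb x y) = y" by (simp_all add: cx_def cy_def *)
  with \<open>emb x y \<in> U\<close> show "emb x y \<in> Box" using assms by (simp add: Box_def)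
qed

lemma BoxD: "p \<in> Box \<Longrightarrow> p \<in> U" "p \<in> Box \<Longrightarrow> norm (cx p) \<le> \<delta>" "p \<in> Box \<Longrightarrow> norm (cy p) \<le> \<delta>"
  by (auto simp: Box_def)

lemma cx_p0 [simp]: "cx p0 = 0" "cy p0 = 0"
  by (simp_all add: cx_def cy_def \<phi>_p0)

lemma F_Box:
  assumes "p \<in> Box" "norm \<epsilon> < \<delta>"
  shows "F \<epsilon> p \<in> U" "cx (F \<epsilon> p) = cx p + ((cx p)^2 + \<epsilon>^2) * a \<epsilon> (cx p) (cy p)"
    "norm (cy (F \<epsilon> p)) \<le> lam * norm (cy p) + C * norm ((cx p)^2 + \<epsilon>^2)"
  using dynamics[OF assms(2) BoxD(2,3)[OF assms(1)]] emb_cx_cy[OF BoxD(1)[OF assms(1)]]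
  by (auto simp: cx_def cy_def emb_def)

lemma continuous_cx: "continuous_on U cx" and continuous_cy: "continuous_on U cy"
  unfolding cx_def cy_def using chartU(3) by (auto intro!: continuous_intros)

lemma continuous_emb: "continuous_on (cball 0 \<delta> \<times> cball 0 \<delta>) (\<lambda>(x, y). emb x y)"
proof -
  have 1: "continuous_on (cball 0 \<delta> \<times> cball 0 \<delta>) (\<lambda>w :: complex \<times> complex. vector [fst w, snd w] :: complex^2)"
  proof -
    have eq: "(\<lambda>w :: complex \<times> complex. vector [fst w, snd w] :: complex^2) = (\<lambda>w. axis 1 (fst w) + axis 2 (snd w))"
      by (auto simp: vec_eq_iff forall_2 axis_def fun_eq_iff)
    show ?thesis
      unfolding eq by (intro continuous_intros bounded_linear.continuous_on[OF bounded_linear_axis])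
  qed
  have "continuous_on (cball 0 \<delta> \<times> cball 0 \<delta>) (\<lambda>w. inv_into U \<phi> (vector [fst w, snd w]))"
    by (rule continuous_on_compose2[OF chartU(4) 1]) (use box in auto)
  then show ?thesis by (simp add: emb_def case_prod_unfold)
qed

lemma open_small_box: "open {p \<in> U. norm (cx p) < e1 \<and> norm (cy p) < e2}"
proof -
  have "{p \<in> U. norm (cx p) < e1 \<and> norm (cy p) < e2} = (U \<inter> cx -` ball 0 e1) \<inter> (U \<inter> cy -` ball 0 e2)" by auto
  then show ?thesis
    using continuous_open_preimage[OF continuous_cx chartU(1), of "ball 0 e1"]
      continuous_open_preimage[OF continuous_cy chartU(1), of "ball 0 e2"] by auto
qed

lemma p0_neighbourhood:
  assumes "open V" "p0 \<in> V"
  obtains e where "0 < e" "e \<le> \<delta>" "\<And>p. p \<in> U \<Longrightarrow> norm (cx p) < e \<Longrightarrow> norm (cy p) < e \<Longrightarrow> p \<in> V"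
proof -
  have "open (\<phi> ` (U \<inter> V))" by (rule open_chart_image[OF holo_chart_is_chart[OF chart] assms(1)])
  moreover have "0 \<in> \<phi> ` (U \<inter> V)" using p0_in assms \<phi>_p0 by force
  ultimately obtain e where e: "e > 0" "ball 0 e \<subseteq> \<phi> ` (U \<inter> V)" using open_contains_ball_eq by blast
  show ?thesis
  proof (rule that[of "min (e / 2) \<delta>"])
    fix p assume p: "p \<in> U" "norm (cx p) < min (e / 2) \<delta>" "norm (cy p) < min (e / 2) \<delta>"
    have "norm (\<phi> p) < e" using norm_vec2_le[of "\<phi> p"] p by (simp add: cx_def cy_def)
    then obtain p' where "p' \<in> U \<inter> V" "\<phi> p = \<phi> p'" using e by auto
    then show "p \<in> V" using p chartU(5) by (metis IntD1 IntD2 inj_on_def)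
  qed (use e \<delta> in auto)
qed

lemma F0: "automorphism A (F 0)" using automorphism[of 0] \<delta> by simp
lemma bij_F0: "bij (F 0)" using F0 by (simp add: automorphism_def)
lemma holo_F0: "holo_self_map A (F 0)" using F0 by (simp add: automorphism_def)
lemma holo_inv_F0: "holo_self_map A (inv (F 0))" using F0 by (simp add: automorphism_def)
lemma holo_F: "norm \<epsilon> < \<delta> \<Longrightarrow> holo_self_map A (F \<epsilon>)" using automorphism by (simp add: automorphism_def)

lemma inv_F0 [simp]: "inv (F 0) (F 0 p) = p" "F 0 (inv (F 0) p) = p"
  using bij_F0 by (simp_all add: bij_is_inj bij_is_surj surj_f_inv_f)

lemma funpow_inv_F0 [simp]: "(inv (F 0) ^^ n) ((F 0 ^^ n) p) = p" "(F 0 ^^ n) ((inv (F 0) ^^ n) p) = p"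
proof -
  show "(inv (F 0) ^^ n) ((F 0 ^^ n) p) = p"
    by (induction n arbitrary: p) (simp_all add: funpow_swap1)
  show "(F 0 ^^ n) ((inv (F 0) ^^ n) p) = p"
    by (induction n arbitrary: p) (simp_all add: funpow_swap1)
qed

lemma fixed_funpow [simp]: "(F 0 ^^ n) p0 = p0"
  by (induction n) (auto simp: fixed)

lemma continuous_F_funpow:
  "continuous_on (ball 0 \<delta> \<times> UNIV) (\<lambda>(\<epsilon>, p). (F \<epsilon> ^^ n) p)"
proof (induction n)
  case 0
  show ?case by (simp add: case_prod_unfold continuous_intros)
next
  case (Suc n)
  have "continuous_on (ball 0 \<delta> \<times> UNIV) (\<lambda>w. (fst w, (F (fst w) ^^ n) (snd w)))"
    using Suc by (intro continuous_intros) (simp add: case_prod_unfold)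
  then have "continuous_on (ball 0 \<delta> \<times> UNIV) (\<lambda>w. (\<lambda>(\<epsilon>, p). F \<epsilon> p) (fst w, (F (fst w) ^^ n) (snd w)))"
    by (rule continuous_on_compose2[OF joint_continuous]) auto
  then show ?case by (simp add: case_prod_unfold)
qed

lemma continuous_F0_funpow: "continuous_on UNIV (F 0 ^^ n)"
  using holo_self_map_funpow[OF surface holo_F0] by (rule holo_self_map_continuous)

lemma continuous_inv_F0_funpow: "continuous_on UNIV (inv (F 0) ^^ n)"
  using holo_self_map_funpow[OF surface holo_inv_F0] by (rule holo_self_map_continuous)

text \<open>Turns a self map, in particular an iterate, into a function of one variable along a
  curve given by its coordinates. It is used wherever a Cauchy estimate is applied to iterates of
  points of the polydisc.\<close>

lemma holomorphic_on_curve_emb: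
  assumes f: "holo_self_map A f" and T: "open T"
    and c: "c1 holomorphic_on T" "c2 holomorphic_on T"
    and b: "\<And>t. t \<in> T \<Longrightarrow> norm (c1 t) \<le> \<delta>" "\<And>t. t \<in> T \<Longrightarrow> norm (c2 t) \<le> \<delta>"
    and fU: "\<And>t. t \<in> T \<Longrightarrow> f (emb (c1 t) (c2 t)) \<in> V" and V: "holo_chart A (V, \<psi>)"
  shows "(\<lambda>t. \<psi> (f (emb (c1 t) (c2 t))) $ i) holomorphic_on T"
proof -
  have "(\<lambda>t. (\<psi> \<circ> f \<circ> inv_into U \<phi>) (vector [c1 t, c2 t]) $ i) holomorphic_on T"
  proof (rule holo_map_curve_holomorphic[OF holo_self_map_in_charts[OF surface f chart V] _ T])
    show "(\<lambda>t. (vector [c1 t, c2 t] :: complex^2) $ j) holomorphic_on T" for j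
      using c exhaust_2[of j] by auto
    fix t assume t: "t \<in> T"
    have "vector [c1 t, c2 t] = \<phi> (emb (c1 t) (c2 t))" using emb_box(4) b t by simp
    then show "vector [c1 t, c2 t] \<in> \<phi> ` (U \<inter> f -` V)" using emb_box(1) fU b t by auto
  qed
  then show ?thesis by (simp add: emb_def)
qed

end

section \<open>Orbits asymptotic to the fixed point\<close>

text \<open>Each step raises the real part by at least 1/2 and the norm by at most 3/2; the weaker
  rates 1/4 and 2 leave room to forget the value at \<open>n1\<close>.\<close>

lemma approximate_translation_growth:
  fixes u :: "nat \<Rightarrow> complex"
  assumes "\<And>n. n \<ge> n1 \<Longrightarrow> norm (u (Suc n) - u n - 1) \<le> 1/2"
  shows "\<forall>\<^sub>F n in sequentially. real n / 4 \<le> Re (u n) \<and> norm (u n) \<le> 2 * real n"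
proof -
  have *: "Re (u (n1 + k)) \<ge> Re (u n1) + real k / 2 \<and> norm (u (n1 + k)) \<le> norm (u n1) + 3/2 * real k" for k
  proof (induction k)
    case (Suc k)
    have s: "norm (u (Suc (n1 + k)) - u (n1 + k) - 1) \<le> 1/2" by (rule assms) simp
    then have "\<bar>Re (u (Suc (n1 + k)) - u (n1 + k) - 1)\<bar> \<le> 1/2" using abs_Re_le_cmod order_trans by blast
    moreover have "norm (u (Suc (n1 + k))) \<le> 1/2 + (norm (u (n1 + k)) + 1)"
      by (rule norm_add_bound[OF _ s norm_add_bound[OF _ order_refl, of _ "u (n1 + k)" 1]]) auto
    moreover have "real (Suc k) = real k + 1" by simp
    ultimately show ?case using Suc unfolding minus_complex.simps one_complex.simps add_Suc_right abs_le_iff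
      by (simp only: distrib_left add_divide_distrib) linarith
  qed simp
  define N where "N = n1 + nat \<lceil>4 * \<bar>Re (u n1)\<bar> + 2 * norm (u n1) + 2 * real n1\<rceil>"
  show ?thesis
    unfolding eventually_sequentially
  proof (intro exI allI impI)
    fix n assume n: "N \<le> n"
    define k where "k = n - n1"
    have nk: "n = n1 + k" using n by (simp add: k_def N_def)
    have "4 * \<bar>Re (u n1)\<bar> + 2 * norm (u n1) + 2 * real n1 \<le> real (nat \<lceil>4 * \<bar>Re (u n1)\<bar> + 2 * norm (u n1) + 2 * real n1\<rceil>)"
      by (rule real_nat_ceiling_ge)
    also have "\<dots> \<le> real k" using n by (simp add: k_def N_def)
    finally have a: "4 * \<bar>Re (u n1)\<bar> + 2 * norm (u n1) + 2 * real n1 \<le> real k" .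
    have b: "- \<bar>Re (u n1)\<bar> \<le> Re (u n1)" "0 \<le> norm (u n1)" "0 \<le> real n1" by simp_all
    have c: "Re (u n1) + real k / 2 \<le> Re (u n)" "norm (u n) \<le> norm (u n1) + 3/2 * real k"
      using *[of k] by (simp_all add: nk)
    have d: "real n = real n1 + real k" by (simp add: nk)
    have "real n \<le> 4 * Re (u n)" using a b c(1) d by linarith
    moreover have "norm (u n) \<le> 2 * real n" using a b c(2) d abs_ge_zero[of "Re (u n1)"] by linarith
    ultimately have "real n \<le> 4 * Re (u n)" "norm (u n) \<le> 2 * real n" by blast+
    then show "real n / 4 \<le> Re (u n) \<and> norm (u n) \<le> 2 * real n" by simp
  qed
qed

lemma convergent_if_summable_increments:
  fixes f :: "nat \<Rightarrow> complex"
  assumes "\<And>n. n \<ge> n1 \<Longrightarrow> norm (f (Suc n) - f n) \<le> e n" "summable e"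
  shows "convergent f"
proof -
  have "summable (\<lambda>n. f (Suc n) - f n)"
    by (rule summable_comparison_test[OF _ assms(2)]) (use assms(1) in auto)
  then have "(\<lambda>n. \<Sum>k<n. f (Suc k) - f k) \<longlonglongrightarrow> (\<Sum>n. f (Suc n) - f n)" by (rule summable_LIMSEQ)
  then have "(\<lambda>n. f n - f 0) \<longlonglongrightarrow> (\<Sum>n. f (Suc n) - f n)" by (simp add: sum_lessThan_telescope)
  then have "(\<lambda>n. (f n - f 0) + f 0) \<longlonglongrightarrow> (\<Sum>n. f (Suc n) - f n) + f 0" by (intro tendsto_add tendsto_const)
  then show ?thesis by (auto simp: convergent_def)
qed

lemma eventually_log_small:
  fixes M K c :: real
  assumes "c > 0"
  shows "\<forall>\<^sub>F n in sequentially. M + K * (ln (2 * real n) + pi) \<le> c * real n"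
proof -
  have n1: "(\<lambda>n. x * (1 / real n)) \<longlonglongrightarrow> x * 0" for x :: real
    by (intro tendsto_intros lim_1_over_n)
  have "(\<lambda>n. (M + K * (ln 2 + pi)) * (1 / real n) + K * (ln (real n) / real n)) \<longlonglongrightarrow> (M + K * (ln 2 + pi)) * 0 + K * 0"
    by (intro tendsto_add n1 tendsto_mult_left lim_ln_over_n)
  then have "\<forall>\<^sub>F n in sequentially. (M + K * (ln 2 + pi)) * (1 / real n) + K * (ln (real n) / real n) < c"
    by (rule order_tendstoD(2)) (use assms in simp)
  with eventually_ge_at_top[of 1] show ?thesis
  proof eventually_elim
    case (elim n)
    then have "M + K * (ln 2 + pi) + K * ln (real n) < c * real n" by (simp add: field_simps)
    then show ?case using elim by (simp add: ln_mult algebra_simps)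
  qed
qed

text \<open>By convergence, \<open>u n - n\<close> is \<open>- q * Ln (u n)\<close> up to a bounded
  term, and the growth bound makes this logarithm \<open>O(ln n)\<close>.\<close>

lemma translation_coordinate_asymptotics:
  fixes u :: "nat \<Rightarrow> complex"
  assumes g: "\<forall>\<^sub>F n in sequentially. real n / 4 \<le> Re (u n) \<and> norm (u n) \<le> 2 * real n"
    and conv: "convergent (\<lambda>n. u n + q * Ln (u n) - of_nat n)"
  shows "\<forall>\<^sub>F n in sequentially. norm (u n - of_nat n) \<le> real n / 4"
proof -
  have "Bseq (\<lambda>n. u n + q * Ln (u n) - of_nat n)" using conv by (rule convergent_imp_Bseq)
  then obtain M where M: "M > 0" "\<And>n. norm (u n + q * Ln (u n) - of_nat n) \<le> M" unfolding Bseq_def by auto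
  have "\<forall>\<^sub>F n in sequentially. M + norm q * (ln (2 * real n) + pi) \<le> 1/4 * real n"
    by (rule eventually_log_small) simp
  with g eventually_ge_at_top[of 4] show ?thesis
  proof eventually_elim
    case (elim n)
    have "norm (u n) \<ge> Re (u n)" by (rule complex_Re_le_cmod)
    then have n1: "norm (u n) \<ge> 1" using elim by (simp add: field_simps)
    then have "norm (Ln (u n)) \<le> ln (norm (u n)) + pi" using norm_Ln_le_ln_norm[of "u n"] by fastforce
    also have "ln (norm (u n)) \<le> ln (2 * real n)" using elim n1 by (intro ln_mono) auto
    finally have l: "norm (q * Ln (u n)) \<le> norm q * (ln (2 * real n) + pi)"
      unfolding norm_mult by (intro mult_left_mono) auto
    have "norm (u n - of_nat n) \<le> M + norm q * (ln (2 * real n) + pi)"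
      by (rule norm_diff_bound[OF _ M(2)[of n] l]) simp
    then show ?case using elim by simp
  qed
qed

text \<open>Meant for the increment of x under one step of \<open>F 0\<close>: being quadratic in x,
  it adds nothing to the derivative at a zero of x.\<close>

lemma has_field_derivative_zero_if_quadratic:
  fixes g k :: "complex \<Rightarrow> complex"
  assumes g: "(g has_field_derivative d) (at 0)" "g 0 = 0"
    and k: "k 0 = 0" "s > 0" "\<And>t. norm t < s \<Longrightarrow> norm (k t) \<le> 2 * norm (g t) ^ 2"
  shows "(k has_field_derivative 0) (at 0)"
proof -
  have 1: "((\<lambda>t. g t / t) \<longlongrightarrow> d) (at 0)"
    using g by (simp add: has_field_derivative_iff)
  have 2: "(g \<longlongrightarrow> 0) (at 0)"
    using DERIV_isCont[OF g(1)] g(2) by (simp add: isCont_def)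
  have "((\<lambda>t. 2 * norm (g t / t) * norm (g t)) \<longlongrightarrow> 2 * norm d * norm (0::complex)) (at 0)"
    by (intro tendsto_intros 1 2)
  then have z: "((\<lambda>t. 2 * norm (g t / t) * norm (g t)) \<longlongrightarrow> 0) (at 0)" by simp
  have "\<forall>\<^sub>F t in at 0. norm ((k t - k 0) / (t - 0)) \<le> 2 * norm (g t / t) * norm (g t)"
    unfolding eventually_at
  proof (intro exI conjI ballI impI)
    fix t :: complex assume t: "t \<noteq> 0 \<and> dist t 0 < s"
    then have "norm (k t) \<le> 2 * norm (g t) ^ 2" using k(3) by simp
    then have "norm (k t) / norm t \<le> 2 * norm (g t) ^ 2 / norm t" by (rule divide_right_mono) simp
    then show "norm ((k t - k 0) / (t - 0)) \<le> 2 * norm (g t / t) * norm (g t)"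
      using k(1) by (simp add: norm_divide power2_eq_square)
  qed (use k in auto)
  then have "((\<lambda>t. (k t - k 0) / (t - 0)) \<longlongrightarrow> 0) (at 0)" by (rule Lim_null_comparison[OF _ z])
  then show ?thesis by (simp add: has_field_derivative_iff)
qed

section \<open>The map \<open>F 0\<close> in the coordinate -1/x, and orbits that avoid x =
  0\<close>

context semiparabolic_family
begin

text \<open>In this coordinate \<open>F 0\<close> is nearly the translation by 1. Basin orbits end
  with positive real part, backward orbits on the asymptotic curve with negative real part;
  accordingly \<open>win\<close> takes the logarithm of -x and \<open>wout\<close> that of
  x.\<close>

definition vv :: "'a \<Rightarrow> complex" where "vv p = - 1 / cx p"
definition win :: "'a \<Rightarrow> complex" where "win p = w_in q (\<phi> p)"
definition wout :: "'a \<Rightarrow> complex" where "wout p = w_out q (\<phi> p)"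

lemma win_eq: "Re (vv p) > 0 \<Longrightarrow> win p = vv p + q * Ln (vv p)"
proof -
  assume "Re (vv p) > 0"
  then have "vv p \<notin> \<real>\<^sub>\<le>\<^sub>0" by (auto simp: complex_nonpos_Reals_iff)
  then have "Ln (inverse (vv p)) = - Ln (vv p)" by (rule Ln_inverse)
  moreover have "inverse (vv p) = - cx p" by (simp add: vv_def inverse_eq_divide)
  ultimately show ?thesis by (simp add: win_def w_in_def vv_def cx_def)
qed

lemma wout_eq: "Re (vv p) < 0 \<Longrightarrow> wout p = vv p + q * Ln (- vv p)"
proof -
  assume "Re (vv p) < 0"
  then have "- vv p \<notin> \<real>\<^sub>\<le>\<^sub>0" by (auto simp: complex_nonpos_Reals_iff)
  then have "Ln (inverse (- vv p)) = - Ln (- vv p)" by (rule Ln_inverse)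
  moreover have "inverse (- vv p) = cx p" by (simp add: vv_def inverse_eq_divide)
  ultimately show ?thesis by (simp add: wout_def w_out_def vv_def cx_def)
qed

text \<open>At parameter 0 the first coordinate becomes \<open>x * (1 + x * a)\<close>. Hence -1/x
  moves by \<open>a / (1 + x * a)\<close> and its logarithm changes by
  \<open>- Ln (1 + x * a)\<close>, the expressions that \<open>a_bounds\<close> and
  \<open>step0\<close> control.\<close>

lemma F0_Box_step:
  assumes p: "p \<in> Box"
  shows "cx p \<noteq> 0 \<Longrightarrow> cx (F 0 p) \<noteq> 0"
    and "cx p = 0 \<Longrightarrow> cx (F 0 p) = 0"
    and "norm (cy (F 0 p)) \<le> lam * norm (cy p) + C * norm (cx p)^2"
    and "norm (cx (F 0 p) - cx p) \<le> 2 * norm (cx p)^2"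
    and "cx p \<noteq> 0 \<Longrightarrow> norm (vv (F 0 p) - vv p - 1) \<le> 1/2"
    and "cx p \<noteq> 0 \<Longrightarrow> Re (vv p) > 0 \<Longrightarrow> Re (vv (F 0 p)) > 0 \<Longrightarrow>
      norm (win (F 0 p) - win p - 1 - r * cy p) \<le> C * (norm (cx p)^2 + norm (cy p)^2)"
    and "cx p \<noteq> 0 \<Longrightarrow> Re (vv p) < 0 \<Longrightarrow> Re (vv (F 0 p)) < 0 \<Longrightarrow>
      norm (wout (F 0 p) - wout p - 1 - r * cy p) \<le> C * (norm (cx p)^2 + norm (cy p)^2)"
proof -
  have e0: "norm (0::complex) < \<delta>" using \<delta> by simp
  define x y where "x = cx p" and "y = cy p"
  define b where "b = a 0 x y"
  have xy: "norm x \<le> \<delta>" "norm y \<le> \<delta>" using BoxD[OF p] by (auto simp: x_def y_def)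
  note ab = a_bounds[OF e0 xy, folded b_def]
  note st = step0[OF e0 xy, folded b_def]
  have x': "cx (F 0 p) = x * (1 + x * b)"
    using F_Box(2)[OF p e0] by (simp add: x_def y_def b_def algebra_simps power2_eq_square)
  have Re1: "Re (1 + x * b) > 0" using abs_Re_le_cmod[of "x * b"] ab by (simp add: abs_le_iff)
  have nz: "1 + x * b \<noteq> 0"
  proof
    assume "1 + x * b = 0"
    then show False using Re1 by (simp only:) simp
  qed
  show "cx (F 0 p) \<noteq> 0" if "cx p \<noteq> 0" using that x' nz by (simp add: x_def)
  show "cx (F 0 p) = 0" if "cx p = 0" using that x' by (simp add: x_def)
  show "norm (cy (F 0 p)) \<le> lam * norm (cy p) + C * norm (cx p)^2"
    using F_Box(3)[OF p e0] by (simp add: norm_power)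
  have "norm (cx (F 0 p) - cx p) = norm b * norm x ^ 2"
    using x' by (simp add: x_def algebra_simps power2_eq_square norm_mult)
  also have "\<dots> \<le> 2 * norm x^2" using ab by (intro mult_right_mono) auto
  finally show "norm (cx (F 0 p) - cx p) \<le> 2 * norm (cx p)^2" by (simp add: x_def)
  assume x0: "cx p \<noteq> 0"
  have vd: "vv (F 0 p) - vv p = b / (1 + x * b)"
  proof -
    have "- 1 / (x * w) - (- 1 / x) = (w - 1) / (x * w)" if "w \<noteq> 0" for w
      using x0 that by (simp add: x_def field_simps)
    from this[OF nz] show ?thesis using x0 by (simp add: vv_def x' x_def[symmetric])
  qed
  then show "norm (vv (F 0 p) - vv p - 1) \<le> 1/2" using ab by simp
  have quot: "vv (F 0 p) / vv p = 1 / (1 + x * b)"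
  proof -
    have "(- 1 / (x * w)) / (- 1 / x) = 1 / w" if "w \<noteq> 0" for w
      using x0 that by (simp add: x_def field_simps)
    from this[OF nz] show ?thesis using x0 by (simp add: vv_def x' x_def[symmetric])
  qed
  have lnq: "Ln (1 / (1 + x * b)) = - Ln (1 + x * b)"
    using Ln_divide_Re_pos[of 1 "1 + x * b"] Re1 by simp
  show "norm (win (F 0 p) - win p - 1 - r * cy p) \<le> C * (norm (cx p)^2 + norm (cy p)^2)"
    if "Re (vv p) > 0" "Re (vv (F 0 p)) > 0"
  proof -
    have "Ln (vv (F 0 p)) - Ln (vv p) = - Ln (1 + x * b)"
      using Ln_divide_Re_pos[OF that(2,1)] quot lnq by simp
    then have l: "Ln (vv (F 0 p)) = Ln (vv p) - Ln (1 + x * b)" by (simp add: algebra_simps)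
    have "win (F 0 p) - win p - 1 - r * cy p = b / (1 + x * b) - q * Ln (1 + x * b) - 1 - r * y"
      unfolding win_eq[OF that(1)] win_eq[OF that(2)] l vd[symmetric] by (simp add: y_def algebra_simps)
    then show ?thesis using st by (simp add: x_def y_def)
  qed
  show "norm (wout (F 0 p) - wout p - 1 - r * cy p) \<le> C * (norm (cx p)^2 + norm (cy p)^2)"
    if "Re (vv p) < 0" "Re (vv (F 0 p)) < 0"
  proof -
    have "Ln (- vv (F 0 p)) - Ln (- vv p) = - Ln (1 + x * b)"
      using Ln_divide_Re_pos[of "- vv (F 0 p)" "- vv p"] that quot lnq by simp
    then have l: "Ln (- vv (F 0 p)) = Ln (- vv p) - Ln (1 + x * b)" by (simp add: algebra_simps)
    have "wout (F 0 p) - wout p - 1 - r * cy p = b / (1 + x * b) - q * Ln (1 + x * b) - 1 - r * y"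
      unfolding wout_eq[OF that(1)] wout_eq[OF that(2)] l vd[symmetric] by (simp add: y_def algebra_simps)
    then show ?thesis using st by (simp add: x_def y_def)
  qed
qed

text \<open>If an orbit in the basin reached \<open>x = 0\<close>, the maps \<open>F 0 ^^ m\<close> would have \<open>x\<close>-derivative 1 along
  a disc whose images shrink to \<open>p0\<close>, against the Cauchy estimate.\<close>

lemma basin_orbit_cx_nonzero:
  assumes p: "p \<in> basin (F 0) p0"
  shows "\<forall>\<^sub>F n in sequentially. (F 0 ^^ n) p \<in> Box \<and> cx ((F 0 ^^ n) p) \<noteq> 0"
proof -
  obtain N where N: "open N" "p \<in> N"
    "\<And>V. open V \<Longrightarrow> p0 \<in> V \<Longrightarrow> \<forall>\<^sub>F n in sequentially. \<forall>z\<in>N. (F 0 ^^ n) z \<in> V"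
    using p by (auto simp: basin_def)
  define SB where "SB = (\<lambda>e. {p \<in> U. norm (cx p) < e \<and> norm (cy p) < e})"
  have SB: "\<forall>\<^sub>F n in sequentially. \<forall>z\<in>N. (F 0 ^^ n) z \<in> SB e" if "e > 0" for e
    by (rule N(3)) (use that p0_in open_small_box in \<open>auto simp: SB_def\<close>)
  obtain n0 where n0: "\<And>n z. n \<ge> n0 \<Longrightarrow> z \<in> N \<Longrightarrow> (F 0 ^^ n) z \<in> SB \<delta>"
    using SB[OF \<delta>(1)] by (auto simp: eventually_sequentially)
  have inBox: "z \<in> Box" if "z \<in> SB \<delta>" for z using that by (auto simp: SB_def Box_def)
  have "(F 0 ^^ n) p \<in> Box \<and> cx ((F 0 ^^ n) p) \<noteq> 0" if n: "n \<ge> n0" for n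
  proof (intro conjI notI)
    show pB: "(F 0 ^^ n) p \<in> Box" using n0[OF n N(2)] inBox by blast
    assume c0: "cx ((F 0 ^^ n) p) = 0"
    define y0 where "y0 = cy ((F 0 ^^ n) p)"
    have y0: "norm y0 \<le> \<delta>" using BoxD(3)[OF pB] by (simp add: y0_def)
    have e0: "emb 0 y0 = (F 0 ^^ n) p" using emb_cx_cy[OF BoxD(1)[OF pB]] c0 by (simp add: y0_def)
    have ce: "continuous_on (cball 0 \<delta>) (\<lambda>t. emb t y0)"
    proof -
      have "continuous_on (cball 0 \<delta>) (\<lambda>t. (\<lambda>(x, y). emb x y) (t, y0))"
        by (rule continuous_on_compose2[OF continuous_emb]) (use y0 in \<open>auto intro!: continuous_intros\<close>)
      then show ?thesis by simp
    qed
    \<comment> \<open>A small horizontal disc through the orbit point is pulled back into N, so that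
      later iterates of all its points approach \<open>p0\<close> uniformly.\<close>
    have "continuous_on (cball 0 \<delta>) (\<lambda>t. (inv (F 0) ^^ n) (emb t y0))"
      by (rule continuous_on_compose2[OF continuous_inv_F0_funpow ce]) auto
    then have "open (ball 0 \<delta> \<inter> (\<lambda>t. (inv (F 0) ^^ n) (emb t y0)) -` N)"
      by (intro continuous_open_preimage[OF _ open_ball N(1)]) (auto intro: continuous_on_subset)
    moreover have "0 \<in> ball 0 \<delta> \<inter> (\<lambda>t. (inv (F 0) ^^ n) (emb t y0)) -` N"
      using \<delta> N(2) by (simp add: e0)
    ultimately obtain s where s: "s > 0" "ball 0 s \<subseteq> ball 0 \<delta> \<inter> (\<lambda>t. (inv (F 0) ^^ n) (emb t y0)) -` N"
      using open_contains_ball_eq by blast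
    have t\<delta>: "norm t \<le> \<delta>" and tN: "(inv (F 0) ^^ n) (emb t y0) \<in> N" if "norm t < s" for t
      using s(2) that by (auto simp: subset_iff)
    have orb: "(F 0 ^^ m) (emb t y0) = (F 0 ^^ (m + n)) ((inv (F 0) ^^ n) (emb t y0))" for m t
      by (simp add: funpow_add)
    have inSB: "(F 0 ^^ m) (emb t y0) \<in> SB \<delta>" if "norm t < s" for m t
      unfolding orb by (rule n0[OF _ tN[OF that]]) (use n in simp)
    define g where "g = (\<lambda>m t. cx ((F 0 ^^ m) (emb t y0)))"
    \<comment> \<open>At the centre x stays 0, and one step changes x by \<open>O(x^2)\<close>, so
      the derivative 1 of the parametrization persists.\<close>
    have der: "(g m has_field_derivative 1) (at 0) \<and> g m 0 = 0" for m
    proof (induction m)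
      case 0
      have "(g 0 has_field_derivative 1) (at 0)"
        by (rule has_field_derivative_transform_within_open[where f = "\<lambda>t. t" and S = "ball 0 s"])
           (use s(1) emb_box(2) t\<delta> y0 in \<open>auto simp: g_def\<close>)
      then show ?case using c0 by (simp add: g_def e0)
    next
      case (Suc m)
      have g0: "g m 0 = 0" using Suc by simp
      have "g (Suc m) 0 = 0"
        using F0_Box_step(2)[OF inBox[OF inSB[of 0 m]]] s(1) g0 by (simp add: g_def)
      have "((\<lambda>t. g (Suc m) t - g m t) has_field_derivative 0) (at 0)"
      proof (rule has_field_derivative_zero_if_quadratic[where g = "g m" and d = 1 and s = s])
        show "norm (g (Suc m) t - g m t) \<le> 2 * norm (g m t)^2" if "norm t < s" for t
          using F0_Box_step(4)[OF inBox[OF inSB[OF that, of m]]] by (simp add: g_def)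
      qed (use Suc s(1) \<open>g (Suc m) 0 = 0\<close> in auto)
      moreover have "(g m has_field_derivative 1) (at 0)" using Suc by simp
      ultimately have "((\<lambda>t. (g (Suc m) t - g m t) + g m t) has_field_derivative 0 + 1) (at 0)"
        by (rule DERIV_add)
      then show ?case using \<open>g (Suc m) 0 = 0\<close> by simp
    qed
    \<comment> \<open>The bound s/16 gives the Cauchy estimate \<open>4 * (s / 16) / s = 1/4\<close>
      for a derivative that equals 1.\<close>
    obtain m where m: "\<And>z. z \<in> N \<Longrightarrow> (F 0 ^^ (m + n)) z \<in> SB (s / 16)"
      using SB[of "s / 16"] s(1) unfolding eventually_sequentially by (metis divide_pos_pos le_add1 zero_less_numeral)
    have hol: "g m holomorphic_on ball 0 s"
      unfolding g_def cx_def
    proof (rule holomorphic_on_curve_emb[OF holo_self_map_funpow[OF surface holo_F0] _ _ _ _ _ _ chart])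
      show "(F 0 ^^ m) (emb t y0) \<in> U" if "t \<in> ball 0 s" for t
        using inSB[of t m] that by (simp add: SB_def)
    qed (use t\<delta> y0 in \<open>auto intro!: holomorphic_intros\<close>)
    have "norm (deriv (g m) 0) \<le> 4 * (s / 16) / s"
    proof (rule holomorphic_bounded_ball_estimates(1)[OF hol s(1)])
      fix t :: complex assume "t \<in> ball 0 s"
      then show "norm (g m t) \<le> s / 16" using m[OF tN[of t]] by (simp add: g_def orb SB_def)
    qed
    moreover have "deriv (g m) 0 = 1" using der by (simp add: DERIV_imp_deriv)
    ultimately show False using s(1) by simp
  qed
  then show ?thesis unfolding eventually_sequentially by blast
qed

end

section \<open>Summability along orbits and convergence of the two Fatou coordinates\<close>

lemma summable_if_contracted:
  fixes y c :: "nat \<Rightarrow> real"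
  assumes y: "\<And>n. y n \<ge> 0" and l: "0 \<le> l" "l < 1" and c: "summable c" "\<And>n. c n \<ge> 0"
    and rec: "\<And>n. n \<ge> n1 \<Longrightarrow> y (Suc n) \<le> l * y n + c n"
  shows "summable y"
proof -
  have l1: "1 - l > 0" using l by simp
  have "summable (\<lambda>k. y (k + n1))"
  proof (rule summableI_nonneg_bounded)
    fix N
    \<comment> \<open>Keeping \<open>y (N + n1)\<close> on the left lets the recursion pass through
      the induction.\<close>
    have "(1 - l) * (\<Sum>k<N. y (k + n1)) + y (N + n1) \<le> y n1 + (\<Sum>k<N. c (k + n1))"
    proof (induction N)
      case (Suc N)
      have "y (Suc N + n1) \<le> l * y (N + n1) + c (N + n1)" using rec[of "N + n1"] by simp
      then show ?case using Suc by (simp add: algebra_simps)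
    qed simp
    also have "(\<Sum>k<N. c (k + n1)) \<le> (\<Sum>k. c (k + n1))"
      by (rule sum_le_suminf) (use c in \<open>auto simp: summable_iff_shift\<close>)
    finally have "(1 - l) * (\<Sum>k<N. y (k + n1)) \<le> y n1 + (\<Sum>k. c (k + n1))" using y[of "N + n1"] by simp
    then show "(\<Sum>k<N. y (k + n1)) \<le> (y n1 + (\<Sum>k. c (k + n1))) / (1 - l)"
      using l1 by (simp add: pos_le_divide_eq mult.commute)
  qed (rule y)
  then show ?thesis by (simp add: summable_iff_shift)
qed

text \<open>On a backward orbit the contraction runs against the index, so a bound for all terms
  takes the place of the initial value.\<close>

lemma summable_if_expanded_bounded:
  fixes y c :: "nat \<Rightarrow> real"
  assumes y: "\<And>n. y n \<ge> 0" "\<And>n. n \<ge> n1 \<Longrightarrow> y n \<le> B" and l: "0 \<le> l" "l < 1"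
    and c: "summable c" "\<And>n. c n \<ge> 0"
    and rec: "\<And>n. n \<ge> n1 \<Longrightarrow> y n \<le> l * y (Suc n) + c n"
  shows "summable y"
proof -
  have l1: "1 - l > 0" using l by simp
  have "summable (\<lambda>k. y (k + n1))"
  proof (rule summableI_nonneg_bounded)
    fix N
    have "(1 - l) * (\<Sum>k<N. y (k + n1)) \<le> l * y (N + n1) + (\<Sum>k<N. c (k + n1))"
    proof (induction N)
      case (Suc N)
      have "y (N + n1) \<le> l * y (Suc N + n1) + c (N + n1)" using rec[of "N + n1"] by simp
      then show ?case using Suc by (simp add: algebra_simps)
    qed (use l y in simp)
    also have "(\<Sum>k<N. c (k + n1)) \<le> (\<Sum>k. c (k + n1))"
      by (rule sum_le_suminf) (use c in \<open>auto simp: summable_iff_shift\<close>)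
    also have "l * y (N + n1) \<le> l * B" using y(2)[of "N + n1"] l by (intro mult_left_mono) auto
    finally have "(1 - l) * (\<Sum>k<N. y (k + n1)) \<le> l * B + (\<Sum>k. c (k + n1))" by simp
    then show "(\<Sum>k<N. y (k + n1)) \<le> (l * B + (\<Sum>k. c (k + n1))) / (1 - l)"
      using l1 by (simp add: pos_le_divide_eq mult.commute)
  qed (rule y)
  then show ?thesis by (simp add: summable_iff_shift)
qed

lemma summable_const_over_square: "summable (\<lambda>n. K / (real n)^2)"
  using summable_mult[OF inverse_power_summable[of 2, where 'a = real], of K] by (simp add: field_simps)

context semiparabolic_family
begin

lemma cx_le_if_vv_ge:
  assumes "real n / 4 \<le> norm (vv p)" "n \<ge> 1"
  shows "norm (cx p)^2 \<le> 16 / (real n)^2"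
proof -
  have "norm (vv p) = 1 / norm (cx p)" by (simp add: vv_def norm_divide)
  moreover have "norm (vv p) > 0" by (rule less_le_trans[OF _ assms(1)]) (use assms(2) in simp)
  ultimately have "norm (cx p) \<le> 4 / real n" using assms by (auto simp: field_simps)
  then have "norm (cx p)^2 \<le> (4 / real n)^2" by (intro power_mono) auto
  then show ?thesis by (simp add: power_divide)
qed

text \<open>Linear growth of \<open>vv\<close> gives \<open>norm x \<le> 4 / n\<close>. Then y is
  summable by contraction, and so are the increments of \<open>win - n\<close>; the limit in
  \<open>fatou_in\<close> therefore exists, and its existence sharpens the position of
  \<open>vv\<close>.\<close>

lemma basin_asymptotics:
  assumes p: "p \<in> basin (F 0) p0"
  shows "\<forall>\<^sub>F n in sequentially. (F 0 ^^ n) p \<in> Box \<and> Re (vv ((F 0 ^^ n) p)) > 0 \<and>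
      norm (vv ((F 0 ^^ n) p) - of_nat n) \<le> real n / 4"
    and "(\<lambda>n. win ((F 0 ^^ n) p) - of_nat n) \<longlonglongrightarrow> fatou_in (F 0) \<phi> q p"
    and "(\<lambda>n. cy ((F 0 ^^ n) p)) \<longlonglongrightarrow> 0"
proof -
  define P where "P = (\<lambda>n. (F 0 ^^ n) p)"
  have PS: "P (Suc n) = F 0 (P n)" for n by (simp add: P_def)
  obtain n1 where n1: "\<And>n. n \<ge> n1 \<Longrightarrow> P n \<in> Box \<and> cx (P n) \<noteq> 0"
    using basin_orbit_cx_nonzero[OF p] by (auto simp: P_def eventually_sequentially)
  have g: "\<forall>\<^sub>F n in sequentially. real n / 4 \<le> Re (vv (P n)) \<and> norm (vv (P n)) \<le> 2 * real n"
    by (rule approximate_translation_growth[of n1]) (use n1 F0_Box_step(5) in \<open>auto simp: PS\<close>)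
  then obtain n2 where n2: "\<And>n. n \<ge> n2 \<Longrightarrow> real n / 4 \<le> Re (vv (P n))"
    by (auto simp: eventually_sequentially)
  define n3 where "n3 = max (max n1 n2) 1"
  have n3: "P n \<in> Box" "cx (P n) \<noteq> 0" "real n / 4 \<le> Re (vv (P n))" "n \<ge> 1" "Re (vv (P n)) > 0" if "n \<ge> n3" for n
  proof -
    show "P n \<in> Box" "cx (P n) \<noteq> 0" "n \<ge> 1" using n1 that by (auto simp: n3_def)
    show *: "real n / 4 \<le> Re (vv (P n))" by (rule n2) (use that in \<open>simp add: n3_def\<close>)
    show "Re (vv (P n)) > 0" by (rule less_le_trans[OF _ *]) (use \<open>n \<ge> 1\<close> in simp)
  qed
  have x2: "norm (cx (P n))^2 \<le> 16 / (real n)^2" if "n \<ge> n3" for n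
    by (rule cx_le_if_vv_ge) (use n3(4)[OF that] order_trans[OF n3(3)[OF that] complex_Re_le_cmod] in auto)
  define Y where "Y = (\<lambda>n. norm (cy (P n)))"
  have sY: "summable Y"
  proof (rule summable_if_contracted[where ?n1.0 = n3 and c = "\<lambda>n. 16 * C / (real n)^2"])
    fix n assume n: "n \<ge> n3"
    have "Y (Suc n) \<le> lam * Y n + C * norm (cx (P n))^2"
      using F0_Box_step(3)[OF n3(1)[OF n]] by (simp add: Y_def PS)
    also have "C * norm (cx (P n))^2 \<le> C * (16 / (real n)^2)" using x2[OF n] C by (intro mult_left_mono) auto
    finally show "Y (Suc n) \<le> lam * Y n + 16 * C / (real n)^2" by (simp add: mult.commute)
  qed (use lam C summable_const_over_square in \<open>auto simp: Y_def\<close>)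
  then have "Y \<longlonglongrightarrow> 0" by (rule summable_LIMSEQ_zero)
  then show "(\<lambda>n. cy ((F 0 ^^ n) p)) \<longlonglongrightarrow> 0" by (simp add: Y_def P_def tendsto_norm_zero_iff)
  have conv: "convergent (\<lambda>n. win (P n) - of_nat n)"
  proof (rule convergent_if_summable_increments[where ?n1.0 = n3])
    show "summable (\<lambda>n. (norm r + C) * Y n + 16 * C / (real n)^2)"
      by (intro summable_add summable_mult sY summable_const_over_square)
    fix n assume n: "n \<ge> n3"
    have s: "norm (win (P (Suc n)) - win (P n) - 1 - r * cy (P n)) \<le> C * (norm (cx (P n))^2 + (Y n)^2)"
      using F0_Box_step(6)[OF n3(1,2,5)[OF n]] n3(5)[of "Suc n"] n by (simp add: PS Y_def)
    have "(Y n)^2 \<le> 1 * Y n" unfolding power2_eq_square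
      using BoxD(3)[OF n3(1)[OF n]] \<delta> by (intro mult_right_mono) (auto simp: Y_def)
    then have "C * (norm (cx (P n))^2 + (Y n)^2) \<le> C * (16 / (real n)^2 + Y n)"
      using C x2[OF n] by (intro mult_left_mono add_mono) auto
    with s have s': "norm (win (P (Suc n)) - win (P n) - 1 - r * cy (P n)) \<le> C * (16 / (real n)^2 + Y n)" by simp
    have "norm (win (P (Suc n)) - of_nat (Suc n) - (win (P n) - of_nat n)) \<le> C * (16 / (real n)^2 + Y n) + norm r * Y n"
      by (rule norm_add_bound[OF _ s', of _ "r * cy (P n)"]) (auto simp: Y_def norm_mult)
    then show "norm (win (P (Suc n)) - of_nat (Suc n) - (win (P n) - of_nat n)) \<le> (norm r + C) * Y n + 16 * C / (real n)^2"
      by (simp add: algebra_simps)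
  qed
  then have "(\<lambda>n. win (P n) - of_nat n) \<longlonglongrightarrow> lim (\<lambda>n. win (P n) - of_nat n)"
    by (simp add: convergent_LIMSEQ_iff)
  then show "(\<lambda>n. win ((F 0 ^^ n) p) - of_nat n) \<longlonglongrightarrow> fatou_in (F 0) \<phi> q p"
    by (simp add: P_def win_def fatou_in_def)
  have "convergent (\<lambda>n. vv (P n) + q * Ln (vv (P n)) - of_nat n)"
  proof -
    have "\<forall>\<^sub>F n in sequentially. win (P n) - of_nat n = vv (P n) + q * Ln (vv (P n)) - of_nat n"
      unfolding eventually_sequentially using n3(5) win_eq by auto
    from convergent_cong[OF this] conv show ?thesis by (rule iffD1)
  qed
  from translation_coordinate_asymptotics[OF g this] eventually_ge_at_top[of n3]
  show "\<forall>\<^sub>F n in sequentially. (F 0 ^^ n) p \<in> Box \<and> Re (vv ((F 0 ^^ n) p)) > 0 \<and>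
      norm (vv ((F 0 ^^ n) p) - of_nat n) \<le> real n / 4"
    by eventually_elim (use n3 in \<open>auto simp: P_def\<close>)
qed

text \<open>The scheme of \<open>basin_asymptotics\<close> in reversed time, where y is no longer
  contracted; its summability comes from boundedness in the polydisc.\<close>

lemma asymptotic_curve_asymptotics:
  assumes p: "p \<in> asymptotic_curve (F 0) p0"
  shows "\<forall>\<^sub>F n in sequentially. (inv (F 0) ^^ n) p \<in> Box \<and> Re (vv ((inv (F 0) ^^ n) p)) < 0 \<and>
      norm (vv ((inv (F 0) ^^ n) p) + of_nat n) \<le> real n / 2"
    and "(\<lambda>n. wout ((inv (F 0) ^^ n) p) + of_nat n) \<longlonglongrightarrow> fatou_out (F 0) \<phi> q p"
    and "(\<lambda>n. cy ((inv (F 0) ^^ n) p)) \<longlonglongrightarrow> 0"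
proof -
  define P where "P = (\<lambda>n. (inv (F 0) ^^ n) p)"
  have PS: "F 0 (P (Suc n)) = P n" for n by (simp add: P_def)
  have lim: "P \<longlonglongrightarrow> p0" and pne: "p \<noteq> p0" using p by (auto simp: asymptotic_curve_def P_def)
  have "\<forall>\<^sub>F n in sequentially. P n \<in> {p \<in> U. norm (cx p) < \<delta> \<and> norm (cy p) < \<delta>}"
    by (rule topological_tendstoD[OF lim open_small_box]) (use p0_in \<delta> in auto)
  then obtain n0 where n0: "\<And>n. n \<ge> n0 \<Longrightarrow> P n \<in> Box"
    unfolding eventually_sequentially Box_def using less_imp_le by (metis (mono_tags, lifting) mem_Collect_eq)
  \<comment> \<open>If x vanished it would vanish on the whole backward tail. There y shrinks
    forwards by the factor \<open>lam\<close> per step while it stays bounded, so y = 0 and the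
    orbit would be that of \<open>p0\<close>.\<close>
  have nz: "cx (P n) \<noteq> 0" if n: "n \<ge> n0" for n
  proof
    assume c0: "cx (P n) = 0"
    have z: "cx (P (n + k)) = 0" for k
    proof (induction k)
      case (Suc k)
      show ?case
      proof (rule ccontr)
        assume "cx (P (n + Suc k)) \<noteq> 0"
        then have "cx (F 0 (P (Suc (n + k)))) \<noteq> 0" using F0_Box_step(1)[of "P (n + Suc k)"] n0 n by simp
        then show False using Suc by (simp only: PS)
      qed
    qed (use c0 in simp)
    have y: "norm (cy (P n)) \<le> lam ^ k * norm (cy (P (n + k)))" for k
    proof (induction k)
      case (Suc k)
      have "norm (cy (F 0 (P (Suc (n + k))))) \<le> lam * norm (cy (P (Suc (n + k))))"
        using F0_Box_step(3)[of "P (Suc (n + k))"] n0 n z[of "Suc k"] by simp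
      then have "norm (cy (P (n + k))) \<le> lam * norm (cy (P (Suc (n + k))))" by (simp only: PS)
      then have "lam ^ k * norm (cy (P (n + k))) \<le> lam ^ k * (lam * norm (cy (P (Suc (n + k)))))"
        using lam by (intro mult_left_mono) auto
      then show ?case using Suc by (simp add: ac_simps)
    qed simp
    have "norm (cy (P n)) \<le> lam ^ k * 1" for k
    proof -
      have "norm (cy (P (n + k))) \<le> 1" using BoxD(3)[OF n0[of "n + k"]] n \<delta> by simp
      then have "lam ^ k * norm (cy (P (n + k))) \<le> lam ^ k * 1" using lam by (intro mult_left_mono) auto
      then show ?thesis using y[of k] by simp
    qed
    moreover have "(\<lambda>k. lam ^ k * 1) \<longlonglongrightarrow> 0" using LIMSEQ_power_zero[of lam] lam by simp
    ultimately have "norm (cy (P n)) \<le> 0" by (intro LIMSEQ_le_const[of "\<lambda>k. lam ^ k * 1"]) auto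
    then have "P n = emb 0 0" using emb_cx_cy[OF BoxD(1)[OF n0[OF n]]] c0 by simp
    also have "\<dots> = p0" using emb_cx_cy[OF p0_in] by simp
    finally have "(F 0 ^^ n) (P n) = p0" by simp
    then show False using pne by (simp add: P_def)
  qed
  have st: "norm (vv (P n) - vv (P (Suc n)) - 1) \<le> 1/2" if "n \<ge> n0" for n
    using F0_Box_step(5)[OF n0[of "Suc n"] nz[of "Suc n"]] that by (simp add: PS)
  have g: "\<forall>\<^sub>F n in sequentially. real n / 4 \<le> Re (- vv (P n)) \<and> norm (- vv (P n)) \<le> 2 * real n"
    by (rule approximate_translation_growth[of n0]) (use st in simp)
  then obtain n2 where n2: "\<And>n. n \<ge> n2 \<Longrightarrow> real n / 4 \<le> Re (- vv (P n))"
    by (auto simp: eventually_sequentially)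
  define n3 where "n3 = max (max n0 n2) 1"
  have n3: "P n \<in> Box" "cx (P n) \<noteq> 0" "real n / 4 \<le> Re (- vv (P n))" "n \<ge> 1" "Re (vv (P n)) < 0" if "n \<ge> n3" for n
  proof -
    show "P n \<in> Box" "cx (P n) \<noteq> 0" "n \<ge> 1" using n0 nz that by (auto simp: n3_def)
    show *: "real n / 4 \<le> Re (- vv (P n))" by (rule n2) (use that in \<open>simp add: n3_def\<close>)
    have "0 < Re (- vv (P n))" by (rule less_le_trans[OF _ *]) (use \<open>n \<ge> 1\<close> in simp)
    then show "Re (vv (P n)) < 0" by simp
  qed
  have x2: "norm (cx (P n))^2 \<le> 16 / (real n)^2" if "n \<ge> n3" for n
    by (rule cx_le_if_vv_ge)
       (use n3[OF that] order_trans[OF n3(3)[OF that] complex_Re_le_cmod] in auto)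
  define Y where "Y = (\<lambda>n. norm (cy (P n)))"
  have cs: "summable (\<lambda>n. K / (real (Suc n))^2)" for K
    using summable_const_over_square[of K] summable_Suc_iff[of "\<lambda>n. K / (real n)^2"] by simp
  have sY: "summable Y"
  proof (rule summable_if_expanded_bounded[where ?n1.0 = n3 and c = "\<lambda>n. 16 * C / (real (Suc n))^2" and B = 1])
    show "Y n \<le> 1" if "n \<ge> n3" for n using BoxD(3)[OF n3(1)[OF that]] \<delta> by (simp add: Y_def)
    fix n assume n: "n \<ge> n3"
    have "Y n \<le> lam * Y (Suc n) + C * norm (cx (P (Suc n)))^2"
      using F0_Box_step(3)[OF n3(1)[of "Suc n"]] n by (simp add: Y_def PS)
    also have "C * norm (cx (P (Suc n)))^2 \<le> C * (16 / (real (Suc n))^2)"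
      using x2[of "Suc n"] n C by (intro mult_left_mono) auto
    finally show "Y n \<le> lam * Y (Suc n) + 16 * C / (real (Suc n))^2" by (simp add: mult.commute)
  qed (use lam C cs in \<open>auto simp: Y_def\<close>)
  then have "Y \<longlonglongrightarrow> 0" by (rule summable_LIMSEQ_zero)
  then show "(\<lambda>n. cy ((inv (F 0) ^^ n) p)) \<longlonglongrightarrow> 0" by (simp add: Y_def P_def tendsto_norm_zero_iff)
  have conv: "convergent (\<lambda>n. wout (P n) + of_nat n)"
  proof (rule convergent_if_summable_increments[where ?n1.0 = n3])
    have "summable (\<lambda>n. Y (Suc n))" using sY by (simp add: summable_Suc_iff)
    then show "summable (\<lambda>n. (norm r + C) * Y (Suc n) + 16 * C / (real (Suc n))^2)"
      by (intro summable_add summable_mult cs)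
    fix n assume n: "n \<ge> n3"
    then have Sn: "Suc n \<ge> n3" by simp
    have s: "norm (wout (P n) - wout (P (Suc n)) - 1 - r * cy (P (Suc n))) \<le> C * (norm (cx (P (Suc n)))^2 + (Y (Suc n))^2)"
      using F0_Box_step(7)[OF n3(1,2,5)[OF Sn]] n3(5)[OF n] by (simp add: PS Y_def)
    have "(Y (Suc n))^2 \<le> 1 * Y (Suc n)" unfolding power2_eq_square
      using BoxD(3)[OF n3(1)[OF Sn]] \<delta> by (intro mult_right_mono) (auto simp: Y_def)
    then have "C * (norm (cx (P (Suc n)))^2 + (Y (Suc n))^2) \<le> C * (16 / (real (Suc n))^2 + Y (Suc n))"
      using C x2[OF Sn] by (intro mult_left_mono add_mono) auto
    with s have s': "norm (wout (P n) - wout (P (Suc n)) - 1 - r * cy (P (Suc n))) \<le> C * (16 / (real (Suc n))^2 + Y (Suc n))" by simp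
    have "norm (- (wout (P (Suc n)) + of_nat (Suc n) - (wout (P n) + of_nat n))) \<le> C * (16 / (real (Suc n))^2 + Y (Suc n)) + norm r * Y (Suc n)"
      by (rule norm_add_bound[OF _ s', of _ "r * cy (P (Suc n))"]) (auto simp: Y_def norm_mult)
    then show "norm (wout (P (Suc n)) + of_nat (Suc n) - (wout (P n) + of_nat n)) \<le> (norm r + C) * Y (Suc n) + 16 * C / (real (Suc n))^2"
      unfolding norm_minus_cancel by (simp add: algebra_simps)
  qed
  then have cl: "(\<lambda>n. wout (P n) + of_nat n) \<longlonglongrightarrow> lim (\<lambda>n. wout (P n) + of_nat n)"
    by (simp add: convergent_LIMSEQ_iff)
  then show "(\<lambda>n. wout ((inv (F 0) ^^ n) p) + of_nat n) \<longlonglongrightarrow> fatou_out (F 0) \<phi> q p"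
    by (simp add: P_def wout_def fatou_out_def)
  have "convergent (\<lambda>n. - vv (P n) + (- q) * Ln (- vv (P n)) - of_nat n)"
  proof -
    have "\<forall>\<^sub>F n in sequentially. - (wout (P n) + of_nat n) = - vv (P n) + (- q) * Ln (- vv (P n)) - of_nat n"
      unfolding eventually_sequentially by (intro exI[of _ n3] allI impI) (simp add: wout_eq n3(5))
    from convergent_cong[OF this] show ?thesis
      by (rule iffD1) (rule iffD1[OF convergent_minus_iff conv])
  qed
  from translation_coordinate_asymptotics[OF g this]
  have "\<forall>\<^sub>F n in sequentially. norm (- vv (P n) - of_nat n) \<le> real n / 4" .
  then have "\<forall>\<^sub>F n in sequentially. norm (vv (P n) + of_nat n) \<le> real n / 2"
  proof eventually_elim
    case (elim n)
    have "norm (vv (P n) + of_nat n) = norm (- (- vv (P n) - of_nat n))" by (simp add: add.commute)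
    also have "\<dots> = norm (- vv (P n) - of_nat n)" by (rule norm_minus_cancel)
    finally show ?case using elim by simp
  qed
  with eventually_ge_at_top[of n3]
  show "\<forall>\<^sub>F n in sequentially. (inv (F 0) ^^ n) p \<in> Box \<and> Re (vv ((inv (F 0) ^^ n) p)) < 0 \<and>
      norm (vv ((inv (F 0) ^^ n) p) + of_nat n) \<le> real n / 2"
    by eventually_elim (use n3 in \<open>auto simp: P_def\<close>)
qed

end

section \<open>Leaving the fixed point along the repelling direction\<close>

lemma sum_inverse_squares_below:
  assumes "n < K"
  shows "(\<Sum>m<n. 1 / (real K - real m)^2) \<le> 1 / (real K - real n)"
  using assms
proof (induction n)
  case (Suc n)
  define j where "j = real K - real n"
  have j: "j > 1" using Suc.prems by (simp add: j_def)
  have "(\<Sum>m<Suc n. 1 / (real K - real m)^2) \<le> 1 / j + 1 / j^2" using Suc by (simp add: j_def)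
  also have "\<dots> = (j + 1) / j^2" using j by (simp add: power2_eq_square field_simps)
  also have "\<dots> \<le> 1 / (j - 1)"
  proof -
    have "(j + 1) * (j - 1) \<le> j^2" by (simp add: power2_eq_square algebra_simps)
    then show ?thesis using j by (simp add: divide_simps)
  qed
  finally show ?case by (simp add: j_def algebra_simps)
qed simp

text \<open>A relative error of 3/4 leaves the real part at least d/4, so the argument is bounded; 5
  dominates \<open>ln 2 + pi\<close>.\<close>

lemma norm_Ln_half_plane_le:
  assumes "\<bar>d\<bar> \<ge> 1" "d > 0" "norm (u - of_real d) \<le> 3/4 * d" "d \<ge> 4"
  shows "norm (Ln u) \<le> 5 + ln d" "Re u > 0" "norm u \<ge> d / 4" "norm u \<le> 2 * d"
proof -
  have "\<bar>Re (u - of_real d)\<bar> \<le> 3/4 * d" using abs_Re_le_cmod assms(3) order_trans by blast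
  from abs_le_D2[OF this] have "Re u \<ge> d / 4" by simp
  then show "Re u > 0" using assms by simp
  show n1: "norm u \<ge> d / 4" using \<open>Re u \<ge> d / 4\<close> complex_Re_le_cmod order_trans by blast
  have "norm u \<le> 3/4 * d + d" by (rule norm_add_bound[OF _ assms(3), of _ "of_real d"]) (use assms in auto)
  then show n2: "norm u \<le> 2 * d" using assms by simp
  have n3: "norm u \<ge> 1" using n1 assms by simp
  have "norm (Ln u) \<le> \<bar>ln (norm u)\<bar> + pi" by (rule norm_Ln_le_ln_norm) (use n3 in auto)
  also have "\<bar>ln (norm u)\<bar> = ln (norm u)" using n3 by simp
  also have "ln (norm u) \<le> ln (2 * d)" using n2 n3 by (intro ln_mono) auto
  also have "\<dots> = ln 2 + ln d" using assms by (simp add: ln_mult)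
  also have "ln (2::real) \<le> 1" using ln_le_minus_one[of 2] by simp
  finally show "norm (Ln u) \<le> 5 + ln d" using pi_less_4 by simp
qed

lemma Ln_difference_le:
  assumes u: "norm (u - of_real d) \<le> d / 2" and w: "norm (w - of_real d) \<le> d / 2" and d: "d > 0"
  shows "norm (Ln u - Ln w) \<le> 2 / d * norm (u - w)"
proof (rule field_differentiable_bound[where S = "cball (of_real d) (d/2)" and f' = inverse])
  fix z :: complex assume "z \<in> cball (of_real d) (d / 2)"
  then have z: "norm (z - of_real d) \<le> d / 2" by (simp add: dist_norm norm_minus_commute)
  then have "\<bar>Re (z - of_real d)\<bar> \<le> d / 2" using abs_Re_le_cmod order_trans by blast
  from abs_le_D2[OF this] have Re: "Re z \<ge> d / 2" by simp
  then have "z \<notin> \<real>\<^sub>\<le>\<^sub>0" using d by (auto simp: complex_nonpos_Reals_iff)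
  then show "(Ln has_field_derivative inverse z) (at z within cball (of_real d) (d / 2))"
    by (rule has_field_derivative_at_within[OF has_field_derivative_Ln])
  have "norm z \<ge> d / 2" using Re complex_Re_le_cmod order_trans by blast
  then have "inverse (norm z) \<le> inverse (d / 2)" by (intro le_imp_inverse_le) (use d in auto)
  then show "norm (inverse z) \<le> 2 / d" by (simp add: norm_divide inverse_eq_divide)
qed (use u w in \<open>auto simp: dist_norm norm_minus_commute\<close>)

context semiparabolic_family
begin

lemma cx_if_vv: "d > 0 \<Longrightarrow> norm (vv p) \<ge> d \<Longrightarrow> cx p \<noteq> 0 \<and> norm (cx p) \<le> 1 / d"
proof -
  assume d: "d > 0" "norm (vv p) \<ge> d"
  have e: "norm (vv p) = 1 / norm (cx p)" by (simp add: vv_def norm_divide)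
  have "norm (vv p) > 0" using d by linarith
  then have c: "cx p \<noteq> 0" by (auto simp: vv_def)
  then show ?thesis using d e by (simp add: field_simps)
qed

text \<open>The bootstrap for an orbit that starts near \<open>vv = - K\<close> and is followed up
  to the predicted position \<open>- K0\<close>; the distance d of the prediction from 0 falls from
  K to K0.\<close>

lemma outgoing_orbit_bounds:
  obtains R0 C' where "R0 \<ge> 8" "C' \<ge> 0" "4 / R0 \<le> \<delta>"
    "\<And>K K0 p m. \<lbrakk>real K0 \<ge> R0; K0 \<le> K; p \<in> Box; norm (cy p) \<le> \<delta>/2; norm (vv p + of_nat K) \<le> real K / 2;
      norm (wout p + of_nat K) \<le> real K0 / 8; m \<le> K - K0\<rbrakk> \<Longrightarrow>
      (F 0 ^^ m) p \<in> Box \<and> norm (vv ((F 0 ^^ m) p) + of_nat (K - m)) \<le> real (K - m) / 2 \<and>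
      norm (cy ((F 0 ^^ m) p)) \<le> lam ^ m * norm (cy p) + C' / (real K0)^2 \<and>
      norm (wout ((F 0 ^^ m) p) - wout p - of_nat m) \<le> C' * (norm (cy p) + 1 / real K0)"
proof -
  \<comment> \<open>4 comes from \<open>norm x ^ 2 \<le> 4 / d^2\<close>, valid since
    \<open>norm (vv p) \<ge> d / 2\<close>; 5 comes from the logarithm bound
    \<open>5 + ln d\<close>.\<close>
  have C1: "1 \<le> 4 * C + 5" using C by simp
  define R0 where "R0 = bootstrap_radius lam (4 * C + 5) \<delta> q r"
  define C' where "C' = bootstrap_const lam (4 * C + 5) r"
  have B: "R0 \<ge> 8" "C' \<ge> 0"
    using bootstrap_radius_ge[OF lam(2) C1 \<delta>(1)] bootstrap_const_nonneg[OF lam(2) C1] by (simp_all add: R0_def C'_def)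
  \<comment> \<open>With \<open>norm (vv p) \<ge> R1 / 4\<close> this keeps \<open>norm x\<close> at
    most \<open>\<delta>\<close>.\<close>
  define R1 where "R1 = max R0 (4 / \<delta>)"
  show ?thesis
  proof (rule that[of R1 C'])
    show "R1 \<ge> 8" using B by (simp add: R1_def)
    have "4 / \<delta> \<le> R1" by (simp add: R1_def)
    then show d4: "4 / R1 \<le> \<delta>" using \<delta> \<open>R1 \<ge> 8\<close> by (simp add: field_simps)
    fix K K0 p m
    assume K0: "real K0 \<ge> R1" "K0 \<le> K" and p: "p \<in> Box" "norm (cy p) \<le> \<delta>/2" "norm (vv p + of_nat K) \<le> real K / 2"
      "norm (wout p + of_nat K) \<le> real K0 / 8" and m: "m \<le> K - K0"
    have K08: "real K0 \<ge> 8" "real K0 \<ge> R0" using K0 B by (simp_all add: R1_def)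
    define P where "P = (\<lambda>m. (F 0 ^^ m) p)"
    have PS: "P (Suc m) = F 0 (P m)" for m by (simp add: P_def)
    define d where "d = (\<lambda>m. real K - real m)"
    define c where "c = (\<lambda>m. of_nat m - of_nat K :: complex)"
    have cd: "vv (P m) - c m = - (- vv (P m) - of_real (d m))" for m by (simp add: c_def d_def)
    have nn: "norm (vv (P m) - c m) = norm (- vv (P m) - of_real (d m))" for m unfolding cd norm_minus_cancel ..
    have dR: "d m \<ge> real K0" if "m \<le> K - K0" for m using that K0 by (simp add: d_def)
    have d8: "d m \<ge> 8" if "m \<le> K - K0" for m using dR[OF that] K08 by simp
    have good: "norm (Ln (- vv (P m))) \<le> 5 + ln (d m)" "Re (vv (P m)) < 0" "norm (vv (P m)) \<ge> d m / 4"
      if "m \<le> K - K0" "norm (vv (P m) - c m) \<le> 3/4 * d m" for m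
      using norm_Ln_half_plane_le[of "d m" "- vv (P m)"] that(2) d8[OF that(1)] unfolding nn by auto
    have cx34: "cx (P m) \<noteq> 0" "norm (cx (P m)) \<le> \<delta>" if "m \<le> K - K0" "norm (vv (P m) - c m) \<le> 3/4 * d m" for m
    proof -
      have *: "norm (vv (P m)) \<ge> R1 / 4" using good(3)[OF that] dR[OF that(1)] K0 by simp
      have "R1 / 4 > 0" using \<open>R1 \<ge> 8\<close> by simp
      from cx_if_vv[OF this *] d4 show "cx (P m) \<noteq> 0" "norm (cx (P m)) \<le> \<delta>" by auto
    qed
    have v0eq: "vv (P 0) - c 0 = vv p + of_nat K" by (simp add: P_def c_def)
    have v0: "norm (vv (P 0) - c 0) \<le> d 0 / 2" unfolding v0eq using p by (simp add: d_def)
    have v0': "norm (vv (P 0) - c 0) \<le> 3/4 * d 0" using v0 d8[of 0] by simp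
    have W: "wout (P m) = vv (P m) + q * Ln (- vv (P m))" if "m \<le> K - K0" "norm (vv (P m) - c m) \<le> 3/4 * d m" for m
      by (rule wout_eq[OF good(2)[OF that]])
    have concl: "P m \<in> Box \<and> norm (vv (P m) - c m) \<le> d m / 2 \<and> norm (cy (P m)) \<le> \<delta> \<and>
       norm (cy (P m)) \<le> lam ^ m * norm (cy (P 0)) + C' / (real K0)^2 \<and>
       norm (vv (P m) + q * Ln (- vv (P m)) - (vv (P 0) + q * Ln (- vv (P 0))) - of_nat m) \<le> C' * (norm (cy (P 0)) + 1 / real K0)"
      unfolding C'_def
    proof (rule translation_bootstrap[OF lam C1 \<delta>, where I = "\<lambda>m. P m \<in> Box" and d = d and n = "K - K0"])
      show "bootstrap_radius lam (4 * C + 5) \<delta> q r \<le> real K0" using K08 by (simp add: R0_def)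
      show "(\<Sum>m<K - K0. 1 / (d m)^2) \<le> 4 / real K0"
      proof -
        have "(\<Sum>m<K - K0. 1 / (d m)^2) \<le> 1 / (real K - real (K - K0))"
          unfolding d_def by (rule sum_inverse_squares_below) (use K0 K08 in auto)
        also have "\<dots> \<le> 4 / real K0" using K0 K08 by (simp add: field_simps)
        finally show ?thesis .
      qed
      have "vv (P 0) + q * Ln (- vv (P 0)) - c 0 = wout p + of_nat K"
        using W[of 0] v0' by (simp add: P_def c_def)
      then show "norm (vv (P 0) + q * Ln (- vv (P 0)) - c 0) \<le> real K0 / 8" using p by simp
      show "norm (vv (P (Suc m)) - vv (P m) - 1) \<le> 1/2 \<and> norm (cy (P (Suc m))) \<le> lam * norm (cy (P m)) + (4 * C + 5) / (d m)^2"
        if m: "m < K - K0" "P m \<in> Box" "norm (vv (P m) - c m) \<le> d m / 2" for m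
      proof -
        have v34: "norm (vv (P m) - c m) \<le> 3/4 * d m" and mm: "m \<le> K - K0" using m d8[of m] by auto
        note cx = cx34[OF mm v34]
        have v2: "norm (vv (P m)) \<ge> d m / 2"
          using norm_triangle_ineq2[of "of_real (d m)" "- (- vv (P m) - of_real (d m))"] m(3) d8[OF mm]
            norm_triangle_ineq4[of "- vv (P m)" "- vv (P m) - of_real (d m)"]
          unfolding nn by simp
        have "norm (cx (P m)) \<le> 1 / (d m / 2)" using cx_if_vv[OF _ v2] d8[OF mm] by simp
        then have "norm (cx (P m))^2 \<le> (1 / (d m / 2))^2" by (intro power_mono) auto
        then have "norm (cx (P m))^2 \<le> 4 / (d m)^2" by (simp add: power_divide)
        then have "C * norm (cx (P m))^2 \<le> C * (4 / (d m)^2)" using C by (intro mult_left_mono) auto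
        also have "\<dots> \<le> (4 * C + 5) / (d m)^2" using C by (simp add: divide_right_mono mult.commute)
        finally have "C * norm (cx (P m))^2 \<le> (4 * C + 5) / (d m)^2" .
        then show ?thesis using F0_Box_step(3,5)[OF m(2)] cx by (auto simp: PS)
      qed
      show "P (Suc m) \<in> Box \<and> norm (vv (P (Suc m)) + q * Ln (- vv (P (Suc m))) - (vv (P m) + q * Ln (- vv (P m))) - 1 - r * cy (P m))
          \<le> (4 * C + 5) * (1 / (d m)^2 + norm (cy (P m))^2)"
        if m: "m < K - K0" "P m \<in> Box" "norm (vv (P m) - c m) \<le> d m / 2" "norm (cy (P (Suc m))) \<le> \<delta>"
          "norm (vv (P (Suc m)) - c (Suc m)) \<le> 3/4 * d (Suc m)" for m
      proof
        have v34: "norm (vv (P m) - c m) \<le> 3/4 * d m" and mm: "m \<le> K - K0" "Suc m \<le> K - K0" using m d8[of m] by auto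
        show "P (Suc m) \<in> Box"
          using F_Box(1)[OF m(2), of 0] \<delta> cx34[OF mm(2) m(5)] m(4) by (auto simp: Box_def PS)
        have v2: "norm (vv (P m)) \<ge> d m / 2"
          using norm_triangle_ineq4[of "- vv (P m)" "- vv (P m) - of_real (d m)"] m(3) d8[OF mm(1)]
          unfolding nn by simp
        have "norm (cx (P m)) \<le> 1 / (d m / 2)" using cx_if_vv[OF _ v2] d8[OF mm(1)] by simp
        then have "norm (cx (P m))^2 \<le> (1 / (d m / 2))^2" by (intro power_mono) auto
        then have x2: "norm (cx (P m))^2 \<le> 4 * (1 / (d m)^2)" by (simp add: power_divide)
        have "norm (wout (P (Suc m)) - wout (P m) - 1 - r * cy (P m)) \<le> C * (norm (cx (P m))^2 + norm (cy (P m))^2)"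
          using F0_Box_step(7)[OF m(2) cx34(1)[OF mm(1) v34]] good(2)[OF mm(1) v34] good(2)[OF mm(2) m(5)] by (simp add: PS)
        also have "\<dots> \<le> C * (4 * (1 / (d m)^2) + 4 * norm (cy (P m))^2)"
          using C x2 by (intro mult_left_mono add_mono) auto
        also have "\<dots> = (4 * C) * (1 / (d m)^2 + norm (cy (P m))^2)" by (simp add: algebra_simps)
        also have "\<dots> \<le> (4 * C + 5) * (1 / (d m)^2 + norm (cy (P m))^2)" by (intro mult_right_mono) auto
        finally show "norm (vv (P (Suc m)) + q * Ln (- vv (P (Suc m))) - (vv (P m) + q * Ln (- vv (P m))) - 1 - r * cy (P m))
          \<le> (4 * C + 5) * (1 / (d m)^2 + norm (cy (P m))^2)"
          unfolding W[OF mm(1) v34] W[OF mm(2) m(5)] .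
      qed
      show "norm (Ln (- vv (P m))) \<le> (4 * C + 5) * (1 + ln (d m))"
        if "m \<le> K - K0" "P m \<in> Box" "norm (vv (P m) - c m) \<le> 3/4 * d m" for m
      proof -
        have "ln (d m) \<ge> 0" using d8[OF that(1)] by simp
        then have "5 + ln (d m) \<le> 5 * (1 + ln (d m))" by simp
        also have "\<dots> \<le> (4 * C + 5) * (1 + ln (d m))" using C \<open>ln (d m) \<ge> 0\<close> by (intro mult_right_mono) auto
        finally show ?thesis using good(1)[OF that(1,3)] by simp
      qed
    qed (use K08 dR p m v0 in \<open>auto simp: P_def c_def d_def\<close>)
    have v34: "norm (vv (P m) - c m) \<le> 3/4 * d m" using concl d8[OF m] by simp
    have e: "vv (P m) - c m = vv (P m) + of_nat (K - m)" "d m = real (K - m)"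
      using m by (simp_all add: c_def d_def of_nat_diff)
    show "(F 0 ^^ m) p \<in> Box \<and> norm (vv ((F 0 ^^ m) p) + of_nat (K - m)) \<le> real (K - m) / 2 \<and>
      norm (cy ((F 0 ^^ m) p)) \<le> lam ^ m * norm (cy p) + C' / (real K0)^2 \<and>
      norm (wout ((F 0 ^^ m) p) - wout p - of_nat m) \<le> C' * (norm (cy p) + 1 / real K0)"
      using concl unfolding W[OF m v34, symmetric] W[OF le0 v0', symmetric] unfolding e by (simp add: P_def)
  qed (use B in auto)
qed

text \<open>Points of \<open>QQ K \<zeta> \<eta>\<close> come close to the point with outgoing Fatou coordinate \<open>\<zeta>\<close> after \<open>K\<close> steps.\<close>

definition QQ :: "nat \<Rightarrow> complex \<Rightarrow> real \<Rightarrow> 'a set" where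
  "QQ K \<zeta> \<eta> = {p \<in> Box. norm (vv p + of_nat K) \<le> real K / 2 \<and> norm (wout p - (\<zeta> - of_nat K)) \<le> \<eta> \<and> norm (cy p) \<le> \<eta>}"

text \<open>An approximate solution on y = 0 of \<open>wout = \<zeta> - K\<close>: one step
  \<open>v = u - q * Ln (- u)\<close> of the iteration starting at \<open>u = \<zeta> - K\<close>.
  The defect \<open>q * (Ln (- v) - Ln (- u))\<close> is \<open>O(ln K / K)\<close>, and the formula
  is holomorphic in \<open>\<zeta>\<close>.\<close>

definition tgt :: "nat \<Rightarrow> complex \<Rightarrow> 'a" where
  "tgt K \<zeta> = emb (- 1 / (\<zeta> - of_nat K - q * Ln (of_nat K - \<zeta>))) 0"

lemma left_half_ball:
  assumes "norm (v + of_nat K) \<le> real K / 2" "K \<ge> 8"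
  shows "Re v < 0" "norm v \<ge> real K / 2" "norm (Ln (- v)) \<le> ln (2 * real K) + pi" "norm (- v - of_real (real K)) \<le> real K / 2"
proof -
  have e: "- v - of_real (real K) = - (v + of_nat K)" by simp
  show n: "norm (- v - of_real (real K)) \<le> real K / 2" unfolding e norm_minus_cancel by (rule assms)
  have "\<bar>Re (v + of_nat K)\<bar> \<le> real K / 2" using abs_Re_le_cmod assms(1) order_trans by blast
  from abs_le_D1[OF this] have R: "Re v \<le> - (real K / 2)" by simp
  then show "Re v < 0" using assms(2) by (simp add: le_less_trans)
  have "- Re v \<le> norm v" using abs_Re_le_cmod[of v] by linarith
  then show n1: "norm v \<ge> real K / 2" using R by linarith
  have "norm v \<le> real K / 2 + real K"
    by (rule norm_diff_bound[OF _ assms(1), of _ "of_nat K"]) auto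
  then have n2: "norm v \<le> 2 * real K" by simp
  have v1: "norm v \<ge> 1" using n1 assms(2) by linarith
  have "norm (Ln (- v)) \<le> \<bar>ln (norm v)\<bar> + pi" using norm_Ln_le_ln_norm[of "- v"] v1 by fastforce
  also have "\<bar>ln (norm v)\<bar> = ln (norm v)" using v1 by simp
  also have "ln (norm v) \<le> ln (2 * real K)" using n2 v1 by (intro ln_mono) auto
  finally show "norm (Ln (- v)) \<le> ln (2 * real K) + pi" by simp
qed

text \<open>The logarithm is negligible against K, so the crude K/2 in \<open>QQ\<close> improves to
  K/4. The margin is spent when points are moved along complex lines.\<close>

lemma QQ_eventually_near:
  "\<forall>\<^sub>F K in sequentially. \<forall>\<zeta> p. norm \<zeta> \<le> M \<longrightarrow> p \<in> QQ K \<zeta> 1 \<longrightarrow> norm (vv p + of_nat K) \<le> real K / 4"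
proof -
  have "\<forall>\<^sub>F K in sequentially. (1 + M) + norm q * (ln (2 * real K) + pi) \<le> 1/4 * real K"
    by (rule eventually_log_small) simp
  then show ?thesis using eventually_ge_at_top[of 8]
proof eventually_elim
  case (elim K)
  show ?case
  proof (intro allI impI)
    fix \<zeta> p assume z: "norm \<zeta> \<le> M" and "p \<in> QQ K \<zeta> 1"
    then have p: "norm (vv p + of_nat K) \<le> real K / 2" "norm (wout p - (\<zeta> - of_nat K)) \<le> 1" by (auto simp: QQ_def)
    note h = left_half_ball[OF p(1) elim(2)]
    have l: "norm (q * Ln (- vv p)) \<le> norm q * (ln (2 * real K) + pi)"
      unfolding norm_mult using h(3) by (intro mult_left_mono) auto
    have "norm (vv p + of_nat K) \<le> (1 + M) + norm q * (ln (2 * real K) + pi)"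
      by (rule norm_diff_bound[OF _ norm_add_bound[OF refl p(2) z] l]) (simp add: wout_eq[OF h(1)])
    then show "norm (vv p + of_nat K) \<le> real K / 4" using elim(1) by simp
  qed
qed
qed

text \<open>The correction \<open>q * Ln\<close> has Lipschitz constant at most
  \<open>2 * norm q / K \<le> 1/2\<close> there, so \<open>wout\<close> determines \<open>vv\<close>
  up to a factor 2.\<close>

lemma QQ_close:
  assumes p: "p \<in> QQ K \<zeta> \<eta>" "p' \<in> QQ K \<zeta> \<eta>" and K: "K \<ge> 8" "real K \<ge> 4 * norm q"
  shows "norm (vv p - vv p') \<le> 4 * \<eta>" "norm (cy p - cy p') \<le> 2 * \<eta>"
proof -
  have q1: "norm (vv p + of_nat K) \<le> real K / 2" "norm (wout p - (\<zeta> - of_nat K)) \<le> \<eta>" "norm (cy p) \<le> \<eta>"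
    and q2: "norm (vv p' + of_nat K) \<le> real K / 2" "norm (wout p' - (\<zeta> - of_nat K)) \<le> \<eta>" "norm (cy p') \<le> \<eta>"
    using p by (auto simp: QQ_def)
  note h1 = left_half_ball[OF q1(1) K(1)] and h2 = left_half_ball[OF q2(1) K(1)]
  show "norm (cy p - cy p') \<le> 2 * \<eta>" using norm_diff_bound[OF refl q1(3) q2(3)] by simp
  have "norm (wout p - wout p') \<le> \<eta> + \<eta>" by (rule norm_diff_bound[OF _ q1(2) q2(2)]) simp
  then have w: "norm (wout p - wout p') \<le> 2 * \<eta>" by simp
  have "norm (Ln (- vv p) - Ln (- vv p')) \<le> 2 / real K * norm (- vv p - - vv p')"
    by (rule Ln_difference_le[OF h1(4) h2(4)]) (use K in simp)
  also have "norm (- vv p - - vv p') = norm (vv p - vv p')" by (simp add: norm_minus_commute)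
  finally have l: "norm (q * (Ln (- vv p) - Ln (- vv p'))) \<le> norm q * (2 / real K * norm (vv p - vv p'))"
    unfolding norm_mult by (intro mult_left_mono) auto
  have "norm q * (2 / real K) \<le> 1/2" using K by (simp add: field_simps)
  then have "norm q * (2 / real K) * norm (vv p - vv p') \<le> 1/2 * norm (vv p - vv p')" by (intro mult_right_mono) auto
  then have l': "norm (q * (Ln (- vv p) - Ln (- vv p'))) \<le> 1/2 * norm (vv p - vv p')" using order_trans[OF l] by (simp only: mult.assoc)
  have "norm (vv p - vv p') \<le> 2 * \<eta> + 1/2 * norm (vv p - vv p')"
    by (rule norm_diff_bound[OF _ w l']) (simp add: wout_eq[OF h1(1)] wout_eq[OF h2(1)] algebra_simps)
  then show "norm (vv p - vv p') \<le> 4 * \<eta>" by simp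
qed

lemma tgt_eventually:
  assumes \<eta>: "\<eta> > 0"
  shows "\<forall>\<^sub>F K in sequentially. \<forall>\<zeta>. norm \<zeta> \<le> M \<longrightarrow>
    tgt K \<zeta> \<in> QQ K \<zeta> \<eta> \<and> cy (tgt K \<zeta>) = 0 \<and>
    norm (- 1 / (\<zeta> - of_nat K - q * Ln (of_nat K - \<zeta>))) \<le> \<delta> \<and>
    \<zeta> - of_nat K - q * Ln (of_nat K - \<zeta>) \<noteq> 0 \<and> 0 < Re (of_nat K - \<zeta>)"
proof -
  have "\<forall>\<^sub>F K in sequentially. nat \<lceil>max (2 * \<bar>M\<bar>) (4 / \<delta>)\<rceil> \<le> K" by (rule eventually_ge_at_top)
  moreover have "\<forall>\<^sub>F K in sequentially. M + norm q * (ln (2 * real K) + pi) \<le> 1/4 * real K"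
    by (rule eventually_log_small) simp
  ultimately show ?thesis
    using eventually_ge_at_top[of 8] eventually_log_small[OF \<eta>, of 0 "2 * norm q * norm q"]
  proof eventually_elim
    case (elim K)
    have "max (2 * \<bar>M\<bar>) (4 / \<delta>) \<le> real (nat \<lceil>max (2 * \<bar>M\<bar>) (4 / \<delta>)\<rceil>)" by (rule real_nat_ceiling_ge)
    also have "\<dots> \<le> real K" using elim(1) by (rule of_nat_mono)
    finally have KM: "2 * \<bar>M\<bar> \<le> real K" "4 / \<delta> \<le> real K" by auto
    have K8: "K \<ge> 8" using elim by simp
    show ?case
    proof (intro allI impI)
      fix \<zeta> :: complex assume z: "norm \<zeta> \<le> M"
      define u where "u = \<zeta> - of_nat K"
      define w where "w = \<zeta> - of_nat K - q * Ln (of_nat K - \<zeta>)"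
      have u: "norm (u + of_nat K) \<le> real K / 2" using z KM by (simp add: u_def)
      note hu = left_half_ball[OF u K8]
      have mu: "- u = of_nat K - \<zeta>" by (simp add: u_def)
      have l: "norm (q * Ln (- u)) \<le> norm q * (ln (2 * real K) + pi)"
        unfolding norm_mult using hu(3) by (intro mult_left_mono) auto
      have "norm (w + of_nat K) \<le> M + norm q * (ln (2 * real K) + pi)"
        by (rule norm_diff_bound[OF _ z l]) (simp add: w_def mu)
      then have "norm (w + of_nat K) \<le> real K / 4" using elim by simp
      then have w: "norm (w + of_nat K) \<le> real K / 2" by simp
      note hw = left_half_ball[OF w K8]
      have w0: "w \<noteq> 0" using hw(1) by auto
      have nw: "norm (- 1 / w) \<le> \<delta>"
      proof -
        have "4 \<le> \<delta> * real K" using KM \<delta> by (simp add: divide_le_eq mult.commute)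
        also have "\<dots> \<le> \<delta> * (2 * norm w)" using hw(2) \<delta> by (intro mult_left_mono) auto
        finally have "1 \<le> \<delta> * norm w" by simp
        then show ?thesis using w0 by (simp add: norm_divide divide_le_eq)
      qed
      have t: "tgt K \<zeta> = emb (- 1 / w) 0" by (simp add: tgt_def w_def)
      have n0: "norm (0::complex) \<le> \<delta>" using \<delta> by simp
      note e = emb_box[OF nw n0, folded t]
      have vt: "vv (tgt K \<zeta>) = w" using e w0 by (simp add: vv_def)
      have wt: "wout (tgt K \<zeta>) - (\<zeta> - of_nat K) = q * (Ln (- w) - Ln (- u))"
        using wout_eq[of "tgt K \<zeta>"] hw(1) by (simp add: vt) (simp add: w_def mu algebra_simps)
      have "norm (Ln (- w) - Ln (- u)) \<le> 2 / real K * norm (- w - - u)"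
        by (rule Ln_difference_le[OF hw(4) hu(4)]) (use K8 in simp)
      also have "- w - - u = q * Ln (- u)" by (simp add: w_def u_def)
      also have "2 / real K * norm (q * Ln (- u)) \<le> 2 / real K * (norm q * (ln (2 * real K) + pi))"
        using l by (intro mult_left_mono) auto
      finally have "norm q * norm (Ln (- w) - Ln (- u)) \<le> norm q * (2 / real K * (norm q * (ln (2 * real K) + pi)))"
        by (intro mult_left_mono) auto
      also have "\<dots> = (2 * norm q * norm q * (ln (2 * real K) + pi)) / real K" by simp
      also have "\<dots> \<le> \<eta>" using elim K8 by (simp add: divide_le_eq)
      finally have "norm (wout (tgt K \<zeta>) - (\<zeta> - of_nat K)) \<le> \<eta>" unfolding wt by (simp add: norm_mult)
      then have "tgt K \<zeta> \<in> QQ K \<zeta> \<eta>" using e w \<eta> by (simp add: QQ_def vt)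
      then show "tgt K \<zeta> \<in> QQ K \<zeta> \<eta> \<and> cy (tgt K \<zeta>) = 0 \<and>
        norm (- 1 / (\<zeta> - of_nat K - q * Ln (of_nat K - \<zeta>))) \<le> \<delta> \<and>
        \<zeta> - of_nat K - q * Ln (of_nat K - \<zeta>) \<noteq> 0 \<and> 0 < Re (of_nat K - \<zeta>)"
        using e(3) nw w0 hu(1) unfolding w_def mu[symmetric] by simp
    qed
  qed
qed

text \<open>Two nearby points stay close all the way out: on the complex line through them the iterate
  is bounded on a disc whose radius is inversely proportional to their distance.\<close>

lemma outgoing_lipschitz:
  obtains R1 where "R1 \<ge> 8"
    "\<And>K K0 p p'. \<lbrakk>real K0 \<ge> R1; K0 \<le> K; p \<in> Box; p' \<in> Box; norm (vv p + of_nat K) \<le> real K / 4;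
      norm (wout p + of_nat K) \<le> real K0 / 16; norm (cy p) \<le> \<delta> / 8;
      norm (vv p - vv p') + norm (cy p - cy p') \<le> \<delta> / 16\<rbrakk> \<Longrightarrow>
      (F 0 ^^ (K - K0)) p \<in> Box \<and> (F 0 ^^ (K - K0)) p' \<in> Box \<and>
      norm (cx ((F 0 ^^ (K - K0)) p) - cx ((F 0 ^^ (K - K0)) p')) \<le> 32 / \<delta> * (norm (vv p - vv p') + norm (cy p - cy p')) \<and>
      norm (cy ((F 0 ^^ (K - K0)) p) - cy ((F 0 ^^ (K - K0)) p')) \<le> 32 / \<delta> * (norm (vv p - vv p') + norm (cy p - cy p'))"
proof -
  obtain R0 C' where R0: "R0 \<ge> 8" "C' \<ge> 0" "4 / R0 \<le> \<delta>"
    and out: "\<And>K K0 p m. \<lbrakk>real K0 \<ge> R0; K0 \<le> K; p \<in> Box; norm (cy p) \<le> \<delta>/2; norm (vv p + of_nat K) \<le> real K / 2;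
      norm (wout p + of_nat K) \<le> real K0 / 8; m \<le> K - K0\<rbrakk> \<Longrightarrow>
      (F 0 ^^ m) p \<in> Box \<and> norm (vv ((F 0 ^^ m) p) + of_nat (K - m)) \<le> real (K - m) / 2 \<and>
      norm (cy ((F 0 ^^ m) p)) \<le> lam ^ m * norm (cy p) + C' / (real K0)^2 \<and>
      norm (wout ((F 0 ^^ m) p) - wout p - of_nat m) \<le> C' * (norm (cy p) + 1 / real K0)"
    by (rule outgoing_orbit_bounds) (rule that)
  \<comment> \<open>Leaves room \<open>K0 / 16\<close> for the change of \<open>wout\<close>, at
    most \<open>1 + norm q\<close>, over the disc on the line through p and p'.\<close>
  define R1 where "R1 = max R0 (16 * (1 + norm q))"
  show ?thesis
  proof (rule that[of R1])
    show "R1 \<ge> 8" using R0 by (simp add: R1_def)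
    fix K K0 p p'
    assume K0: "real K0 \<ge> R1" "K0 \<le> K" and p: "p \<in> Box" "p' \<in> Box" "norm (vv p + of_nat K) \<le> real K / 4"
      "norm (wout p + of_nat K) \<le> real K0 / 16" "norm (cy p) \<le> \<delta> / 8"
      and D: "norm (vv p - vv p') + norm (cy p - cy p') \<le> \<delta> / 16"
    define \<Delta> where "\<Delta> = norm (vv p - vv p') + norm (cy p - cy p')"
    define f where "f = F 0 ^^ (K - K0)"
    have KR: "real K0 \<ge> R0" "real K0 \<ge> 16 * (1 + norm q)" using K0 by (simp_all add: R1_def)
    have K8: "K \<ge> 8" "real K \<ge> 8" using KR R0 K0 by linarith+
    have \<Delta>0: "\<Delta> \<ge> 0" by (simp add: \<Delta>_def)
    define v where "v = (\<lambda>t. vv p + t * (vv p' - vv p))"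
    define y where "y = (\<lambda>t. cy p + t * (cy p' - cy p))"
    define Z where "Z = (\<lambda>t. emb (- 1 / v t) (y t))"
    have dv: "norm (v t - vv p) \<le> \<delta> / 8 \<and> norm (y t - cy p) \<le> \<delta> / 8" if "norm t * \<Delta> \<le> \<delta> / 8" for t
    proof -
      have "norm (v t - vv p) \<le> norm t * \<Delta>" "norm (y t - cy p) \<le> norm t * \<Delta>"
        by (simp_all add: v_def y_def norm_mult \<Delta>_def norm_minus_commute mult_left_mono)
      then show ?thesis using that by simp
    qed
    have v2: "norm (vv p + of_nat K) \<le> real K / 2" using p(3) by simp
    have "norm (vv p) \<ge> real K / 2" by (rule left_half_ball(2)[OF v2 K8(1)])
    have good: "Z t \<in> Box \<and> f (Z t) \<in> Box \<and> norm (- 1 / v t) \<le> \<delta> \<and> norm (y t) \<le> \<delta> \<and> v t \<noteq> 0" if t: "norm t * \<Delta> \<le> \<delta> / 8" for t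
    proof -
      have d1: "norm (v t - vv p) \<le> 1" "norm (v t - vv p) \<le> \<delta>/8" "norm (y t - cy p) \<le> \<delta>/8"
        using dv[OF t] \<delta> by auto
      have vK: "norm (v t + of_nat K) \<le> real K / 2"
      proof -
        have "norm (v t + of_nat K) \<le> 1 + real K / 4" by (rule norm_add_bound[OF _ d1(1) p(3)]) simp
        then show ?thesis using K8 by simp
      qed
      note hv = left_half_ball[OF vK K8(1)] and hp = left_half_ball[OF v2 K8(1)]
      have v0: "v t \<noteq> 0" using hv(1) by auto
      have nv: "norm (- 1 / v t) \<le> \<delta>"
      proof -
        have "4 \<le> \<delta> * R0" using R0 by (simp add: divide_le_eq)
        also have "\<dots> \<le> \<delta> * (2 * norm (v t))" using hv(2) \<delta> KR K0 by (intro mult_left_mono) auto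
        finally have "1 \<le> \<delta> * norm (v t)" by simp
        then show ?thesis using v0 by (simp add: norm_divide divide_le_eq)
      qed
      have "norm (y t) \<le> \<delta>/8 + \<delta>/8" by (rule norm_add_bound[OF _ d1(3) p(5)]) simp
      then have ny: "norm (y t) \<le> \<delta> / 2" "norm (y t) \<le> \<delta>" using \<delta> by auto
      note e = emb_box[OF nv ny(2)]
      have vZ: "vv (Z t) = v t" using e v0 by (simp add: vv_def Z_def)
      have "norm (Ln (- v t) - Ln (- vv p)) \<le> 2 / real K * norm (- v t - - vv p)"
        by (rule Ln_difference_le[OF hv(4) hp(4)]) (use K8 in simp)
      also have "norm (- v t - - vv p) = norm (v t - vv p)" by (simp add: norm_minus_commute)
      also have "2 / real K * norm (v t - vv p) \<le> 1 * 1" using d1 K8 by (intro mult_mono) auto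
      finally have "norm (q * (Ln (- v t) - Ln (- vv p))) \<le> norm q * 1" unfolding norm_mult by (intro mult_left_mono) auto
      then have l: "norm (q * (Ln (- v t) - Ln (- vv p))) \<le> norm q" by simp
      have "wout (Z t) + of_nat K = (wout p + of_nat K) + ((v t - vv p) + q * (Ln (- v t) - Ln (- vv p)))"
        using wout_eq[of "Z t"] wout_eq[of p] hv(1) hp(1) by (simp add: vZ algebra_simps)
      then have "norm (wout (Z t) + of_nat K) \<le> real K0 / 16 + (1 + norm q)"
        by (rule norm_add_bound[OF _ p(4) norm_add_bound[OF refl d1(1) l]])
      then have wZ: "norm (wout (Z t) + of_nat K) \<le> real K0 / 8" using KR by simp
      have ZB: "Z t \<in> Box" using e(5) by (simp add: Z_def)
      have "f (Z t) \<in> Box"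
        using out[OF KR(1) K0(2) ZB, of "K - K0"] e(3) ny vK wZ unfolding f_def by (simp add: vZ) (simp add: Z_def)
      then show ?thesis using ZB nv ny v0 by blast
    qed
    have Z0: "Z 0 = p"
    proof -
      have "- 1 / vv p = cx p" by (simp add: vv_def)
      then show ?thesis using emb_cx_cy[OF BoxD(1)[OF p(1)]] by (simp add: Z_def v_def y_def)
    qed
    have Z1: "Z 1 = p'"
    proof -
      have "- 1 / vv p' = cx p'" by (simp add: vv_def)
      then show ?thesis using emb_cx_cy[OF BoxD(1)[OF p(2)]] by (simp add: Z_def v_def y_def)
    qed
    have D8: "norm (1::complex) * \<Delta> \<le> \<delta> / 8" "norm (0::complex) * \<Delta> \<le> \<delta>/8" using D \<delta> by (simp_all add: \<Delta>_def)
    have inB: "f p \<in> Box" "f p' \<in> Box" using good[OF D8(1)] good[OF D8(2)] by (simp_all add: Z0 Z1)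
    have est: "norm (\<phi> (f p) $ i - \<phi> (f p') $ i) \<le> 32 / \<delta> * \<Delta>" for i
    proof (cases "\<Delta> = 0")
      case True
      then have "vv p = vv p'" "cy p = cy p'" unfolding \<Delta>_def by (simp_all add: add_nonneg_eq_0_iff)
      then have "Z 1 = Z 0" by (simp add: Z_def v_def y_def)
      then show ?thesis using True by (simp add: Z0 Z1)
    next
      case False
      have D': "16 * \<Delta> \<le> \<delta>" using D by (simp add: \<Delta>_def)
      \<comment> \<open>On this disc \<open>vv\<close> and y move by at most
        \<open>\<delta> / 8\<close> and the iterate has coordinates of norm at most 1, so the Cauchy
        constant is \<open>4 / \<rho> = 32 * \<Delta> / \<delta>\<close>.\<close>
      define \<rho> where "\<rho> = \<delta> / (8 * \<Delta>)"
      have \<rho>: "\<rho> > 0" "1 \<le> \<rho> / 2" using False \<Delta>0 \<delta> D' by (auto simp: \<rho>_def field_simps)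
      have inr: "norm t * \<Delta> \<le> \<delta> / 8" if "t \<in> ball 0 \<rho>" for t :: complex
      proof -
        have "norm t * \<Delta> \<le> \<rho> * \<Delta>" using that \<Delta>0 by (intro mult_right_mono) auto
        then show ?thesis using False by (simp add: \<rho>_def)
      qed
      have hol: "(\<lambda>t. \<phi> (f (Z t)) $ i) holomorphic_on ball 0 \<rho>"
        unfolding Z_def
      proof (rule holomorphic_on_curve_emb[OF _ _ _ _ _ _ _ chart])
        show "holo_self_map A f" unfolding f_def by (rule holo_self_map_funpow[OF surface holo_F0])
        show "(\<lambda>t. - 1 / v t) holomorphic_on ball 0 \<rho>" "y holomorphic_on ball 0 \<rho>"
          using good[OF inr] unfolding v_def y_def by (auto intro!: holomorphic_intros)
        show "f (emb (- 1 / v t) (y t)) \<in> U" if "t \<in> ball 0 \<rho>" for t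
          using good[OF inr[OF that]] BoxD(1) by (simp add: Z_def)
      qed (use good[OF inr] in auto)
      have bd: "norm (\<phi> (f (Z t)) $ i) \<le> 1" if "t \<in> ball 0 \<rho>" for t
        using BoxD(2,3)[of "f (Z t)"] good[OF inr[OF that]] \<delta> exhaust_2[of i] by (auto simp: cx_def cy_def)
      have "norm (\<phi> (f (Z 1)) $ i - \<phi> (f (Z 0)) $ i) \<le> 4 * 1 / \<rho> * norm (1::complex)"
        by (rule holomorphic_bounded_ball_estimates(2)[OF hol \<rho>(1) bd]) (use \<rho> in auto)
      then show ?thesis by (simp add: Z0 Z1 \<rho>_def norm_minus_commute)
    qed
    show "(F 0 ^^ (K - K0)) p \<in> Box \<and> (F 0 ^^ (K - K0)) p' \<in> Box \<and>
      norm (cx ((F 0 ^^ (K - K0)) p) - cx ((F 0 ^^ (K - K0)) p')) \<le> 32 / \<delta> * (norm (vv p - vv p') + norm (cy p - cy p')) \<and>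
      norm (cy ((F 0 ^^ (K - K0)) p) - cy ((F 0 ^^ (K - K0)) p')) \<le> 32 / \<delta> * (norm (vv p - vv p') + norm (cy p - cy p'))"
      using inB est[of 1] est[of 2] by (simp add: cx_def cy_def \<Delta>_def f_def)
  qed
qed

end

section \<open>The parametrization of the asymptotic curve\<close>

context semiparabolic_family
begin

lemma QQ_mono: "\<eta> \<le> \<eta>' \<Longrightarrow> QQ K \<zeta> \<eta> \<subseteq> QQ K \<zeta> \<eta>'"
  by (auto simp: QQ_def)

lemma Re_cx_pos_if_Re_vv_neg: "Re (vv p) < 0 \<Longrightarrow> Re (cx p) > 0"
proof -
  assume v: "Re (vv p) < 0"
  then have "vv p \<noteq> 0" by auto
  then have "cx p \<noteq> 0" by (auto simp: vv_def)
  have "cx p = - inverse (vv p)" by (simp add: vv_def)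
  then have "Re (cx p) = - Re (vv p) / (norm (vv p))^2" by (simp add: Re_complex_div_eq_0 cmod_power2)
  then show ?thesis using v \<open>vv p \<noteq> 0\<close> by (simp add: divide_neg_pos)
qed

text \<open>The points \<open>(F 0 ^^ (K - K0)) (tgt K \<zeta>)\<close> are uniformly Cauchy in K: a
  later target, pushed forward to level K, lies in \<open>QQ K \<zeta> \<eta>\<close> together with
  \<open>tgt K \<zeta>\<close>, and points of this set remain close down to level K0. Stopping K0
  steps before the end keeps everything in the chart.\<close>

lemma outgoing_limit:
  obtains Kmin E where "E \<ge> 0"
    "\<And>K0. K0 \<ge> Kmin \<Longrightarrow> \<exists>X Y. X holomorphic_on ball 0 M \<and> Y holomorphic_on ball 0 M \<and>
      (\<forall>\<zeta>\<in>ball 0 M. norm (X \<zeta>) \<le> \<delta> \<and> norm (Y \<zeta>) \<le> \<delta> \<and> emb (X \<zeta>) (Y \<zeta>) \<in> QQ K0 \<zeta> (E / real K0) \<and>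
         (\<lambda>K. (F 0 ^^ K) (tgt K \<zeta>)) \<longlonglongrightarrow> (F 0 ^^ K0) (emb (X \<zeta>) (Y \<zeta>))) \<and>
      (\<forall>\<eta>. 0 < \<eta> \<and> \<eta> \<le> \<delta> / 128 \<longrightarrow> (\<exists>K1\<ge>K0. \<forall>K\<ge>K1. \<forall>\<zeta>\<in>ball 0 M. \<forall>p\<in>QQ K \<zeta> \<eta>.
         (F 0 ^^ (K - K0)) p \<in> Box \<and> norm (cx ((F 0 ^^ (K - K0)) p) - X \<zeta>) \<le> 192 / \<delta> * \<eta> \<and>
         norm (cy ((F 0 ^^ (K - K0)) p) - Y \<zeta>) \<le> 192 / \<delta> * \<eta>))"
proof -
  obtain R0 C' where R0: "R0 \<ge> 8" "C' \<ge> 0" "4 / R0 \<le> \<delta>"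
    and out: "\<And>K K0 p m. \<lbrakk>real K0 \<ge> R0; K0 \<le> K; p \<in> Box; norm (cy p) \<le> \<delta>/2; norm (vv p + of_nat K) \<le> real K / 2;
      norm (wout p + of_nat K) \<le> real K0 / 8; m \<le> K - K0\<rbrakk> \<Longrightarrow>
      (F 0 ^^ m) p \<in> Box \<and> norm (vv ((F 0 ^^ m) p) + of_nat (K - m)) \<le> real (K - m) / 2 \<and>
      norm (cy ((F 0 ^^ m) p)) \<le> lam ^ m * norm (cy p) + C' / (real K0)^2 \<and>
      norm (wout ((F 0 ^^ m) p) - wout p - of_nat m) \<le> C' * (norm (cy p) + 1 / real K0)"
    by (rule outgoing_orbit_bounds) (rule that)
  obtain R1 where R1: "R1 \<ge> 8"
    and lip: "\<And>K K0 p p'. \<lbrakk>real K0 \<ge> R1; K0 \<le> K; p \<in> Box; p' \<in> Box; norm (vv p + of_nat K) \<le> real K / 4;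
      norm (wout p + of_nat K) \<le> real K0 / 16; norm (cy p) \<le> \<delta> / 8;
      norm (vv p - vv p') + norm (cy p - cy p') \<le> \<delta> / 16\<rbrakk> \<Longrightarrow>
      (F 0 ^^ (K - K0)) p \<in> Box \<and> (F 0 ^^ (K - K0)) p' \<in> Box \<and>
      norm (cx ((F 0 ^^ (K - K0)) p) - cx ((F 0 ^^ (K - K0)) p')) \<le> 32 / \<delta> * (norm (vv p - vv p') + norm (cy p - cy p')) \<and>
      norm (cy ((F 0 ^^ (K - K0)) p) - cy ((F 0 ^^ (K - K0)) p')) \<le> 32 / \<delta> * (norm (vv p - vv p') + norm (cy p - cy p'))"
    by (rule outgoing_lipschitz) (rule that)
  define \<eta>0 where "\<eta>0 = \<delta> / 128"
  have \<eta>0: "\<eta>0 > 0" "\<eta>0 \<le> 1/128" using \<delta> by (auto simp: \<eta>0_def)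
  have "\<forall>\<^sub>F K in sequentially. nat \<lceil>max (max R0 R1) (max (4 * norm q) (16 * (\<bar>M\<bar> + 2)))\<rceil> \<le> K"
    by (rule eventually_ge_at_top)
  with QQ_eventually_near[of M] tgt_eventually[OF \<eta>0(1), of M]
  have "\<forall>\<^sub>F K in sequentially. (\<forall>\<zeta> p. norm \<zeta> \<le> M \<longrightarrow> p \<in> QQ K \<zeta> 1 \<longrightarrow> norm (vv p + of_nat K) \<le> real K / 4) \<and>
     (\<forall>\<zeta>. norm \<zeta> \<le> M \<longrightarrow> tgt K \<zeta> \<in> QQ K \<zeta> \<eta>0 \<and> cy (tgt K \<zeta>) = 0 \<and>
       norm (- 1 / (\<zeta> - of_nat K - q * Ln (of_nat K - \<zeta>))) \<le> \<delta> \<and>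
       \<zeta> - of_nat K - q * Ln (of_nat K - \<zeta>) \<noteq> 0 \<and> 0 < Re (of_nat K - \<zeta>)) \<and>
     real K \<ge> R0 \<and> real K \<ge> R1 \<and> real K \<ge> 4 * norm q \<and> real K \<ge> 16 * (\<bar>M\<bar> + 2)"
  proof eventually_elim
    case (elim K)
    have "max (max R0 R1) (max (4 * norm q) (16 * (\<bar>M\<bar> + 2))) \<le> real (nat \<lceil>max (max R0 R1) (max (4 * norm q) (16 * (\<bar>M\<bar> + 2)))\<rceil>)"
      by (rule real_nat_ceiling_ge)
    also have "\<dots> \<le> real K" using elim(3) by (rule of_nat_mono)
    finally have "R0 \<le> real K" "R1 \<le> real K" "4 * norm q \<le> real K" "16 * (\<bar>M\<bar> + 2) \<le> real K" by simp_all
    with elim(1,2) show ?case by blast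
  qed
  then obtain Kmin where Kmin: "\<And>K. K \<ge> Kmin \<Longrightarrow> (\<forall>\<zeta> p. norm \<zeta> \<le> M \<longrightarrow> p \<in> QQ K \<zeta> 1 \<longrightarrow> norm (vv p + of_nat K) \<le> real K / 4) \<and>
     (\<forall>\<zeta>. norm \<zeta> \<le> M \<longrightarrow> tgt K \<zeta> \<in> QQ K \<zeta> \<eta>0 \<and> cy (tgt K \<zeta>) = 0 \<and>
       norm (- 1 / (\<zeta> - of_nat K - q * Ln (of_nat K - \<zeta>))) \<le> \<delta> \<and>
       \<zeta> - of_nat K - q * Ln (of_nat K - \<zeta>) \<noteq> 0 \<and> 0 < Re (of_nat K - \<zeta>)) \<and>
     real K \<ge> R0 \<and> real K \<ge> R1 \<and> real K \<ge> 4 * norm q \<and> real K \<ge> 16 * (\<bar>M\<bar> + 2)"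
    unfolding eventually_sequentially by blast
  have near: "norm (vv p + of_nat K) \<le> real K / 4" if "K \<ge> Kmin" "norm \<zeta> \<le> M" "p \<in> QQ K \<zeta> 1" for K \<zeta> p
    using Kmin[OF that(1)] that by blast
  have tgtQ: "tgt K \<zeta> \<in> QQ K \<zeta> \<eta>0" "cy (tgt K \<zeta>) = 0"
     "norm (- 1 / (\<zeta> - of_nat K - q * Ln (of_nat K - \<zeta>))) \<le> \<delta>"
     "\<zeta> - of_nat K - q * Ln (of_nat K - \<zeta>) \<noteq> 0" "0 < Re (of_nat K - \<zeta>)" if "K \<ge> Kmin" "norm \<zeta> \<le> M" for K \<zeta>
    using Kmin[OF that(1)] that by blast+
  have KR: "real K \<ge> R0" "real K \<ge> R1" "real K \<ge> 4 * norm q" "real K \<ge> 16 * (\<bar>M\<bar> + 2)" if "K \<ge> Kmin" for K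
    using Kmin[OF that] by blast+
  have wK: "norm (wout p + of_nat K) \<le> real K0 / 16" if "K0 \<ge> Kmin" "norm \<zeta> \<le> M" "p \<in> QQ K \<zeta> \<eta>" "\<eta> \<le> 1" for p K K0 \<zeta> \<eta>
  proof -
    have p: "norm (wout p - (\<zeta> - of_nat K)) \<le> \<eta>" using that by (simp add: QQ_def)
    have "norm (wout p + of_nat K) \<le> \<eta> + M" by (rule norm_add_bound[OF _ p that(2)]) simp
    then show ?thesis using KR(4)[OF that(1)] that(4) by simp
  qed
  \<comment> \<open>192 = 32 * 6: \<open>QQ_close\<close> bounds the distance of two points by
    \<open>4 * \<eta> + 2 * \<eta>\<close>, and \<open>outgoing_lipschitz\<close> multiplies it by
    \<open>32 / \<delta>\<close>.\<close>
  have two: "(F 0 ^^ (K - K0)) p \<in> Box \<and> (F 0 ^^ (K - K0)) p' \<in> Box \<and>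
      norm (cx ((F 0 ^^ (K - K0)) p) - cx ((F 0 ^^ (K - K0)) p')) \<le> 192 / \<delta> * \<eta> \<and>
      norm (cy ((F 0 ^^ (K - K0)) p) - cy ((F 0 ^^ (K - K0)) p')) \<le> 192 / \<delta> * \<eta>"
    if K: "K0 \<ge> Kmin" "K \<ge> K0" and z: "norm \<zeta> \<le> M" and p: "p \<in> QQ K \<zeta> \<eta>" "p' \<in> QQ K \<zeta> \<eta>" and \<eta>: "\<eta> \<le> \<eta>0" for K K0 \<zeta> p p' \<eta>
  proof -
    have Kmin': "K \<ge> Kmin" using K by simp
    have K8: "K \<ge> 8" using KR(1)[OF Kmin'] R0 by linarith
    note c = QQ_close[OF p K8 KR(3)[OF Kmin']]
    have D: "norm (vv p - vv p') + norm (cy p - cy p') \<le> 6 * \<eta>" using c by simp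
    have e1: "\<eta> \<le> 1" "6 * \<eta> \<le> \<delta> / 16" "\<eta> \<le> \<delta> / 8" using \<eta> \<eta>0 \<delta> by (auto simp: \<eta>0_def)
    have p1: "p \<in> QQ K \<zeta> 1" using p e1 QQ_mono by blast
    have l: "(F 0 ^^ (K - K0)) p \<in> Box \<and> (F 0 ^^ (K - K0)) p' \<in> Box \<and>
      norm (cx ((F 0 ^^ (K - K0)) p) - cx ((F 0 ^^ (K - K0)) p')) \<le> 32 / \<delta> * (norm (vv p - vv p') + norm (cy p - cy p')) \<and>
      norm (cy ((F 0 ^^ (K - K0)) p) - cy ((F 0 ^^ (K - K0)) p')) \<le> 32 / \<delta> * (norm (vv p - vv p') + norm (cy p - cy p'))"
      by (rule lip[OF KR(2)[OF K(1)] K(2) _ _ near[OF Kmin' z p1] wK[OF K(1) z p(1) e1(1)]])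
         (use p D e1 in \<open>auto simp: QQ_def\<close>)
    have "32 / \<delta> * (norm (vv p - vv p') + norm (cy p - cy p')) \<le> 32 / \<delta> * (6 * \<eta>)"
      using D \<delta> by (intro mult_left_mono) auto
    also have "\<dots> = 192 / \<delta> * \<eta>" by simp
    finally show ?thesis using l by auto
  qed
  have outt: "(F 0 ^^ (K' - K)) (tgt K' \<zeta>) \<in> Box \<and> norm (vv ((F 0 ^^ (K' - K)) (tgt K' \<zeta>)) + of_nat K) \<le> real K / 2 \<and>
      norm (cy ((F 0 ^^ (K' - K)) (tgt K' \<zeta>))) \<le> C' / real K \<and>
      norm (wout ((F 0 ^^ (K' - K)) (tgt K' \<zeta>)) - (\<zeta> - of_nat K)) \<le> C' / real K + \<eta>"
    if K: "K \<ge> Kmin" "K' \<ge> K" and z: "norm \<zeta> \<le> M" and q: "tgt K' \<zeta> \<in> QQ K' \<zeta> \<eta>" for K K' \<zeta> \<eta>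
  proof -
    have K'm: "K' \<ge> Kmin" using K by simp
    note t = tgtQ[OF K'm z]
    have w: "norm (wout (tgt K' \<zeta>) + of_nat K') \<le> real K / 16"
      by (rule wK[OF K(1) z t(1)]) (use \<eta>0 in simp)
    have *: "K' - (K' - K) = K" using K by simp
    have o: "(F 0 ^^ (K' - K)) (tgt K' \<zeta>) \<in> Box \<and> norm (vv ((F 0 ^^ (K' - K)) (tgt K' \<zeta>)) + of_nat (K' - (K' - K))) \<le> real (K' - (K' - K)) / 2 \<and>
      norm (cy ((F 0 ^^ (K' - K)) (tgt K' \<zeta>))) \<le> lam ^ (K' - K) * norm (cy (tgt K' \<zeta>)) + C' / (real K)^2 \<and>
      norm (wout ((F 0 ^^ (K' - K)) (tgt K' \<zeta>)) - wout (tgt K' \<zeta>) - of_nat (K' - K)) \<le> C' * (norm (cy (tgt K' \<zeta>)) + 1 / real K)"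
      by (rule out[OF KR(1)[OF K(1)] K(2)]) (use t w \<delta> in \<open>auto simp: QQ_def\<close>)
    have K1: "real K \<ge> 1" using KR(1)[OF K(1)] R0 by simp
    have "C' / (real K)^2 \<le> C' / real K"
      using R0 K1 by (intro divide_left_mono) (auto simp: power2_eq_square)
    moreover have "norm (wout ((F 0 ^^ (K' - K)) (tgt K' \<zeta>)) - (\<zeta> - of_nat K)) \<le> C' / real K + \<eta>"
    proof (rule norm_add_bound)
      show "norm (wout ((F 0 ^^ (K' - K)) (tgt K' \<zeta>)) - wout (tgt K' \<zeta>) - of_nat (K' - K)) \<le> C' / real K"
        using o t(2) by simp
      show "norm (wout (tgt K' \<zeta>) - (\<zeta> - of_nat K')) \<le> \<eta>" using q by (simp add: QQ_def)
    qed (use K in \<open>simp add: of_nat_diff\<close>)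
    ultimately show ?thesis using o t(2) unfolding * by auto
  qed
  \<comment> \<open>For large K the defect of the target and the drift \<open>C' / K\<close> are
    each at most \<open>\<eta> / 2\<close>.\<close>
  have deep: "\<exists>K1\<ge>K0. \<forall>K\<ge>K1. \<forall>K'\<ge>K. \<forall>\<zeta>. norm \<zeta> \<le> M \<longrightarrow> (F 0 ^^ (K' - K)) (tgt K' \<zeta>) \<in> QQ K \<zeta> \<eta>"
    if K0: "K0 \<ge> Kmin" and \<eta>: "\<eta> > 0" for K0 \<eta>
  proof -
    have h2: "\<eta> / 2 > 0" using \<eta> by simp
    from tgt_eventually[OF h2, of M] obtain K2 where K2: "\<And>K \<zeta>. K \<ge> K2 \<Longrightarrow> norm \<zeta> \<le> M \<Longrightarrow> tgt K \<zeta> \<in> QQ K \<zeta> (\<eta> / 2)"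
      unfolding eventually_sequentially by blast
    define K1 where "K1 = max (max K0 K2) (nat \<lceil>2 * C' / \<eta>\<rceil> + 1)"
    show ?thesis
    proof (intro exI[of _ K1] conjI allI impI)
      fix K K' and \<zeta> :: complex assume K: "K1 \<le> K" "K \<le> K'" and z: "norm \<zeta> \<le> M"
      have "2 * C' / \<eta> \<le> real (nat \<lceil>2 * C' / \<eta>\<rceil>)" by (rule real_nat_ceiling_ge)
      also have "\<dots> \<le> real K" by (rule of_nat_mono) (use K in \<open>unfold K1_def, linarith\<close>)
      finally have "2 * C' / \<eta> \<le> real K" .
      then have "2 * C' \<le> \<eta> * real K" using \<eta> by (simp add: divide_le_eq mult.commute)
      moreover have "real K > 0" using K by (simp add: K1_def)
      ultimately have c: "C' / real K \<le> \<eta> / 2" by (simp add: divide_le_eq mult.commute)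
      have Km: "K \<ge> Kmin" "K' \<ge> K2" using K K0 by (auto simp: K1_def)
      have c2: "C' / real K \<le> \<eta>" "C' / real K + \<eta> / 2 \<le> \<eta>" using c \<eta> by linarith+
      from outt[OF Km(1) K(2) z K2[OF Km(2) z]] c2
      show "(F 0 ^^ (K' - K)) (tgt K' \<zeta>) \<in> QQ K \<zeta> \<eta>" unfolding QQ_def by (auto intro: order_trans)
    qed (simp add: K1_def)
  qed
  show ?thesis
  proof (rule that[of C' Kmin])
    show "C' \<ge> 0" by (rule R0)
    fix K0 assume K0: "K0 \<ge> Kmin"
    define g where "g = (\<lambda>K \<zeta>. (F 0 ^^ (K - K0)) (tgt K \<zeta>))"
    have gsplit: "g K' \<zeta> = (F 0 ^^ (K - K0)) ((F 0 ^^ (K' - K)) (tgt K' \<zeta>))" if "K0 \<le> K" "K \<le> K'" for K K' \<zeta>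
    proof -
      have "K' - K0 = (K - K0) + (K' - K)" using that by simp
      then show ?thesis by (simp only: g_def funpow_add comp_def)
    qed
    have cmp: "\<exists>K1\<ge>K0. \<forall>K\<ge>K1. \<forall>K'\<ge>K. \<forall>\<zeta> p. norm \<zeta> \<le> M \<longrightarrow> p \<in> QQ K \<zeta> \<eta> \<longrightarrow>
        (F 0 ^^ (K - K0)) p \<in> Box \<and> norm (cx ((F 0 ^^ (K - K0)) p) - cx (g K' \<zeta>)) \<le> 192 / \<delta> * \<eta> \<and>
        norm (cy ((F 0 ^^ (K - K0)) p) - cy (g K' \<zeta>)) \<le> 192 / \<delta> * \<eta>" if \<eta>: "\<eta> > 0" "\<eta> \<le> \<eta>0" for \<eta>
    proof -
      obtain K1 where K1: "K1 \<ge> K0" "\<And>K K' \<zeta>. K \<ge> K1 \<Longrightarrow> K' \<ge> K \<Longrightarrow> norm \<zeta> \<le> M \<Longrightarrow> (F 0 ^^ (K' - K)) (tgt K' \<zeta>) \<in> QQ K \<zeta> \<eta>"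
        using deep[OF K0 \<eta>(1)] by blast
      show ?thesis
      proof (intro exI[of _ K1] conjI K1(1) allI impI)
        fix K K' \<zeta> p assume K: "K1 \<le> K" "K \<le> K'" and z: "norm \<zeta> \<le> M" and p: "p \<in> QQ K \<zeta> \<eta>"
        have KK: "K \<ge> K0" using K K1 by simp
        from two[OF K0 KK z p K1(2)[OF K z] \<eta>(2)]
        show "(F 0 ^^ (K - K0)) p \<in> Box" "norm (cx ((F 0 ^^ (K - K0)) p) - cx (g K' \<zeta>)) \<le> 192 / \<delta> * \<eta>"
          "norm (cy ((F 0 ^^ (K - K0)) p) - cy (g K' \<zeta>)) \<le> 192 / \<delta> * \<eta>"
          unfolding gsplit[OF KK K(2)] by blast+
      qed
    qed
    have gg: "\<exists>K1\<ge>K0. \<forall>K\<ge>K1. \<forall>K'\<ge>K. \<forall>\<zeta>. norm \<zeta> \<le> M \<longrightarrow>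
        norm (cx (g K \<zeta>) - cx (g K' \<zeta>)) \<le> 192 / \<delta> * \<eta> \<and> norm (cy (g K \<zeta>) - cy (g K' \<zeta>)) \<le> 192 / \<delta> * \<eta>"
      if \<eta>: "\<eta> > 0" "\<eta> \<le> \<eta>0" for \<eta>
    proof -
      obtain K1 where K1: "K1 \<ge> K0" "\<And>K K' \<zeta> p. K \<ge> K1 \<Longrightarrow> K' \<ge> K \<Longrightarrow> norm \<zeta> \<le> M \<Longrightarrow> p \<in> QQ K \<zeta> \<eta> \<Longrightarrow>
        norm (cx ((F 0 ^^ (K - K0)) p) - cx (g K' \<zeta>)) \<le> 192 / \<delta> * \<eta> \<and>
        norm (cy ((F 0 ^^ (K - K0)) p) - cy (g K' \<zeta>)) \<le> 192 / \<delta> * \<eta>" using cmp[OF \<eta>] by blast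
      obtain K2 where K2: "K2 \<ge> K0" "\<And>K K' \<zeta>. K \<ge> K2 \<Longrightarrow> K' \<ge> K \<Longrightarrow> norm \<zeta> \<le> M \<Longrightarrow> (F 0 ^^ (K' - K)) (tgt K' \<zeta>) \<in> QQ K \<zeta> \<eta>"
        using deep[OF K0 \<eta>(1)] by blast
      show ?thesis
      proof (intro exI[of _ "max K1 K2"] conjI allI impI)
        fix K K' and \<zeta> :: complex assume K: "max K1 K2 \<le> K" "K \<le> K'" and z: "norm \<zeta> \<le> M"
        have "tgt K \<zeta> \<in> QQ K \<zeta> \<eta>" using K2(2)[of K K \<zeta>] K z by simp
        from K1(2)[OF _ K(2) z this] K
        show "norm (cx (g K \<zeta>) - cx (g K' \<zeta>)) \<le> 192 / \<delta> * \<eta>" "norm (cy (g K \<zeta>) - cy (g K' \<zeta>)) \<le> 192 / \<delta> * \<eta>"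
          by (auto simp: g_def)
      qed (use K1 in simp)
    qed
    have small: "\<exists>\<eta>. 0 < \<eta> \<and> \<eta> \<le> \<eta>0 \<and> 192 / \<delta> * \<eta> < e" if "e > 0" for e :: real
    proof (intro exI conjI)
      show "0 < min \<eta>0 (\<delta> * e / 384)" "min \<eta>0 (\<delta> * e / 384) \<le> \<eta>0" using \<eta>0 \<delta> that by auto
      have "192 / \<delta> * min \<eta>0 (\<delta> * e / 384) \<le> 192 / \<delta> * (\<delta> * e / 384)" using \<delta> by (intro mult_left_mono) auto
      also have "\<dots> < e" using \<delta> that by simp
      finally show "192 / \<delta> * min \<eta>0 (\<delta> * e / 384) < e" .
    qed
    have "uniformly_Cauchy_on (ball 0 M) (\<lambda>K \<zeta>. cx (g K \<zeta>))" "uniformly_Cauchy_on (ball 0 M) (\<lambda>K \<zeta>. cy (g K \<zeta>))"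
    proof -
      have cc: "\<exists>N. \<forall>\<zeta>\<in>ball 0 M. \<forall>m\<ge>N. \<forall>n\<ge>N. dist (cx (g m \<zeta>)) (cx (g n \<zeta>)) < e \<and> dist (cy (g m \<zeta>)) (cy (g n \<zeta>)) < e" if "e > 0" for e
      proof -
        obtain \<eta> where \<eta>: "0 < \<eta>" "\<eta> \<le> \<eta>0" "192 / \<delta> * \<eta> < e" using small[OF \<open>e > 0\<close>] by blast
        obtain K1 where K1: "\<And>K K' \<zeta>. K \<ge> K1 \<Longrightarrow> K' \<ge> K \<Longrightarrow> norm \<zeta> \<le> M \<Longrightarrow>
          norm (cx (g K \<zeta>) - cx (g K' \<zeta>)) \<le> 192 / \<delta> * \<eta> \<and> norm (cy (g K \<zeta>) - cy (g K' \<zeta>)) \<le> 192 / \<delta> * \<eta>"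
          using gg[OF \<eta>(1,2)] by blast
        show ?thesis
        proof (intro exI[of _ K1] ballI allI impI)
          fix \<zeta> :: complex and m n assume z: "\<zeta> \<in> ball 0 M" and mn: "K1 \<le> m" "K1 \<le> n"
          have z': "norm \<zeta> \<le> M" using z by simp
          show "dist (cx (g m \<zeta>)) (cx (g n \<zeta>)) < e \<and> dist (cy (g m \<zeta>)) (cy (g n \<zeta>)) < e"
          proof (cases "m \<le> n")
            case True
            from K1[OF mn(1) True z'] \<eta> show ?thesis by (simp add: dist_norm)
          next
            case False
            then have "n \<le> m" by simp
            from K1[OF mn(2) this z'] \<eta> show ?thesis by (simp add: dist_norm norm_minus_commute)
          qed
        qed
      qed
      show "uniformly_Cauchy_on (ball 0 M) (\<lambda>K \<zeta>. cx (g K \<zeta>))" "uniformly_Cauchy_on (ball 0 M) (\<lambda>K \<zeta>. cy (g K \<zeta>))"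
        unfolding uniformly_Cauchy_on_def using cc by (meson, meson)
    qed
    then obtain X Y where X: "uniform_limit (ball 0 M) (\<lambda>K \<zeta>. cx (g K \<zeta>)) X sequentially"
      and Y: "uniform_limit (ball 0 M) (\<lambda>K \<zeta>. cy (g K \<zeta>)) Y sequentially"
      unfolding uniformly_convergent_eq_Cauchy[symmetric] uniformly_convergent_on_def by blast
    have gK: "g K \<zeta> \<in> Box \<and> norm (vv (g K \<zeta>) + of_nat K0) \<le> real K0 / 2 \<and> norm (cy (g K \<zeta>)) \<le> C' / real K0"
      if "K \<ge> K0" "norm \<zeta> \<le> M" for K \<zeta>
    proof -
      have Km: "K \<ge> Kmin" using that K0 by simp
      from outt[OF K0 that tgtQ(1)[OF Km that(2)]] show ?thesis unfolding g_def by blast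
    qed
    have hol: "(\<lambda>\<zeta>. \<phi> (g K \<zeta>) $ i) holomorphic_on ball 0 M" if K: "K \<ge> K0" for K i
      unfolding g_def tgt_def
    proof (rule holomorphic_on_curve_emb[OF holo_self_map_funpow[OF surface holo_F0] _ _ _ _ _ _ chart])
      have Km: "K \<ge> Kmin" using K K0 by simp
      have t: "norm (- 1 / (\<zeta> - of_nat K - q * Ln (of_nat K - \<zeta>))) \<le> \<delta>"
        "\<zeta> - of_nat K - q * Ln (of_nat K - \<zeta>) \<noteq> 0" "0 < Re (of_nat K - \<zeta>)" if "\<zeta> \<in> ball 0 M" for \<zeta> :: complex
        using tgtQ(3-5)[OF Km, of \<zeta>] that by auto
      have nr: "of_nat K - \<zeta> \<notin> \<real>\<^sub>\<le>\<^sub>0" if "\<zeta> \<in> ball 0 M" for \<zeta> :: complex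
        using t(3)[OF that] by (auto simp: complex_nonpos_Reals_iff)
      show "(\<lambda>\<zeta>. - 1 / (\<zeta> - of_nat K - q * Ln (of_nat K - \<zeta>))) holomorphic_on ball 0 M"
        by (intro holomorphic_intros) (use nr t(2) in auto)
      show "norm (- 1 / (\<zeta> - of_nat K - q * Ln (of_nat K - \<zeta>))) \<le> \<delta>" if "\<zeta> \<in> ball 0 M" for \<zeta> by (rule t(1)[OF that])
      show "(F 0 ^^ (K - K0)) (emb (- 1 / (\<zeta> - of_nat K - q * Ln (of_nat K - \<zeta>))) 0) \<in> U" if "\<zeta> \<in> ball 0 M" for \<zeta> :: complex
        using gK[OF K, of \<zeta>] that BoxD(1) unfolding g_def tgt_def by simp
    qed (use \<delta> in auto)
    have limhol: "Z holomorphic_on ball 0 M" if Z: "uniform_limit (ball 0 M) (\<lambda>K \<zeta>. \<phi> (g K \<zeta>) $ i) Z sequentially" for Z i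
    proof (rule holomorphic_uniform_sequence[where f = "\<lambda>n \<zeta>. \<phi> (g (n + K0) \<zeta>) $ i"])
      show "(\<lambda>\<zeta>. \<phi> (g (n + K0) \<zeta>) $ i) holomorphic_on ball 0 M" for n by (rule hol) simp
      fix x :: complex assume "x \<in> ball 0 M"
      then obtain d where d: "d > 0" "cball x d \<subseteq> ball 0 M" using open_contains_cball_eq[OF open_ball] by blast
      have "uniform_limit (ball 0 M) (\<lambda>n \<zeta>. \<phi> (g (n + K0) \<zeta>) $ i) Z sequentially"
        using filterlim_compose[OF Z filterlim_add_const_nat_at_top[of K0]] by simp
      then show "\<exists>d>0. cball x d \<subseteq> ball 0 M \<and> uniform_limit (cball x d) (\<lambda>n \<zeta>. \<phi> (g (n + K0) \<zeta>) $ i) Z sequentially"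
        using d uniform_limit_on_subset by blast
    qed simp
    have Xh: "X holomorphic_on ball 0 M" using X limhol[of 1 X] by (simp add: cx_def)
    have Yh: "Y holomorphic_on ball 0 M" using Y limhol[of 2 Y] by (simp add: cy_def)
    have Xl: "(\<lambda>K. cx (g K \<zeta>)) \<longlonglongrightarrow> X \<zeta>" and Yl: "(\<lambda>K. cy (g K \<zeta>)) \<longlonglongrightarrow> Y \<zeta>" if "\<zeta> \<in> ball 0 M" for \<zeta> :: complex
      using tendsto_uniform_limitI[OF X that] tendsto_uniform_limitI[OF Y that] by auto
    have pt: "norm (X \<zeta>) \<le> \<delta> \<and> norm (Y \<zeta>) \<le> \<delta> \<and> emb (X \<zeta>) (Y \<zeta>) \<in> QQ K0 \<zeta> (C' / real K0) \<and>
         (\<lambda>K. (F 0 ^^ K) (tgt K \<zeta>)) \<longlonglongrightarrow> (F 0 ^^ K0) (emb (X \<zeta>) (Y \<zeta>))" if z: "\<zeta> \<in> ball 0 M" for \<zeta> :: complex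
    proof -
      have z': "norm \<zeta> \<le> M" using z by simp
      note gz = gK[OF _ z'] and xl = Xl[OF z] and yl = Yl[OF z]
      have K08: "K0 \<ge> 8" using KR(1)[OF K0] R0 by linarith
      have nX: "norm (X \<zeta>) \<le> \<delta>"
        by (rule LIMSEQ_le_const2[OF tendsto_norm[OF xl]]) (use gz BoxD(2) in blast)
      have nY: "norm (Y \<zeta>) \<le> \<delta>"
        by (rule LIMSEQ_le_const2[OF tendsto_norm[OF yl]]) (use gz BoxD(3) in blast)
      have nY': "norm (Y \<zeta>) \<le> C' / real K0"
        by (rule LIMSEQ_le_const2[OF tendsto_norm[OF yl]]) (use gz in blast)
      \<comment> \<open>A lower bound passes to the limit and keeps \<open>X \<zeta>\<close> away
        from 0, so that \<open>vv\<close> and \<open>wout\<close> converge too.\<close>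
      have lowx: "norm (cx (g K \<zeta>)) \<ge> 1 / (2 * real K0)" if K: "K \<ge> K0" for K
      proof -
        have v: "norm (vv (g K \<zeta>) + of_nat K0) \<le> real K0 / 2" using gz[OF K] by blast
        have v0: "vv (g K \<zeta>) \<noteq> 0" using left_half_ball(1)[OF v K08] by auto
        have "norm (vv (g K \<zeta>)) \<le> real K0 / 2 + real K0" by (rule norm_diff_bound[OF _ v, of _ "of_nat K0"]) auto
        then have "norm (vv (g K \<zeta>)) \<le> 2 * real K0" by simp
        moreover have "norm (vv (g K \<zeta>)) = 1 / norm (cx (g K \<zeta>))" by (simp add: vv_def norm_divide)
        moreover have "norm (cx (g K \<zeta>)) > 0" using v0 by (auto simp: vv_def)
        ultimately show ?thesis using K08 by (simp add: field_simps)
      qed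
      have "1 / (2 * real K0) \<le> norm (X \<zeta>)"
        by (rule LIMSEQ_le_const[OF tendsto_norm[OF xl]]) (use lowx in blast)
      moreover have "1 / (2 * real K0) > 0" using K08 by simp
      ultimately have X0: "X \<zeta> \<noteq> 0" by auto
      note e = emb_box[OF nX nY]
      have vl: "(\<lambda>K. vv (g K \<zeta>)) \<longlonglongrightarrow> vv (emb (X \<zeta>) (Y \<zeta>))"
        unfolding vv_def e by (intro tendsto_intros xl X0)
      have vE: "norm (vv (emb (X \<zeta>) (Y \<zeta>)) + of_nat K0) \<le> real K0 / 2"
        by (rule LIMSEQ_le_const2[OF tendsto_norm[OF tendsto_add[OF vl tendsto_const]]]) (use gz in blast)
      note hE = left_half_ball[OF vE K08]
      have wl: "(\<lambda>K. wout (g K \<zeta>)) \<longlonglongrightarrow> wout (emb (X \<zeta>) (Y \<zeta>))"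
      proof -
        have "Re (cx (emb (X \<zeta>) (Y \<zeta>))) > 0" by (rule Re_cx_pos_if_Re_vv_neg[OF hE(1)])
        then have "X \<zeta> \<notin> \<real>\<^sub>\<le>\<^sub>0" by (auto simp: e complex_nonpos_Reals_iff)
        then have "(\<lambda>K. - 1 / cx (g K \<zeta>) - q * Ln (cx (g K \<zeta>))) \<longlonglongrightarrow> - 1 / X \<zeta> - q * Ln (X \<zeta>)"
          by (intro tendsto_intros xl X0)
        then show ?thesis using e by (simp add: wout_def w_out_def cx_def)
      qed
      have wE: "norm (wout (emb (X \<zeta>) (Y \<zeta>)) - (\<zeta> - of_nat K0)) \<le> C' / real K0"
      proof (rule field_le_epsilon)
        fix \<eta> :: real assume \<eta>: "0 < \<eta>"
        obtain K2 where K2: "\<And>K. K \<ge> K2 \<Longrightarrow> tgt K \<zeta> \<in> QQ K \<zeta> \<eta>"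
          using tgt_eventually[OF \<eta>, of M] z' unfolding eventually_sequentially by blast
        show "norm (wout (emb (X \<zeta>) (Y \<zeta>)) - (\<zeta> - of_nat K0)) \<le> C' / real K0 + \<eta>"
        proof (rule LIMSEQ_le_const2[OF tendsto_norm[OF tendsto_diff[OF wl tendsto_const]]], intro exI[of _ "max K0 K2"] allI impI)
          fix K assume "max K0 K2 \<le> K"
          then show "norm (wout (g K \<zeta>) - (\<zeta> - of_nat K0)) \<le> C' / real K0 + \<eta>"
            using outt[OF K0 _ z' K2, of K] by (simp add: g_def)
        qed
      qed
      have gl: "(\<lambda>K. (F 0 ^^ K0) (g K \<zeta>)) \<longlonglongrightarrow> (F 0 ^^ K0) (emb (X \<zeta>) (Y \<zeta>))"
      proof -
        have c: "continuous_on (cball 0 \<delta> \<times> cball 0 \<delta>) (\<lambda>w. (F 0 ^^ K0) (emb (fst w) (snd w)))"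
          by (rule continuous_on_compose2[OF continuous_F0_funpow]) (use continuous_emb in \<open>auto simp: case_prod_unfold\<close>)
        have l: "(\<lambda>K. (cx (g (K + K0) \<zeta>), cy (g (K + K0) \<zeta>))) \<longlonglongrightarrow> (X \<zeta>, Y \<zeta>)"
          by (intro tendsto_Pair LIMSEQ_ignore_initial_segment xl yl)
        have "(\<lambda>K. (\<lambda>w. (F 0 ^^ K0) (emb (fst w) (snd w))) (cx (g (K + K0) \<zeta>), cy (g (K + K0) \<zeta>)))
            \<longlonglongrightarrow> (\<lambda>w. (F 0 ^^ K0) (emb (fst w) (snd w))) (X \<zeta>, Y \<zeta>)"
          by (rule continuous_on_tendsto_compose[OF c l]) (use nX nY gz BoxD(2,3) in auto)
        then have "(\<lambda>K. (F 0 ^^ K0) (emb (cx (g (K + K0) \<zeta>)) (cy (g (K + K0) \<zeta>)))) \<longlonglongrightarrow> (F 0 ^^ K0) (emb (X \<zeta>) (Y \<zeta>))"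
          by simp
        moreover have "emb (cx (g (K + K0) \<zeta>)) (cy (g (K + K0) \<zeta>)) = g (K + K0) \<zeta>" for K
          by (rule emb_cx_cy) (use gz BoxD(1) in simp)
        ultimately show ?thesis by (simp add: LIMSEQ_offset[where k = K0])
      qed
      have "(\<lambda>K. (F 0 ^^ K) (tgt K \<zeta>)) \<longlonglongrightarrow> (F 0 ^^ K0) (emb (X \<zeta>) (Y \<zeta>))"
      proof (rule Lim_transform_eventually[OF gl])
        show "\<forall>\<^sub>F K in sequentially. (F 0 ^^ K0) (g K \<zeta>) = (F 0 ^^ K) (tgt K \<zeta>)"
          unfolding eventually_sequentially
        proof (intro exI[of _ K0] allI impI)
          fix K assume "K0 \<le> K"
          then have "(F 0 ^^ K) (tgt K \<zeta>) = (F 0 ^^ (K0 + (K - K0))) (tgt K \<zeta>)" by simp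
          then show "(F 0 ^^ K0) (g K \<zeta>) = (F 0 ^^ K) (tgt K \<zeta>)" by (simp only: funpow_add comp_def g_def)
        qed
      qed
      then show ?thesis using nX nY nY' e vE wE by (simp add: QQ_def)
    qed
    have cc: "\<exists>K1\<ge>K0. \<forall>K\<ge>K1. \<forall>\<zeta>\<in>ball 0 M. \<forall>p\<in>QQ K \<zeta> \<eta>.
         (F 0 ^^ (K - K0)) p \<in> Box \<and> norm (cx ((F 0 ^^ (K - K0)) p) - X \<zeta>) \<le> 192 / \<delta> * \<eta> \<and>
         norm (cy ((F 0 ^^ (K - K0)) p) - Y \<zeta>) \<le> 192 / \<delta> * \<eta>" if \<eta>: "0 < \<eta>" "\<eta> \<le> \<delta> / 128" for \<eta>
    proof -
      obtain K1 where K1: "K1 \<ge> K0" "\<And>K K' \<zeta> p. K \<ge> K1 \<Longrightarrow> K' \<ge> K \<Longrightarrow> norm \<zeta> \<le> M \<Longrightarrow> p \<in> QQ K \<zeta> \<eta> \<Longrightarrow>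
        (F 0 ^^ (K - K0)) p \<in> Box \<and> norm (cx ((F 0 ^^ (K - K0)) p) - cx (g K' \<zeta>)) \<le> 192 / \<delta> * \<eta> \<and>
        norm (cy ((F 0 ^^ (K - K0)) p) - cy (g K' \<zeta>)) \<le> 192 / \<delta> * \<eta>" using cmp[of \<eta>] \<eta> unfolding \<eta>0_def by blast
      show ?thesis
      proof (intro exI[of _ K1] conjI K1(1) allI impI ballI)
        fix K \<zeta> p assume K: "K1 \<le> K" and z: "\<zeta> \<in> ball 0 M" and p: "p \<in> QQ K \<zeta> \<eta>"
        have z': "norm \<zeta> \<le> M" using z by simp
        show "(F 0 ^^ (K - K0)) p \<in> Box" using K1(2)[OF K order_refl z' p] by blast
        show "norm (cx ((F 0 ^^ (K - K0)) p) - X \<zeta>) \<le> 192 / \<delta> * \<eta>"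
          by (rule LIMSEQ_le_const2[OF tendsto_norm[OF tendsto_diff[OF tendsto_const Xl[OF z]]]])
             (use K1(2)[OF K _ z' p] in blast)
        show "norm (cy ((F 0 ^^ (K - K0)) p) - Y \<zeta>) \<le> 192 / \<delta> * \<eta>"
          by (rule LIMSEQ_le_const2[OF tendsto_norm[OF tendsto_diff[OF tendsto_const Yl[OF z]]]])
             (use K1(2)[OF K _ z' p] in blast)
      qed
    qed
    show "\<exists>X Y. X holomorphic_on ball 0 M \<and> Y holomorphic_on ball 0 M \<and>
      (\<forall>\<zeta>\<in>ball 0 M. norm (X \<zeta>) \<le> \<delta> \<and> norm (Y \<zeta>) \<le> \<delta> \<and> emb (X \<zeta>) (Y \<zeta>) \<in> QQ K0 \<zeta> (C' / real K0) \<and>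
         (\<lambda>K. (F 0 ^^ K) (tgt K \<zeta>)) \<longlonglongrightarrow> (F 0 ^^ K0) (emb (X \<zeta>) (Y \<zeta>))) \<and>
      (\<forall>\<eta>. 0 < \<eta> \<and> \<eta> \<le> \<delta> / 128 \<longrightarrow> (\<exists>K1\<ge>K0. \<forall>K\<ge>K1. \<forall>\<zeta>\<in>ball 0 M. \<forall>p\<in>QQ K \<zeta> \<eta>.
         (F 0 ^^ (K - K0)) p \<in> Box \<and> norm (cx ((F 0 ^^ (K - K0)) p) - X \<zeta>) \<le> 192 / \<delta> * \<eta> \<and>
         norm (cy ((F 0 ^^ (K - K0)) p) - Y \<zeta>) \<le> 192 / \<delta> * \<eta>))"
      using Xh Yh pt cc by blast
  qed
qed

text \<open>Defined as a limit because surjectivity of the outgoing Fatou coordinate is deduced from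
  it.\<close>

definition Psi :: "complex \<Rightarrow> 'a" where "Psi \<zeta> = lim (\<lambda>K. (F 0 ^^ K) (tgt K \<zeta>))"

text \<open>\<open>Psi \<zeta>\<close> may lie outside the chart, so X and Y are the coordinates of
  its K0-th preimage. The last clause covers all points of \<open>QQ\<close>, which makes other
  orbits comparable with \<open>Psi\<close>.\<close>

definition Psi_coords :: "real \<Rightarrow> real \<Rightarrow> nat \<Rightarrow> (complex \<Rightarrow> complex) \<Rightarrow> (complex \<Rightarrow> complex) \<Rightarrow> bool" where
  "Psi_coords M E K0 X Y \<longleftrightarrow> X holomorphic_on ball 0 M \<and> Y holomorphic_on ball 0 M \<and>
    (\<forall>\<zeta>\<in>ball 0 M. norm (X \<zeta>) \<le> \<delta> \<and> norm (Y \<zeta>) \<le> \<delta> \<and> emb (X \<zeta>) (Y \<zeta>) \<in> QQ K0 \<zeta> (E / real K0) \<and>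
      (inv (F 0) ^^ K0) (Psi \<zeta>) = emb (X \<zeta>) (Y \<zeta>)) \<and>
    (\<forall>\<eta>. 0 < \<eta> \<and> \<eta> \<le> \<delta> / 128 \<longrightarrow> (\<exists>K1\<ge>K0. \<forall>K\<ge>K1. \<forall>\<zeta>\<in>ball 0 M. \<forall>p\<in>QQ K \<zeta> \<eta>.
       (F 0 ^^ (K - K0)) p \<in> Box \<and> norm (cx ((F 0 ^^ (K - K0)) p) - X \<zeta>) \<le> 192 / \<delta> * \<eta> \<and>
       norm (cy ((F 0 ^^ (K - K0)) p) - Y \<zeta>) \<le> 192 / \<delta> * \<eta>))"

lemma Psi_coordsD:
  assumes "Psi_coords M E K0 X Y"
  shows "X holomorphic_on ball 0 M" "Y holomorphic_on ball 0 M"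
    and "\<And>\<zeta>. \<zeta> \<in> ball 0 M \<Longrightarrow> norm (X \<zeta>) \<le> \<delta>" "\<And>\<zeta>. \<zeta> \<in> ball 0 M \<Longrightarrow> norm (Y \<zeta>) \<le> \<delta>"
    and "\<And>\<zeta>. \<zeta> \<in> ball 0 M \<Longrightarrow> emb (X \<zeta>) (Y \<zeta>) \<in> QQ K0 \<zeta> (E / real K0)"
    and "\<And>\<zeta>. \<zeta> \<in> ball 0 M \<Longrightarrow> (inv (F 0) ^^ K0) (Psi \<zeta>) = emb (X \<zeta>) (Y \<zeta>)"
    and "\<And>\<zeta>. \<zeta> \<in> ball 0 M \<Longrightarrow> Psi \<zeta> = (F 0 ^^ K0) (emb (X \<zeta>) (Y \<zeta>))"
proof -
  show *: "(inv (F 0) ^^ K0) (Psi \<zeta>) = emb (X \<zeta>) (Y \<zeta>)" if "\<zeta> \<in> ball 0 M" for \<zeta>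
    using assms that unfolding Psi_coords_def by blast
  show "Psi \<zeta> = (F 0 ^^ K0) (emb (X \<zeta>) (Y \<zeta>))" if "\<zeta> \<in> ball 0 M" for \<zeta>
    unfolding *[OF that, symmetric] by simp
qed (use assms in \<open>unfold Psi_coords_def, blast+\<close>)

lemma Psi_coords_near:
  assumes "Psi_coords M E K0 X Y" "0 < \<eta>" "\<eta> \<le> \<delta> / 128" "\<zeta> \<in> ball 0 M"
  obtains K1 where "K1 \<ge> K0" "\<And>K p. K \<ge> K1 \<Longrightarrow> p \<in> QQ K \<zeta> \<eta> \<Longrightarrow>
       (F 0 ^^ (K - K0)) p \<in> Box \<and> norm (cx ((F 0 ^^ (K - K0)) p) - X \<zeta>) \<le> 192 / \<delta> * \<eta> \<and>
       norm (cy ((F 0 ^^ (K - K0)) p) - Y \<zeta>) \<le> 192 / \<delta> * \<eta>"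
proof -
  have "\<exists>K1\<ge>K0. \<forall>K\<ge>K1. \<forall>\<zeta>\<in>ball 0 M. \<forall>p\<in>QQ K \<zeta> \<eta>.
       (F 0 ^^ (K - K0)) p \<in> Box \<and> norm (cx ((F 0 ^^ (K - K0)) p) - X \<zeta>) \<le> 192 / \<delta> * \<eta> \<and>
       norm (cy ((F 0 ^^ (K - K0)) p) - Y \<zeta>) \<le> 192 / \<delta> * \<eta>"
    using assms(1-3) unfolding Psi_coords_def by simp
  then obtain K1 where "K1 \<ge> K0" "\<And>K \<zeta> p. K \<ge> K1 \<Longrightarrow> \<zeta> \<in> ball 0 M \<Longrightarrow> p \<in> QQ K \<zeta> \<eta> \<Longrightarrow>
       (F 0 ^^ (K - K0)) p \<in> Box \<and> norm (cx ((F 0 ^^ (K - K0)) p) - X \<zeta>) \<le> 192 / \<delta> * \<eta> \<and>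
       norm (cy ((F 0 ^^ (K - K0)) p) - Y \<zeta>) \<le> 192 / \<delta> * \<eta>" by blast
  with that[of K1] assms(4) show thesis by simp
qed

lemma Psi_local:
  obtains Kmin E where "E \<ge> 0" "\<And>K0. K0 \<ge> Kmin \<Longrightarrow> \<exists>X Y. Psi_coords M E K0 X Y"
proof (rule outgoing_limit[of M])
  fix E Kmin
  assume E: "0 \<le> E" and *: "\<And>K0. K0 \<ge> Kmin \<Longrightarrow> \<exists>X Y. X holomorphic_on ball 0 M \<and> Y holomorphic_on ball 0 M \<and>
      (\<forall>\<zeta>\<in>ball 0 M. norm (X \<zeta>) \<le> \<delta> \<and> norm (Y \<zeta>) \<le> \<delta> \<and> emb (X \<zeta>) (Y \<zeta>) \<in> QQ K0 \<zeta> (E / real K0) \<and>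
         (\<lambda>K. (F 0 ^^ K) (tgt K \<zeta>)) \<longlonglongrightarrow> (F 0 ^^ K0) (emb (X \<zeta>) (Y \<zeta>))) \<and>
      (\<forall>\<eta>. 0 < \<eta> \<and> \<eta> \<le> \<delta> / 128 \<longrightarrow> (\<exists>K1\<ge>K0. \<forall>K\<ge>K1. \<forall>\<zeta>\<in>ball 0 M. \<forall>p\<in>QQ K \<zeta> \<eta>.
         (F 0 ^^ (K - K0)) p \<in> Box \<and> norm (cx ((F 0 ^^ (K - K0)) p) - X \<zeta>) \<le> 192 / \<delta> * \<eta> \<and>
         norm (cy ((F 0 ^^ (K - K0)) p) - Y \<zeta>) \<le> 192 / \<delta> * \<eta>))"
  show thesis
  proof (rule that[of E Kmin, OF E])
    fix K0 assume "K0 \<ge> Kmin"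
    from *[OF this] obtain X Y where XY: "X holomorphic_on ball 0 M" "Y holomorphic_on ball 0 M"
      "\<forall>\<zeta>\<in>ball 0 M. norm (X \<zeta>) \<le> \<delta> \<and> norm (Y \<zeta>) \<le> \<delta> \<and> emb (X \<zeta>) (Y \<zeta>) \<in> QQ K0 \<zeta> (E / real K0) \<and>
         (\<lambda>K. (F 0 ^^ K) (tgt K \<zeta>)) \<longlonglongrightarrow> (F 0 ^^ K0) (emb (X \<zeta>) (Y \<zeta>))"
      "\<forall>\<eta>. 0 < \<eta> \<and> \<eta> \<le> \<delta> / 128 \<longrightarrow> (\<exists>K1\<ge>K0. \<forall>K\<ge>K1. \<forall>\<zeta>\<in>ball 0 M. \<forall>p\<in>QQ K \<zeta> \<eta>.
         (F 0 ^^ (K - K0)) p \<in> Box \<and> norm (cx ((F 0 ^^ (K - K0)) p) - X \<zeta>) \<le> 192 / \<delta> * \<eta> \<and>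
         norm (cy ((F 0 ^^ (K - K0)) p) - Y \<zeta>) \<le> 192 / \<delta> * \<eta>)"
      by (elim exE conjE) (rule that)
    have P: "Psi \<zeta> = (F 0 ^^ K0) (emb (X \<zeta>) (Y \<zeta>))" if "\<zeta> \<in> ball 0 M" for \<zeta>
      unfolding Psi_def by (rule limI) (use XY(3) that in blast)
    have "(inv (F 0) ^^ K0) (Psi \<zeta>) = emb (X \<zeta>) (Y \<zeta>)" if "\<zeta> \<in> ball 0 M" for \<zeta>
      unfolding P[OF that] by simp
    with XY(3) have "\<forall>\<zeta>\<in>ball 0 M. norm (X \<zeta>) \<le> \<delta> \<and> norm (Y \<zeta>) \<le> \<delta> \<and> emb (X \<zeta>) (Y \<zeta>) \<in> QQ K0 \<zeta> (E / real K0) \<and>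
        (inv (F 0) ^^ K0) (Psi \<zeta>) = emb (X \<zeta>) (Y \<zeta>)" by blast
    then have "Psi_coords M E K0 X Y"
      unfolding Psi_coords_def by (intro conjI XY(1,2,4))
    then show "\<exists>X Y. Psi_coords M E K0 X Y" by blast
  qed
qed

lemma Psi_backward_orbit:
  obtains Kmin E where "E \<ge> 0" "\<And>K. K \<ge> Kmin \<Longrightarrow> (inv (F 0) ^^ K) (Psi \<zeta>) \<in> QQ K \<zeta> (E / real K)"
proof -
  obtain Kmin E where E: "E \<ge> 0" "\<And>K0. K0 \<ge> Kmin \<Longrightarrow> \<exists>X Y. Psi_coords (norm \<zeta> + 1) E K0 X Y"
    by (rule Psi_local) (rule that)
  have z: "\<zeta> \<in> ball 0 (norm \<zeta> + 1)" by simp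
  show thesis
  proof (rule that[of E Kmin, OF E(1)])
    fix K assume "K \<ge> Kmin"
    from E(2)[OF this] obtain X Y where XY: "Psi_coords (norm \<zeta> + 1) E K X Y" by blast
    show "(inv (F 0) ^^ K) (Psi \<zeta>) \<in> QQ K \<zeta> (E / real K)"
      unfolding Psi_coordsD(6)[OF XY z] by (rule Psi_coordsD(5)[OF XY z])
  qed
qed

lemma const_over_n_tendsto_0: "(\<lambda>n. x / real n) \<longlonglongrightarrow> 0"
  using tendsto_mult_left[OF lim_1_over_n, of x] by simp

text \<open>The backward iterates of \<open>Psi \<zeta>\<close> lie in
  \<open>QQ K \<zeta> (E / K)\<close>, which sends x and y to 0 and \<open>wout + K\<close> to
  \<open>\<zeta>\<close>.\<close>

lemma Psi_in_asymptotic_curve: "Psi \<zeta> \<in> asymptotic_curve (F 0) p0"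
  and fatou_out_Psi: "fatou_out (F 0) \<phi> q (Psi \<zeta>) = \<zeta>"
proof -
  obtain Kmin E where E: "E \<ge> 0" "\<And>K. K \<ge> Kmin \<Longrightarrow> (inv (F 0) ^^ K) (Psi \<zeta>) \<in> QQ K \<zeta> (E / real K)"
    using Psi_backward_orbit by blast
  define P where "P = (\<lambda>n. (inv (F 0) ^^ n) (Psi \<zeta>))"
  have QP: "P n \<in> Box" "norm (vv (P n) + of_nat n) \<le> real n / 2" "norm (wout (P n) - (\<zeta> - of_nat n)) \<le> E / real n"
    "norm (cy (P n)) \<le> E / real n" if "n \<ge> Kmin" for n
    using E(2)[OF that] by (auto simp: QQ_def P_def)
  have cxP: "cx (P n) \<noteq> 0 \<and> norm (cx (P n)) \<le> 2 / real n" if "n \<ge> Kmin" "n \<ge> 8" for n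
  proof -
    have "norm (vv (P n)) \<ge> real n / 2" by (rule left_half_ball(2)[OF QP(2)[OF that(1)] that(2)])
    from cx_if_vv[OF _ this] that show ?thesis by simp
  qed
  have "P \<longlonglongrightarrow> p0"
  proof (rule topological_tendstoI)
    fix V assume V: "open V" "p0 \<in> V"
    obtain e where e: "0 < e" "e \<le> \<delta>" "\<And>p. p \<in> U \<Longrightarrow> norm (cx p) < e \<Longrightarrow> norm (cy p) < e \<Longrightarrow> p \<in> V"
      using p0_neighbourhood[OF V] by metis
    have "\<forall>\<^sub>F n in sequentially. 2 / real n < e" "\<forall>\<^sub>F n in sequentially. E / real n < e"
      using order_tendstoD(2)[OF const_over_n_tendsto_0 e(1)] by auto
    with eventually_ge_at_top[of "max Kmin 8"] show "\<forall>\<^sub>F n in sequentially. P n \<in> V"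
    proof eventually_elim
      case (elim n)
      then have n: "n \<ge> Kmin" "n \<ge> 8" by auto
      show ?case by (rule e(3)) (use elim cxP[OF n] QP[OF n(1)] BoxD(1) in auto)
    qed
  qed
  moreover have "Psi \<zeta> \<noteq> p0"
  proof
    assume "Psi \<zeta> = p0"
    define n where "n = max Kmin 8"
    have "P n = (inv (F 0) ^^ n) ((F 0 ^^ n) p0)" unfolding P_def \<open>Psi \<zeta> = p0\<close> fixed_funpow ..
    then have "P n = p0" unfolding funpow_inv_F0 .
    then show False using cxP[of n] by (simp add: n_def)
  qed
  ultimately show "Psi \<zeta> \<in> asymptotic_curve (F 0) p0" by (simp add: asymptotic_curve_def P_def[symmetric])
  have "(\<lambda>n. (wout (P n) + of_nat n) - \<zeta>) \<longlonglongrightarrow> 0"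
  proof (rule Lim_null_comparison[OF _ const_over_n_tendsto_0[of E]])
    show "\<forall>\<^sub>F n in sequentially. norm ((wout (P n) + of_nat n) - \<zeta>) \<le> E / real n"
      unfolding eventually_sequentially
    proof (intro exI[of _ Kmin] allI impI)
      fix n assume "Kmin \<le> n"
      have e: "(wout (P n) + of_nat n) - \<zeta> = wout (P n) - (\<zeta> - of_nat n)" by simp
      show "norm ((wout (P n) + of_nat n) - \<zeta>) \<le> E / real n" unfolding e by (rule QP(3)[OF \<open>Kmin \<le> n\<close>])
    qed
  qed
  then have "(\<lambda>n. wout (P n) + of_nat n) \<longlonglongrightarrow> \<zeta>" by (simp add: LIM_zero_iff)
  then show "fatou_out (F 0) \<phi> q (Psi \<zeta>) = \<zeta>"
    by (simp add: fatou_out_def P_def wout_def limI)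
qed

lemma continuous_F0_emb: "continuous_on (cball 0 \<delta> \<times> cball 0 \<delta>) (\<lambda>w. (F 0 ^^ n) (emb (fst w) (snd w)))"
  by (rule continuous_on_compose2[OF continuous_F0_funpow]) (use continuous_emb in \<open>auto simp: case_prod_unfold\<close>)

lemma QQ_iterates_near_Psi:
  assumes V: "open V" "Psi \<zeta> \<in> V"
  obtains \<eta> K1 where "\<eta> > 0" "\<And>K p. K \<ge> K1 \<Longrightarrow> p \<in> QQ K \<zeta> \<eta> \<Longrightarrow> (F 0 ^^ K) p \<in> V"
proof -
  obtain Kmin E where E: "E \<ge> 0" "\<And>K0. K0 \<ge> Kmin \<Longrightarrow> \<exists>X Y. Psi_coords (norm \<zeta> + 1) E K0 X Y"
    by (rule Psi_local) (rule that)
  have z: "\<zeta> \<in> ball 0 (norm \<zeta> + 1)" by simp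
  obtain X Y where XY: "Psi_coords (norm \<zeta> + 1) E Kmin X Y" using E(2)[OF order_refl] by blast
  note nX = Psi_coordsD(3)[OF XY z] and nY = Psi_coordsD(4)[OF XY z]
  have "(F 0 ^^ Kmin) (emb (fst (X \<zeta>, Y \<zeta>)) (snd (X \<zeta>, Y \<zeta>))) \<in> V"
    using V Psi_coordsD(7)[OF XY z] by simp
  moreover have "(X \<zeta>, Y \<zeta>) \<in> cball 0 \<delta> \<times> cball 0 \<delta>" using nX nY by simp
  ultimately have "\<exists>T. open T \<and> (X \<zeta>, Y \<zeta>) \<in> T \<and> (\<forall>w\<in>cball 0 \<delta> \<times> cball 0 \<delta>. w \<in> T \<longrightarrow> (F 0 ^^ Kmin) (emb (fst w) (snd w)) \<in> V)"
    using continuous_F0_emb[of Kmin] V(1) unfolding continuous_on_topological by blast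
  then obtain T where T: "open T" "(X \<zeta>, Y \<zeta>) \<in> T"
    "\<And>x y. norm x \<le> \<delta> \<Longrightarrow> norm y \<le> \<delta> \<Longrightarrow> (x, y) \<in> T \<Longrightarrow> (F 0 ^^ Kmin) (emb x y) \<in> V" by auto
  obtain e where e: "e > 0" "ball (X \<zeta>, Y \<zeta>) e \<subseteq> T" using T open_contains_ball_eq by blast
  \<comment> \<open>Two coordinate errors of at most \<open>192/1000 * e\<close> add up to less than
    e.\<close>
  define \<eta> where "\<eta> = min (\<delta> / 128) (e * \<delta> / 1000)"
  have \<eta>: "\<eta> > 0" "\<eta> \<le> \<delta> / 128" using e \<delta> by (auto simp: \<eta>_def)
  have "192 / \<delta> * \<eta> \<le> 192 / \<delta> * (e * \<delta> / 1000)" using \<delta> by (intro mult_left_mono) (auto simp: \<eta>_def)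
  then have \<eta>e: "192 / \<delta> * \<eta> \<le> e * 192/1000" using \<delta> by simp
  obtain K1 where K1: "K1 \<ge> Kmin" "\<And>K p. K \<ge> K1 \<Longrightarrow> p \<in> QQ K \<zeta> \<eta> \<Longrightarrow>
       (F 0 ^^ (K - Kmin)) p \<in> Box \<and> norm (cx ((F 0 ^^ (K - Kmin)) p) - X \<zeta>) \<le> 192 / \<delta> * \<eta> \<and>
       norm (cy ((F 0 ^^ (K - Kmin)) p) - Y \<zeta>) \<le> 192 / \<delta> * \<eta>"
    using Psi_coords_near[OF XY \<eta> z] by blast
  show thesis
  proof (rule that[of \<eta> K1, OF \<eta>(1)])
    fix K p assume K: "K \<ge> K1" and p: "p \<in> QQ K \<zeta> \<eta>"
    define p' where "p' = (F 0 ^^ (K - Kmin)) p"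
    have p': "p' \<in> Box" "norm (cx p' - X \<zeta>) \<le> 192 / \<delta> * \<eta>" "norm (cy p' - Y \<zeta>) \<le> 192 / \<delta> * \<eta>"
      using K1(2)[OF K p] by (auto simp: p'_def)
    have "dist (cx p', cy p') (X \<zeta>, Y \<zeta>) \<le> dist (cx p') (X \<zeta>) + dist (cy p') (Y \<zeta>)"
      unfolding dist_Pair_Pair by (rule sqrt_sum_squares_le_sum) simp_all
    also have "\<dots> = norm (cx p' - X \<zeta>) + norm (cy p' - Y \<zeta>)" by (simp add: dist_norm)
    also have "\<dots> < e" using p' \<eta>e e by linarith
    finally have "(cx p', cy p') \<in> T" using e by (auto simp: dist_commute)
    then have "(F 0 ^^ Kmin) (emb (cx p') (cy p')) \<in> V" using T(3) BoxD(2,3)[OF p'(1)] by blast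
    then have "(F 0 ^^ Kmin) p' \<in> V" using emb_cx_cy[OF BoxD(1)[OF p'(1)]] by simp
    moreover have "(F 0 ^^ Kmin) p' = (F 0 ^^ (Kmin + (K - Kmin))) p" by (simp only: p'_def funpow_add comp_def)
    ultimately show "(F 0 ^^ K) p \<in> V" using K K1(1) by simp
  qed
qed

text \<open>With \<open>\<zeta>\<close> the Fatou coordinate of p, the backward iterates of p
  eventually lie in \<open>QQ K \<zeta> \<eta>\<close>; going forward again puts p itself into every
  neighbourhood of \<open>Psi \<zeta>\<close>.\<close>

lemma asymptotic_curve_eq_Psi:
  assumes p: "p \<in> asymptotic_curve (F 0) p0"
  shows "p = Psi (fatou_out (F 0) \<phi> q p)"
proof (rule ccontr)
  define \<zeta> where "\<zeta> = fatou_out (F 0) \<phi> q p"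
  assume "p \<noteq> Psi (fatou_out (F 0) \<phi> q p)"
  then obtain V W where VW: "open V" "open W" "Psi \<zeta> \<in> V" "p \<in> W" "V \<inter> W = {}"
    using hausdorff[of "Psi \<zeta>" p] by (auto simp: \<zeta>_def)
  obtain \<eta> K1 where \<eta>: "\<eta> > 0" "\<And>K p. K \<ge> K1 \<Longrightarrow> p \<in> QQ K \<zeta> \<eta> \<Longrightarrow> (F 0 ^^ K) p \<in> V"
    using QQ_iterates_near_Psi[OF VW(1,3)] by metis
  note as = asymptotic_curve_asymptotics[OF p]
  have "\<forall>\<^sub>F K in sequentially. dist (wout ((inv (F 0) ^^ K) p) + of_nat K) \<zeta> < \<eta>"
    by (rule tendstoD[OF as(2)[folded \<zeta>_def] \<eta>(1)])
  moreover have "\<forall>\<^sub>F K in sequentially. dist (cy ((inv (F 0) ^^ K) p)) 0 < \<eta>" by (rule tendstoD[OF as(3) \<eta>(1)])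
  ultimately have "\<forall>\<^sub>F K in sequentially. p \<in> V" using as(1) eventually_ge_at_top[of K1]
  proof eventually_elim
    case (elim K)
    have e: "wout ((inv (F 0) ^^ K) p) - (\<zeta> - of_nat K) = (wout ((inv (F 0) ^^ K) p) + of_nat K) - \<zeta>" by simp
    have "norm (wout ((inv (F 0) ^^ K) p) - (\<zeta> - of_nat K)) \<le> \<eta>"
      unfolding e using elim(1) unfolding dist_norm by (rule less_imp_le)
    then have "(inv (F 0) ^^ K) p \<in> QQ K \<zeta> \<eta>" using elim by (simp add: QQ_def)
    from \<eta>(2)[OF elim(4) this] show ?case by simp
  qed
  then have "p \<in> V" by simp
  then show False using VW by blast
qed

lemma fatou_out_inv_eq_Psi: "fatou_out_inv (F 0) p0 \<phi> q = Psi"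
proof
  fix \<zeta>
  have "inj_on (fatou_out (F 0) \<phi> q) (asymptotic_curve (F 0) p0)"
  proof (rule inj_onI)
    fix p p' assume p: "p \<in> asymptotic_curve (F 0) p0" "p' \<in> asymptotic_curve (F 0) p0"
      and e: "fatou_out (F 0) \<phi> q p = fatou_out (F 0) \<phi> q p'"
    show "p = p'" using asymptotic_curve_eq_Psi[OF p(1), unfolded e] asymptotic_curve_eq_Psi[OF p(2)] by (rule trans[OF _ sym])
  qed
  from inv_into_f_f[OF this Psi_in_asymptotic_curve[of \<zeta>]]
  show "fatou_out_inv (F 0) p0 \<phi> q \<zeta> = Psi \<zeta>" by (simp add: fatou_out_Psi fatou_out_inv_def)
qed

lemma Psi_basin_if_transition_domain: "\<zeta> \<in> transition_domain (F 0) p0 \<phi> q \<Longrightarrow> Psi \<zeta> \<in> basin (F 0) p0"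
  unfolding transition_domain_def using asymptotic_curve_eq_Psi[symmetric] by (elim imageE) simp

lemma continuous_Psi: "continuous_on UNIV Psi"
  unfolding continuous_on_eq_continuous_at[OF open_UNIV]
proof
  fix \<zeta> :: complex
  define M where "M = norm \<zeta> + 1"
  have z: "\<zeta> \<in> ball 0 M" by (simp add: M_def)
  obtain Kmin E where E: "E \<ge> 0" "\<And>K0. K0 \<ge> Kmin \<Longrightarrow> \<exists>X Y. Psi_coords M E K0 X Y"
    by (rule Psi_local) (rule that)
  show "isCont Psi \<zeta>"
  proof -
    obtain X Y where C: "Psi_coords M E Kmin X Y" using E(2)[OF order_refl] by blast
    note XY = Psi_coordsD(1,2)[OF C] and XYp = Psi_coordsD(3,4,7)[OF C]
    have "continuous_on (ball 0 M) (\<lambda>\<zeta>. (X \<zeta>, Y \<zeta>))"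
      by (intro continuous_intros holomorphic_on_imp_continuous_on XY)
    then have "continuous_on (ball 0 M) (\<lambda>\<zeta>. (\<lambda>w. (F 0 ^^ Kmin) (emb (fst w) (snd w))) (X \<zeta>, Y \<zeta>))"
      by (rule continuous_on_compose2[OF continuous_F0_emb]) (use XYp in auto)
    then have "continuous_on (ball 0 M) Psi" by (rule continuous_on_eq) (use XYp in auto)
    then show ?thesis using z by (simp add: continuous_on_eq_continuous_at)
  qed
qed

text \<open>Holomorphy comes from the coordinates X and Y. The tangent is nonzero because
  \<open>wout\<close> along the curve differs from \<open>\<zeta> - K0\<close> by at most 1/8 on a
  unit disc, so its derivative is within 1/2 of 1, whereas u = 0 would make it 0.\<close>

lemma Psi_has_derivative:
  assumes V: "holo_chart A (V, \<psi>)" and z: "Psi \<zeta>0 \<in> V"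
  obtains u where "u \<noteq> 0" "((\<lambda>\<zeta>. \<psi> (Psi \<zeta>)) has_derivative (\<lambda>h. h *s u)) (at \<zeta>0)"
proof -
  \<comment> \<open>Room for the unit disc about \<open>\<zeta>0\<close> on which the Cauchy
    estimate is taken.\<close>
  define M where "M = norm \<zeta>0 + 2"
  obtain Kmin E where E: "E \<ge> 0" "\<And>K0. K0 \<ge> Kmin \<Longrightarrow> \<exists>X Y. Psi_coords M E K0 X Y"
    by (rule Psi_local) (rule that)
  define K0 where "K0 = max (max Kmin 8) (nat \<lceil>8 * E\<rceil>)"
  have K0: "K0 \<ge> Kmin" "K0 \<ge> 8" by (auto simp: K0_def)
  have "8 * E \<le> real (nat \<lceil>8 * E\<rceil>)" by (rule real_nat_ceiling_ge)
  also have "\<dots> \<le> real K0" by (rule of_nat_mono) (simp add: K0_def)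
  finally have EK: "E / real K0 \<le> 1/8" using K0 by (simp add: field_simps)
  obtain X Y where C: "Psi_coords M E K0 X Y" using E(2)[OF K0(1)] by blast
  note XY = Psi_coordsD(1,2)[OF C]
  have XYp: "norm (X \<zeta>) \<le> \<delta> \<and> norm (Y \<zeta>) \<le> \<delta> \<and> emb (X \<zeta>) (Y \<zeta>) \<in> QQ K0 \<zeta> (E / real K0) \<and>
         Psi \<zeta> = (F 0 ^^ K0) (emb (X \<zeta>) (Y \<zeta>)) \<and> (inv (F 0) ^^ K0) (Psi \<zeta>) = emb (X \<zeta>) (Y \<zeta>)"
    if "\<zeta> \<in> ball 0 M" for \<zeta> using Psi_coordsD(3-7)[OF C that] by blast
  define T where "T = ball 0 M \<inter> Psi -` V"
  note cV = is_chartD[OF holo_chart_is_chart[OF V]]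
  have oT: "open T" unfolding T_def
    by (rule continuous_open_preimage[OF continuous_on_subset[OF continuous_Psi] open_ball cV(1)]) simp
  have zM: "\<zeta>0 \<in> ball 0 M" by (simp add: M_def)
  have zT: "\<zeta>0 \<in> T" using z zM by (simp add: T_def)
  have hol: "(\<lambda>\<zeta>. \<psi> (Psi \<zeta>) $ i) holomorphic_on T" for i
  proof (rule holomorphic_transform)
    show "(\<lambda>\<zeta>. \<psi> ((F 0 ^^ K0) (emb (X \<zeta>) (Y \<zeta>))) $ i) holomorphic_on T"
      by (rule holomorphic_on_curve_emb[OF holo_self_map_funpow[OF surface holo_F0] oT _ _ _ _ _ V])
         (use XY XYp holomorphic_on_subset in \<open>auto simp: T_def\<close>)
  qed (use XYp in \<open>auto simp: T_def\<close>)
  define u where "u = (\<chi> i. deriv (\<lambda>\<zeta>. \<psi> (Psi \<zeta>) $ i) \<zeta>0)"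
  have d: "((\<lambda>\<zeta>. \<psi> (Psi \<zeta>)) has_derivative (\<lambda>h. h *s u)) (at \<zeta>0)"
    by (rule holomorphic_curve_has_derivative) (use holomorphic_derivI[OF hol oT zT] in \<open>simp add: u_def\<close>)
  have "u \<noteq> 0"
  proof
    assume u0: "u = 0"
    define f where "f = inv (F 0) ^^ K0"
    have fe: "f (Psi \<zeta>) = emb (X \<zeta>) (Y \<zeta>)" if "\<zeta> \<in> ball 0 M" for \<zeta> using XYp[OF that] by (simp add: f_def)
    have h: "holo_map (\<phi> \<circ> f \<circ> inv_into V \<psi>) (\<psi> ` (V \<inter> f -` U))"
      unfolding f_def by (rule holo_self_map_in_charts[OF surface holo_self_map_funpow[OF surface holo_inv_F0] V chart])
    have "f (Psi \<zeta>0) \<in> U" using fe[OF zM] emb_box(1) XYp[OF zM] by simp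
    then have "\<psi> (Psi \<zeta>0) \<in> \<psi> ` (V \<inter> f -` U)" using z by auto
    from holo_map_at[OF h this] obtain J where J: "(\<phi> \<circ> f \<circ> inv_into V \<psi> has_derivative (\<lambda>v. J *v v)) (at (\<psi> (Psi \<zeta>0)))" by blast
    have "((\<lambda>\<zeta>. (\<phi> \<circ> f \<circ> inv_into V \<psi>) (\<psi> (Psi \<zeta>))) has_derivative (\<lambda>h. h *s (J *v u))) (at \<zeta>0)"
      by (rule has_derivative_curve_compose[OF d J])
    from has_derivative_curve_nth[OF this, of 1]
    have "((\<lambda>\<zeta>. (\<phi> \<circ> f \<circ> inv_into V \<psi>) (\<psi> (Psi \<zeta>)) $ 1) has_field_derivative 0) (at \<zeta>0)" by (simp add: u0)
    then have X0: "(X has_field_derivative 0) (at \<zeta>0)"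
    proof (rule has_field_derivative_transform_within_open[OF _ oT zT])
      fix \<zeta> assume "\<zeta> \<in> T"
      then have t: "\<zeta> \<in> ball 0 M" "Psi \<zeta> \<in> V" by (auto simp: T_def)
      have "(\<phi> \<circ> f \<circ> inv_into V \<psi>) (\<psi> (Psi \<zeta>)) $ 1 = cx (emb (X \<zeta>) (Y \<zeta>))" using cV(6)[OF t(2)] fe[OF t(1)] by (simp add: cx_def)
      then show "(\<phi> \<circ> f \<circ> inv_into V \<psi>) (\<psi> (Psi \<zeta>)) $ 1 = X \<zeta>" using emb_box(2) XYp[OF t(1)] by simp
    qed
    define Wt where "Wt = (\<lambda>\<zeta>. - 1 / X \<zeta> - q * Ln (X \<zeta>))"
    have Xpos: "Re (X \<zeta>) > 0 \<and> norm (Wt \<zeta> - (\<zeta> - of_nat K0)) \<le> 1/8" if "\<zeta> \<in> ball 0 M" for \<zeta>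
    proof -
      have Q: "emb (X \<zeta>) (Y \<zeta>) \<in> QQ K0 \<zeta> (E / real K0)" and e: "cx (emb (X \<zeta>) (Y \<zeta>)) = X \<zeta>" using XYp[OF that] emb_box(2) by auto
      have "norm (vv (emb (X \<zeta>) (Y \<zeta>)) + of_nat K0) \<le> real K0 / 2" using Q by (simp add: QQ_def)
      from Re_cx_pos_if_Re_vv_neg[OF left_half_ball(1)[OF this K0(2)]] have R: "Re (X \<zeta>) > 0" by (simp add: e)
      have "wout (emb (X \<zeta>) (Y \<zeta>)) = Wt \<zeta>" using e by (simp add: wout_def w_out_def cx_def Wt_def)
      then have "norm (Wt \<zeta> - (\<zeta> - of_nat K0)) \<le> E / real K0" using Q by (simp add: QQ_def)
      then show ?thesis using EK R by linarith
    qed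
    have nr: "X \<zeta> \<notin> \<real>\<^sub>\<le>\<^sub>0" "X \<zeta> \<noteq> 0" if "\<zeta> \<in> ball 0 M" for \<zeta> using Xpos[OF that] by (auto simp: complex_nonpos_Reals_iff)
    define k where "k = (\<lambda>t. Wt (\<zeta>0 + t) - (\<zeta>0 + t - of_nat K0))"
    have tM: "\<zeta>0 + t \<in> ball 0 M" if "t \<in> ball 0 1" for t
      using that norm_triangle_ineq[of \<zeta>0 t] by (simp add: M_def)
    have Wh: "Wt holomorphic_on ball 0 M" unfolding Wt_def by (intro holomorphic_intros XY) (use nr in auto)
    have kh: "k holomorphic_on ball 0 1"
    proof -
      have "(Wt \<circ> (\<lambda>t. \<zeta>0 + t)) holomorphic_on ball 0 1"
      proof (rule holomorphic_on_compose_gen[OF _ Wh])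
        show "(\<lambda>t. \<zeta>0 + t) holomorphic_on ball 0 1" by (intro holomorphic_intros)
        show "(\<lambda>t. \<zeta>0 + t) ` ball 0 1 \<subseteq> ball 0 M" by (rule image_subsetI) (rule tM)
      qed
      then show ?thesis unfolding k_def comp_def by (intro holomorphic_intros)
    qed
    have "norm (deriv k 0) \<le> 4 * (1/8) / 1"
      by (rule holomorphic_bounded_ball_estimates(1)[OF kh]) (use Xpos[OF tM] in \<open>auto simp: k_def\<close>)
    moreover have "deriv k 0 = - 1"
    proof (rule DERIV_imp_deriv)
      have "(Wt has_field_derivative 0) (at \<zeta>0)"
        unfolding Wt_def by (rule derivative_eq_intros X0 nr zM refl)+ simp
      then have "((\<lambda>t. Wt (\<zeta>0 + t)) has_field_derivative 0) (at 0)"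
        using DERIV_shift[of Wt 0 0 \<zeta>0] by (simp add: add.commute)
      then show "(k has_field_derivative - 1) (at 0)" unfolding k_def by (auto intro!: derivative_eq_intros)
    qed
    ultimately show False by simp
  qed
  then show thesis using d that by blast
qed

text \<open>The curve is a differentiable image of a set of real dimension two in real dimension
  four, hence negligible.\<close>

lemma interior_Psi_image_empty:
  assumes V: "holo_chart A (V, \<psi>)" and S: "S \<subseteq> {\<psi> (Psi \<zeta>) | \<zeta>. Psi \<zeta> \<in> V}"
  shows "interior S = {}"
proof -
  define T where "T = {\<zeta>. Psi \<zeta> \<in> V}"
  have d: "(\<lambda>\<zeta>. \<psi> (Psi \<zeta>)) differentiable_on T"
    unfolding differentiable_on_def
  proof
    fix \<zeta> assume "\<zeta> \<in> T"
    then have "Psi \<zeta> \<in> V" by (simp add: T_def)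
    then obtain u where "((\<lambda>\<zeta>. \<psi> (Psi \<zeta>)) has_derivative (\<lambda>h. h *s u)) (at \<zeta>)"
      using Psi_has_derivative[OF V] by metis
    then show "(\<lambda>\<zeta>. \<psi> (Psi \<zeta>)) differentiable at \<zeta> within T"
      using differentiable_at_withinI differentiable_def by blast
  qed
  have "negligible ((\<lambda>\<zeta>. \<psi> (Psi \<zeta>)) ` T)"
    by (rule negligible_differentiable_image_lowdim[OF _ d]) simp
  moreover have "interior S \<subseteq> (\<lambda>\<zeta>. \<psi> (Psi \<zeta>)) ` T" using interior_subset S by (fastforce simp: T_def)
  ultimately have "negligible (interior S)" by (rule negligible_subset)
  then show ?thesis using open_not_negligible open_interior by blast
qed

end

section \<open>Passing through the gate\<close>

lemma sum_inverse_squares_above: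
  assumes "K \<ge> 2"
  shows "(\<Sum>m<n. 1 / (real K + real m)^2) \<le> 1 / (real K - 1) - 1 / (real K + real n - 1)"
proof (induction n)
  case (Suc n)
  define j where "j = real K + real n"
  have j: "j > 1" using assms by (simp add: j_def)
  have "1 / j^2 \<le> 1 / ((j - 1) * j)"
  proof (rule divide_left_mono)
    show "(j - 1) * j \<le> j^2" using j by (simp add: power2_eq_square mult_right_mono)
  qed (use j in auto)
  also have "\<dots> = 1 / (j - 1) - 1 / j" using j by (simp add: field_simps)
  finally have "1 / j^2 \<le> 1 / (j - 1) - 1 / j" .
  then show ?case using Suc by (simp add: j_def)
qed simp

text \<open>The real part of \<open>z / H\<close> has the sign of that of \<open>z * cnj H\<close>,
  which deviates from \<open>s * P\<close> by at most the fraction 1/32 + 7/8 + 7/256 =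
  239/256.\<close>

lemma Re_divide_pos_near_reals:
  fixes z H :: complex and s P :: real
  assumes z: "norm (z - of_real s) \<le> 7/8 * s" "s > 0" and H: "norm (H - of_real P) \<le> P / 32" "P > 0"
  shows "Re (z / H) > 0"
proof -
  define e where "e = z - of_real s"
  define \<kappa> where "\<kappa> = H - of_real P"
  define Q where "Q = of_real s * cnj \<kappa> + e * of_real P + e * cnj \<kappa>"
  have "norm Q \<le> s * (P/32) + 7/8 * s * P + 7/8 * s * (P / 32)"
    unfolding Q_def
  proof (rule norm_add_bound[OF refl norm_add_bound[OF refl]])
    have ck: "norm (cnj \<kappa>) \<le> P / 32" unfolding complex_mod_cnj \<kappa>_def by (rule H(1))
    show "norm (of_real s * cnj \<kappa>) \<le> s * (P/32)" unfolding norm_mult using z(2) ck by (simp add: mult_left_mono)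
    show "norm (e * of_real P) \<le> 7/8 * s * P" unfolding norm_mult using z(1) H(2) by (simp add: e_def)
    show "norm (e * cnj \<kappa>) \<le> 7/8 * s * (P / 32)" unfolding norm_mult
      by (intro mult_mono ck) (use z in \<open>auto simp: e_def\<close>)
  qed
  then have q: "norm Q \<le> 239/256 * (s * P)" by (simp add: mult.commute)
  have "Re (z * cnj H) = s * P + Re Q"
    by (simp add: Q_def e_def \<kappa>_def algebra_simps)
  moreover have "- Re Q \<le> norm Q" using abs_Re_le_cmod[of Q] by (rule abs_le_D2)
  moreover have "s * P > 0" using z H by simp
  ultimately have "Re (z * cnj H) > 0" using q by linarith
  moreover have "H \<noteq> 0"
  proof
    assume "H = 0"
    then show False using H by simp
  qed
  ultimately have "Re (z * cnj H / of_real ((norm H)^2)) > 0" by (simp add: Re_divide_of_real del: of_real_power)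
  then show ?thesis unfolding complex_div_cnj[of z H] by simp
qed

text \<open>With \<open>H = \<pi> / \<epsilon>\<close>, each of v, \<open>H - v\<close> and H is
  near a positive real, up to a fixed fraction of it. Hence
  \<open>\<epsilon> * v = \<pi> * v / H\<close> lies in the strip between 0 and pi, where the sine
  is comparable with the distance to the nearer end, and
  \<open>sin (\<epsilon> * v) / \<epsilon>\<close> is of order d.\<close>

lemma gate_coordinate_estimates:
  fixes \<epsilon> v :: complex and c s d P :: real
  assumes \<epsilon>: "\<epsilon> \<noteq> 0" "norm (of_real pi / \<epsilon> - of_real P) \<le> s' / 32" and P: "P = c + s" "s' \<le> s" "2 * s' \<le> P" "0 < s'"
    and d: "d = min c s" "16 \<le> d" and v: "norm (v - of_real c) \<le> 3/4 * d"
  shows "0 < Re (\<epsilon> * v)" "Re (\<epsilon> * v) < pi" "0 < Re \<epsilon>" "norm \<epsilon> \<le> 4 / d"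
    "norm (sin (\<epsilon> * v)) \<ge> norm \<epsilon> * d / 16" "sin (\<epsilon> * v) \<noteq> 0" "0 < Re (sin (\<epsilon> * v))"
    "norm (Ln (sin (\<epsilon> * v)) - Ln \<epsilon>) \<le> 30 + ln d"
proof -
  define H where "H = of_real pi / \<epsilon>"
  have cd: "c \<ge> d" "s \<ge> d" "c > 0" "s > 0" "P \<ge> 2 * d" "P > 0" using d P by auto
  have HP: "norm (H - of_real P) \<le> P / 32" using \<epsilon>(2) P by (simp add: H_def)
  have H0: "H \<noteq> 0" using \<epsilon> by (simp add: H_def)
  have \<epsilon>H: "\<epsilon> = of_real pi / H" using \<epsilon> by (simp add: H_def)
  have ev: "\<epsilon> * v = of_real pi * (v / H)" by (simp add: \<epsilon>H)
  have Rpi: "Re (of_real pi * z) = pi * Re z" for z by simp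
  have v1: "norm (v - of_real c) \<le> 7/8 * c" using v cd by simp
  have v2: "norm (H - v - of_real s) \<le> 7/8 * s"
  proof -
    have "norm (H - v - of_real s) \<le> s' / 32 + 3/4 * d"
      by (rule norm_diff_bound[OF _ _ v, of _ "H - of_real P"]) (use \<epsilon>(2) P in \<open>simp_all add: H_def\<close>)
    then show ?thesis using cd P by simp
  qed
  have "0 < Re (v / H)" by (rule Re_divide_pos_near_reals[OF v1 cd(3) HP cd(6)])
  then show r1: "0 < Re (\<epsilon> * v)" unfolding ev Rpi by simp
  have "0 < Re ((H - v) / H)" by (rule Re_divide_pos_near_reals[OF v2 cd(4) HP cd(6)])
  also have "(H - v) / H = 1 - v / H" using H0 by (simp add: field_simps)
  finally have "Re (v / H) < 1" by simp
  then show r2: "Re (\<epsilon> * v) < pi" unfolding ev Rpi by simp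
  show "0 < Re \<epsilon>"
  proof -
    have "0 < Re (1 / H)" by (rule Re_divide_pos_near_reals[of _ 1, OF _ _ HP cd(6)]) auto
    then have "0 < Re (of_real pi * (1 / H))" unfolding Rpi by simp
    then show ?thesis by (simp add: \<epsilon>H)
  qed
  have nH: "norm H \<ge> P / 2"
  proof -
    have "norm (of_real P :: complex) \<le> norm H + P / 32"
      by (rule norm_diff_bound[OF _ order_refl HP]) simp
    then show ?thesis using cd by simp
  qed
  have nH0: "norm H > 0" using H0 by simp
  have n\<epsilon>: "norm \<epsilon> = pi / norm H" by (simp add: \<epsilon>H norm_divide)
  show "norm \<epsilon> \<le> 4 / d"
  proof -
    have "pi / norm H \<le> 4 / norm H" using pi_less_4 nH0 by (intro divide_right_mono) auto
    also have "\<dots> \<le> 4 / d" using nH cd d nH0 by (intro divide_left_mono) auto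
    finally show ?thesis by (simp add: n\<epsilon>)
  qed
  have nv: "norm v \<ge> d / 8" "norm v \<le> 2 * c"
  proof -
    have "norm (of_real c :: complex) \<le> norm v + 7/8 * c" by (rule norm_diff_bound[OF _ order_refl v1]) simp
    then show "norm v \<ge> d / 8" using cd by simp
    have "norm v \<le> 7/8 * c + c" by (rule norm_add_bound[OF _ v1, of _ "of_real c"]) (use cd in auto)
    then show "norm v \<le> 2 * c" using cd by simp
  qed
  have nHv: "norm (H - v) \<ge> d / 8" "norm (H - v) \<le> 2 * s"
  proof -
    have "norm (of_real s :: complex) \<le> norm (H - v) + 7/8 * s" by (rule norm_diff_bound[OF _ order_refl v2]) simp
    then show "norm (H - v) \<ge> d / 8" using cd by simp
    have "norm (H - v) \<le> 7/8 * s + s" by (rule norm_add_bound[OF _ v2, of _ "of_real s"]) (use cd in auto)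
    then show "norm (H - v) \<le> 2 * s" using cd by simp
  qed
  have pv: "of_real pi - \<epsilon> * v = \<epsilon> * (H - v)" using \<epsilon> H0 by (simp add: H_def field_simps)
  have "min (norm (\<epsilon> * v)) (norm (of_real pi - \<epsilon> * v)) / 2 \<le> norm (sin (\<epsilon> * v))"
    by (rule norm_sin_ge_min) (use r1 r2 in auto)
  moreover have "norm (\<epsilon> * v) \<ge> norm \<epsilon> * (d / 8)" unfolding norm_mult using nv by (intro mult_left_mono) auto
  moreover have "norm (of_real pi - \<epsilon> * v) \<ge> norm \<epsilon> * (d / 8)" unfolding pv norm_mult using nHv by (intro mult_left_mono) auto
  ultimately show low: "norm (sin (\<epsilon> * v)) \<ge> norm \<epsilon> * d / 16" by (simp add: min_def split: if_splits)
  have n\<epsilon>0: "norm \<epsilon> > 0" using \<epsilon> by simp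
  have "norm \<epsilon> * d / 16 > 0" using n\<epsilon>0 d by simp
  then show s0: "sin (\<epsilon> * v) \<noteq> 0" using low by auto
  show Rs: "0 < Re (sin (\<epsilon> * v))" by (rule Re_sin_pos[OF r1 r2])
  show "norm (Ln (sin (\<epsilon> * v)) - Ln \<epsilon>) \<le> 30 + ln d"
  proof -
    have leq: "Ln (sin (\<epsilon> * v)) - Ln \<epsilon> = Ln (sin (\<epsilon> * v) / \<epsilon>)"
      by (rule Ln_divide_Re_pos[symmetric, OF Rs]) fact
    define u where "u = sin (\<epsilon> * v) / \<epsilon>"
    have nu: "norm u \<ge> d / 16" using low n\<epsilon>0 by (simp add: u_def norm_divide pos_le_divide_eq mult.commute)
    have big: "norm \<epsilon> * x \<le> 16" if "x \<le> 2 * P" "0 \<le> x" for x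
    proof -
      have "norm \<epsilon> * x \<le> (4 / norm H) * (2 * P)" unfolding n\<epsilon>
        using pi_less_4 that nH0 by (intro mult_mono divide_right_mono) auto
      also have "\<dots> \<le> 16" using nH nH0 by (simp add: divide_le_eq)
      finally show ?thesis .
    qed
    have up: "norm (sin (\<epsilon> * x)) \<le> norm \<epsilon> * norm x * exp 16" if "norm x \<le> 2 * P" for x
    proof -
      have "norm (sin (\<epsilon> * x)) \<le> norm (\<epsilon> * x) * exp (norm (\<epsilon> * x))" by (rule norm_sin_le)
      also have "\<dots> \<le> norm (\<epsilon> * x) * exp 16" using big[OF that] by (intro mult_left_mono) (auto simp: norm_mult)
      finally show ?thesis by (simp add: norm_mult)
    qed
    \<comment> \<open>The nearer end of the gate is used: v itself if \<open>c \<le> s\<close>,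
      otherwise \<open>H - v\<close> through \<open>sin (\<pi> - z) = sin z\<close>. The factor
      \<open>exp 16\<close> reflects \<open>norm (\<epsilon> * x) \<le> 16\<close>.\<close>
    have "norm (sin (\<epsilon> * v)) \<le> norm \<epsilon> * (2 * d) * exp 16"
    proof (cases "c \<le> s")
      case True
      have "norm (sin (\<epsilon> * v)) \<le> norm \<epsilon> * norm v * exp 16" by (rule up) (use nv cd P in linarith)
      also have "\<dots> \<le> norm \<epsilon> * (2 * d) * exp 16" using nv d True by (intro mult_right_mono mult_left_mono) auto
      finally show ?thesis .
    next
      case False
      have "sin (\<epsilon> * v) = sin (of_real pi - \<epsilon> * v)" by (simp add: sin_diff flip: sin_of_real cos_of_real)
      then have "norm (sin (\<epsilon> * v)) \<le> norm \<epsilon> * norm (H - v) * exp 16" unfolding pv using up[of "H - v"] nHv cd P by simp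
      also have "\<dots> \<le> norm \<epsilon> * (2 * d) * exp 16" using nHv d False by (intro mult_right_mono mult_left_mono) auto
      finally show ?thesis .
    qed
    then have nu2: "norm u \<le> 2 * d * exp 16" using n\<epsilon>0 by (simp add: u_def norm_divide divide_le_eq ac_simps)
    have nu1: "norm u \<ge> 1" using nu d(2) by linarith
    have "norm (Ln u) \<le> \<bar>ln (norm u)\<bar> + pi" by (rule norm_Ln_le_ln_norm) (use nu1 in auto)
    moreover have "\<bar>ln (norm u)\<bar> = ln (norm u)" using nu1 by simp
    moreover have "ln (norm u) \<le> ln (2 * d * exp 16)" using nu1 nu2 by (intro ln_mono) auto
    moreover have "ln (2 * d * exp 16) = ln 2 + ln d + 16"
    proof -
      have "0 < d" using d(2) by linarith
      then show ?thesis by (simp add: ln_mult)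
    qed
    ultimately have "norm (Ln u) \<le> 30 + ln d" using ln_2_less_1 pi_less_4 by linarith
    then show ?thesis by (simp add: leq u_def)
  qed
qed

text \<open>With \<open>x = - \<epsilon> * cot (\<epsilon> * v)\<close> the map moves \<open>v\<close> by \<open>Arctan t / \<epsilon>\<close>, by the addition theorem.\<close>

lemma gate_lift_step:
  fixes x a \<epsilon> v t A :: complex
  assumes rel: "x * sin (\<epsilon> * v) = - \<epsilon> * cos (\<epsilon> * v)" and nz: "1 + x * a \<noteq> 0" "\<epsilon> \<noteq> 0"
    and t: "t = \<epsilon> * (a / (1 + x * a))" "norm t \<le> 1/2"
  shows "(x + (x^2 + \<epsilon>^2) * a) * sin (\<epsilon> * (v + Arctan t / \<epsilon>)) = - \<epsilon> * cos (\<epsilon> * (v + Arctan t / \<epsilon>))"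
    and "sin (\<epsilon> * (v + Arctan t / \<epsilon>)) = cos (Arctan t) / (1 + x * a) * sin (\<epsilon> * v)"
proof -
  define s c K S where "s = sin (\<epsilon> * v)" "c = cos (\<epsilon> * v)" "K = cos (Arctan t)" "S = sin (Arctan t)"
  have K0: "K \<noteq> 0" using Arctan_small(3)[OF t(2)] by (simp add: s_c_K_S_def)
  have S: "S = t * K" using Arctan_small(1)[OF t(2)] K0 by (simp add: tan_def s_c_K_S_def field_simps)
  have e: "\<epsilon> * (v + Arctan t / \<epsilon>) = \<epsilon> * v + Arctan t" using nz by (simp add: field_simps)
  have r: "x * s = - \<epsilon> * c" using rel by (simp add: s_c_K_S_def)
  have tw: "t * (1 + x * a) = \<epsilon> * a" using nz by (simp add: t)
  have sin1: "sin (\<epsilon> * (v + Arctan t / \<epsilon>)) = K * (s + c * t)"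
    unfolding e sin_add by (simp add: s_c_K_S_def[symmetric] S algebra_simps)
  have cos1: "cos (\<epsilon> * (v + Arctan t / \<epsilon>)) = K * (c - s * t)"
    unfolding e cos_add by (simp add: s_c_K_S_def[symmetric] S algebra_simps)
  have k1: "(s + c * t) * (1 + x * a) = s"
  proof -
    have "(s + c * t) * (1 + x * a) = s + a * (x * s) + c * (t * (1 + x * a))" by (simp add: algebra_simps)
    then show ?thesis unfolding r tw by (simp add: algebra_simps)
  qed
  then have k1': "s + c * t = s / (1 + x * a)" using nz by (simp add: field_simps)
  show "sin (\<epsilon> * (v + Arctan t / \<epsilon>)) = cos (Arctan t) / (1 + x * a) * sin (\<epsilon> * v)"
    unfolding sin1 k1' by (simp add: s_c_K_S_def)
  have k2: "(c - s * t) * (1 + x * a) = c * (1 + x * a) - s * (\<epsilon> * a)"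
    unfolding tw[symmetric] by (simp add: algebra_simps)
  have "(x + (x^2 + \<epsilon>^2) * a) * s = - \<epsilon> * (c * (1 + x * a) - s * (\<epsilon> * a))"
  proof -
    have "(x + (x^2 + \<epsilon>^2) * a) * s = (x * s) + x * a * (x * s) + \<epsilon>^2 * a * s" by (simp add: algebra_simps power2_eq_square)
    then show ?thesis unfolding r by (simp add: algebra_simps power2_eq_square)
  qed
  then have "((x + (x^2 + \<epsilon>^2) * a) * (s + c * t)) * (1 + x * a) = (- \<epsilon> * (c - s * t)) * (1 + x * a)"
    unfolding mult.assoc k1 k2 by simp
  then have "(x + (x^2 + \<epsilon>^2) * a) * (s + c * t) = - \<epsilon> * (c - s * t)"
    by (rule mult_right_cancel[OF nz(1), THEN iffD1])
  then show "(x + (x^2 + \<epsilon>^2) * a) * sin (\<epsilon> * (v + Arctan t / \<epsilon>)) = - \<epsilon> * cos (\<epsilon> * (v + Arctan t / \<epsilon>))"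
    unfolding sin1 cos1 by (metis (no_types, opaque_lifting) mult.assoc mult.commute)
qed

text \<open>The relation gives
  \<open>x^2 + \<epsilon>^2 = (\<epsilon> / sin (\<epsilon> * v))^2\<close>, and the lower bound on
  the sine makes this \<open>O(1 / d^2)\<close>.\<close>

lemma gate_x_estimates:
  fixes x \<epsilon> v :: complex and d :: real
  assumes rel: "x * sin (\<epsilon> * v) = - \<epsilon> * cos (\<epsilon> * v)" and d: "d > 0"
    and s: "norm (sin (\<epsilon> * v)) \<ge> norm \<epsilon> * d / 16" "sin (\<epsilon> * v) \<noteq> 0" and \<epsilon>: "norm \<epsilon> \<le> 4 / d"
  shows "norm (x^2 + \<epsilon>^2) \<le> 256 / d^2" "norm x ^ 2 \<le> 272 / d^2" "norm \<epsilon>^2 \<le> 16 / d^2" "norm x \<le> 17 / d"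
proof -
  have "(x^2 + \<epsilon>^2) * (sin (\<epsilon> * v))^2 = (x * sin (\<epsilon> * v))^2 + \<epsilon>^2 * (sin (\<epsilon> * v))^2" by (simp add: algebra_simps power2_eq_square)
  also have "\<dots> = \<epsilon>^2 * ((cos (\<epsilon> * v))^2 + (sin (\<epsilon> * v))^2)"
    unfolding rel by (simp only: power_mult_distrib power2_minus distrib_left)
  finally have "(x^2 + \<epsilon>^2) * (sin (\<epsilon> * v))^2 = \<epsilon>^2" by simp
  then have xe: "x^2 + \<epsilon>^2 = (\<epsilon> / sin (\<epsilon> * v))^2" using s(2) by (simp add: power_divide field_simps)
  have "norm \<epsilon> * d \<le> 16 * norm (sin (\<epsilon> * v))" using s(1) by simp
  then have "norm (\<epsilon> / sin (\<epsilon> * v)) \<le> 16 / d" using s(2) d by (simp add: norm_divide divide_le_eq pos_le_divide_eq)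
  then have "norm (\<epsilon> / sin (\<epsilon> * v)) ^ 2 \<le> (16 / d)^2" by (intro power_mono) auto
  then show 1: "norm (x^2 + \<epsilon>^2) \<le> 256 / d^2" unfolding xe norm_power by (simp add: power_divide)
  have "norm \<epsilon> ^ 2 \<le> (4 / d)^2" using \<epsilon> by (intro power_mono) auto
  then show 2: "norm \<epsilon>^2 \<le> 16 / d^2" by (simp add: power_divide)
  have "norm (x^2) \<le> 256 / d^2 + norm (\<epsilon>^2)" by (rule norm_diff_bound[OF _ 1 order_refl]) simp
  then show 3: "norm x ^ 2 \<le> 272 / d^2" using 2 by (simp add: norm_power)
  have "272 / d^2 \<le> (17 / d)^2" by (simp add: power_divide divide_right_mono)
  then have "norm x ^ 2 \<le> (17 / d)^2" using 3 by linarith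
  then show "norm x \<le> 17 / d" by (rule power2_le_imp_le) (use d in auto)
qed

context semiparabolic_family
begin

text \<open>One constant for three hypotheses of the bootstrap: \<open>288 * C\<close> for the
  translation error (288 = 272 + 16), \<open>256 * C\<close> for y, and 30 for the
  logarithm.\<close>

definition gate_C :: real where "gate_C = 300 * C + 30"

text \<open>The bootstrap through the gate. The predicted positions run from K to
  \<open>K + n\<close>; the coordinate degenerates near 0 and near \<open>2 * K + n\<close>, and d
  is the distance to the nearer of these.\<close>

lemma gate_orbit_bounds:
  fixes \<epsilon> v0 :: complex
  assumes K: "real K \<ge> bootstrap_radius lam gate_C \<delta> q r" "real K \<ge> 17 / \<delta>" "K \<ge> 16"
    and \<epsilon>: "\<epsilon> \<noteq> 0" "norm (of_real pi / \<epsilon> - of_nat (2 * K + n)) \<le> real K / 32"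
    and p: "p \<in> Box" "norm (cy p) \<le> \<delta> / 2"
    and v0: "cx p * sin (\<epsilon> * v0) = - \<epsilon> * cos (\<epsilon> * v0)" "norm (v0 - of_nat K) \<le> real K / 2"
      "norm (v0 + q * (Ln (sin (\<epsilon> * v0)) - Ln \<epsilon>) - of_nat K) \<le> real K / 8"
  obtains vn where "(F \<epsilon> ^^ n) p \<in> Box" "norm (vn - of_nat (K + n)) \<le> real K / 2"
    "cx ((F \<epsilon> ^^ n) p) * sin (\<epsilon> * vn) = - \<epsilon> * cos (\<epsilon> * vn)" "0 < Re (sin (\<epsilon> * vn))" "0 < Re \<epsilon>"
    "norm (cy ((F \<epsilon> ^^ n) p)) \<le> lam ^ n * norm (cy p) + bootstrap_const lam gate_C r / (real K)^2"
    "norm (vn + q * (Ln (sin (\<epsilon> * vn)) - Ln \<epsilon>) - (v0 + q * (Ln (sin (\<epsilon> * v0)) - Ln \<epsilon>)) - of_nat n)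
      \<le> bootstrap_const lam gate_C r * (norm (cy p) + 1 / real K)"
proof -
  define P where "P = (\<lambda>m. (F \<epsilon> ^^ m) p)"
  have PS: "P (Suc m) = F \<epsilon> (P m)" for m by (simp add: P_def)
  define b where "b = (\<lambda>m. a \<epsilon> (cx (P m)) (cy (P m)))"
  define t where "t = (\<lambda>m. \<epsilon> * (b m / (1 + cx (P m) * b m)))"
  \<comment> \<open>v is lifted step by step along the orbit, so no branch of the inverse cotangent
    has to be chosen.\<close>
  define v where "v = rec_nat v0 (\<lambda>m vm. vm + Arctan (t m) / \<epsilon>)"
  have vS: "v (Suc m) = v m + Arctan (t m) / \<epsilon>" and vz: "v 0 = v0" for m by (simp_all add: v_def)
  define l where "l = (\<lambda>m. Ln (sin (\<epsilon> * v m)) - Ln \<epsilon>)"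
  define c where "c = (\<lambda>m. of_nat (K + m) :: complex)"
  define d where "d = (\<lambda>m. min (real (K + m)) (real (K + n) - real m))"
  have C1: "1 \<le> gate_C" using C by (simp add: gate_C_def)
  have K0: "real K > 0" using K by simp
  have dK: "d m \<ge> real K" if "m \<le> n" for m using that by (simp add: d_def)
  have d16: "d m \<ge> 16" if "m \<le> n" for m using dK[OF that] K(3) by simp
  have coord: "0 < Re (\<epsilon> * v m)" "Re (\<epsilon> * v m) < pi" "0 < Re \<epsilon>" "norm \<epsilon> \<le> 4 / d m"
    "norm (sin (\<epsilon> * v m)) \<ge> norm \<epsilon> * d m / 16" "sin (\<epsilon> * v m) \<noteq> 0" "0 < Re (sin (\<epsilon> * v m))"
    "norm (l m) \<le> 30 + ln (d m)" if "m \<le> n" "norm (v m - c m) \<le> 3/4 * d m" for m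
  proof -
    have e: "norm (of_real pi / \<epsilon> - of_real (real (2 * K + n))) \<le> real K / 32" using \<epsilon>(2) by simp
    have P: "real (2 * K + n) = real (K + m) + (real (K + n) - real m)" "real K \<le> real (K + n) - real m"
      "2 * real K \<le> real (2 * K + n)" "0 < real K" using that K0 by simp_all
    have v: "norm (v m - of_real (real (K + m))) \<le> 3/4 * d m" using that(2) by (simp add: c_def)
    have dm: "d m = min (real (K + m)) (real (K + n) - real m)" by (simp add: d_def)
    note G = gate_coordinate_estimates[OF \<epsilon>(1) e P dm d16[OF that(1)] v]
    show "0 < Re (\<epsilon> * v m)" "Re (\<epsilon> * v m) < pi" "0 < Re \<epsilon>" "norm \<epsilon> \<le> 4 / d m"
      "norm (sin (\<epsilon> * v m)) \<ge> norm \<epsilon> * d m / 16" "sin (\<epsilon> * v m) \<noteq> 0" "0 < Re (sin (\<epsilon> * v m))"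
      "norm (l m) \<le> 30 + ln (d m)" unfolding l_def by (rule G)+
  qed
  have \<epsilon>\<delta>: "norm \<epsilon> < \<delta>"
  proof -
    have "norm \<epsilon> \<le> 4 / d 0" by (rule coord(4)) (use v0 K in \<open>auto simp: vz c_def d_def\<close>)
    also have "\<dots> \<le> 4 / real K" using dK[of 0] K0 by (intro divide_left_mono) auto
    also have "\<dots> < 17 / real K" using K0 by (intro divide_strict_right_mono) auto
    also have "\<dots> \<le> \<delta>" using K(2) K0 \<delta> by (simp add: divide_le_eq mult.commute)
    finally show ?thesis .
  qed
  define I where "I = (\<lambda>m. P m \<in> Box \<and> cx (P m) * sin (\<epsilon> * v m) = - \<epsilon> * cos (\<epsilon> * v m))"
  have xest: "norm ((cx (P m))^2 + \<epsilon>^2) \<le> 256 / (d m)^2" "norm (cx (P m)) ^ 2 \<le> 272 / (d m)^2" "norm \<epsilon>^2 \<le> 16 / (d m)^2" "norm (cx (P m)) \<le> \<delta>"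
    if m: "m \<le> n" "norm (v m - c m) \<le> 3/4 * d m" "cx (P m) * sin (\<epsilon> * v m) = - \<epsilon> * cos (\<epsilon> * v m)" for m
  proof -
    have d0: "d m > 0" using d16[OF m(1)] by simp
    note g = gate_x_estimates[OF m(3) d0 coord(5,6,4)[OF m(1,2)]]
    show "norm ((cx (P m))^2 + \<epsilon>^2) \<le> 256 / (d m)^2" "norm (cx (P m)) ^ 2 \<le> 272 / (d m)^2" "norm \<epsilon>^2 \<le> 16 / (d m)^2"
      by (rule g)+
    have "17 / d m \<le> 17 / real K" using dK[OF m(1)] K0 by (intro divide_left_mono) auto
    also have "\<dots> \<le> \<delta>" using K(2) K0 \<delta> by (simp add: divide_le_eq mult.commute)
    finally show "norm (cx (P m)) \<le> \<delta>" using g(4) by simp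
  qed
  have ab: "norm (t m) \<le> 1/2" "1 + cx (P m) * b m \<noteq> 0" if "P m \<in> Box" for m
  proof -
    note A = a_bounds[OF \<epsilon>\<delta> BoxD(2,3)[OF that], folded b_def]
    show "norm (t m) \<le> 1/2" using A by (simp add: t_def b_def)
    show "1 + cx (P m) * b m \<noteq> 0"
    proof
      assume "1 + cx (P m) * b m = 0"
      then have "norm (cx (P m) * b m) = norm (- 1 :: complex)" by (metis add_eq_0_iff)
      then show False using A by (simp add: b_def)
    qed
  qed
  have concl: "I n \<and> norm (v n - c n) \<le> d n / 2 \<and> norm (cy (P n)) \<le> \<delta> \<and>
    norm (cy (P n)) \<le> lam ^ n * norm (cy (P 0)) + bootstrap_const lam gate_C r / (real K)^2 \<and>
    norm (v n + q * l n - (v 0 + q * l 0) - of_nat n) \<le> bootstrap_const lam gate_C r * (norm (cy (P 0)) + 1 / real K)"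
  proof (rule translation_bootstrap[OF lam C1 \<delta> K(1), where d = d and c = c and n = n])
    show "(\<Sum>m<n. 1 / (d m)^2) \<le> 4 / real K"
    proof -
      \<comment> \<open>The reciprocal square of a minimum is at most the sum of both reciprocal
        squares, and each of the two sums telescopes.\<close>
      have "(\<Sum>m<n. 1 / (d m)^2) \<le> (\<Sum>m<n. 1 / (real K + real m)^2 + 1 / (real (K + n) - real m)^2)"
      proof (rule sum_mono)
        fix m assume "m \<in> {..<n}"
        then have "real (K + n) - real m > 0" using K by simp
        then show "1 / (d m)^2 \<le> 1 / (real K + real m)^2 + 1 / (real (K + n) - real m)^2"
          by (auto simp: d_def min_def)
      qed
      also have "\<dots> \<le> 1 / (real K - 1) + 1 / real K"
        unfolding sum.distrib
      proof (rule add_mono)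
        have K2: "K \<ge> 2" using K(3) by simp
        have "0 \<le> 1 / (real K + real n - 1)" using K by simp
        then show "(\<Sum>m<n. 1 / (real K + real m)^2) \<le> 1 / (real K - 1)"
          using sum_inverse_squares_above[OF K2, of n] by linarith
        show "(\<Sum>m<n. 1 / (real (K + n) - real m)^2) \<le> 1 / real K"
          using sum_inverse_squares_below[of n "K + n"] K by simp
      qed
      also have "1 / (real K - 1) \<le> 2 / real K" using K(3) by (simp add: field_simps)
      finally have "(\<Sum>m<n. 1 / (d m)^2) \<le> 2 / real K + 1 / real K" by simp
      also have "\<dots> \<le> 4 / real K" using K0 by (simp add: divide_right_mono flip: add_divide_distrib)
      finally show ?thesis .
    qed
    show "I 0" using p v0 by (simp add: I_def P_def vz)
    show "norm (v 0 + q * l 0 - c 0) \<le> real K / 8" using v0(3) by (simp add: vz l_def c_def)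
    show "norm (v 0 - c 0) \<le> d 0 / 2" using v0(2) by (simp add: vz c_def d_def)
    show "norm (cy (P 0)) \<le> \<delta> / 2" using p by (simp add: P_def)
    show "norm (v (Suc m) - v m - 1) \<le> 1/2 \<and> norm (cy (P (Suc m))) \<le> lam * norm (cy (P m)) + gate_C / (d m)^2"
      if m: "m < n" "I m" "norm (v m - c m) \<le> d m / 2" "norm (cy (P m)) \<le> \<delta>" for m
    proof -
      have mm: "m \<le> n" "norm (v m - c m) \<le> 3/4 * d m" using m d16[of m] by auto
      have B: "P m \<in> Box" and rel: "cx (P m) * sin (\<epsilon> * v m) = - \<epsilon> * cos (\<epsilon> * v m)" using m(2) by (auto simp: I_def)
      have "norm (Arctan (t m) / \<epsilon> - 1) \<le> 1/2" using step[OF \<epsilon>\<delta> BoxD(2,3)[OF B] \<epsilon>(1)] by (simp add: t_def b_def)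
      moreover have "C * norm ((cx (P m))^2 + \<epsilon>^2) \<le> gate_C / (d m)^2"
      proof -
        have "C * norm ((cx (P m))^2 + \<epsilon>^2) \<le> C * (256 / (d m)^2)" using xest(1)[OF mm rel] C by (intro mult_left_mono) auto
        also have "\<dots> = (C * 256) / (d m)^2" by simp
        also have "\<dots> \<le> gate_C / (d m)^2" using C by (intro divide_right_mono) (auto simp: gate_C_def)
        finally show ?thesis .
      qed
      ultimately show ?thesis using F_Box(3)[OF B \<epsilon>\<delta>] by (simp add: vS PS)
    qed
    show "I (Suc m) \<and> norm (v (Suc m) + q * l (Suc m) - (v m + q * l m) - 1 - r * cy (P m)) \<le> gate_C * (1 / (d m)^2 + norm (cy (P m))^2)"
      if m: "m < n" "I m" "norm (v m - c m) \<le> d m / 2" "norm (cy (P m)) \<le> \<delta>" "norm (cy (P (Suc m))) \<le> \<delta>"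
        "norm (v (Suc m) - c (Suc m)) \<le> 3/4 * d (Suc m)" for m
    proof
      have mm: "m \<le> n" "norm (v m - c m) \<le> 3/4 * d m" and mS: "Suc m \<le> n" using m d16[of m] by auto
      have B: "P m \<in> Box" and rel: "cx (P m) * sin (\<epsilon> * v m) = - \<epsilon> * cos (\<epsilon> * v m)" using m(2) by (auto simp: I_def)
      have cxS: "cx (P (Suc m)) = cx (P m) + ((cx (P m))^2 + \<epsilon>^2) * b m" using F_Box(2)[OF B \<epsilon>\<delta>] by (simp add: PS b_def)
      have te: "t m = \<epsilon> * (b m / (1 + cx (P m) * b m))" by (simp add: t_def)
      note L = gate_lift_step[OF rel ab(2)[OF B] \<epsilon>(1) te ab(1)[OF B], folded vS cxS]
      show "I (Suc m)"
        using F_Box(1)[OF B \<epsilon>\<delta>] xest(4)[OF mS m(6) L(1)] m(5) L(1) by (simp add: I_def Box_def PS)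
      have q1: "sin (\<epsilon> * v (Suc m)) / sin (\<epsilon> * v m) = cos (Arctan (t m)) / (1 + cx (P m) * b m)"
        using L(2) coord(6)[OF mm] by simp
      have "Ln (sin (\<epsilon> * v (Suc m))) - Ln (sin (\<epsilon> * v m)) = Ln (cos (Arctan (t m)) / (1 + cx (P m) * b m))"
        using Ln_divide_Re_pos[OF coord(7)[OF mS m(6)] coord(7)[OF mm]] unfolding q1 by simp
      then have lS: "l (Suc m) = l m + Ln (cos (Arctan (t m)) / (1 + cx (P m) * b m))" by (simp add: l_def algebra_simps)
      have eq: "v (Suc m) + q * l (Suc m) - (v m + q * l m) - 1 - r * cy (P m) =
        Arctan (t m) / \<epsilon> + q * Ln (cos (Arctan (t m)) / (1 + cx (P m) * b m)) - 1 - r * cy (P m)"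
        unfolding lS vS by (simp add: algebra_simps)
      have "norm (v (Suc m) + q * l (Suc m) - (v m + q * l m) - 1 - r * cy (P m)) \<le> C * (norm (cx (P m))^2 + norm (cy (P m))^2 + norm \<epsilon>^2)"
        unfolding eq using step[OF \<epsilon>\<delta> BoxD(2,3)[OF B] \<epsilon>(1)] by (simp add: t_def b_def)
      also have "\<dots> \<le> C * (288 * (1 / (d m)^2) + 288 * norm (cy (P m))^2)"
      proof (rule mult_left_mono)
        have "norm (cx (P m))^2 + norm \<epsilon>^2 \<le> 272 / (d m)^2 + 16 / (d m)^2" using xest(2,3)[OF mm rel] by simp
        also have "\<dots> = 288 * (1 / (d m)^2)" by simp
        finally show "norm (cx (P m))^2 + norm (cy (P m))^2 + norm \<epsilon>^2 \<le> 288 * (1 / (d m)^2) + 288 * norm (cy (P m))^2"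
          using zero_le_power2[of "norm (cy (P m))"] by linarith
      qed (use C in simp)
      also have "\<dots> = (288 * C) * (1 / (d m)^2 + norm (cy (P m))^2)" by (simp add: algebra_simps)
      also have "\<dots> \<le> gate_C * (1 / (d m)^2 + norm (cy (P m))^2)"
        using C by (intro mult_right_mono) (auto simp: gate_C_def)
      finally show "norm (v (Suc m) + q * l (Suc m) - (v m + q * l m) - 1 - r * cy (P m)) \<le> gate_C * (1 / (d m)^2 + norm (cy (P m))^2)" .
    qed
    show "norm (l m) \<le> gate_C * (1 + ln (d m))" if m: "m \<le> n" "I m" "norm (v m - c m) \<le> 3/4 * d m" for m
    proof -
      have "ln (d m) \<ge> 0" using d16[OF m(1)] by simp
      then have "30 + ln (d m) \<le> 30 * (1 + ln (d m))" by simp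
      also have "\<dots> \<le> gate_C * (1 + ln (d m))" using C \<open>ln (d m) \<ge> 0\<close> by (intro mult_right_mono) (auto simp: gate_C_def)
      finally show ?thesis using coord(8)[OF m(1,3)] by simp
    qed
  qed (use dK in \<open>auto simp: c_def d_def\<close>)
  have dn: "d n = real K" by (simp add: d_def)
  have gn: "norm (v n - c n) \<le> 3/4 * d n" using concl dn by auto
  show thesis
  proof (rule that[of "v n"])
    show "0 < Re (sin (\<epsilon> * v n))" "0 < Re \<epsilon>" using coord(7,3)[OF order_refl gn] by auto
  qed (use concl dn in \<open>simp_all add: I_def P_def c_def l_def vz\<close>)
qed

end

section \<open>Comparing the gate coordinate with -1/x at the two ends\<close>

lemma Ln_times3_Re_pos:
  assumes "a = b * c * d" "0 < Re a" "0 < Re b" "0 < Re c" "0 < Re d"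
  shows "Ln a = Ln b + Ln c + Ln d"
proof -
  define z where "z = Ln a - (Ln b + Ln c + Ln d)"
  have nz: "a \<noteq> 0" "b \<noteq> 0" "c \<noteq> 0" "d \<noteq> 0" using assms by auto
  have "exp z = a / (b * c * d)" using nz by (simp add: z_def exp_diff exp_add)
  then have "exp z = 1" using assms(1) nz by simp
  then obtain n :: int where n: "Re z = 0" "Im z = of_int (2 * n) * pi" by (auto simp: exp_eq_1)
  \<comment> \<open>Four logarithms of numbers in the right half plane contribute less than pi/2
    each, which excludes nonzero multiples of \<open>2 * pi\<close>.\<close>
  have "\<bar>Im z\<bar> < 2 * pi"
    using Re_Ln_pos_lt_imp[OF assms(2)] Re_Ln_pos_lt_imp[OF assms(3)] Re_Ln_pos_lt_imp[OF assms(4)] Re_Ln_pos_lt_imp[OF assms(5)]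
    unfolding z_def minus_complex.simps plus_complex.simps by linarith
  then have "\<bar>of_int (2 * n)\<bar> * pi < 2 * pi" unfolding n abs_mult by simp
  then have "\<bar>of_int (2 * n)\<bar> < (2::real)" by simp
  then have "n = 0" by linarith
  then have "z = 0" using n by (simp add: complex_eq_iff)
  then show ?thesis by (simp add: z_def)
qed

lemma norm_tan_diff_le:
  fixes s :: complex
  assumes "norm s \<le> 1/10"
  shows "norm (tan s - s) \<le> 12 * norm s ^ 3" "cos s \<noteq> 0" "norm (Ln (cos s)) \<le> 6 * norm s ^ 2" "0 < Re (cos s)"
proof -
  have c: "norm (cos s - 1) \<le> 3 * norm s ^ 2" by (rule norm_cos_minus_one_le) (use assms in simp)
  have "norm s ^ 2 \<le> (1/10)^2" by (rule power_mono) (use assms in auto)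
  then have c1: "norm (cos s - 1) \<le> 3/100" using c by (simp add: power2_eq_square)
  have "1 - norm (cos s) \<le> norm (cos s - 1)" using norm_triangle_ineq2[of 1 "cos s"] by (simp add: norm_minus_commute)
  then have nc: "norm (cos s) \<ge> 1/2" using c1 by simp
  then show c0: "cos s \<noteq> 0" by auto
  show "0 < Re (cos s)"
    using abs_le_D2[OF order_trans[OF abs_Re_le_cmod c1]] by simp
  have "norm (Ln (1 + (cos s - 1))) \<le> 2 * norm (cos s - 1)" by (rule norm_Ln_one_plus_le) (use c1 in simp)
  then show "norm (Ln (cos s)) \<le> 6 * norm s ^ 2" using c by simp
  have "norm ((\<lambda>z. sin z - z) s - (\<lambda>z. sin z - z) 0) \<le> (3 * norm s ^ 2) * norm (s - 0)"
  proof (rule field_differentiable_bound[where f' = "\<lambda>z. cos z - 1" and S = "cball 0 (norm s)"])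
    fix z :: complex assume z: "z \<in> cball 0 (norm s)"
    have "norm (cos z - 1) \<le> 3 * norm z ^ 2" by (rule norm_cos_minus_one_le) (use z assms in simp)
    also have "\<dots> \<le> 3 * norm s ^ 2" using z by (simp add: power_mono)
    finally show "norm (cos z - 1) \<le> 3 * norm s ^ 2" .
  qed (auto intro!: derivative_eq_intros)
  then have s3: "norm (sin s - s) \<le> 3 * norm s ^ 3" by (simp add: power3_eq_cube power2_eq_square mult.assoc)
  have sc: "norm (s * (cos s - 1)) \<le> 3 * norm s ^ 3"
    unfolding norm_mult using mult_left_mono[OF c norm_ge_zero[of s]] by (simp add: power3_eq_cube power2_eq_square ac_simps)
  have "norm (sin s - s * cos s) \<le> 3 * norm s ^ 3 + 3 * norm s ^ 3"
    by (rule norm_diff_bound[OF _ s3 sc]) (simp add: algebra_simps)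
  then have "norm (sin s - s * cos s) / norm (cos s) \<le> 6 * norm s ^ 3 / (1/2)" using nc by (intro frac_le) auto
  moreover have "tan s - s = (sin s - s * cos s) / cos s" using c0 by (simp add: tan_def field_simps)
  ultimately show "norm (tan s - s) \<le> 12 * norm s ^ 3" by (simp add: norm_divide)
qed

text \<open>Let u be the displacement from an end of the gate; then
  \<open>tan (\<epsilon> * u) / \<epsilon>\<close> is -1/x up to sign. For bounded u and
  \<open>\<epsilon>\<close> tending to 0, the coordinate and its logarithmic correction turn into
  those of \<open>F 0\<close>.\<close>

lemma gate_coordinate_limit:
  fixes \<epsilon> u :: complex
  assumes \<epsilon>: "\<epsilon> \<noteq> 0" "0 < Re \<epsilon>" and s: "norm (\<epsilon> * u) \<le> \<sigma>" "\<sigma> \<le> 1/10" and u: "norm u \<le> B" and R: "0 < Re (sin (\<epsilon> * u))"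
  shows "norm (tan (\<epsilon> * u) / \<epsilon> - u) \<le> 12 * B * \<sigma>"
    and "0 < Re (tan (\<epsilon> * u) / \<epsilon>) \<Longrightarrow> norm (Ln (tan (\<epsilon> * u) / \<epsilon>) - (Ln (sin (\<epsilon> * u)) - Ln \<epsilon>)) \<le> 6 * \<sigma>"
proof -
  have s1: "norm (\<epsilon> * u) \<le> 1/10" using s by simp
  note t = norm_tan_diff_le[OF s1]
  have s0: "0 \<le> \<sigma>" using s(1) norm_ge_zero order_trans by blast
  have B0: "0 \<le> B" using u norm_ge_zero order_trans by blast
  have "norm (\<epsilon> * u) ^ 2 \<le> \<sigma> ^ 2" by (rule power_mono[OF s(1)]) simp
  also have "\<dots> \<le> 1 * \<sigma>" unfolding power2_eq_square using s s0 by (intro mult_right_mono) auto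
  finally have s2: "norm (\<epsilon> * u) ^ 2 \<le> \<sigma>" by simp
  have "tan (\<epsilon> * u) / \<epsilon> - u = (tan (\<epsilon> * u) - \<epsilon> * u) / \<epsilon>" using \<epsilon> by (simp add: field_simps)
  then have "norm (tan (\<epsilon> * u) / \<epsilon> - u) \<le> 12 * norm (\<epsilon> * u) ^ 3 / norm \<epsilon>"
    using t(1) by (simp add: norm_divide divide_right_mono)
  also have "\<dots> = 12 * (norm u * norm (\<epsilon> * u) ^ 2)" using \<epsilon> by (simp add: power3_eq_cube power2_eq_square norm_mult)
  also have "\<dots> \<le> 12 * (B * \<sigma>)" using u s2 B0 by (intro mult_left_mono mult_mono) auto
  finally show "norm (tan (\<epsilon> * u) / \<epsilon> - u) \<le> 12 * B * \<sigma>" by simp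
  assume T: "0 < Re (tan (\<epsilon> * u) / \<epsilon>)"
  have "sin (\<epsilon> * u) = \<epsilon> * (tan (\<epsilon> * u) / \<epsilon>) * cos (\<epsilon> * u)" using \<epsilon> t(2) by (simp add: tan_def)
  from Ln_times3_Re_pos[OF this R \<epsilon>(2) T t(4)]
  have "Ln (tan (\<epsilon> * u) / \<epsilon>) - (Ln (sin (\<epsilon> * u)) - Ln \<epsilon>) = - Ln (cos (\<epsilon> * u))" by simp
  then show "norm (Ln (tan (\<epsilon> * u) / \<epsilon>) - (Ln (sin (\<epsilon> * u)) - Ln \<epsilon>)) \<le> 6 * \<sigma>"
    using t(3) s2 by simp
qed

section \<open>Fixed numbers of steps at small parameters, and the passage between the two
  ends\<close>

context semiparabolic_family
begin

text \<open>Compactness transfers statements about \<open>F 0 ^^ K\<close> on \<open>QQ\<close> to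
  nearby parameters. In the coordinates \<open>vv\<close> and y the set is cut out by closed
  conditions in a bounded region where the logarithm is continuous.\<close>

lemma compact_QQ:
  assumes "K \<ge> 8"
  shows "compact (QQ K \<zeta> \<eta>)"
proof -
  define S where "S = {v \<in> cball (- of_nat K) (real K / 2). norm (v + q * Ln (- v) - (\<zeta> - of_nat K)) \<le> \<eta> \<and> norm (- 1 / v) \<le> \<delta>}"
  have half: "Re v < 0" if "v \<in> cball (- of_nat K) (real K / 2)" for v :: complex
    using left_half_ball(1)[of v K] that assms by (simp add: dist_norm norm_minus_commute add.commute)
  have nr: "- v \<notin> \<real>\<^sub>\<le>\<^sub>0" "v \<noteq> 0" if "v \<in> cball (- of_nat K) (real K / 2)" for v :: complex
    using half[OF that] by (auto simp: complex_nonpos_Reals_iff)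
  have "closed S"
  proof -
    have c1: "continuous_on (cball (- of_nat K) (real K / 2)) (\<lambda>v. norm (v + q * Ln (- v) - (\<zeta> - of_nat K)))"
      by (intro continuous_intros) (use nr in auto)
    have c2: "continuous_on (cball (- of_nat K) (real K / 2)) (\<lambda>v::complex. norm (- 1 / v))"
      by (intro continuous_intros) (use nr in auto)
    have "S = (cball (- of_nat K) (real K / 2) \<inter> (\<lambda>v. norm (v + q * Ln (- v) - (\<zeta> - of_nat K))) -` {..\<eta>})
        \<inter> (cball (- of_nat K) (real K / 2) \<inter> (\<lambda>v. norm (- 1 / v)) -` {..\<delta>})"
      by (auto simp: S_def)
    moreover have "closed (cball (- of_nat K) (real K / 2) \<inter> (\<lambda>v. norm (v + q * Ln (- v) - (\<zeta> - of_nat K))) -` {..\<eta>})"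
      by (rule continuous_closed_preimage[OF c1 closed_cball closed_atMost])
    moreover have "closed (cball (- of_nat K) (real K / 2) \<inter> (\<lambda>v::complex. norm (- 1 / v)) -` {..\<delta>})"
      by (rule continuous_closed_preimage[OF c2 closed_cball closed_atMost])
    ultimately show ?thesis by (simp only: closed_Int)
  qed
  then have "compact (cball (- of_nat K) (real K / 2) \<inter> S)" by (rule compact_Int_closed[OF compact_cball])
  moreover have "cball (- of_nat K) (real K / 2) \<inter> S = S" unfolding S_def by blast
  ultimately have "compact S" by simp
  then have c: "compact (S \<times> cball (0::complex) (min \<delta> \<eta>))" by (intro compact_Times) auto
  have "continuous_on (S \<times> cball 0 (min \<delta> \<eta>)) (\<lambda>w. (- 1 / fst w, snd w))"
    by (intro continuous_intros) (use nr in \<open>auto simp: S_def\<close>)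
  then have "continuous_on (S \<times> cball 0 (min \<delta> \<eta>)) (\<lambda>w. (\<lambda>(x, y). emb x y) (- 1 / fst w, snd w))"
    by (rule continuous_on_compose2[OF continuous_emb]) (auto simp: S_def)
  then have "compact ((\<lambda>w. (\<lambda>(x, y). emb x y) (- 1 / fst w, snd w)) ` (S \<times> cball 0 (min \<delta> \<eta>)))"
    by (rule compact_continuous_image[OF _ c])
  moreover have "(\<lambda>w. (\<lambda>(x, y). emb x y) (- 1 / fst w, snd w)) ` (S \<times> cball 0 (min \<delta> \<eta>)) = QQ K \<zeta> \<eta>"
  proof (intro equalityI subsetI)
    fix p assume "p \<in> (\<lambda>w. (\<lambda>(x, y). emb x y) (- 1 / fst w, snd w)) ` (S \<times> cball 0 (min \<delta> \<eta>))"
    then obtain v y where p: "p = emb (- 1 / v) y" "v \<in> S" "norm y \<le> \<delta>" "norm y \<le> \<eta>" by auto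
    have vb: "v \<in> cball (- of_nat K) (real K / 2)" and v1: "norm (- 1 / v) \<le> \<delta>" using p(2) by (auto simp: S_def)
    note e = emb_box[OF v1 p(3), folded p(1)]
    have vv: "vv p = v" using e(2) nr(2)[OF vb] by (simp add: vv_def)
    have w: "wout p = v + q * Ln (- v)" using wout_eq[of p] half[OF vb] unfolding vv by blast
    have "norm (vv p + of_nat K) \<le> real K / 2"
      using vb unfolding vv by (simp add: dist_norm norm_minus_commute add.commute)
    moreover have "norm (wout p - (\<zeta> - of_nat K)) \<le> \<eta>" using p(2) unfolding w S_def by blast
    moreover have "norm (cy p) \<le> \<eta>" using p(4) e(3) by simp
    ultimately show "p \<in> QQ K \<zeta> \<eta>" using e(5) unfolding QQ_def by blast
  next
    fix p assume "p \<in> QQ K \<zeta> \<eta>"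
    then have p: "p \<in> Box" "norm (vv p + of_nat K) \<le> real K / 2" "norm (wout p - (\<zeta> - of_nat K)) \<le> \<eta>" "norm (cy p) \<le> \<eta>"
      by (auto simp: QQ_def)
    have "- of_nat K - vv p = - (vv p + of_nat K)" by simp
    then have "dist (- of_nat K) (vv p) = norm (vv p + of_nat K)" unfolding dist_norm by (simp only: norm_minus_cancel)
    then have vb: "vv p \<in> cball (- of_nat K) (real K / 2)" using p(2) by simp
    have x: "- 1 / vv p = cx p" by (simp add: vv_def)
    have "vv p \<in> S" using p vb wout_eq[OF half[OF vb]] BoxD(2)[OF p(1)] unfolding S_def mem_Collect_eq x by simp
    moreover have "cy p \<in> cball 0 (min \<delta> \<eta>)" using p BoxD(3)[OF p(1)] by simp
    moreover have "p = (\<lambda>(x, y). emb x y) (- 1 / fst (vv p, cy p), snd (vv p, cy p))"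
      unfolding fst_conv snd_conv prod.case x by (rule emb_cx_cy[OF BoxD(1)[OF p(1)], symmetric])
    ultimately show "p \<in> (\<lambda>w. (\<lambda>(x, y). emb x y) (- 1 / fst w, snd w)) ` (S \<times> cball 0 (min \<delta> \<eta>))" by blast
  qed
  ultimately show ?thesis by simp
qed

lemma open_family_preimage: "open V \<Longrightarrow> open {w \<in> ball 0 \<delta> \<times> UNIV. (F (fst w) ^^ n) (snd w) \<in> V}"
proof -
  assume V: "open V"
  have o: "open (ball 0 \<delta> \<times> (UNIV :: 'a set))" by (intro open_Times) auto
  have "open ((ball 0 \<delta> \<times> UNIV) \<inter> (\<lambda>(\<epsilon>, p). (F \<epsilon> ^^ n) p) -` V)"
    by (rule continuous_open_preimage[OF continuous_F_funpow o V])
  moreover have "(ball 0 \<delta> \<times> UNIV) \<inter> (\<lambda>(\<epsilon>, p). (F \<epsilon> ^^ n) p) -` V = {w \<in> ball 0 \<delta> \<times> UNIV. (F (fst w) ^^ n) (snd w) \<in> V}"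
    by auto
  ultimately show ?thesis by simp
qed

text \<open>The tube lemma makes the admissible parameter range uniform over Q.\<close>

lemma compact_family_image:
  assumes "open V" "compact Q" "\<And>p. p \<in> Q \<Longrightarrow> (F 0 ^^ n) p \<in> V"
  obtains e where "e > 0" "\<And>\<epsilon> p. norm \<epsilon> < e \<Longrightarrow> p \<in> Q \<Longrightarrow> (F \<epsilon> ^^ n) p \<in> V"
proof -
  have "{0} \<times> Q \<subseteq> {w \<in> ball 0 \<delta> \<times> UNIV. (F (fst w) ^^ n) (snd w) \<in> V}" using assms(3) \<delta> by auto
  from Elementary_Topology.tube_lemma[OF assms(2) open_family_preimage[OF assms(1)] this]
  obtain X0 where X0: "0 \<in> X0" "open X0" "X0 \<times> Q \<subseteq> {w \<in> ball 0 \<delta> \<times> UNIV. (F (fst w) ^^ n) (snd w) \<in> V}" by blast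
  then obtain e where e: "e > 0" "ball 0 e \<subseteq> X0" using open_contains_ball_eq by blast
  show thesis
  proof (rule that[OF e(1)])
    fix \<epsilon> :: complex and p assume "norm \<epsilon> < e" "p \<in> Q"
    then have "(\<epsilon>, p) \<in> X0 \<times> Q" using e by auto
    then show "(F \<epsilon> ^^ n) p \<in> V" using X0(3) by force
  qed
qed

lemma family_neighbourhood:
  assumes "open V" "(F 0 ^^ n) p \<in> V"
  obtains e N where "e > 0" "open N" "p \<in> N" "\<And>\<epsilon> p'. norm \<epsilon> < e \<Longrightarrow> p' \<in> N \<Longrightarrow> (F \<epsilon> ^^ n) p' \<in> V"
proof -
  have "(0, p) \<in> {w \<in> ball 0 \<delta> \<times> UNIV. (F (fst w) ^^ n) (snd w) \<in> V}" using assms \<delta> by simp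
  from open_prod_elim[OF open_family_preimage[OF assms(1)] this]
  obtain X0 N where X0: "open X0" "open N" "(0, p) \<in> X0 \<times> N" "X0 \<times> N \<subseteq> {w \<in> ball 0 \<delta> \<times> UNIV. (F (fst w) ^^ n) (snd w) \<in> V}" by blast
  then obtain e where e: "e > 0" "ball 0 e \<subseteq> X0" using open_contains_ball_eq by blast
  show thesis
  proof (rule that[OF e(1) X0(2)])
    show "p \<in> N" using X0(3) by simp
    fix \<epsilon> :: complex and p' assume "norm \<epsilon> < e" "p' \<in> N"
    then have "(\<epsilon>, p') \<in> X0 \<times> N" using e by auto
    then show "(F \<epsilon> ^^ n) p' \<in> V" using X0(4) by force
  qed
qed

text \<open>The corrected coordinate starts near \<open>Z + K\<close> and gains n; at the exit
  \<open>wout\<close> is this value minus \<open>\<pi> / \<epsilon>\<close>. With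
  \<open>m = 2 * K + n\<close> the result is \<open>Z + (m - \<pi> / \<epsilon>) - K\<close>, close
  to \<open>Z + \<alpha> - K\<close>.\<close>

lemma gate_passage_to_QQ:
  assumes K: "real K \<ge> bootstrap_radius lam gate_C \<delta> q r" "real K \<ge> 17 / \<delta>" "K \<ge> 16"
      "norm Z + norm \<alpha> + 3 \<le> real K / 32" "norm Z + norm \<alpha> + 1 + norm q * (5 + ln (real K)) \<le> real K / 2"
      "bootstrap_const lam gate_C r / real K \<le> \<eta> / 8"
    and \<eta>: "0 < \<eta>" "\<eta> \<le> 1"
    and \<epsilon>: "\<epsilon> \<noteq> 0" "norm (of_nat m - of_real pi / \<epsilon> - \<alpha>) \<le> \<eta> / 8" "m \<ge> 2 * K"
    and \<sigma>: "4 * real K * norm \<epsilon> \<le> \<sigma>" "\<sigma> \<le> 1/20" "(48 * real K + 6 * norm q) * \<sigma> \<le> \<eta> / 8"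
    and p: "p \<in> Box" "norm (cy p) \<le> \<delta> / 2" "norm (cy p) \<le> \<eta> / 2" "bootstrap_const lam gate_C r * norm (cy p) \<le> \<eta> / 8"
      "norm (vv p - of_nat K) \<le> 3/8 * real K" "norm (win p - of_nat K - Z) \<le> \<eta> / 8"
  shows "(F \<epsilon> ^^ (m - 2 * K)) p \<in> QQ K (Z + \<alpha>) \<eta>"
proof -
  define n where "n = m - 2 * K"
  define C' where "C' = bootstrap_const lam gate_C r"
  have m: "m = 2 * K + n" using \<epsilon>(3) by (simp add: n_def)
  have C'0: "C' \<ge> 0" unfolding C'_def by (rule bootstrap_const_nonneg) (use lam C in \<open>auto simp: gate_C_def\<close>)
  have K16: "real K \<ge> 16" using K(3) by simp
  have \<sigma>0: "\<sigma> \<ge> 0" using \<sigma>(1) by (rule order_trans[rotated]) simp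
  have small: "12 * (2 * real K) * \<sigma> \<le> \<eta> / 8" "norm q * (6 * \<sigma>) \<le> \<eta> / 8"
    "12 * (2 * real K) * \<sigma> + norm q * (6 * \<sigma>) \<le> \<eta> / 8"
  proof -
    have "(48 * real K + 6 * norm q) * \<sigma> = 12 * (2 * real K) * \<sigma> + norm q * (6 * \<sigma>) + 24 * real K * \<sigma>" by (simp add: algebra_simps)
    moreover have "0 \<le> 24 * real K * \<sigma>" "0 \<le> norm q * (6 * \<sigma>)" using \<sigma>0 by simp_all
    ultimately show "12 * (2 * real K) * \<sigma> \<le> \<eta> / 8" "norm q * (6 * \<sigma>) \<le> \<eta> / 8"
      "12 * (2 * real K) * \<sigma> + norm q * (6 * \<sigma>) \<le> \<eta> / 8" using \<sigma>(3) by linarith+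
  qed
  define H where "H = of_real pi / \<epsilon>"
  have Hm: "norm (H - of_nat (2 * K + n)) \<le> real K / 32"
  proof -
    have "norm (of_nat m - H) \<le> \<eta> / 8 + norm \<alpha>" by (rule norm_add_bound[OF _ \<epsilon>(2) order_refl]) (simp add: H_def)
    then have "norm (H - of_nat (2 * K + n)) \<le> \<eta> / 8 + norm \<alpha>" unfolding m by (simp add: norm_minus_commute)
    then show ?thesis using K(4) \<eta> norm_ge_zero[of Z] by linarith
  qed
  have nvp: "norm (vv p) \<le> 2 * real K"
  proof -
    have "norm (vv p) \<le> 3/8 * real K + real K" by (rule norm_add_bound[OF _ p(5), of _ "of_nat K"]) auto
    then show ?thesis by simp
  qed
  have Revp: "Re (vv p) > 0"
  proof -
    have "\<bar>Re (vv p - of_nat K)\<bar> \<le> 3/8 * real K" using abs_Re_le_cmod p(5) order_trans by blast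
    from abs_le_D2[OF this] show ?thesis using K16 by simp
  qed
  have cxp: "cx p \<noteq> 0" using Revp by (auto simp: vv_def)
  \<comment> \<open>Solves the gate relation at the entrance, since
    \<open>tan (\<epsilon> * v0) = \<epsilon> * vv p\<close>.\<close>
  define v0 where "v0 = Arctan (\<epsilon> * vv p) / \<epsilon>"
  have ev0: "\<epsilon> * v0 = Arctan (\<epsilon> * vv p)" using \<epsilon>(1) by (simp add: v0_def)
  have eps2: "norm (\<epsilon> * vv p) \<le> \<sigma> / 2"
  proof -
    have "norm (\<epsilon> * vv p) \<le> norm \<epsilon> * (2 * real K)" unfolding norm_mult using nvp by (intro mult_left_mono) auto
    also have "norm \<epsilon> * (2 * real K) = (4 * real K * norm \<epsilon>) / 2" by simp
    also have "\<dots> \<le> \<sigma> / 2" using \<sigma>(1) by (intro divide_right_mono) auto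
    finally show ?thesis .
  qed
  have t: "norm (\<epsilon> * vv p) \<le> 1/2" using eps2 \<sigma> by simp
  note At = Arctan_small[OF t]
  have s0: "norm (\<epsilon> * v0) \<le> \<sigma>" unfolding ev0 using At(2) eps2 by simp
  have tan0: "tan (\<epsilon> * v0) / \<epsilon> = vv p" unfolding ev0 At(1) using \<epsilon>(1) by simp
  have v0v: "norm (v0 - vv p) \<le> 1"
  proof -
    have "norm (Arctan (\<epsilon> * vv p) - \<epsilon> * vv p) \<le> 2 * norm (\<epsilon> * vv p) ^ 3" by (rule norm_Arctan_diff_le[OF t])
    also have "\<dots> = norm \<epsilon> * (2 * norm (vv p) * norm (\<epsilon> * vv p)^2)" by (simp add: norm_mult power3_eq_cube power2_eq_square)
    finally have "norm \<epsilon> * norm (v0 - vv p) \<le> norm \<epsilon> * (2 * norm (vv p) * norm (\<epsilon> * vv p)^2)"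
      using \<epsilon>(1) by (simp add: v0_def right_diff_distrib flip: norm_mult)
    then have "norm (v0 - vv p) \<le> 2 * norm (vv p) * norm (\<epsilon> * vv p)^2" using \<epsilon>(1) by simp
    also have "\<dots> \<le> 2 * (2 * real K) * \<sigma>"
    proof (rule mult_mono)
      have "norm (\<epsilon> * vv p)^2 \<le> \<sigma>^2" using eps2 \<sigma>0 by (intro power_mono) auto
      also have "\<dots> \<le> 1 * \<sigma>" unfolding power2_eq_square using \<sigma> \<sigma>0 by (intro mult_right_mono) auto
      finally show "norm (\<epsilon> * vv p)^2 \<le> \<sigma>" by simp
    qed (use nvp in auto)
    also have "\<dots> \<le> 12 * (2 * real K) * \<sigma>" using \<sigma>0 by (simp add: mult_right_mono)
    also have "\<dots> \<le> 1" using small(1) \<eta> by simp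
    finally show ?thesis .
  qed
  have nv0: "norm v0 \<le> 2 * real K"
  proof -
    have "norm (v0 - of_nat K) \<le> 1 + 3/8 * real K" by (rule norm_add_bound[OF _ v0v p(5)]) simp
    then have "norm v0 \<le> (1 + 3/8 * real K) + real K" by (rule norm_add_bound[of v0 "v0 - of_nat K" "of_nat K", rotated]) auto
    then show ?thesis using K16 by simp
  qed
  have v0K: "norm (v0 - of_nat K) \<le> real K / 2"
  proof -
    have "norm (v0 - of_nat K) \<le> 1 + 3/8 * real K" by (rule norm_add_bound[OF _ v0v p(5)]) simp
    then show ?thesis using K16 by simp
  qed
  have gate0: "0 < Re \<epsilon>" "0 < Re (sin (\<epsilon> * v0))"
  proof -
    have e: "norm (of_real pi / \<epsilon> - of_real (real (2 * K + n))) \<le> real K / 32" using Hm by (simp add: H_def)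
    have P: "real (2 * K + n) = real K + real (K + n)" "real K \<le> real (K + n)" "2 * real K \<le> real (2 * K + n)" "0 < real K"
      using K16 by auto
    have d: "real K = min (real K) (real (K + n))" by simp
    have v: "norm (v0 - of_real (real K)) \<le> 3/4 * real K" using v0K by simp
    show "0 < Re \<epsilon>" "0 < Re (sin (\<epsilon> * v0))" using gate_coordinate_estimates[OF \<epsilon>(1) e P d K16 v] by blast+
  qed
  note G0 = gate_coordinate_limit[OF \<epsilon>(1) gate0(1) s0 _ nv0 gate0(2)]
  have \<sigma>10: "\<sigma> \<le> 1/10" using \<sigma> by simp
  define W0 where "W0 = v0 + q * (Ln (sin (\<epsilon> * v0)) - Ln \<epsilon>)"
  have W0: "norm (W0 - win p) \<le> \<eta> / 8"
  proof -
    have g1: "norm (vv p - v0) \<le> 12 * (2 * real K) * \<sigma>" using G0(1)[OF \<sigma>10] by (simp add: tan0)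
    have g2: "norm (q * (Ln (vv p) - (Ln (sin (\<epsilon> * v0)) - Ln \<epsilon>))) \<le> norm q * (6 * \<sigma>)"
      unfolding norm_mult using G0(2)[OF \<sigma>10] Revp by (intro mult_left_mono) (simp_all add: tan0)
    have "norm (win p - W0) \<le> 12 * (2 * real K) * \<sigma> + norm q * (6 * \<sigma>)"
      by (rule norm_add_bound[OF _ g1 g2]) (simp add: W0_def win_eq[OF Revp] algebra_simps)
    then show ?thesis using small(3) by (simp add: norm_minus_commute)
  qed
  have W0K: "norm (W0 - of_nat K - Z) \<le> \<eta> / 4"
  proof -
    have "norm (W0 - of_nat K - Z) \<le> \<eta> / 8 + \<eta> / 8" by (rule norm_add_bound[OF _ W0 p(6)]) simp
    then show ?thesis by simp
  qed
  have "norm (W0 - of_nat K) \<le> \<eta> / 4 + norm Z" by (rule norm_add_bound[OF _ W0K order_refl]) simp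
  then have W08: "norm (v0 + q * (Ln (sin (\<epsilon> * v0)) - Ln \<epsilon>) - of_nat K) \<le> real K / 8"
    using K(4) \<eta> norm_ge_zero[of \<alpha>] unfolding W0_def by linarith
  have rel0: "cx p * sin (\<epsilon> * v0) = - \<epsilon> * cos (\<epsilon> * v0)"
  proof -
    have "tan (\<epsilon> * v0) = \<epsilon> * vv p" unfolding ev0 by (rule At(1))
    then have "sin (\<epsilon> * v0) = \<epsilon> * vv p * cos (\<epsilon> * v0)"
      using At(3) unfolding ev0 tan_def by (simp add: divide_eq_eq)
    then show ?thesis using cxp by (simp add: vv_def)
  qed
  obtain vn where vn: "(F \<epsilon> ^^ n) p \<in> Box" "norm (vn - of_nat (K + n)) \<le> real K / 2"
    "cx ((F \<epsilon> ^^ n) p) * sin (\<epsilon> * vn) = - \<epsilon> * cos (\<epsilon> * vn)" "0 < Re (sin (\<epsilon> * vn))" "0 < Re \<epsilon>"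
    "norm (cy ((F \<epsilon> ^^ n) p)) \<le> lam ^ n * norm (cy p) + C' / (real K)^2"
    "norm (vn + q * (Ln (sin (\<epsilon> * vn)) - Ln \<epsilon>) - (v0 + q * (Ln (sin (\<epsilon> * v0)) - Ln \<epsilon>)) - of_nat n) \<le> C' * (norm (cy p) + 1 / real K)"
    unfolding C'_def using gate_orbit_bounds[OF K(1-3) \<epsilon>(1) Hm[unfolded H_def] p(1,2) rel0 v0K W08] by blast
  \<comment> \<open>Near the exit of the gate \<open>u = \<pi> / \<epsilon> - v\<close> plays the role that \<open>v\<close> has at the entrance.\<close>
  define z where "z = (F \<epsilon> ^^ n) p"
  define u where "u = H - vn"
  have evn: "\<epsilon> * vn = of_real pi - \<epsilon> * u" using \<epsilon>(1) by (simp add: u_def H_def field_simps)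
  have sn: "sin (\<epsilon> * vn) = sin (\<epsilon> * u)" and cn: "cos (\<epsilon> * vn) = - cos (\<epsilon> * u)"
    unfolding evn by (simp_all add: sin_diff cos_diff flip: sin_of_real cos_of_real)
  have uK: "norm (u - of_nat K) \<le> 17/32 * real K"
  proof -
    have "norm (u - of_nat K) \<le> real K / 32 + real K / 2" by (rule norm_diff_bound[OF _ Hm vn(2)]) (simp add: u_def)
    then show ?thesis by simp
  qed
  have nu: "norm u \<le> 2 * real K"
  proof -
    have "norm u \<le> 17/32 * real K + real K" by (rule norm_add_bound[OF _ uK, of _ "of_nat K"]) auto
    then show ?thesis by simp
  qed
  have su: "norm (\<epsilon> * u) \<le> \<sigma>"
  proof -
    have "norm (\<epsilon> * u) \<le> norm \<epsilon> * (2 * real K)" unfolding norm_mult using nu by (intro mult_left_mono) auto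
    also have "\<dots> \<le> 4 * real K * norm \<epsilon>" by simp
    finally show ?thesis using \<sigma>(1) by simp
  qed
  note G1 = gate_coordinate_limit[OF \<epsilon>(1) vn(5) su \<sigma>10 nu vn(4)[unfolded sn]]
  have cu: "cos (\<epsilon> * u) \<noteq> 0" by (rule norm_tan_diff_le(2)) (use su \<sigma>10 in simp)
  have su0: "sin (\<epsilon> * u) \<noteq> 0" using vn(4) unfolding sn by auto
  have rel: "cx z * sin (\<epsilon> * u) = \<epsilon> * cos (\<epsilon> * u)" using vn(3) by (simp add: sn cn z_def)
  have vz: "vv z = - (tan (\<epsilon> * u) / \<epsilon>)"
  proof -
    have "cx z = \<epsilon> * cos (\<epsilon> * u) / sin (\<epsilon> * u)" using rel su0 by (simp add: eq_divide_eq)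
    then show ?thesis using su0 cu \<epsilon>(1) by (simp add: vv_def tan_def)
  qed
  have g1: "norm (u - tan (\<epsilon> * u) / \<epsilon>) \<le> 12 * (2 * real K) * \<sigma>" using G1(1) by (simp add: norm_minus_commute)
  have uhK: "norm (- vv z - of_nat K) \<le> 3/4 * real K"
  proof -
    have "norm (- vv z - of_nat K) \<le> 17/32 * real K + 12 * (2 * real K) * \<sigma>"
      by (rule norm_diff_bound[OF _ uK g1]) (simp add: vz)
    then show ?thesis using small(1) \<eta> K16 by simp
  qed
  have uhK': "norm (- vv z - of_real (real K)) \<le> 3/4 * real K" using uhK by simp
  have K1: "\<bar>real K\<bar> \<ge> 1" "real K > 0" "real K \<ge> 4" using K16 by auto
  note h = norm_Ln_half_plane_le[OF K1(1,2) uhK' K1(3)]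
  have Rz: "Re (vv z) < 0" using h(2) by simp
  have T: "0 < Re (tan (\<epsilon> * u) / \<epsilon>)" using Rz by (simp add: vz)
  define Wn where "Wn = vn + q * (Ln (sin (\<epsilon> * vn)) - Ln \<epsilon>)"
  have e1: "norm (wout z - (Wn - H)) \<le> \<eta> / 8"
  proof -
    have g2: "norm (q * (Ln (- vv z) - (Ln (sin (\<epsilon> * u)) - Ln \<epsilon>))) \<le> norm q * (6 * \<sigma>)"
      unfolding norm_mult vz using G1(2)[OF T] by (intro mult_left_mono) simp_all
    have "norm (wout z - (Wn - H)) \<le> 12 * (2 * real K) * \<sigma> + norm q * (6 * \<sigma>)"
      by (rule norm_add_bound[OF _ g1 g2]) (simp add: wout_eq[OF Rz] Wn_def u_def sn[unfolded u_def] vz[unfolded u_def] algebra_simps)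
    then show ?thesis using small(3) by simp
  qed
  have e2: "norm (Wn - W0 - of_nat n) \<le> \<eta> / 4"
  proof -
    have "norm (Wn - W0 - of_nat n) \<le> C' * (norm (cy p) + 1 / real K)" using vn(7) by (simp add: Wn_def W0_def)
    also have "\<dots> = C' * norm (cy p) + C' / real K" by (simp add: distrib_left)
    also have "\<dots> \<le> \<eta> / 8 + \<eta> / 8" using p(4) K(6) by (intro add_mono) (simp_all add: C'_def)
    finally show ?thesis by simp
  qed
  \<comment> \<open>Error budget in units of \<open>\<eta>\<close>: exit 1/8, passage 1/4, entrance
    1/4, phase 1/8.\<close>
  have w: "norm (wout z - (Z + \<alpha> - of_nat K)) \<le> \<eta>"
  proof -
    have "norm (wout z - (Z + \<alpha> - of_nat K)) \<le> \<eta> / 8 + (\<eta> / 4 + (\<eta> / 4 + \<eta> / 8))"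
      by (rule norm_add_bound[OF _ e1 norm_add_bound[OF refl e2 norm_add_bound[OF refl W0K \<epsilon>(2)]]])
         (simp add: m H_def)
    then show ?thesis using \<eta> by simp
  qed
  have y: "norm (cy z) \<le> \<eta>"
  proof -
    have "lam ^ n * norm (cy p) \<le> 1 * norm (cy p)" using lam by (intro mult_right_mono power_le_one) auto
    moreover have "C' / (real K)^2 \<le> C' / real K" using C'0 K16 by (intro divide_left_mono) (auto simp: power2_eq_square)
    ultimately show ?thesis using vn(6) p(3) K(6) \<eta> unfolding z_def C'_def by linarith
  qed
  have vK: "norm (vv z + of_nat K) \<le> real K / 2"
  proof -
    have l: "norm (q * Ln (- vv z)) \<le> norm q * (5 + ln (real K))" unfolding norm_mult using h(1) by (intro mult_left_mono) auto
    have "norm (vv z + of_nat K) \<le> (\<eta> + (norm Z + norm \<alpha>)) + norm q * (5 + ln (real K))"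
      by (rule norm_diff_bound[OF _ norm_add_bound[OF refl w norm_triangle_ineq] l]) (simp add: wout_eq[OF Rz])
    then show ?thesis using K(5) \<eta> by simp
  qed
  show ?thesis using vn(1) vK w y by (simp add: QQ_def n_def[symmetric] z_def)
qed

end

section \<open>Iterates along an \<open>\<alpha>\<close>-sequence\<close>

locale gate_sequence = semiparabolic_family +
  fixes \<epsilon> :: "nat \<Rightarrow> complex" and n :: "nat \<Rightarrow> nat" and \<alpha> :: complex
  assumes \<epsilon>_nonzero: "\<epsilon> j \<noteq> 0" and \<epsilon>_tendsto: "\<epsilon> \<longlonglongrightarrow> 0"
    and n_at_top: "filterlim n at_top sequentially"
    and phase_tendsto: "(\<lambda>j. of_nat (n j) - of_real pi / \<epsilon> j) \<longlonglongrightarrow> \<alpha>"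
begin

definition T :: "'a \<Rightarrow> 'a" where "T p = Psi (fatou_in (F 0) \<phi> q p + \<alpha>)"

lemma open_basin: "open (basin (F 0) p0)"
proof (subst open_subopen, intro ballI)
  fix p assume "p \<in> basin (F 0) p0"
  then obtain N where N: "open N" "p \<in> N"
    "\<forall>V. open V \<and> p0 \<in> V \<longrightarrow> (\<forall>\<^sub>F n in sequentially. \<forall>z\<in>N. (F 0 ^^ n) z \<in> V)" by (auto simp: basin_def)
  then have "N \<subseteq> basin (F 0) p0" unfolding basin_def by blast
  with N show "\<exists>N. open N \<and> p \<in> N \<and> N \<subseteq> basin (F 0) p0" by blast
qed

text \<open>The condition on the real part keeps -1/x off the branch cut, so the remaining strict
  inequalities are open.\<close>

lemma open_incoming_domain:
  assumes "\<kappa> > 0"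
  shows "open {x. x \<noteq> 0 \<and> Re (- 1 / x) > 0 \<and> norm (- 1 / x - of_nat K) < 3/8 * real K \<and>
     norm (- 1 / x + q * Ln (- 1 / x) - of_nat K - Z) < \<kappa>}" (is "open ?X")
proof -
  define H0 where "H0 = {v :: complex. Re v > 0}"
  have H0: "open H0" unfolding H0_def by (rule open_halfspace_Re_gt)
  define g where "g v = v + q * Ln v - of_nat K - Z" for v
  have "continuous_on H0 g" unfolding g_def
    by (intro continuous_intros) (auto simp: H0_def complex_nonpos_Reals_iff)
  then have "open (H0 \<inter> g -` ball 0 \<kappa>)" by (rule continuous_open_preimage[OF _ H0 open_ball])
  then have H: "open ((H0 \<inter> g -` ball 0 \<kappa>) \<inter> ball (of_nat K) (3/8 * real K))" by (rule open_Int[OF _ open_ball])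
  have "continuous_on (- {0}) (\<lambda>x :: complex. - 1 / x)" by (intro continuous_intros) auto
  from continuous_open_preimage[OF this _ H]
  have "open (- {0} \<inter> (\<lambda>x. - 1 / x) -` ((H0 \<inter> g -` ball 0 \<kappa>) \<inter> ball (of_nat K) (3/8 * real K)))" by auto
  moreover have "- {0} \<inter> (\<lambda>x. - 1 / x) -` ((H0 \<inter> g -` ball 0 \<kappa>) \<inter> ball (of_nat K) (3/8 * real K)) = ?X"
    by (auto simp: H0_def g_def dist_norm norm_minus_commute simp del: minus_divide_left)
  ultimately show ?thesis by simp
qed

text \<open>The \<open>n j\<close> iterates split as \<open>K + (n j - 2 * K) + K\<close>. K is
  fixed first, from orbits of \<open>F 0\<close> alone; then \<open>\<epsilon>\<close> is made small
  enough for the outer blocks to be perturbations of \<open>F 0 ^^ K\<close>, and the middle block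
  is \<open>gate_passage_to_QQ\<close>.\<close>

lemma gate_passage:
  assumes p: "p \<in> basin (F 0) p0" and V: "open V" "T p \<in> V"
  shows "\<exists>N. open N \<and> p \<in> N \<and> (\<forall>\<^sub>F j in sequentially. \<forall>p'\<in>N. (F (\<epsilon> j) ^^ n j) p' \<in> V)"
proof -
  define Z where "Z = fatou_in (F 0) \<phi> q p"
  have "Psi (Z + \<alpha>) \<in> V" using V(2) by (simp add: T_def Z_def)
  from QQ_iterates_near_Psi[OF V(1) this] obtain \<eta>0 K1 where \<eta>0: "\<eta>0 > 0"
    "\<And>K p. K \<ge> K1 \<Longrightarrow> p \<in> QQ K (Z + \<alpha>) \<eta>0 \<Longrightarrow> (F 0 ^^ K) p \<in> V" by metis
  define \<eta> where "\<eta> = min \<eta>0 1"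
  have \<eta>: "0 < \<eta>" "\<eta> \<le> 1" "\<eta> \<le> \<eta>0" using \<eta>0 by (auto simp: \<eta>_def)
  define C' where "C' = bootstrap_const lam gate_C r"
  have C'0: "C' \<ge> 0" unfolding C'_def by (rule bootstrap_const_nonneg) (use lam C in \<open>auto simp: gate_C_def\<close>)
  \<comment> \<open>The bound on y at the entrance: within half the polydisc, within half the target
    tolerance, and with \<open>C' * c0 \<le> \<eta> / 8\<close>.\<close>
  define c0 where "c0 = min (\<delta> / 2) (min (\<eta> / 2) (\<eta> / (8 * (C' + 1))))"
  have c0: "c0 > 0" "c0 \<le> \<delta> / 2" "c0 \<le> \<eta> / 2" "c0 \<le> \<eta> / (8 * (C' + 1))"
  proof -
    have "0 < \<eta> / (8 * (C' + 1))" using \<eta>(1) C'0 by simp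
    with \<delta>(1) \<eta>(1) show "c0 > 0" unfolding c0_def min_less_iff_conj by linarith
    show "c0 \<le> \<delta> / 2" unfolding c0_def by (rule min.cobounded1)
    show "c0 \<le> \<eta> / 2" unfolding c0_def by (rule min.coboundedI2[OF min.cobounded1])
    show "c0 \<le> \<eta> / (8 * (C' + 1))" unfolding c0_def by (rule min.coboundedI2[OF min.cobounded2])
  qed
  have C'c0: "C' * c0 \<le> \<eta> / 8"
  proof -
    have "C' * c0 \<le> (C' + 1) * (\<eta> / (8 * (C' + 1)))" by (rule mult_mono) (use c0 C'0 in auto)
    also have "\<dots> = \<eta> / 8" using C'0 by (simp add: field_simps)
    finally show ?thesis .
  qed
  define X where "X = max (max (bootstrap_radius lam gate_C \<delta> q r) (17 / \<delta>)) (max (32 * (norm Z + norm \<alpha> + 3)) (8 * C' / \<eta>))"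
  have "\<forall>\<^sub>F K in sequentially. (K \<ge> K1 \<and> K \<ge> 16) \<and> real K \<ge> X \<and>
      (norm Z + norm \<alpha> + 1 + 5 * norm q) + norm q * (ln (2 * real K) + pi) \<le> 1/2 * real K \<and>
      ((F 0 ^^ K) p \<in> Box \<and> Re (vv ((F 0 ^^ K) p)) > 0 \<and> norm (vv ((F 0 ^^ K) p) - of_nat K) \<le> real K / 4) \<and>
      dist (win ((F 0 ^^ K) p) - of_nat K) Z < \<eta> / 8 \<and> dist (cy ((F 0 ^^ K) p)) 0 < c0"
  proof (intro eventually_conj)
    show "\<forall>\<^sub>F K in sequentially. real K \<ge> X"
      by (rule eventually_compose_filterlim[OF eventually_ge_at_top filterlim_real_sequentially])
    show "\<forall>\<^sub>F K in sequentially. dist (win ((F 0 ^^ K) p) - of_nat K) Z < \<eta> / 8"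
      by (rule tendstoD[OF basin_asymptotics(2)[OF p, folded Z_def]]) (use \<eta> in auto)
    show "\<forall>\<^sub>F K in sequentially. dist (cy ((F 0 ^^ K) p)) 0 < c0"
      by (rule tendstoD[OF basin_asymptotics(3)[OF p] c0(1)])
    show "\<forall>\<^sub>F K in sequentially. (norm Z + norm \<alpha> + 1 + 5 * norm q) + norm q * (ln (2 * real K) + pi) \<le> 1/2 * real K"
      by (rule eventually_log_small) simp
    have b: "\<forall>\<^sub>F K in sequentially. (F 0 ^^ K) p \<in> Box \<and> Re (vv ((F 0 ^^ K) p)) > 0 \<and>
       norm (vv ((F 0 ^^ K) p) - of_nat K) \<le> real K / 4" by (rule basin_asymptotics(1)[OF p])
    show "\<forall>\<^sub>F K in sequentially. (F 0 ^^ K) p \<in> Box" "\<forall>\<^sub>F K in sequentially. Re (vv ((F 0 ^^ K) p)) > 0"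
      "\<forall>\<^sub>F K in sequentially. norm (vv ((F 0 ^^ K) p) - of_nat K) \<le> real K / 4"
      using b by (auto elim: eventually_mono)
  qed (rule eventually_ge_at_top)+
  from eventually_happens'[OF sequentially_bot this] obtain K where
    K: "K \<ge> K1" "K \<ge> 16" "real K \<ge> X"
      "(norm Z + norm \<alpha> + 1 + 5 * norm q) + norm q * (ln (2 * real K) + pi) \<le> 1/2 * real K" and
    P: "(F 0 ^^ K) p \<in> Box" "Re (vv ((F 0 ^^ K) p)) > 0" "norm (vv ((F 0 ^^ K) p) - of_nat K) \<le> real K / 4"
      "dist (win ((F 0 ^^ K) p) - of_nat K) Z < \<eta> / 8" "dist (cy ((F 0 ^^ K) p)) 0 < c0" by blast
  have KX: "real K \<ge> bootstrap_radius lam gate_C \<delta> q r" "real K \<ge> 17 / \<delta>" "32 * (norm Z + norm \<alpha> + 3) \<le> real K" "8 * C' / \<eta> \<le> real K"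
    using K(3) by (auto simp: X_def)
  have K16: "real K \<ge> 16" using K(2) by simp
  have Klin: "norm Z + norm \<alpha> + 3 \<le> real K / 32" using KX(3) by simp
  have Klog: "norm Z + norm \<alpha> + 1 + norm q * (5 + ln (real K)) \<le> real K / 2"
  proof -
    have "ln (real K) \<le> ln (2 * real K)" using K16 by simp
    then have "ln (real K) \<le> ln (2 * real K) + pi" using pi_gt_zero by (rule add_increasing2[OF less_imp_le, rotated])
    then have "norm q * ln (real K) \<le> norm q * (ln (2 * real K) + pi)" by (rule mult_left_mono) simp
    moreover have "norm q * (5 + ln (real K)) = 5 * norm q + norm q * ln (real K)" by (simp add: algebra_simps)
    ultimately show ?thesis using K(4) by linarith
  qed
  have KC: "C' / real K \<le> \<eta> / 8"
  proof -
    have "8 * C' \<le> real K * \<eta>" using KX(4) unfolding pos_divide_le_eq[OF \<eta>(1)] .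
    then have "C' \<le> \<eta> / 8 * real K" by (simp add: mult.commute)
    moreover have "real K > 0" using K16 by simp
    ultimately show ?thesis by (simp only: pos_divide_le_eq)
  qed
  define P where "P = (F 0 ^^ K) p"
  define Y where "Y = {x. x \<noteq> 0 \<and> Re (- 1 / x) > 0 \<and> norm (- 1 / x - of_nat K) < 3/8 * real K \<and>
     norm (- 1 / x + q * Ln (- 1 / x) - of_nat K - Z) < \<eta> / 8}"
  have Y: "open Y" unfolding Y_def by (rule open_incoming_domain) (use \<eta> in simp)
  define W where "W = (U \<inter> cx -` Y) \<inter> {p \<in> U. norm (cx p) < \<delta> \<and> norm (cy p) < c0}"
  have W: "open W" unfolding W_def
    by (intro open_Int open_small_box continuous_open_preimage[OF continuous_cx chartU(1) Y])
  have WD: "p' \<in> Box \<and> norm (cy p') \<le> c0 \<and> norm (vv p' - of_nat K) \<le> 3/8 * real K \<and> norm (win p' - of_nat K - Z) \<le> \<eta> / 8"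
    if "p' \<in> W" for p'
  proof -
    have b: "p' \<in> U" "norm (cx p') < \<delta>" "norm (cy p') < c0" and y: "cx p' \<in> Y" using that by (auto simp: W_def)
    from y have "Re (vv p') > 0" "norm (vv p' - of_nat K) < 3/8 * real K"
      "norm (vv p' + q * Ln (vv p') - of_nat K - Z) < \<eta> / 8" unfolding Y_def vv_def by blast+
    then show ?thesis using b c0 \<delta> win_eq[of p'] by (simp add: Box_def)
  qed
  have PW: "P \<in> W"
  proof -
    have nz: "cx P \<noteq> 0" using P(2) unfolding P_def[symmetric] vv_def by auto
    have "real K \<le> norm (vv P - of_nat K) + norm (vv P)"
      using norm_triangle_ineq4[of "vv P" "vv P - of_nat K"] by simp
    then have nv: "3/4 * real K \<le> norm (vv P)" using P(3) unfolding P_def[symmetric] by simp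
    have "norm (cx P) < \<delta>"
    proof (rule ccontr)
      assume "\<not> norm (cx P) < \<delta>"
      then have "\<delta> * (3/4 * real K) \<le> norm (cx P) * norm (vv P)" using nv \<delta> by (intro mult_mono) auto
      also have "\<dots> = 1" using nz by (simp add: vv_def norm_divide)
      finally have "\<delta> * real K \<le> 4/3" by simp
      moreover have "17 \<le> \<delta> * real K" using KX(2) \<delta> by (simp add: field_simps)
      ultimately show False by simp
    qed
    moreover have "cx P \<in> Y"
    proof -
      have v: "Re (vv P) > 0" "norm (vv P - of_nat K) < 3/8 * real K" "norm (win P - of_nat K - Z) < \<eta> / 8"
        using P K16 unfolding P_def[symmetric] dist_norm by auto
      then have "norm (vv P + q * Ln (vv P) - of_nat K - Z) < \<eta> / 8" using win_eq by simp
      with v nz show ?thesis unfolding Y_def vv_def by blast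
    qed
    ultimately show ?thesis using P(1,5) unfolding P_def[symmetric] W_def by (simp add: Box_def)
  qed
  obtain e1 N where N: "e1 > 0" "open N" "p \<in> N" "\<And>\<epsilon> p'. norm \<epsilon> < e1 \<Longrightarrow> p' \<in> N \<Longrightarrow> (F \<epsilon> ^^ K) p' \<in> W"
    using family_neighbourhood[OF W PW[unfolded P_def]] by metis
  have cQ: "compact (QQ K (Z + \<alpha>) \<eta>)" by (rule compact_QQ) (use K(2) in simp)
  have "(F 0 ^^ K) p' \<in> V" if "p' \<in> QQ K (Z + \<alpha>) \<eta>" for p'
    by (rule \<eta>0(2)[OF K(1)]) (use that QQ_mono[OF \<eta>(3)] in blast)
  from compact_family_image[OF V(1) cQ this]
  obtain e2 where e2: "e2 > 0" "\<And>\<epsilon> p'. norm \<epsilon> < e2 \<Longrightarrow> p' \<in> QQ K (Z + \<alpha>) \<eta> \<Longrightarrow> (F \<epsilon> ^^ K) p' \<in> V" by metis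
  define s where "s = 48 * real K + 6 * norm q + 1"
  have s: "s > 0" unfolding s_def by (simp add: add_nonneg_pos)
  \<comment> \<open>Bounds \<open>\<epsilon>\<close> times positions of order K at the ends of the
    gate, hence is chosen after K.\<close>
  define \<sigma> where "\<sigma> = min (1/20) (\<eta> / (8 * s))"
  have \<sigma>: "\<sigma> > 0" "\<sigma> \<le> 1/20" using s \<eta> by (auto simp: \<sigma>_def)
  have "(48 * real K + 6 * norm q) * \<sigma> \<le> s * (\<eta> / (8 * s))"
    by (rule mult_mono) (use s \<sigma> in \<open>auto simp: s_def \<sigma>_def\<close>)
  also have "\<dots> = \<eta> / 8" using s by simp
  finally have \<sigma>s: "(48 * real K + 6 * norm q) * \<sigma> \<le> \<eta> / 8" .
  define e where "e = min (\<sigma> / (4 * real K)) (min e1 e2)"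
  have e: "e > 0" using \<sigma> K16 N e2 by (simp add: e_def)
  have "\<forall>\<^sub>F j in sequentially. dist (\<epsilon> j) 0 < e" by (rule tendstoD[OF \<epsilon>_tendsto e])
  moreover have "\<forall>\<^sub>F j in sequentially. dist (of_nat (n j) - of_real pi / \<epsilon> j) \<alpha> < \<eta> / 8"
    by (rule tendstoD[OF phase_tendsto]) (use \<eta> in simp)
  moreover have "\<forall>\<^sub>F j in sequentially. 2 * K \<le> n j"
    by (rule eventually_compose_filterlim[OF eventually_ge_at_top n_at_top])
  ultimately have "\<forall>\<^sub>F j in sequentially. \<forall>p'\<in>N. (F (\<epsilon> j) ^^ n j) p' \<in> V"
  proof eventually_elim
    case (elim j)
    have small: "norm (\<epsilon> j) < e1" "norm (\<epsilon> j) < e2" "norm (\<epsilon> j) < \<sigma> / (4 * real K)" using elim(1) by (auto simp: e_def)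
    then have \<sigma>e: "4 * real K * norm (\<epsilon> j) \<le> \<sigma>" using K16 by (simp add: field_simps)
    show ?case
    proof
      fix p' assume "p' \<in> N"
      then have "(F (\<epsilon> j) ^^ K) p' \<in> W" by (rule N(4)[OF small(1)])
      note w = WD[OF this]
      define p1 where "p1 = (F (\<epsilon> j) ^^ K) p'"
      have w: "p1 \<in> Box" "norm (cy p1) \<le> c0" "norm (vv p1 - of_nat K) \<le> 3/8 * real K" "norm (win p1 - of_nat K - Z) \<le> \<eta> / 8"
        using w by (auto simp: p1_def)
      have "C' * norm (cy p1) \<le> C' * c0" using w C'0 by (intro mult_left_mono)
      then have cy: "norm (cy p1) \<le> \<delta> / 2" "norm (cy p1) \<le> \<eta> / 2" "bootstrap_const lam gate_C r * norm (cy p1) \<le> \<eta> / 8"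
        using w(2) c0 C'c0 unfolding C'_def[symmetric] by linarith+
      have "(F (\<epsilon> j) ^^ (n j - 2 * K)) p1 \<in> QQ K (Z + \<alpha>) \<eta>"
        by (rule gate_passage_to_QQ[OF KX(1,2) K(2) Klin Klog KC[unfolded C'_def] \<eta>(1,2) \<epsilon>_nonzero _ elim(3) \<sigma>e \<sigma>(2) \<sigma>s w(1) cy w(3,4)])
          (use elim(2) in \<open>simp add: dist_norm\<close>)
      then have "(F (\<epsilon> j) ^^ K) ((F (\<epsilon> j) ^^ (n j - 2 * K)) p1) \<in> V" by (rule e2(2)[OF small(2)])
      moreover have "n j = K + ((n j - 2 * K) + K)" using elim(3) by simp
      then have "F (\<epsilon> j) ^^ n j = F (\<epsilon> j) ^^ K \<circ> (F (\<epsilon> j) ^^ (n j - 2 * K) \<circ> F (\<epsilon> j) ^^ K)" by (metis funpow_add)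
      ultimately show "(F (\<epsilon> j) ^^ n j) p' \<in> V" by (simp add: p1_def)
    qed
  qed
  with N show ?thesis by blast
qed

lemma gate_passage_tendsto:
  assumes "p \<in> basin (F 0) p0"
  shows "(\<lambda>j. (F (\<epsilon> j) ^^ n j) p) \<longlonglongrightarrow> T p"
proof (rule topological_tendstoI)
  fix V assume "open V" "T p \<in> V"
  from gate_passage[OF assms this] obtain N where "p \<in> N" "\<forall>\<^sub>F j in sequentially. \<forall>p'\<in>N. (F (\<epsilon> j) ^^ n j) p' \<in> V" by blast
  then show "\<forall>\<^sub>F j in sequentially. (F (\<epsilon> j) ^^ n j) p \<in> V" by (auto elim: eventually_mono)
qed

text \<open>Aiming at V' with closure inside V keeps the limits \<open>T p'\<close> in V as well; in
  this form the passage can be iterated.\<close>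

lemma gate_passage_uniform:
  assumes p: "p \<in> basin (F 0) p0" and V: "open V" "T p \<in> V"
  obtains N where "open N" "p \<in> N" "N \<subseteq> basin (F 0) p0" "\<forall>p'\<in>N. T p' \<in> V"
    "\<forall>\<^sub>F j in sequentially. \<forall>p'\<in>N. (F (\<epsilon> j) ^^ n j) p' \<in> V"
proof -
  obtain V1 \<psi> where V1: "(V1, \<psi>) \<in> A" "T p \<in> V1" using complex_surface_chart_at[OF surface] by metis
  obtain V' where V': "open V'" "T p \<in> V'" "closure V' \<subseteq> V"
    using chart_closed_neighbourhood[OF holo_chart_is_chart[OF complex_surface_holo_chart[OF surface V1(1)]] V1(2) V] by metis
  obtain N where N: "open N" "p \<in> N" "\<forall>\<^sub>F j in sequentially. \<forall>p'\<in>N. (F (\<epsilon> j) ^^ n j) p' \<in> V'"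
    using gate_passage[OF p V'(1,2)] by blast
  show thesis
  proof (rule that)
    show "open (N \<inter> basin (F 0) p0)" by (intro open_Int N open_basin)
    show "\<forall>\<^sub>F j in sequentially. \<forall>p'\<in>N \<inter> basin (F 0) p0. (F (\<epsilon> j) ^^ n j) p' \<in> V"
      using N(3) by eventually_elim (use V'(3) closure_subset in blast)
    show "\<forall>p'\<in>N \<inter> basin (F 0) p0. T p' \<in> V"
    proof
      fix p' assume p': "p' \<in> N \<inter> basin (F 0) p0"
      have "\<forall>\<^sub>F j in sequentially. (F (\<epsilon> j) ^^ n j) p' \<in> closure V'"
        using N(3) by eventually_elim (use p' closure_subset in blast)
      from Lim_in_closed_set[OF closed_closure this sequentially_bot gate_passage_tendsto]
      show "T p' \<in> V" using p' V'(3) by blast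
    qed
  qed (use p N in auto)
qed

text \<open>The induction needs neighbourhoods instead of points: the i-th images move with j, and
  the next passage must work for all of them at once.\<close>

lemma iterated_gate_passage:
  assumes "\<And>i'. i' < i \<Longrightarrow> (T ^^ i') p \<in> basin (F 0) p0" "open V" "(T ^^ i) p \<in> V"
  shows "\<exists>N. open N \<and> p \<in> N \<and> (\<forall>p'\<in>N. (\<forall>i'<i. (T ^^ i') p' \<in> basin (F 0) p0) \<and> (T ^^ i) p' \<in> V) \<and>
    (\<forall>\<^sub>F j in sequentially. \<forall>p'\<in>N. (F (\<epsilon> j) ^^ (i * n j)) p' \<in> V)"
  using assms
proof (induction i arbitrary: V)
  case 0
  then show ?case by (intro exI[of _ V]) auto
next
  case (Suc i)
  have b: "(T ^^ i) p \<in> basin (F 0) p0" by (rule Suc.prems(1)) simp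
  have TV: "T ((T ^^ i) p) \<in> V" using Suc.prems(3) by simp
  obtain M where M: "open M" "(T ^^ i) p \<in> M" "M \<subseteq> basin (F 0) p0" "\<forall>p'\<in>M. T p' \<in> V"
    "\<forall>\<^sub>F j in sequentially. \<forall>p'\<in>M. (F (\<epsilon> j) ^^ n j) p' \<in> V"
    by (rule gate_passage_uniform[OF b Suc.prems(2) TV]) (rule that)
  obtain N where N: "open N" "p \<in> N" "\<forall>p'\<in>N. (\<forall>i'<i. (T ^^ i') p' \<in> basin (F 0) p0) \<and> (T ^^ i) p' \<in> M"
    "\<forall>\<^sub>F j in sequentially. \<forall>p'\<in>N. (F (\<epsilon> j) ^^ (i * n j)) p' \<in> M"
    using Suc.IH[OF Suc.prems(1) M(1,2)] by auto
  have "\<forall>\<^sub>F j in sequentially. \<forall>p'\<in>N. (F (\<epsilon> j) ^^ (Suc i * n j)) p' \<in> V"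
    using N(4) M(5) by eventually_elim (simp add: funpow_add)
  moreover have "(\<forall>i'<Suc i. (T ^^ i') p' \<in> basin (F 0) p0) \<and> (T ^^ Suc i) p' \<in> V" if "p' \<in> N" for p'
    using N(3) that M(3,4) by (auto simp: less_Suc_eq)
  ultimately show ?case using N(1,2) by blast
qed

lemma iterated_gate_passage_tendsto:
  assumes "\<And>i'. i' < i \<Longrightarrow> (T ^^ i') p \<in> basin (F 0) p0"
  shows "(\<lambda>j. (F (\<epsilon> j) ^^ (i * n j)) p) \<longlonglongrightarrow> (T ^^ i) p"
proof (rule topological_tendstoI)
  fix V assume "open V" "(T ^^ i) p \<in> V"
  from iterated_gate_passage[OF assms this] obtain N
    where "p \<in> N" "\<forall>\<^sub>F j in sequentially. \<forall>p'\<in>N. (F (\<epsilon> j) ^^ (i * n j)) p' \<in> V" by blast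
  then show "\<forall>\<^sub>F j in sequentially. (F (\<epsilon> j) ^^ (i * n j)) p \<in> V" by (auto elim: eventually_mono)
qed

lemma funpow_T_Psi: "(T ^^ i) (Psi \<zeta>) = Psi ((transition (F 0) p0 \<phi> q \<alpha> ^^ i) \<zeta>)"
  by (induction i) (simp_all add: T_def transition_def fatou_out_inv_eq_Psi)

lemma saddle_points_near_repelling_point:
  assumes \<zeta>: "\<zeta> \<in> repelling_points (transition_domain (F 0) p0 \<phi> q) (transition (F 0) p0 \<phi> q \<alpha>)"
    and V: "open V" "Psi \<zeta> \<in> V"
  shows "\<forall>\<^sub>F j in sequentially. \<exists>p\<in>V. saddle_periodic A (F (\<epsilon> j)) p"
proof -
  define h where "h = transition (F 0) p0 \<phi> q \<alpha>"
  obtain k D where k: "k \<ge> 1" "(h ^^ k) \<zeta> = \<zeta>" "((h ^^ k) has_field_derivative D) (at \<zeta>)" "norm D > 1"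
    and dom: "\<And>i. (h ^^ i) \<zeta> \<in> transition_domain (F 0) p0 \<phi> q"
    using \<zeta> unfolding repelling_points_def h_def by blast
  have TP: "(T ^^ i) (Psi \<zeta>') = Psi ((h ^^ i) \<zeta>')" for i \<zeta>' unfolding h_def by (rule funpow_T_Psi)
  have bas: "(T ^^ i) (Psi \<zeta>) \<in> basin (F 0) p0" for i
    unfolding TP by (rule Psi_basin_if_transition_domain[OF dom])
  obtain V1 \<psi> where V1: "(V1, \<psi>) \<in> A" "Psi \<zeta> \<in> V1" using complex_surface_chart_at[OF surface] by metis
  have hc: "holo_chart A (V1, \<psi>)" by (rule complex_surface_holo_chart[OF surface V1(1)])
  note c = is_chartD[OF holo_chart_is_chart[OF hc]]
  define z0 where "z0 = \<psi> (Psi \<zeta>)"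
  \<comment> \<open>A bounded coordinate neighbourhood: iterates landing in it have coordinates of
    norm at most \<open>norm z0 + 1\<close>, the common bound that
    \<open>saddle_fixed_points_near_rank_one_limit\<close> asks for.\<close>
  define V2 where "V2 = V1 \<inter> \<psi> -` ball z0 1"
  have V2: "open V2" unfolding V2_def by (rule continuous_open_preimage[OF c(3,1) open_ball])
  have "(T ^^ k) (Psi \<zeta>) \<in> V2" using V1(2) by (simp add: TP k(2) V2_def z0_def)
  from iterated_gate_passage[OF bas V2 this] obtain N where N: "open N" "Psi \<zeta> \<in> N"
    "\<And>p i. p \<in> N \<Longrightarrow> i < k \<Longrightarrow> (T ^^ i) p \<in> basin (F 0) p0" "\<And>p. p \<in> N \<Longrightarrow> (T ^^ k) p \<in> V2"
    "\<forall>\<^sub>F j in sequentially. \<forall>p\<in>N. (F (\<epsilon> j) ^^ (k * n j)) p \<in> V2" by blast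
  have "open (\<psi> ` (V1 \<inter> (N \<inter> V)))" by (intro open_chart_image[OF holo_chart_is_chart[OF hc]] open_Int N(1) V(1))
  moreover have "z0 \<in> \<psi> ` (V1 \<inter> (N \<inter> V))" using V1(2) N(2) V(2) by (simp add: z0_def)
  ultimately obtain s where s: "s > 0" "ball z0 s \<subseteq> \<psi> ` (V1 \<inter> (N \<inter> V))" using open_contains_ball_eq by blast
  define P where "P = inv_into V1 \<psi>"
  have P: "P z \<in> V1" "P z \<in> N" "P z \<in> V" "\<psi> (P z) = z" if z: "z \<in> ball z0 s" for z
  proof -
    obtain p where p: "p \<in> V1 \<inter> (N \<inter> V)" "z = \<psi> p" using s(2) z by blast
    then have "P z = p" using c(6) by (simp add: P_def)
    with p show "P z \<in> V1" "P z \<in> N" "P z \<in> V" "\<psi> (P z) = z" by auto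
  qed
  have z0: "z0 \<in> ball z0 s" "P z0 = Psi \<zeta>" using s(1) c(6)[OF V1(2)] by (auto simp: P_def z0_def)
  have "\<forall>\<^sub>F j in sequentially. dist (\<epsilon> j) 0 < \<delta>" by (rule tendstoD[OF \<epsilon>_tendsto \<delta>(1)])
  moreover have "\<forall>\<^sub>F j in sequentially. 1 \<le> n j"
    by (rule eventually_compose_filterlim[OF eventually_ge_at_top n_at_top])
  ultimately have "\<forall>\<^sub>F j in sequentially. norm (\<epsilon> j) < \<delta> \<and> 1 \<le> n j \<and> (\<forall>p\<in>N. (F (\<epsilon> j) ^^ (k * n j)) p \<in> V2)"
    using N(5) by eventually_elim simp
  then obtain j0 where "\<And>j. j \<ge> j0 \<Longrightarrow> norm (\<epsilon> j) < \<delta> \<and> 1 \<le> n j \<and> (\<forall>p\<in>N. (F (\<epsilon> j) ^^ (k * n j)) p \<in> V2)"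
    unfolding eventually_sequentially by blast
  then have j0: "norm (\<epsilon> (j + j0)) < \<delta>" "1 \<le> n (j + j0)" "\<And>p. p \<in> N \<Longrightarrow> (F (\<epsilon> (j + j0)) ^^ (k * n (j + j0))) p \<in> V2" for j
    by simp_all
  \<comment> \<open>The shift by \<open>j0\<close> makes the eventual bounds hold for every
    index.\<close>
  define f where "f j = F (\<epsilon> (j + j0)) ^^ (k * n (j + j0))" for j
  have fV2: "f j (P z) \<in> V2" if "z \<in> ball z0 s" for j z unfolding f_def by (rule j0(3)[OF P(2)[OF that]])
  define g where "g j = \<psi> \<circ> f j \<circ> inv_into V1 \<psi>" for j
  define G where "G = \<psi> \<circ> (T ^^ k) \<circ> inv_into V1 \<psi>"
  have gP: "g j z = \<psi> (f j (P z))" and GP: "G z = \<psi> ((T ^^ k) (P z))" for j z by (simp_all add: g_def G_def P_def)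
  obtain u where u: "u \<noteq> 0" "((\<lambda>\<zeta>. \<psi> (Psi \<zeta>)) has_derivative (\<lambda>h. h *s u)) (at \<zeta>)"
    using Psi_has_derivative[OF hc V1(2)] by metis
  have "\<forall>\<^sub>F j in sequentially. \<exists>z\<in>ball z0 s. g j z = z \<and> (\<exists>J. (g j has_derivative (\<lambda>v. J *v v)) (at z) \<and>
           (\<exists>\<mu> \<nu>. eigval J \<mu> \<and> eigval J \<nu> \<and> norm \<mu> < 1 \<and> norm \<nu> > 1))"
  proof (rule saddle_fixed_points_near_rank_one_limit[OF s(1) _ _ _ _ u(2,1) z0_def[symmetric] k(3,2,4)])
    fix j
    have "holo_map (g j) (\<psi> ` (V1 \<inter> f j -` V1))"
      unfolding g_def f_def
      by (rule holo_self_map_in_charts[OF surface holo_self_map_funpow[OF surface holo_F[OF j0(1)]] hc hc])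
    moreover have "ball z0 s \<subseteq> \<psi> ` (V1 \<inter> f j -` V1)"
    proof
      fix z assume z: "z \<in> ball z0 s"
      then have "P z \<in> V1 \<inter> f j -` V1" using P(1) fV2 by (auto simp: V2_def)
      then show "z \<in> \<psi> ` (V1 \<inter> f j -` V1)" using P(4)[OF z] by (metis image_eqI)
    qed
    ultimately show "holo_map (g j) (ball z0 s)" by (rule holo_map_subset)
  next
    fix j z assume "z \<in> ball z0 s"
    then have "norm (z0 - g j z) \<le> 1" using fV2 unfolding gP by (simp add: V2_def dist_norm less_imp_le)
    from norm_diff_bound[OF _ order_refl this, of "g j z" z0] show "norm (g j z) \<le> norm z0 + 1" by simp
  next
    fix z assume z: "z \<in> ball z0 s"
    have "(\<lambda>j. (F (\<epsilon> j) ^^ (k * n j)) (P z)) \<longlonglongrightarrow> (T ^^ k) (P z)"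
      by (rule iterated_gate_passage_tendsto[OF N(3)[OF P(2)[OF z]]])
    then have "(\<lambda>j. f j (P z)) \<longlonglongrightarrow> (T ^^ k) (P z)" unfolding f_def by (rule LIMSEQ_ignore_initial_segment)
    then show "(\<lambda>j. g j z) \<longlonglongrightarrow> G z" unfolding gP GP
      by (rule continuous_on_tendsto_compose[OF c(3)]) (use N(4)[OF P(2)[OF z]] fV2[OF z] in \<open>auto simp: V2_def\<close>)
  next
    show "G z0 = z0" unfolding GP z0(2) TP k(2) by (simp add: z0_def)
  next
    have "isCont Psi \<zeta>" using continuous_Psi by (simp add: continuous_on_eq_continuous_at)
    then have "(Psi \<longlongrightarrow> Psi \<zeta>) (nhds \<zeta>)" unfolding tendsto_nhds_iff by (simp add: isCont_def)
    then have "\<forall>\<^sub>F w in nhds \<zeta>. Psi w \<in> V1" by (rule topological_tendstoD[OF _ c(1) V1(2)])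
    then show "\<forall>\<^sub>F w in nhds \<zeta>. G (\<psi> (Psi w)) = \<psi> (Psi ((h ^^ k) w))"
      by eventually_elim (simp add: GP P_def c(6) TP)
  next
    \<comment> \<open>As \<open>k \<ge> 1\<close>, the last map applied is \<open>T\<close>, whose
      values lie on the curve \<open>range Psi\<close>.\<close>
    have "G ` ball z0 s \<subseteq> {\<psi> (Psi \<zeta>) | \<zeta>. Psi \<zeta> \<in> V1}"
    proof
      fix w assume "w \<in> G ` ball z0 s"
      then obtain z where z: "z \<in> ball z0 s" "w = \<psi> ((T ^^ k) (P z))" by (auto simp: GP)
      obtain i where "k = Suc i" using k(1) by (cases k) auto
      then have "(T ^^ k) (P z) \<in> range Psi" by (simp add: T_def)
      moreover have "(T ^^ k) (P z) \<in> V1" using N(4)[OF P(2)[OF z(1)]] by (simp add: V2_def)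
      ultimately show "w \<in> {\<psi> (Psi \<zeta>) | \<zeta>. Psi \<zeta> \<in> V1}" using z(2) by auto
    qed
    then show "interior (G ` ball z0 s) = {}" by (rule interior_Psi_image_empty[OF hc])
  qed (rule s(1))
  then have "\<forall>\<^sub>F j in sequentially. \<exists>p\<in>V. saddle_periodic A (F (\<epsilon> (j + j0))) p"
  proof eventually_elim
    case (elim j)
    then obtain z J where z: "z \<in> ball z0 s" "g j z = z" "(g j has_derivative (\<lambda>v. J *v v)) (at z)"
      "\<exists>\<mu> \<nu>. eigval J \<mu> \<and> eigval J \<nu> \<and> norm \<mu> < 1 \<and> norm \<nu> > 1" by blast
    \<comment> \<open>Coordinates determine the point because \<open>f j (P z)\<close> lies in the
      same chart domain as \<open>P z\<close>.\<close>
    have "\<psi> (f j (P z)) = \<psi> (P z)" using z(2) P(4)[OF z(1)] by (simp add: gP)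
    moreover have "f j (P z) \<in> V1" using fV2[OF z(1)] by (simp add: V2_def)
    ultimately have fp: "f j (P z) = P z" using inj_onD[OF c(5)] P(1)[OF z(1)] by blast
    have "1 \<le> k * n (j + j0)" using k(1) j0(2)[of j] by (simp add: Suc_le_eq)
    moreover have "((\<psi> \<circ> (F (\<epsilon> (j + j0)) ^^ (k * n (j + j0))) \<circ> inv_into V1 \<psi>) has_derivative (\<lambda>v. J *v v)) (at (\<psi> (P z)))"
      using z(3) unfolding g_def f_def P(4)[OF z(1)] .
    ultimately have "saddle_periodic A (F (\<epsilon> (j + j0))) (P z)"
      unfolding saddle_periodic_def
      using fp[unfolded f_def] V1(1) P(1)[OF z(1)] z(4)
      by (intro exI[of _ "k * n (j + j0)"] conjI bexI[of _ "(V1, \<psi>)"]) auto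
    then show ?case using P(3)[OF z(1)] by blast
  qed
  then show ?thesis by (simp add: eventually_sequentially_seg[where P = "\<lambda>j. \<exists>p\<in>V. saddle_periodic A (F (\<epsilon> j)) p"])
qed

lemma J_star_T_subset_liminf: "J_star_T (F 0) p0 \<phi> q \<alpha> \<subseteq> liminf_sets (\<lambda>j. J_star A (F (\<epsilon> j)))"
proof
  fix p assume "p \<in> J_star_T (F 0) p0 \<phi> q \<alpha>"
  then have p: "p \<in> closure (Psi ` repelling_points (transition_domain (F 0) p0 \<phi> q) (transition (F 0) p0 \<phi> q \<alpha>))"
    by (simp add: J_star_T_def fatou_out_inv_eq_Psi)
  show "p \<in> liminf_sets (\<lambda>j. J_star A (F (\<epsilon> j)))"
    unfolding liminf_sets_def
  proof (intro CollectI allI impI)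
    fix V assume V: "open V \<and> p \<in> V"
    then obtain \<zeta> where "\<zeta> \<in> repelling_points (transition_domain (F 0) p0 \<phi> q) (transition (F 0) p0 \<phi> q \<alpha>)" "Psi \<zeta> \<in> V"
      using p by (auto simp: closure_iff_nhds_not_empty)
    from saddle_points_near_repelling_point[OF this(1) _ this(2)] V
    have "\<forall>\<^sub>F j in sequentially. \<exists>p\<in>V. saddle_periodic A (F (\<epsilon> j)) p" by blast
    then show "\<forall>\<^sub>F j in sequentially. V \<inter> J_star A (F (\<epsilon> j)) \<noteq> {}"
    proof eventually_elim
      case (elim j)
      then obtain p' where "p' \<in> V" "saddle_periodic A (F (\<epsilon> j)) p'" by blast
      then have "p' \<in> V \<inter> J_star A (F (\<epsilon> j))"
        using closure_subset[of "{p. saddle_periodic A (F (\<epsilon> j)) p}"] by (auto simp: J_star_def)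
      then show ?case by blast
    qed
  qed
qed

end

section \<open>Normal forms give semi-parabolic families\<close>

lemma norm_vec3_le: "norm (vector [x, y, z] :: complex^3) \<le> norm x + norm y + norm z"
proof -
  have "norm (vector [x, y, z] :: complex^3) \<le> (\<Sum>i\<in>UNIV. norm ((vector [x, y, z] :: complex^3) $ i))"
    unfolding norm_vec_def by (rule L2_set_le_sum) simp
  then show ?thesis by (simp add: sum_3)
qed

lemma holo_fun_near_0:
  fixes f :: "complex^'n \<Rightarrow> complex"
  assumes "holo_fun f (polydisc \<rho>)" "\<rho> > 0" "e > 0"
  shows "\<exists>d>0. \<forall>w. norm w < d \<longrightarrow> norm (f w - f 0) < e"
proof -
  have "0 \<in> (polydisc \<rho> :: (complex^'n) set)" using assms(2) by (simp add: polydisc_def)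
  then obtain a :: "complex^'n" where "(f has_derivative (\<lambda>v. \<Sum>i\<in>UNIV. a $ i * v $ i)) (at 0)"
    using assms(1) unfolding holo_fun_def by blast
  then have "isCont f 0" by (rule has_derivative_continuous)
  then have "\<exists>d>0. \<forall>w. dist w 0 < d \<longrightarrow> dist (f w) (f 0) < e"
    using assms(3) unfolding continuous_at_eps_delta by blast
  then show ?thesis by (simp add: dist_norm)
qed

lemma normal_form_semiparabolic_family:
  assumes surface: "complex_surface A" and family: "holo_family A F" and fixed: "F 0 p0 = p0"
    and chart: "holo_chart A (U, \<phi>)" "p0 \<in> U" "\<phi> p0 = 0"
    and nf: "normal_form F (U, \<phi>) q r b" and b: "norm b < 1"
  obtains a \<delta> lam C where "semiparabolic_family A F U \<phi> p0 q r a \<delta> lam C"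
proof -
  from nf[unfolded normal_form_def prod.case] obtain \<rho> a \<beta> bb C0 where \<rho>: "\<rho> > 0"
    and "holo_fun (\<lambda>w :: complex^3. a (w $ 1) (w $ 2) (w $ 3)) (polydisc \<rho>)"
    and h\<beta>: "holo_fun (\<lambda>w :: complex^3. \<beta> (w $ 1) (w $ 2) (w $ 3)) (polydisc \<rho>)"
    and hb: "holo_fun (\<lambda>w :: complex^2. bb (w $ 1) (w $ 2)) (polydisc \<rho>)" and b0: "bb 0 0 = b"
    and a: "\<forall>\<epsilon> x y. norm \<epsilon> < \<rho> \<and> norm x < \<rho> \<and> norm y < \<rho> \<longrightarrow>
        norm (a \<epsilon> x y - (1 + (q + 1) * x + r * y)) \<le> C0 * (norm x ^ 2 + norm y ^ 2 + norm \<epsilon> ^ 2)"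
    and dyn: "\<forall>\<epsilon> x y. norm \<epsilon> < \<rho> \<and> norm x < \<rho> \<and> norm y < \<rho> \<longrightarrow>
        vector [x, y] \<in> \<phi> ` U \<and> F \<epsilon> (inv_into U \<phi> (vector [x, y])) \<in> U \<and>
        \<phi> (F \<epsilon> (inv_into U \<phi> (vector [x, y]))) =
          vector [x + (x ^ 2 + \<epsilon> ^ 2) * a \<epsilon> x y, bb \<epsilon> x * y + (x ^ 2 + \<epsilon> ^ 2) * \<beta> \<epsilon> x y]"
    by (elim exE conjE) (rule that)
  obtain \<delta>0 where \<delta>0: "\<delta>0 > 0" "\<And>\<epsilon>. norm \<epsilon> < \<delta>0 \<Longrightarrow> automorphism A (F \<epsilon>)"
    "continuous_on (ball 0 \<delta>0 \<times> UNIV) (\<lambda>(\<epsilon>, p). F \<epsilon> p)"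
    using family unfolding holo_family_def by auto
  from holo_fun_near_0[OF h\<beta> \<rho> zero_less_one, unfolded zero_index]
  obtain d1 where d1: "d1 > 0" "\<forall>w :: complex^3. norm w < d1 \<longrightarrow> norm (\<beta> (w $ 1) (w $ 2) (w $ 3) - \<beta> 0 0 0) < 1"
    by (elim exE conjE) (rule that)
  have "0 < (1 - norm b) / 2" using b by simp
  from holo_fun_near_0[OF hb \<rho> this, unfolded zero_index b0]
  obtain d2 where d2: "d2 > 0" "\<forall>w :: complex^2. norm w < d2 \<longrightarrow> norm (bb (w $ 1) (w $ 2) - b) < (1 - norm b) / 2"
    by (elim exE conjE) (rule that)
  \<comment> \<open>The midpoint of \<open>norm b\<close> and 1: by continuity \<open>bb\<close>
    stays below it in norm near 0.\<close>
  define lam where "lam = (1 + norm b) / 2"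
  \<comment> \<open>The constant of the normal form may be negative, whereas the step estimates ask
    for a nonnegative one.\<close>
  define C1 where "C1 = max C0 0"
  define M where "M = norm q + norm r + C1 + 2"
  define C where "C = max 1 (max (100 * M^2) (norm (\<beta> 0 0 0) + 1))"
  define \<delta>M where "\<delta>M = 1 / (100 * M)"
  \<comment> \<open>The quarters of \<open>d1\<close> and \<open>d2\<close> make room for three and
    for two coordinates of size \<open>\<delta>\<close>; \<open>\<delta>M\<close> is the radius of
    the step estimates.\<close>
  define \<delta> where "\<delta> = min 1 (min \<delta>M (min \<delta>0 (min (\<rho> / 2) (min (d1 / 4) (d2 / 4)))))"
  have M: "M > 0" unfolding M_def C1_def by (intro add_nonneg_pos add_nonneg_nonneg) auto
  have \<delta>: "0 < \<delta>" using M \<rho> \<delta>0 d1 d2 by (simp add: \<delta>_def \<delta>M_def)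
  have \<delta>': "\<delta> \<le> 1" "\<delta> \<le> \<delta>M" "\<delta> \<le> \<delta>0" "\<delta> \<le> \<rho> / 2" "\<delta> \<le> d1 / 4" "\<delta> \<le> d2 / 4"
    unfolding \<delta>_def by linarith+
  have C: "1 \<le> C" "100 * M^2 \<le> C" "norm (\<beta> 0 0 0) + 1 \<le> C" unfolding C_def by linarith+
  have less_\<rho>: "norm z < \<rho>" if "norm z \<le> \<delta>" for z :: complex using that \<delta> \<delta>'(4) by linarith
  have ab: "norm (a \<epsilon> x y - (1 + (q + 1) * x + r * y)) \<le> C1 * (norm x ^ 2 + norm y ^ 2 + norm \<epsilon> ^ 2)"
    if "norm \<epsilon> < \<delta>" "norm x \<le> \<delta>" "norm y \<le> \<delta>" for \<epsilon> x y
  proof (rule order_trans[OF a[rule_format] mult_right_mono])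
    show "C0 \<le> C1" by (simp add: C1_def)
  qed (use that less_\<rho> in auto)
  note est = parabolic_step_estimates[where C = C1 and \<delta> = \<delta>M and q = q and r = r, folded M_def, OF _ \<delta>M_def]
  have "semiparabolic_family A F U \<phi> p0 q r a \<delta> lam C"
  proof (rule semiparabolic_family.intro)
    show "automorphism A (F \<epsilon>)" if "norm \<epsilon> < \<delta>" for \<epsilon> using \<delta>0(2) that \<delta>'(3) by simp
    show "continuous_on (ball 0 \<delta> \<times> UNIV) (\<lambda>(\<epsilon>, p). F \<epsilon> p)"
      by (rule continuous_on_subset[OF \<delta>0(3)]) (use \<delta>'(3) in auto)
    show "0 \<le> lam" "lam < 1" using b by (auto simp: lam_def)
    show "vector [x, y] \<in> \<phi> ` U" if "norm x \<le> \<delta>" "norm y \<le> \<delta>" for x y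
      using dyn[rule_format, of 0 x y] less_\<rho> that \<rho> by simp
  next
    fix \<epsilon> x y :: complex assume *: "norm \<epsilon> < \<delta>" "norm x \<le> \<delta>" "norm y \<le> \<delta>"
    note d = dyn[rule_format, OF conjI[OF less_\<rho>[OF less_imp_le[OF *(1)]] conjI[OF less_\<rho>[OF *(2)] less_\<rho>[OF *(3)]]]]
    have "norm (vector [\<epsilon>, x, y] :: complex^3) < d1"
      using norm_vec3_le[of \<epsilon> x y] * \<delta>'(5) \<delta> d1(1) by linarith
    from d1(2)[rule_format, OF this] have "norm (\<beta> \<epsilon> x y - \<beta> 0 0 0) \<le> 1" by simp
    from norm_add_bound[OF _ this order_refl, of _ "\<beta> 0 0 0"] have \<beta>: "norm (\<beta> \<epsilon> x y) \<le> C" using C(3) by simp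
    have "norm (vector [\<epsilon>, x] :: complex^2) < d2"
      using norm_vec2_le[of "vector [\<epsilon>, x]"] * \<delta>'(6) \<delta> d2(1) by simp
    from d2(2)[rule_format, OF this] have "norm (bb \<epsilon> x - b) \<le> (1 - norm b) / 2" by simp
    from norm_add_bound[OF _ this order_refl, of _ b] have bb: "norm (bb \<epsilon> x) \<le> lam"
      unfolding lam_def by (simp add: field_simps)
    have "norm (bb \<epsilon> x * y + (x^2 + \<epsilon>^2) * \<beta> \<epsilon> x y) \<le> lam * norm y + C * norm (x^2 + \<epsilon>^2)"
    proof (rule norm_add_bound[OF refl])
      show "norm (bb \<epsilon> x * y) \<le> lam * norm y" unfolding norm_mult by (rule mult_right_mono[OF bb]) simp
      show "norm ((x^2 + \<epsilon>^2) * \<beta> \<epsilon> x y) \<le> C * norm (x^2 + \<epsilon>^2)"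
        unfolding norm_mult mult.commute[of C] by (rule mult_left_mono[OF \<beta>]) simp
    qed
    then show "F \<epsilon> (inv_into U \<phi> (vector [x, y])) \<in> U \<and>
      \<phi> (F \<epsilon> (inv_into U \<phi> (vector [x, y]))) $ 1 = x + (x^2 + \<epsilon>^2) * a \<epsilon> x y \<and>
      norm (\<phi> (F \<epsilon> (inv_into U \<phi> (vector [x, y]))) $ 2) \<le> lam * norm y + C * norm (x^2 + \<epsilon>^2)"
      using d by simp
    have C1: "0 \<le> C1" by (simp add: C1_def)
    have M': "norm x \<le> \<delta>M" "norm y \<le> \<delta>M" "norm \<epsilon> \<le> \<delta>M" using * \<delta>'(2) by auto
    note e = est[OF C1 M' ab[OF *]]
    have le: "100 * M^2 * (norm x ^ 2 + norm y ^ 2 + norm \<epsilon> ^ 2) \<le> C * (norm x ^ 2 + norm y ^ 2 + norm \<epsilon> ^ 2)"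
      by (rule mult_right_mono[OF C(2)]) simp
    show "norm (x * a \<epsilon> x y) \<le> 1/2 \<and> norm (a \<epsilon> x y) \<le> 2 \<and> norm (a \<epsilon> x y / (1 + x * a \<epsilon> x y) - 1) \<le> 1/2 \<and>
      norm (\<epsilon> * (a \<epsilon> x y / (1 + x * a \<epsilon> x y))) \<le> 1/2"
      by (intro conjI e)
    show "norm (a \<epsilon> x y / (1 + x * a \<epsilon> x y) - q * Ln (1 + x * a \<epsilon> x y) - 1 - r * y)
        \<le> C * (norm x^2 + norm y^2 + norm \<epsilon>^2)"
      by (rule order_trans[OF e(4) le])
    show "norm (Arctan (\<epsilon> * (a \<epsilon> x y / (1 + x * a \<epsilon> x y))) / \<epsilon> - 1) \<le> 1/2 \<and>
      norm (Arctan (\<epsilon> * (a \<epsilon> x y / (1 + x * a \<epsilon> x y))) / \<epsilon>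
          + q * Ln (cos (Arctan (\<epsilon> * (a \<epsilon> x y / (1 + x * a \<epsilon> x y)))) / (1 + x * a \<epsilon> x y)) - 1 - r * y)
        \<le> C * (norm x^2 + norm y^2 + norm \<epsilon>^2)" if "\<epsilon> \<noteq> 0"
      by (intro conjI e(6)[OF that] order_trans[OF e(7)[OF that] le])
  qed (fact surface fixed chart \<delta> \<delta>' C)+
  then show thesis by (rule that)
qed

theorem theorem1:
  fixes A :: "'a::{t2_space, second_countable_topology} chart2 set"
    and F :: "complex \<Rightarrow> 'a \<Rightarrow> 'a"
    and U :: "'a set" and \<phi> :: "'a \<Rightarrow> complex^2" and p0 :: 'a
    and q r b \<alpha> :: complex and \<epsilon> :: "nat \<Rightarrow> complex"
  assumes "complex_surface A"
    and "holo_family A F"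
    and "F 0 p0 = p0"
    and "holo_chart A (U, \<phi>)" and "p0 \<in> U" and "\<phi> p0 = 0"
    and "normal_form F (U, \<phi>) q r b"
    and "0 < norm b" and "norm b < 1"
    and "alpha_sequence \<alpha> \<epsilon>"
  shows "J_star_T (F 0) p0 \<phi> q \<alpha> \<subseteq> liminf_sets (\<lambda>j. J_star A (F (\<epsilon> j)))"
proof -
  obtain a \<delta> lam C where "semiparabolic_family A F U \<phi> p0 q r a \<delta> lam C"
    by (rule normal_form_semiparabolic_family[OF assms(1-7,9)]) (rule that)
  moreover obtain n where "filterlim n at_top sequentially"
    "(\<lambda>j. of_nat (n j) - of_real pi / \<epsilon> j) \<longlonglongrightarrow> \<alpha>"
    using assms(10) unfolding alpha_sequence_def by blast
  moreover have "\<And>j. \<epsilon> j \<noteq> 0" "\<epsilon> \<longlonglongrightarrow> 0" using assms(10) by (auto simp: alpha_sequence_def)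
  ultimately interpret gate_sequence A F U \<phi> p0 q r a \<delta> lam C \<epsilon> n \<alpha>
    by (intro gate_sequence.intro gate_sequence_axioms.intro)
  show ?thesis by (rule J_star_T_subset_liminf)
qed

end
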